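(* Let $\Phi$ be a solution, periodic on $\Omega$, of the square phase field crystal equation \[ \partial_t\Phi=\Delta\mu,\qquad \mu=-\nabla\cdot(|\nabla\Phi|^2\nabla\Phi)-\varepsilon\Phi+(1+\Delta)^2\Phi, \] on $[0,T]$, with initial data $\Phi_0=\Phi(\cdot,0)\in H^{m+6}_{\rm per}(\Omega)$, and assume $\Phi\in H^3(0,T;C^0)\cap H^2(0,T;H^4)\cap L^\infty(0,T;H^{m+6})$. Let $M\in\mathbb{N}$, $\Delta t=T/M$, $t_n=n\Delta t$, and $\Phi^n=Q_N(\Phi(\cdot,t_n))$. Let $\phi^0=Q_N(\Phi_0)$, $\phi^{-1}=\phi^0-\Delta t\,\Delta_N\mu^0$ with $\mu^0=-\nabla_N\cdot(|\nabla_N\phi^0|^2\nabla_N\phi^0)+a\phi^0+2\Delta_N\phi^0+\Delta_N^2\phi^0$, and let $\phi^{k+1}$, $k\ge0$, be determined by \[ \frac{\frac32\phi^{k+1}-2\phi^k+\frac12\phi^{k-1}}{\Delta t}=\Delta_N\Big(-\nabla_N\cdot(|\nabla_N\phi^{k+1}|^2\nabla_N\phi^{k+1})+a\phi^{k+1}+2\Delta_N(2\phi^k-\phi^{k-1})-A\Delta t\,\Delta_N(\phi^{k+1}-\phi^k)+\Delta_N^2\phi^{k+1}\Big). \] If $A\ge\varepsilon^2/16$ and $\Delta t$ and $h$ are sufficiently small, then \[ \max_{0\le n\le M}\|\Phi^n-\phi^n\|_2+\Big(\Delta t\sum_{j=1}^{M}\|\nabla_N\Delta_N(\Phi^j-\phi^j)\|_2^2\Big)^{1/2}\le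 C(\Delta t^2+h^m), \] where $C>0$ is independent of $\Delta t$ and $h$.
   Context: Let $K\in\mathbb{N}$, $N=2K+1$, $h=1/N$, $\Omega=(0,1)^3$, grid points $(x_i,y_j,z_k)=(ih,jh,kh)$. $\mathcal{G}_N$ is the space of real grid functions on $\mathbb{Z}^3$ that are $N$-periodic in each index; $\langle f,g\rangle=h^3\sum_{i,j,k=0}^{N-1}f_{i,j,k}g_{i,j,k}$, $\|f\|_2=\langle f,f\rangle^{1/2}$ (pointwise Euclidean norm for vector-valued grid functions). $Q_N$ maps a continuous periodic function $g$ to the grid function $Q_N(g)_{i,j,k}=g(x_i,y_j,z_k)$. Each $f\in\mathcal{G}_N$ has discrete Fourier expansion $f_{i,j,k}=\sum_{\ell,m,n=-K}^K\hat f_{\ell,m,n}\exp(2\pi\mathrm{i}(\ell x_i+my_j+nz_k))$; $\mathcal{D}_x$ multiplies coefficients by $2\pi\mathrm{i}\ell$ (similarly $\mathcal{D}_y,\mathcal{D}_z$), $\nabla_Nf=(\mathcal{D}_xf,\mathcal{D}_yf,\mathcal{D}_zf)$, $\nabla_N\cdot(f_1,f_2,f_3)=\mathcal{D}_xf_1+\mathcal{D}_yf_2+\mathcal{D}_zf_3$, $\Delta_N$ multiplies coefficients by $-4\pi^2(\ell^2+m^2+n^2)$; nonlinear products are pointwise. Parameters: $0<\varepsilon<1$, $a=1-\varepsilon>0$, $A$ a constant, $m$ a fixed nonnegative integer (regularity index). *)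

theory Defs
  imports "HOL-Analysis.Analysis"
begin

text \<open>Spatial functions are curried functions of (x,y,z).  A space-time function
  Phi is written Phi t x y z, so Phi t is the snapshot at time t.\<close>

type_synonym sfun = "real \<Rightarrow> real \<Rightarrow> real \<Rightarrow> real"

definition box3 :: "(real \<times> real \<times> real) set" where
  "box3 = {0..1} \<times> {0..1} \<times> {0..1}"

definition unc :: "sfun \<Rightarrow> real \<times> real \<times> real \<Rightarrow> real" where
  "unc g = (\<lambda>(x,y,z). g x y z)"

definition periodic3 :: "sfun \<Rightarrow> bool" where
  "periodic3 g \<longleftrightarrow> (\<forall>x y z. g (x+1) y z = g x y z \<and> g x (y+1) z = g x y z \<and> g x y (z+1) = g x y z)"

definition fcoef :: "sfun \<Rightarrow> int \<times> int \<times> int \<Rightarrow> complex" where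
  "fcoef g k = (case k of (k1,k2,k3) \<Rightarrow>
     set_lebesgue_integral lebesgue box3
       (\<lambda>(x,y,z). complex_of_real (g x y z) *
          cis (- 2 * pi * (real_of_int k1 * x + real_of_int k2 * y + real_of_int k3 * z))))"

definition hweight :: "nat \<Rightarrow> int \<times> int \<times> int \<Rightarrow> real" where
  "hweight s k = (case k of (k1,k2,k3) \<Rightarrow> (1 + real_of_int (k1^2 + k2^2 + k3^2)) ^ s)"

definition in_Hper :: "nat \<Rightarrow> sfun \<Rightarrow> bool" where
  "in_Hper s g \<longleftrightarrow> periodic3 g \<and> unc g \<in> borel_measurable (lebesgue_on box3)
     \<and> set_integrable lebesgue box3 (\<lambda>p. (unc g p)^2)
     \<and> (\<lambda>k. hweight s k * (cmod (fcoef g k))^2) summable_on UNIV"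

definition Hper_sq :: "nat \<Rightarrow> sfun \<Rightarrow> real" where
  "Hper_sq s g = (\<Sum>\<^sub>\<infinity>k. hweight s k * (cmod (fcoef g k))^2)"

definition in_C0per :: "sfun \<Rightarrow> bool" where
  "in_C0per g \<longleftrightarrow> periodic3 g \<and> continuous_on UNIV (unc g)"

definition C0_norm :: "sfun \<Rightarrow> real" where
  "C0_norm g = Sup ((\<lambda>p. \<bar>unc g p\<bar>) ` box3)"

definition L2_Hper :: "nat \<Rightarrow> real \<Rightarrow> (real \<Rightarrow> sfun) \<Rightarrow> bool" where
  "L2_Hper s T u \<longleftrightarrow> (\<forall>t\<in>{0..T}. in_Hper s (u t))
     \<and> (\<forall>k. (\<lambda>t. fcoef (u t) k) \<in> borel_measurable (lebesgue_on {0..T}))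
     \<and> integrable (lebesgue_on {0..T}) (\<lambda>t. Hper_sq s (u t))"

text \<open>v is the (weak) time derivative of u as H^s-valued maps
  (u(t) = u(0) + integral of v from 0 to t, tested against every Fourier mode).\<close>
definition wderiv_Hper :: "real \<Rightarrow> (real \<Rightarrow> sfun) \<Rightarrow> (real \<Rightarrow> sfun) \<Rightarrow> bool" where
  "wderiv_Hper T u v \<longleftrightarrow> (\<forall>t\<in>{0..T}. \<forall>k.
     fcoef (u t) k = fcoef (u 0) k + set_lebesgue_integral lebesgue {0..t} (\<lambda>\<tau>. fcoef (v \<tau>) k))"

definition H_time_Hper :: "nat \<Rightarrow> nat \<Rightarrow> real \<Rightarrow> (real \<Rightarrow> sfun) \<Rightarrow> bool" where
  "H_time_Hper r s T u \<longleftrightarrow> (\<exists>D. D 0 = u \<and> (\<forall>a\<le>r. L2_Hper s T (D a))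
     \<and> (\<forall>a<r. wderiv_Hper T (D a) (D (Suc a))))"

definition L2_C0 :: "real \<Rightarrow> (real \<Rightarrow> sfun) \<Rightarrow> bool" where
  "L2_C0 T u \<longleftrightarrow> (\<forall>t\<in>{0..T}. in_C0per (u t))
     \<and> (\<forall>x y z. (\<lambda>t. u t x y z) \<in> borel_measurable (lebesgue_on {0..T}))
     \<and> integrable (lebesgue_on {0..T}) (\<lambda>t. (C0_norm (u t))^2)"

definition wderiv_C0 :: "real \<Rightarrow> (real \<Rightarrow> sfun) \<Rightarrow> (real \<Rightarrow> sfun) \<Rightarrow> bool" where
  "wderiv_C0 T u v \<longleftrightarrow> (\<forall>t\<in>{0..T}. \<forall>x y z.
     u t x y z = u 0 x y z + set_lebesgue_integral lebesgue {0..t} (\<lambda>\<tau>. v \<tau> x y z))"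

definition H_time_C0 :: "nat \<Rightarrow> real \<Rightarrow> (real \<Rightarrow> sfun) \<Rightarrow> bool" where
  "H_time_C0 r T u \<longleftrightarrow> (\<exists>D. D 0 = u \<and> (\<forall>a\<le>r. L2_C0 T (D a))
     \<and> (\<forall>a<r. wderiv_C0 T (D a) (D (Suc a))))"

definition Linf_Hper :: "nat \<Rightarrow> real \<Rightarrow> (real \<Rightarrow> sfun) \<Rightarrow> bool" where
  "Linf_Hper s T u \<longleftrightarrow> (\<forall>k. (\<lambda>t. fcoef (u t) k) \<in> borel_measurable (lebesgue_on {0..T}))
     \<and> (\<exists>B. AE t in lebesgue. t \<in> {0..T} \<longrightarrow> in_Hper s (u t) \<and> Hper_sq s (u t) \<le> B)"

definition dxc :: "sfun \<Rightarrow> sfun" where "dxc g = (\<lambda>x y z. deriv (\<lambda>s. g s y z) x)"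
definition dyc :: "sfun \<Rightarrow> sfun" where "dyc g = (\<lambda>x y z. deriv (\<lambda>s. g x s z) y)"
definition dzc :: "sfun \<Rightarrow> sfun" where "dzc g = (\<lambda>x y z. deriv (\<lambda>s. g x y s) z)"

definition lapc :: "sfun \<Rightarrow> sfun" where
  "lapc g = (\<lambda>x y z. dxc (dxc g) x y z + dyc (dyc g) x y z + dzc (dzc g) x y z)"

definition nlc :: "sfun \<Rightarrow> sfun" where
  "nlc g = (let q = (\<lambda>x y z. (dxc g x y z)^2 + (dyc g x y z)^2 + (dzc g x y z)^2) in
     (\<lambda>x y z. dxc (\<lambda>x y z. q x y z * dxc g x y z) x y z
            + dyc (\<lambda>x y z. q x y z * dyc g x y z) x y z
            + dzc (\<lambda>x y z. q x y z * dzc g x y z) x y z))"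

definition muc :: "real \<Rightarrow> sfun \<Rightarrow> sfun" where
  "muc \<epsilon> g = (\<lambda>x y z. - nlc g x y z - \<epsilon> * g x y z
      + (g x y z + 2 * lapc g x y z + lapc (lapc g) x y z))"

text \<open>Phi solves d_t Phi = Delta mu on [0,T]: its H^4-valued weak time derivative
  equals Delta mu (distributional Laplacian, i.e. in every Fourier mode) for a.e. t.\<close>
definition sPFC_solution :: "real \<Rightarrow> real \<Rightarrow> (real \<Rightarrow> sfun) \<Rightarrow> bool" where
  "sPFC_solution \<epsilon> T Phi \<longleftrightarrow> (\<exists>Phit. L2_Hper 4 T Phi \<and> L2_Hper 4 T Phit \<and> wderiv_Hper T Phi Phit
     \<and> (AE t in lebesgue. t \<in> {0..T} \<longrightarrow> (\<forall>k. fcoef (Phit t) k =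
          complex_of_real (- 4 * pi^2 * real_of_int (fst k ^ 2 + fst (snd k) ^ 2 + snd (snd k) ^ 2))
          * fcoef (muc \<epsilon> (Phi t)) k)))"

type_synonym grid = "int \<Rightarrow> int \<Rightarrow> int \<Rightarrow> real"

definition NN :: "nat \<Rightarrow> int" where "NN K = 2 * int K + 1"
definition hh :: "nat \<Rightarrow> real" where "hh K = 1 / real_of_int (NN K)"

definition QN :: "nat \<Rightarrow> sfun \<Rightarrow> grid" where
  "QN K g = (\<lambda>i j k. g (real_of_int i * hh K) (real_of_int j * hh K) (real_of_int k * hh K))"

text \<open>Discrete Fourier coefficients (exact for N-periodic grid functions, N odd).\<close>
definition dfc :: "nat \<Rightarrow> grid \<Rightarrow> int \<Rightarrow> int \<Rightarrow> int \<Rightarrow> complex" where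
  "dfc K f l m n = (1 / of_int (NN K ^ 3)) *
     (\<Sum>i\<in>{0..<NN K}. \<Sum>j\<in>{0..<NN K}. \<Sum>k\<in>{0..<NN K}.
        complex_of_real (f i j k) *
        cis (- 2 * pi * real_of_int (l * i + m * j + n * k) / real_of_int (NN K)))"

text \<open>Fourier multiplier operator; for the (conjugate-symmetric) multipliers used below
  the result is real, so taking the real part is exact.\<close>
definition specop :: "nat \<Rightarrow> (int \<Rightarrow> int \<Rightarrow> int \<Rightarrow> complex) \<Rightarrow> grid \<Rightarrow> grid" where
  "specop K \<sigma> f = (\<lambda>i j k. Re
     (\<Sum>l\<in>{- int K..int K}. \<Sum>m\<in>{- int K..int K}. \<Sum>n\<in>{- int K..int K}.
        \<sigma> l m n * dfc K f l m n *
        cis (2 * pi * real_of_int (l * i + m * j + n * k) / real_of_int (NN K))))"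

definition DxN :: "nat \<Rightarrow> grid \<Rightarrow> grid" where
  "DxN K = specop K (\<lambda>l m n. \<i> * complex_of_real (2 * pi * real_of_int l))"
definition DyN :: "nat \<Rightarrow> grid \<Rightarrow> grid" where
  "DyN K = specop K (\<lambda>l m n. \<i> * complex_of_real (2 * pi * real_of_int m))"
definition DzN :: "nat \<Rightarrow> grid \<Rightarrow> grid" where
  "DzN K = specop K (\<lambda>l m n. \<i> * complex_of_real (2 * pi * real_of_int n))"
definition LapN :: "nat \<Rightarrow> grid \<Rightarrow> grid" where
  "LapN K = specop K (\<lambda>l m n. complex_of_real (- 4 * pi^2 * real_of_int (l^2 + m^2 + n^2)))"

definition nlN :: "nat \<Rightarrow> grid \<Rightarrow> grid" where
  "nlN K f = (let q = (\<lambda>i j k. (DxN K f i j k)^2 + (DyN K f i j k)^2 + (DzN K f i j k)^2) in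
     (\<lambda>i j k. DxN K (\<lambda>i j k. q i j k * DxN K f i j k) i j k
            + DyN K (\<lambda>i j k. q i j k * DyN K f i j k) i j k
            + DzN K (\<lambda>i j k. q i j k * DzN K f i j k) i j k))"

definition l2N :: "nat \<Rightarrow> grid \<Rightarrow> real" where
  "l2N K f = sqrt (hh K ^ 3 * (\<Sum>i\<in>{0..<NN K}. \<Sum>j\<in>{0..<NN K}. \<Sum>k\<in>{0..<NN K}. (f i j k)^2))"

definition gradl2sqN :: "nat \<Rightarrow> grid \<Rightarrow> real" where
  "gradl2sqN K f = hh K ^ 3 * (\<Sum>i\<in>{0..<NN K}. \<Sum>j\<in>{0..<NN K}. \<Sum>k\<in>{0..<NN K}.
      (DxN K f i j k)^2 + (DyN K f i j k)^2 + (DzN K f i j k)^2)"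

definition bdf2_scheme :: "nat \<Rightarrow> nat \<Rightarrow> real \<Rightarrow> real \<Rightarrow> real \<Rightarrow> sfun \<Rightarrow> (int \<Rightarrow> grid) \<Rightarrow> bool" where
  "bdf2_scheme K M dt \<epsilon> A Phi0 phi \<longleftrightarrow>
     (let a = 1 - \<epsilon>;
          mu0 = (\<lambda>i j k. - nlN K (phi 0) i j k + a * phi 0 i j k + 2 * LapN K (phi 0) i j k
                   + LapN K (LapN K (phi 0)) i j k)
      in phi 0 = QN K Phi0
       \<and> phi (-1) = (\<lambda>i j k. phi 0 i j k - dt * LapN K mu0 i j k)
       \<and> (\<forall>n::int. 0 \<le> n \<and> n < int M \<longrightarrow>
            (\<lambda>i j k. (3/2 * phi (n+1) i j k - 2 * phi n i j k + 1/2 * phi (n-1) i j k) / dt)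
          = LapN K (\<lambda>i j k. - nlN K (phi (n+1)) i j k + a * phi (n+1) i j k
               + 2 * LapN K (\<lambda>i j k. 2 * phi n i j k - phi (n-1) i j k) i j k
               - A * dt * LapN K (\<lambda>i j k. phi (n+1) i j k - phi n i j k) i j k
               + LapN K (LapN K (phi (n+1))) i j k)))"

end

theory Submission
  imports Defs
begin

text \<open>
  Everything is done on Fourier coefficients. The regularity assumptions make the coefficients
  \<open>c t\<close> of the exact solution absolutely summable with weight \<open>|k|^(m+4)\<close>, so sampling,
  and the cubic flux of the samples, differ from the exact ones only by aliasing terms of order
  \<open>h^m\<close>; Taylor expansion in time bounds the BDF2 residual by \<open>\<Delta>t^2\<close> in the mean square.
  Elliptic regularity upgrades the initial value to \<open>H^10\<close>, which controls the ghost value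
  \<open>\<phi>^(-1)\<close> uniformly in \<open>h\<close>.

  Since \<open>|\<nabla>\<phi>|^4\<close> is convex, the scheme decreases a modified energy; this bounds
  \<open>\<nabla>\<phi>^n\<close> in \<open>L^4\<close> uniformly, hence the difference of the cubic fluxes in \<open>L^2\<close> by
  the maximum norm of the gradient error. By interpolation the square of the latter is at most
  \<open>\<delta> \<parallel>\<nabla>\<Delta>e\<parallel>^2 + C \<parallel>e\<parallel>^2\<close>. Testing the error equation with \<open>e\<close>, using the
  G-stability identity of BDF2 and absorbing the \<open>\<nabla>\<Delta>e\<close> terms, a discrete Gronwall argument
  closes the estimate without any a priori bound on the error.
\<close>

section \<open>Discrete Fourier analysis on the periodic grid\<close>

text \<open>The energy controls the discrete gradient only in L^4, never in the maximum norm. So in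
  the flux difference the maximum norm must fall on the gradient error alone. In three dimensions
  that norm lies strictly below the dissipated third-order norm, because \<open>1 / wt k ^ 4\<close>
  is summable, and can be absorbed with an arbitrarily small factor. The start is a second obstacle.
  The ghost value is an Euler extrapolation to time -dt, so the first residual is only O(dt). It
  occurs once and is paired so that it enters as dt^2 times its square, which is still dt^4. It
  contains dt \<open>kap k ^ 3\<close> times the initial potential, itself of order four, so ten
  derivatives of the initial value are needed uniformly in h. The equation at t = 0 gives them,
  since the time derivative lies in H^4 and the leading operator has order six. Finally, the time
  derivatives come in different function scales and the equation holds only for almost every time,
  while the consistency estimate needs it at every grid time. All are identified mode by mode as
  derivatives of one differentiable function of time.\<close>

type_synonym freq = "int \<times> int \<times> int"

definition idot :: "freq \<Rightarrow> freq \<Rightarrow> int" where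
  "idot k p = fst k * fst p + fst (snd k) * fst (snd p) + snd (snd k) * snd (snd p)"

text \<open>\<open>modes K\<close> and \<open>cell K\<close> are two complete residue systems modulo
  N in Z^3. Frequencies use the symmetric one, which is closed under negation and contains the
  representatives of least modulus; points use the one in the definitions of the norms.\<close>

definition modes :: "nat \<Rightarrow> (freq) set" where
  "modes K = {- int K..int K} \<times> {- int K..int K} \<times> {- int K..int K}"

definition cell :: "nat \<Rightarrow> (freq) set" where
  "cell K = {0..<NN K} \<times> {0..<NN K} \<times> {0..<NN K}"

definition chi :: "nat \<Rightarrow> freq \<Rightarrow> freq \<Rightarrow> complex" where
  "chi K k p = cis (2 * pi * real_of_int (idot k p) / real_of_int (NN K))"

definition gv :: "grid \<Rightarrow> freq \<Rightarrow> real" where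
  "gv f p = f (fst p) (fst (snd p)) (snd (snd p))"

text \<open>A grid function is an arbitrary map on Z^3; its coefficients, like \<open>gip\<close>,
  read only the values on \<open>cell K\<close>. Hence inversion is claimed only at points of
  \<open>cell K\<close>, and grid identities are transported through coefficients.\<close>

definition hat :: "nat \<Rightarrow> grid \<Rightarrow> freq \<Rightarrow> complex" where
  "hat K f k = dfc K f (fst k) (fst (snd k)) (snd (snd k))"

definition gip :: "nat \<Rightarrow> grid \<Rightarrow> grid \<Rightarrow> real" where
  "gip K f g = hh K ^ 3 * (\<Sum>p\<in>cell K. gv f p * gv g p)"

lemma NN_pos: "NN K > 0" and NN_real_pos: "real_of_int (NN K) > 0"
  by (auto simp: NN_def)

lemma hh_pos: "hh K > 0" and hh_le_1: "hh K \<le> 1"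
  by (auto simp: hh_def NN_def)

lemma finite_modes [simp]: "finite (modes K)" and finite_cell [simp]: "finite (cell K)"
  by (auto simp: modes_def cell_def)

lemma sum_triple_cell:
  "(\<Sum>i\<in>{0..<NN K}. \<Sum>j\<in>{0..<NN K}. \<Sum>k\<in>{0..<NN K}. f i j k) =
   (\<Sum>p\<in>cell K. f (fst p) (fst (snd p)) (snd (snd p)))"
  by (simp add: cell_def sum.cartesian_product case_prod_unfold)

lemma sum_triple_modes:
  "(\<Sum>i\<in>{- int K..int K}. \<Sum>j\<in>{- int K..int K}. \<Sum>k\<in>{- int K..int K}. f i j k) =
   (\<Sum>p\<in>modes K. f (fst p) (fst (snd p)) (snd (snd p)))"
  by (simp add: modes_def sum.cartesian_product case_prod_unfold)

lemma idot_add: "idot (k + l) p = idot k p + idot l p" "idot k (p + q) = idot k p + idot k q"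
  and idot_diff: "idot (k - l) p = idot k p - idot l p" "idot k (p - q) = idot k p - idot k q"
  and idot_minus: "idot (- k) p = - idot k p"
  by (simp_all add: idot_def algebra_simps)

lemma cnj_chi: "cnj (chi K k p) = chi K (- k) p"
  by (simp add: chi_def idot_minus cis_cnj)

lemma chi_diff: "chi K (k - l) p = chi K k p * cnj (chi K l p)"
    "chi K k (p - q) = chi K k p * cnj (chi K k q)"
  by (simp_all add: chi_def idot_diff cis_mult cis_cnj right_diff_distrib diff_divide_distrib)

lemma norm_chi [simp]: "cmod (chi K k p) = 1"
  by (simp add: chi_def)

lemma hat_eq: "hat K f k = (1 / of_int (NN K ^ 3)) * (\<Sum>p\<in>cell K. complex_of_real (gv f p) * cnj (chi K k p))"
  unfolding hat_def dfc_def sum_triple_cell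
  by (simp add: gv_def chi_def idot_def cis_cnj)

lemma cis_int_ratio_eq_1: "cis (2 * pi * real_of_int l / real_of_int n) = 1 \<longleftrightarrow> n dvd l" if "n > 0"
proof -
  have "cis (2 * pi * real_of_int l / real_of_int n) = 1 \<longleftrightarrow>
      (\<exists>x::int. 2 * pi * real_of_int l / real_of_int n = of_int x * (2 * pi))"
    using cos_one_2pi_int[of "2 * pi * real_of_int l / real_of_int n"]
      cos_one_sin_zero[of "2 * pi * real_of_int l / real_of_int n"]
    by (metis (no_types, opaque_lifting) cis.simps(1) cis.simps(2) complex_eq_iff mult.assoc one_complex.simps)
  also have "\<dots> \<longleftrightarrow> (\<exists>x::int. real_of_int l = of_int (x * n))"
    using that by (simp add: field_simps)
  also have "\<dots> \<longleftrightarrow> n dvd l"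
    by (auto simp only: of_int_eq_iff dvd_def mult.commute)
  finally show ?thesis .
qed

lemma sum_roots_of_unity:
  fixes n l :: int
  assumes "n > 0"
  shows "(\<Sum>i\<in>{0..<n}. cis (2 * pi * real_of_int (l * i) / real_of_int n)) = (if n dvd l then of_int n else 0)"
proof (cases "n dvd l")
  case True
  then have "cis (2 * pi * real_of_int (l * i) / real_of_int n) = 1" for i
    using cis_int_ratio_eq_1[OF assms, of "l * i"] by simp
  then show ?thesis using True assms by (simp add: of_nat_nat)
next
  case False
  let ?w = "cis (2 * pi * real_of_int l / real_of_int n)"
  have w1: "?w \<noteq> 1" using False cis_int_ratio_eq_1[OF assms] by blast
  have eq: "{0..<n} = int ` {..<nat n}"
    using assms image_int_atLeastLessThan[of 0 "nat n"] by (simp add: atLeast0LessThan)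
  have "(\<Sum>i\<in>{0..<n}. cis (2 * pi * real_of_int (l * i) / real_of_int n)) = (\<Sum>i<nat n. ?w ^ i)"
    unfolding eq by (subst sum.reindex) (auto simp: Complex.DeMoivre mult_ac intro!: sum.cong)
  also have "\<dots> = (1 - ?w ^ nat n) / (1 - ?w)"
    using w1 by (subst sum_gp_strict) auto
  also have "?w ^ nat n = 1"
    using assms cis_int_ratio_eq_1[of 1 l] by (simp add: Complex.DeMoivre)
  finally show ?thesis using False by simp
qed

text \<open>Shifting the index by K multiplies the unsymmetric sum by a phase, and this phase is 1
  whenever that sum does not vanish.\<close>

lemma sum_roots_of_unity_sym:
  fixes l :: int
  shows "(\<Sum>i\<in>{- int K..int K}. cis (2 * pi * real_of_int (l * i) / real_of_int (NN K)))
      = (if NN K dvd l then of_int (NN K) else 0)"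
proof -
  let ?n = "NN K"
  let ?s = "cis (2 * pi * real_of_int (- (l * int K)) / real_of_int ?n)"
  have "(\<Sum>i\<in>{- int K..int K}. cis (2 * pi * real_of_int (l * i) / real_of_int ?n)) =
     (\<Sum>i\<in>{0..<?n}. ?s * cis (2 * pi * real_of_int (l * i) / real_of_int ?n))"
    by (rule sum.reindex_bij_witness[where i = "\<lambda>i. i - int K" and j = "\<lambda>i. i + int K"])
      (auto simp: NN_def cis_mult algebra_simps add_divide_distrib)
  also have "\<dots> = ?s * (if ?n dvd l then of_int ?n else 0)"
    by (simp only: sum_distrib_left[symmetric] sum_roots_of_unity[OF NN_pos])
  also have "\<dots> = (if ?n dvd l then of_int ?n else 0)"
    using cis_int_ratio_eq_1[OF NN_pos, of "- (l * int K)" K] by auto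
  finally show ?thesis .
qed

text \<open>For frequencies, \<open>divs N (l - k)\<close> says that l and k alias: their characters
  agree on the grid.\<close>

definition divs :: "int \<Rightarrow> freq \<Rightarrow> bool" where
  "divs n k \<longleftrightarrow> n dvd fst k \<and> n dvd fst (snd k) \<and> n dvd snd (snd k)"

lemma prod_sum3: "(\<Sum>k\<in>A \<times> B \<times> C. f (fst k) * g (fst (snd k)) * h (snd (snd k))) =
   (\<Sum>i\<in>A. f i) * (\<Sum>i\<in>B. g i) * (\<Sum>i\<in>C. (h i :: 'a :: comm_ring_1))"
proof -
  have "(\<Sum>k\<in>A \<times> B \<times> C. f (fst k) * g (fst (snd k)) * h (snd (snd k))) =
      (\<Sum>i\<in>A. \<Sum>j\<in>B. \<Sum>l\<in>C. f i * g j * h l)"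
    by (simp add: sum.cartesian_product case_prod_unfold)
  also have "\<dots> = (\<Sum>i\<in>A. \<Sum>j\<in>B. f i * g j * sum h C)"
    by (simp only: sum_distrib_left)
  also have "\<dots> = sum f A * sum g B * sum h C"
    by (simp only: sum_distrib_left[symmetric] sum_distrib_right[symmetric])
  finally show ?thesis .
qed

lemma chi_split: "chi K k p = cis (2 * pi * real_of_int (fst k * fst p) / real_of_int (NN K))
  * cis (2 * pi * real_of_int (fst (snd k) * fst (snd p)) / real_of_int (NN K))
  * cis (2 * pi * real_of_int (snd (snd k) * snd (snd p)) / real_of_int (NN K))"
  by (simp add: chi_def idot_def cis_mult add_divide_distrib ring_distribs)

lemma sum_chi_cell: "(\<Sum>p\<in>cell K. chi K k p) = (if divs (NN K) k then of_int (NN K ^ 3) else 0)"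
proof -
  let ?r = "\<lambda>l i. cis (2 * pi * real_of_int (l * i) / real_of_int (NN K))"
  have "(\<Sum>p\<in>cell K. chi K k p) = (\<Sum>p\<in>cell K. ?r (fst k) (fst p) * ?r (fst (snd k)) (fst (snd p)) * ?r (snd (snd k)) (snd (snd p)))"
    by (simp only: chi_split)
  also have "\<dots> = (\<Sum>i\<in>{0..<NN K}. ?r (fst k) i) * (\<Sum>i\<in>{0..<NN K}. ?r (fst (snd k)) i) * (\<Sum>i\<in>{0..<NN K}. ?r (snd (snd k)) i)"
    unfolding cell_def by (rule prod_sum3)
  also have "\<dots> = (if divs (NN K) k then of_int (NN K ^ 3) else 0)"
    unfolding sum_roots_of_unity[OF NN_pos] by (simp add: divs_def power3_eq_cube)
  finally show ?thesis .
qed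

lemma sum_chi_modes: "(\<Sum>k\<in>modes K. chi K k p) = (if divs (NN K) p then of_int (NN K ^ 3) else 0)"
proof -
  let ?r = "\<lambda>l i. cis (2 * pi * real_of_int (l * i) / real_of_int (NN K))"
  have "(\<Sum>k\<in>modes K. chi K k p) = (\<Sum>k\<in>modes K. ?r (fst p) (fst k) * ?r (fst (snd p)) (fst (snd k)) * ?r (snd (snd p)) (snd (snd k)))"
    by (simp only: chi_split mult.commute)
  also have "\<dots> = (\<Sum>i\<in>{- int K..int K}. ?r (fst p) i) * (\<Sum>i\<in>{- int K..int K}. ?r (fst (snd p)) i) * (\<Sum>i\<in>{- int K..int K}. ?r (snd (snd p)) i)"
    unfolding modes_def by (rule prod_sum3)
  also have "\<dots> = (if divs (NN K) p then of_int (NN K ^ 3) else 0)"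
    unfolding sum_roots_of_unity_sym by (simp add: divs_def power3_eq_cube)
  finally show ?thesis .
qed

lemma dvd_diff_imp_eq:
  fixes a b :: int
  assumes "a \<in> {c..<c + n}" "b \<in> {c..<c + n}" "n dvd (a - b)"
  shows "a = b"
proof (rule ccontr)
  assume "a \<noteq> b"
  then have "n \<le> \<bar>a - b\<bar>" using assms(3) dvd_imp_le_int[of "a - b" n] by auto
  then show False using assms by auto
qed

lemma divs_cell: "p \<in> cell K \<Longrightarrow> q \<in> cell K \<Longrightarrow> divs (NN K) (p - q) \<longleftrightarrow> p = q"
  using dvd_diff_imp_eq[where c = 0 and n = "NN K"]
  by (auto simp: divs_def cell_def prod_eq_iff)

lemma divs_modes: "p \<in> modes K \<Longrightarrow> q \<in> modes K \<Longrightarrow> divs (NN K) (p - q) \<longleftrightarrow> p = q"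
  using dvd_diff_imp_eq[where c = "- int K" and n = "NN K"]
  by (auto simp: divs_def modes_def prod_eq_iff NN_def)

lemma sum_delta_if:
  "finite A \<Longrightarrow> a \<in> A \<Longrightarrow> (\<Sum>x\<in>A. f x * (if x = a then c else 0)) = f a * (c :: 'b :: comm_ring_1)"
  by (simp add: if_distrib cong: if_cong)

lemma hat_inversion:
  assumes "p \<in> cell K"
  shows "complex_of_real (gv f p) = (\<Sum>k\<in>modes K. hat K f k * chi K k p)"
proof -
  let ?c = "1 / complex_of_int (NN K ^ 3)"
  have "(\<Sum>k\<in>modes K. hat K f k * chi K k p) =
      ?c * (\<Sum>k\<in>modes K. \<Sum>q\<in>cell K. complex_of_real (gv f q) * chi K k (p - q))"
    unfolding hat_eq
    by (simp add: sum_distrib_left sum_distrib_right chi_diff mult_ac)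
  also have "\<dots> = ?c * (\<Sum>q\<in>cell K. complex_of_real (gv f q) * (\<Sum>k\<in>modes K. chi K k (p - q)))"
    by (subst sum.swap) (simp add: sum_distrib_left)
  also have "\<dots> = ?c * (\<Sum>q\<in>cell K. complex_of_real (gv f q) * (if q = p then of_int (NN K ^ 3) else 0))"
    using assms by (intro arg_cong2[where f = "(*)"] sum.cong refl) (auto simp: sum_chi_modes divs_cell)
  also have "\<dots> = ?c * (complex_of_real (gv f p) * of_int (NN K ^ 3))"
    using assms by (subst sum_delta_if) auto
  also have "\<dots> = complex_of_real (gv f p)" using NN_pos[of K] by simp
  finally show ?thesis by simp
qed

lemma hat_parseval: "complex_of_real (gip K f g) = (\<Sum>k\<in>modes K. hat K f k * cnj (hat K g k))"
proof -
  let ?c = "1 / complex_of_int (NN K ^ 3)"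
  have "(\<Sum>p\<in>cell K. complex_of_real (gv f p * gv g p)) =
     (\<Sum>p\<in>cell K. complex_of_real (gv f p) * cnj (\<Sum>k\<in>modes K. hat K g k * chi K k p))"
    by (rule sum.cong[OF refl]) (simp add: hat_inversion[symmetric])
  also have "\<dots> = (\<Sum>k\<in>modes K. (\<Sum>p\<in>cell K. complex_of_real (gv f p) * cnj (chi K k p)) * cnj (hat K g k))"
    by (simp add: sum_distrib_left sum_distrib_right, subst sum.swap) (simp add: mult_ac)
  finally have *: "(\<Sum>p\<in>cell K. complex_of_real (gv f p * gv g p)) = \<dots>" .
  have "complex_of_real (gip K f g) = ?c * (\<Sum>p\<in>cell K. complex_of_real (gv f p * gv g p))"
    by (simp add: gip_def hh_def power_divide)
  also have "\<dots> = (\<Sum>k\<in>modes K. hat K f k * cnj (hat K g k))"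
    unfolding * hat_eq[of K f] by (simp add: sum_distrib_left mult_ac)
  finally show ?thesis .
qed

lemma gip_self: "gip K f f = (\<Sum>k\<in>modes K. (cmod (hat K f k))\<^sup>2)"
proof -
  have "complex_of_real (gip K f f) = complex_of_real (\<Sum>k\<in>modes K. (cmod (hat K f k))\<^sup>2)"
    unfolding hat_parseval by (simp add: complex_norm_square del: of_real_power)
  then show ?thesis using of_real_eq_iff by blast
qed

lemma gip_Re: "gip K f g = (\<Sum>k\<in>modes K. Re (hat K f k * cnj (hat K g k)))"
  using arg_cong[OF hat_parseval, of Re K f g] by simp

section \<open>Trigonometric interpolation and Fourier multipliers on the grid\<close>

definition synth :: "nat \<Rightarrow> (freq \<Rightarrow> complex) \<Rightarrow> grid" where
  "synth K a = (\<lambda>i j l. Re (\<Sum>k\<in>modes K. a k * chi K k (i, j, l)))"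

lemma modes_minus: "k \<in> modes K \<Longrightarrow> - k \<in> modes K"
  by (auto simp: modes_def)

text \<open>Substituting -k for k turns the sum into its conjugate, so taking the real part in
  \<open>synth\<close> loses nothing.\<close>

lemma gv_synth: 
  assumes "\<And>k. k \<in> modes K \<Longrightarrow> a (- k) = cnj (a k)"
  shows "complex_of_real (gv (synth K a) p) = (\<Sum>k\<in>modes K. a k * chi K k p)"
proof -
  let ?S = "\<Sum>k\<in>modes K. a k * chi K k p"
  have "cnj ?S = (\<Sum>k\<in>modes K. a (- k) * chi K (- k) p)"
    unfolding cnj_sum by (rule sum.cong[OF refl]) (simp only: assms complex_cnj_mult cnj_chi)
  also have "\<dots> = ?S"
    by (rule sum.reindex_bij_witness[where i = uminus and j = uminus]) (auto simp: modes_minus)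
  finally have "Im ?S = 0" by (simp only: complex_is_Real_iff[symmetric] Reals_cnj_iff)
  then show ?thesis by (simp add: gv_def synth_def complex_eq_iff)
qed

lemma hat_synth:
  assumes "\<And>k. k \<in> modes K \<Longrightarrow> a (- k) = cnj (a k)" "k \<in> modes K"
  shows "hat K (synth K a) k = a k"
proof -
  let ?c = "1 / complex_of_int (NN K ^ 3)"
  note [simp] = gv_synth[of K a, OF assms(1)]
  have "hat K (synth K a) k = ?c * (\<Sum>p\<in>cell K. \<Sum>l\<in>modes K. a l * chi K (l - k) p)"
    unfolding hat_eq by (simp add: sum_distrib_left chi_diff mult_ac)
  also have "\<dots> = ?c * (\<Sum>l\<in>modes K. a l * (\<Sum>p\<in>cell K. chi K (l - k) p))"
    by (subst sum.swap) (simp add: sum_distrib_left)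
  also have "\<dots> = ?c * (\<Sum>l\<in>modes K. a l * (if l = k then of_int (NN K ^ 3) else 0))"
    using assms by (intro arg_cong2[where f = "(*)"] sum.cong refl) (auto simp: sum_chi_cell divs_modes)
  also have "\<dots> = a k" using assms NN_pos[of K] by (subst sum_delta_if) auto
  finally show ?thesis .
qed

lemma hat_minus: "hat K f (- k) = cnj (hat K f k)"
  by (simp add: hat_eq cnj_chi)

lemma hat_specop:
  assumes "\<And>l m n. \<sigma> (- l) (- m) (- n) = cnj (\<sigma> l m n)" "k \<in> modes K"
  shows "hat K (specop K \<sigma> f) k = \<sigma> (fst k) (fst (snd k)) (snd (snd k)) * hat K f k"
proof -
  have eq: "specop K \<sigma> f = synth K (\<lambda>k. \<sigma> (fst k) (fst (snd k)) (snd (snd k)) * hat K f k)"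
    unfolding specop_def synth_def sum_triple_modes by (simp add: hat_def chi_def idot_def)
  show ?thesis unfolding eq
    by (subst hat_synth) (use assms in \<open>auto simp: hat_minus\<close>)
qed

text \<open>The symbol of minus the Laplacian. On a single mode every linear operator of the scheme
  is a polynomial in \<open>kap k\<close>.\<close>

definition kap :: "freq \<Rightarrow> real" where
  "kap k = 4 * pi\<^sup>2 * real_of_int ((fst k)\<^sup>2 + (fst (snd k))\<^sup>2 + (snd (snd k))\<^sup>2)"

lemma hat_DxN: "k \<in> modes K \<Longrightarrow> hat K (DxN K f) k = \<i> * complex_of_real (2 * pi * real_of_int (fst k)) * hat K f k"
  and hat_DyN: "k \<in> modes K \<Longrightarrow> hat K (DyN K f) k = \<i> * complex_of_real (2 * pi * real_of_int (fst (snd k))) * hat K f k"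
  and hat_DzN: "k \<in> modes K \<Longrightarrow> hat K (DzN K f) k = \<i> * complex_of_real (2 * pi * real_of_int (snd (snd k))) * hat K f k"
  and hat_LapN: "k \<in> modes K \<Longrightarrow> hat K (LapN K f) k = - complex_of_real (kap k) * hat K f k"
  unfolding DxN_def DyN_def DzN_def LapN_def by (subst hat_specop; simp add: kap_def)+

lemma hat_add: "hat K (\<lambda>i j k. f i j k + g i j k) k = hat K f k + hat K g k"
  and hat_diff: "hat K (\<lambda>i j k. f i j k - g i j k) k = hat K f k - hat K g k"
  and hat_cmult: "hat K (\<lambda>i j k. c * f i j k) k = complex_of_real c * hat K f k"
  and hat_uminus: "hat K (\<lambda>i j k. - f i j k) k = - hat K f k"
  by (simp_all add: hat_eq gv_def ring_distribs sum.distrib sum_subtractf sum_negf sum_distrib_left mult_ac)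

lemma hat_cdiv: "hat K (\<lambda>i j k. f i j k / c) k = hat K f k / complex_of_real c"
  using hat_cmult[of K "1 / c" f k] by simp

lemmas hat_simps = hat_DxN hat_DyN hat_DzN hat_LapN hat_add hat_diff hat_cmult hat_uminus hat_cdiv

lemma l2N_eq: "l2N K f = sqrt (\<Sum>k\<in>modes K. (cmod (hat K f k))\<^sup>2)"
  unfolding gip_self[symmetric]
  by (simp add: l2N_def sum_triple_cell gip_def gv_def power2_eq_square)

lemma gradl2sqN_eq: "gradl2sqN K f = (\<Sum>k\<in>modes K. kap k * (cmod (hat K f k))\<^sup>2)"
proof -
  have "gradl2sqN K f = gip K (DxN K f) (DxN K f) + gip K (DyN K f) (DyN K f) + gip K (DzN K f) (DzN K f)"
    by (simp add: gradl2sqN_def sum_triple_cell gip_def gv_def power2_eq_square sum.distrib ring_distribs)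
  also have "\<dots> = (\<Sum>k\<in>modes K. kap k * (cmod (hat K f k))\<^sup>2)"
    unfolding gip_self sum.distrib[symmetric]
    by (rule sum.cong[OF refl])
      (simp add: hat_simps norm_mult power_mult_distrib kap_def power2_eq_square algebra_simps)
  finally show ?thesis .
qed

lemma gradl2sqN_LapN: "gradl2sqN K (LapN K f) = (\<Sum>k\<in>modes K. kap k ^ 3 * (cmod (hat K f k))\<^sup>2)"
  unfolding gradl2sqN_eq
  by (rule sum.cong[OF refl])
    (simp add: hat_simps norm_mult power_mult_distrib power3_eq_cube power2_eq_square mult_ac)

section \<open>Weighted summability over the frequency lattice\<close>

text \<open>With this modulus \<open>wt\<close> is submultiplicative with constant 1
  (\<open>wt_add_le\<close>), so weighted l1 spaces of coefficients are algebras under convolution.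
  Up to constants, \<open>wt k ^ (2 * s)\<close> is \<open>hweight s k\<close>.\<close>

definition wt :: "freq \<Rightarrow> real" where
  "wt k = 1 + \<bar>real_of_int (fst k)\<bar> + \<bar>real_of_int (fst (snd k))\<bar> + \<bar>real_of_int (snd (snd k))\<bar>"

lemma wt_ge_1: "wt k \<ge> 1" and wt_pos: "wt k > 0" and wt_nonneg [simp]: "wt k \<ge> 0"
  by (auto simp: wt_def)

lemma wt_pow_ge_1: "wt k ^ s \<ge> 1" and wt_pow_nonneg [simp]: "wt k ^ s \<ge> 0"
  using wt_ge_1[of k] wt_pos[of k] by (auto simp: one_le_power)

lemma wt_pow_mono: "s \<le> r \<Longrightarrow> wt k ^ s \<le> wt k ^ r"
  by (rule power_increasing[OF _ wt_ge_1])

lemma wt_add_le: "wt (j + k) \<le> wt j * wt k"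
proof -
  have ineq: "1 + \<bar>a + a'\<bar> + \<bar>b + b'\<bar> + \<bar>c + c'\<bar> \<le> (1 + \<bar>a\<bar> + \<bar>b\<bar> + \<bar>c\<bar>) * (1 + \<bar>a'\<bar> + \<bar>b'\<bar> + \<bar>c'\<bar>)"
    for a b c a' b' c' :: real
  proof -
    define p where "p = \<bar>a\<bar> + \<bar>b\<bar> + \<bar>c\<bar>"
    define q where "q = \<bar>a'\<bar> + \<bar>b'\<bar> + \<bar>c'\<bar>"
    have "0 \<le> p * q" by (simp add: p_def q_def)
    moreover have "(1 + \<bar>a\<bar> + \<bar>b\<bar> + \<bar>c\<bar>) * (1 + \<bar>a'\<bar> + \<bar>b'\<bar> + \<bar>c'\<bar>) = 1 + p + q + p * q"
      by (simp add: p_def q_def algebra_simps)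
    moreover have "1 + \<bar>a + a'\<bar> + \<bar>b + b'\<bar> + \<bar>c + c'\<bar> \<le> 1 + p + q"
      unfolding p_def q_def by linarith
    ultimately show ?thesis by linarith
  qed
  show ?thesis by (simp add: wt_def ineq)
qed

lemma wt_pow_add_le: "wt (j + k) ^ s \<le> wt j ^ s * wt k ^ s"
  using power_mono[OF wt_add_le wt_nonneg, of j k s] by (simp add: power_mult_distrib)

lemma kap_nonneg [simp]: "kap k \<ge> 0"
  by (simp add: kap_def)

lemma four_pi_sq_bounds: "36 \<le> 4 * pi\<^sup>2" "4 * pi\<^sup>2 \<le> 64"
proof -
  have "3 * 3 \<le> pi * pi" "pi * pi \<le> 4 * 4"
    by (intro mult_mono; use pi_gt3 pi_less_4 in simp)+
  then show "36 \<le> 4 * pi\<^sup>2" "4 * pi\<^sup>2 \<le> 64" by (simp_all add: power2_eq_square)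
qed

lemma int_sq_sum_ge_1: "k \<noteq> 0 \<Longrightarrow> (fst k)\<^sup>2 + (fst (snd k))\<^sup>2 + (snd (snd k))\<^sup>2 \<ge> (1 :: int)"
  for k :: "freq"
proof -
  assume "k \<noteq> 0"
  then have d: "fst k \<noteq> 0 \<or> fst (snd k) \<noteq> 0 \<or> snd (snd k) \<noteq> 0" by (auto simp: prod_eq_iff)
  have sq: "x\<^sup>2 \<ge> 1" if "x \<noteq> 0" for x :: int
    using zero_less_power2[of x] that by linarith
  have nn: "(fst k)\<^sup>2 \<ge> 0" "(fst (snd k))\<^sup>2 \<ge> 0" "(snd (snd k))\<^sup>2 \<ge> 0" by auto
  from d show ?thesis by (elim disjE) (drule sq, use nn in linarith)+
qed

lemma kap_ge: 
  assumes "k \<noteq> 0"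
  shows "kap k \<ge> 36"
proof -
  have "1 \<le> real_of_int ((fst k)\<^sup>2 + (fst (snd k))\<^sup>2 + (snd (snd k))\<^sup>2)"
    using int_sq_sum_ge_1[OF assms] by linarith
  then have "36 * 1 \<le> kap k"
    unfolding kap_def using four_pi_sq_bounds(1) by (intro mult_mono) auto
  then show ?thesis by simp
qed

lemma kap_zero [simp]: "kap 0 = 0"
  by (simp add: kap_def)

lemma kap_le_wt: "kap k \<le> 64 * wt k ^ 2"
proof -
  have "real_of_int ((fst k)\<^sup>2 + (fst (snd k))\<^sup>2 + (snd (snd k))\<^sup>2) \<le> wt k ^ 2"
  proof -
    have "a\<^sup>2 + b\<^sup>2 + c\<^sup>2 \<le> (1 + \<bar>a\<bar> + \<bar>b\<bar> + \<bar>c\<bar>)\<^sup>2" for a b c :: real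
    proof -
      have "a\<^sup>2 + b\<^sup>2 + c\<^sup>2 = \<bar>a\<bar>\<^sup>2 + \<bar>b\<bar>\<^sup>2 + \<bar>c\<bar>\<^sup>2" by simp
      also have "\<dots> \<le> (1 + \<bar>a\<bar> + \<bar>b\<bar> + \<bar>c\<bar>)\<^sup>2"
        unfolding power2_eq_square by (simp add: algebra_simps add_nonneg_nonneg)
      finally show ?thesis .
    qed
    then show ?thesis by (simp add: wt_def)
  qed
  then show ?thesis unfolding kap_def
    using four_pi_sq_bounds by (intro mult_mono) auto
qed

lemma wt_sq_le: "wt k ^ 2 \<le> 4 * (1 + real_of_int ((fst k)\<^sup>2 + (fst (snd k))\<^sup>2 + (snd (snd k))\<^sup>2))"
proof -
  have "(1 + \<bar>a\<bar> + \<bar>b\<bar> + \<bar>c\<bar>)\<^sup>2 \<le> 4 * (1 + (a\<^sup>2 + b\<^sup>2 + c\<^sup>2))" for a b c :: real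
  proof -
    have *: "(1 + x + y + z)\<^sup>2 \<le> 4 * (1 + (x\<^sup>2 + y\<^sup>2 + z\<^sup>2))" for x y z :: real
    proof -
      have "0 \<le> (1 - x)\<^sup>2 + (1 - y)\<^sup>2 + (1 - z)\<^sup>2 + (x - y)\<^sup>2 + (x - z)\<^sup>2 + (y - z)\<^sup>2" by simp
      then show ?thesis by (simp add: power2_eq_square algebra_simps)
    qed
    show ?thesis using *[of "\<bar>a\<bar>" "\<bar>b\<bar>" "\<bar>c\<bar>"] by simp
  qed
  then show ?thesis by (simp add: wt_def)
qed

text \<open>For k \<noteq> 0 the summand 1 in the weight costs at most a factor 2, and the resulting
  8 is below 36 \<le> 4 pi^2. At the zero mode \<open>kap\<close> vanishes while \<open>wt\<close>
  is 1.\<close>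

lemma wt_sq_le_kap: "k \<noteq> 0 \<Longrightarrow> wt k ^ 2 \<le> kap k"
proof -
  assume k: "k \<noteq> 0"
  let ?s = "real_of_int ((fst k)\<^sup>2 + (fst (snd k))\<^sup>2 + (snd (snd k))\<^sup>2)"
  have s: "?s \<ge> 1" using int_sq_sum_ge_1[OF k] by linarith
  have "wt k ^ 2 \<le> 4 * (1 + ?s)" by (rule wt_sq_le)
  also have "\<dots> \<le> 36 * ?s" using s by simp
  also have "\<dots> \<le> kap k" unfolding kap_def using four_pi_sq_bounds s by (intro mult_right_mono) auto
  finally show ?thesis .
qed

lemma wt_pow_le_hweight: "wt k ^ (2 * s) \<le> 4 ^ s * hweight s k"
proof -
  have "(wt k ^ 2) ^ s \<le> (4 * (1 + real_of_int ((fst k)\<^sup>2 + (fst (snd k))\<^sup>2 + (snd (snd k))\<^sup>2))) ^ s"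
    by (intro power_mono wt_sq_le) auto
  then show ?thesis unfolding power_mult_distrib by (simp add: hweight_def power_mult case_prod_unfold)
qed

lemma abs_summable_prod:
  fixes f :: "'a \<Rightarrow> 'c :: {banach, real_normed_field}" and g :: "'b \<Rightarrow> 'c"
  assumes "(\<lambda>x. norm (f x)) summable_on A" "(\<lambda>x. norm (g x)) summable_on B"
  shows "(\<lambda>p. norm (f (fst p) * g (snd p))) summable_on A \<times> B"
proof -
  have "(\<lambda>y. norm (f x * g y)) summable_on B" for x
    using summable_on_cmult_right[OF assms(2), of "norm (f x)"] by (simp add: norm_mult)
  moreover have "infsum (\<lambda>y. norm (f x * g y)) B = norm (f x) * infsum (\<lambda>y. norm (g y)) B" for x
    by (simp add: norm_mult infsum_cmult_right')
  moreover have "(\<lambda>x. norm (norm (f x) * infsum (\<lambda>y. norm (g y)) B)) summable_on A"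
    using summable_on_cmult_left[OF assms(1), of "\<bar>infsum (\<lambda>y. norm (g y)) B\<bar>"] by (simp add: abs_mult)
  ultimately show ?thesis
    unfolding Infinite_Sum.abs_summable_on_Sigma_iff fst_conv snd_conv by simp
qed

text \<open>The exponent is a third of 4: \<open>wt k\<close> dominates 1 + |k_i| for each
  component, so \<open>1 / wt k ^ 4\<close> is at most a product of three one-dimensional terms with
  this exponent, which exceeds 1.\<close>

lemma summable_on_int_powr: "(\<lambda>n::int. (1 + \<bar>real_of_int n\<bar>) powr (- (4/3))) summable_on UNIV"
proof -
  let ?f = "\<lambda>n::int. (1 + \<bar>real_of_int n\<bar>) powr (- (4/3))"
  have "summable (\<lambda>n. real (Suc n) powr (- (4/3)))"
    by (subst summable_Suc_iff[where f = "\<lambda>n. real n powr (- (4/3))"]) (simp add: summable_real_powr_iff)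
  then have s: "(\<lambda>n. real (Suc n) powr (- (4/3))) summable_on UNIV"
    by (intro summable_nonneg_imp_summable_on) auto
  have "?f summable_on (int ` UNIV)"
    using s by (subst summable_on_reindex) (auto simp: inj_on_def o_def add_ac)
  moreover have "?f summable_on ((\<lambda>n. - int n) ` UNIV)"
    using s by (subst summable_on_reindex) (auto simp: inj_on_def o_def add_ac)
  ultimately have "?f summable_on (int ` UNIV \<union> (\<lambda>n. - int n) ` UNIV)"
    by (rule summable_on_union)
  also have "int ` UNIV \<union> (\<lambda>n. - int n) ` UNIV = UNIV"
  proof -
    have "x \<in> int ` UNIV \<union> (\<lambda>n. - int n) ` UNIV" for x :: int
      by (cases x rule: int_cases2) auto
    then show ?thesis by blast
  qed
  finally show ?thesis .
qed

lemma summable_on_wt: "(\<lambda>k. 1 / wt k ^ 4) summable_on UNIV"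
proof -
  let ?f = "\<lambda>n::int. (1 + \<bar>real_of_int n\<bar>) powr (- (4/3))"
  have s: "(\<lambda>x. norm (?f x)) summable_on UNIV" using summable_on_int_powr by simp
  have "(\<lambda>k. norm (?f (fst k) * (?f (fst (snd k)) * ?f (snd (snd k))))) summable_on (UNIV \<times> (UNIV \<times> UNIV))"
    using abs_summable_prod[OF s abs_summable_prod[OF s s]] by simp
  then have t: "(\<lambda>k. ?f (fst k) * (?f (fst (snd k)) * ?f (snd (snd k)))) summable_on UNIV"
    by (simp add: abs_mult)
  have "norm (1 / wt k ^ 4) \<le> ?f (fst k) * (?f (fst (snd k)) * ?f (snd (snd k)))" for k
  proof -
    have "1 / wt k ^ 4 = wt k powr (- 4)"
      using wt_pos[of k] by (simp add: powr_minus powr_numeral divide_inverse)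
    also have "\<dots> = wt k powr (- (4/3)) * (wt k powr (- (4/3)) * wt k powr (- (4/3)))"
      by (simp add: powr_add[symmetric])
    also have "\<dots> \<le> ?f (fst k) * (?f (fst (snd k)) * ?f (snd (snd k)))"
      by (intro mult_mono powr_mono2') (auto simp: wt_def)
    finally show ?thesis using wt_pos[of k] by simp
  qed
  from Infinite_Sum.abs_summable_on_comparison_test'[OF t this] show ?thesis by simp
qed

text \<open>The squared constant of the embedding of H^(s+2) into the space of
  \<open>wsum s\<close>; it also bounds sums over alias classes.\<close>

definition wt4sum :: real where "wt4sum = (\<Sum>\<^sub>\<infinity>k. 1 / wt k ^ 4)"

lemma sum_wt4_le: "finite F \<Longrightarrow> (\<Sum>k\<in>F. 1 / wt k ^ 4) \<le> wt4sum"
  unfolding wt4sum_def by (rule finite_sum_le_infsum[OF summable_on_wt]) auto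

lemma wt4sum_nonneg: "wt4sum \<ge> 0"
  using sum_wt4_le[of "{}"] by simp

text \<open>Membership in the Wiener algebra with s derivatives. Products of exact quantities are
  estimated in this scale rather than in Sobolev spaces.\<close>

definition wsum :: "nat \<Rightarrow> (freq \<Rightarrow> complex) \<Rightarrow> bool" where
  "wsum s a \<longleftrightarrow> (\<lambda>k. wt k ^ s * cmod (a k)) summable_on UNIV"

definition wnorm :: "nat \<Rightarrow> (freq \<Rightarrow> complex) \<Rightarrow> real" where
  "wnorm s a = (\<Sum>\<^sub>\<infinity>k. wt k ^ s * cmod (a k))"

lemma nonneg_summable_bound:
  fixes f :: "'a \<Rightarrow> real"
  assumes "\<And>x. f x \<ge> 0" "\<And>F. finite F \<Longrightarrow> sum f F \<le> B"
  shows "f summable_on UNIV" "infsum f UNIV \<le> B"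
proof -
  show "f summable_on UNIV"
    using assms by (intro nonneg_bdd_above_summable_on) (auto intro!: bdd_aboveI[where M = B])
  then show "infsum f UNIV \<le> B" using assms by (intro infsum_le_finite_sums)
qed

lemma wsumI:
  assumes "\<And>F. finite F \<Longrightarrow> (\<Sum>k\<in>F. wt k ^ s * cmod (a k)) \<le> B"
  shows "wsum s a" "wnorm s a \<le> B"
  using nonneg_summable_bound[of "\<lambda>k. wt k ^ s * cmod (a k)" B] assms
  by (auto simp: wsum_def wnorm_def)

lemma wnorm_finite_sum_le: "wsum s a \<Longrightarrow> finite F \<Longrightarrow> (\<Sum>k\<in>F. wt k ^ s * cmod (a k)) \<le> wnorm s a"
  unfolding wsum_def wnorm_def by (rule finite_sum_le_infsum) auto

lemma wnorm_nonneg: "wnorm s a \<ge> 0"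
  unfolding wnorm_def by (rule infsum_nonneg) auto

lemma wsum_mono:
  assumes "wsum r a" "s \<le> r"
  shows "wsum s a" "wnorm s a \<le> wnorm r a"
proof -
  have "(\<Sum>k\<in>F. wt k ^ s * cmod (a k)) \<le> wnorm r a" if "finite F" for F
  proof -
    have "(\<Sum>k\<in>F. wt k ^ s * cmod (a k)) \<le> (\<Sum>k\<in>F. wt k ^ r * cmod (a k))"
      by (intro sum_mono mult_right_mono wt_pow_mono assms) auto
    also have "\<dots> \<le> wnorm r a" by (rule wnorm_finite_sum_le[OF assms(1) that])
    finally show ?thesis .
  qed
  from wsumI[OF this] show "wsum s a" "wnorm s a \<le> wnorm r a" by auto
qed

lemma wsum_abs_summable: "wsum s a \<Longrightarrow> (\<lambda>k. cmod (a k)) summable_on UNIV"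
  using wsum_mono(1)[of s a 0] by (simp add: wsum_def)

lemma wsum_dominated:
  assumes "wsum s a" "\<And>k. cmod (b k) \<le> C * wt k ^ r * cmod (a k)" "r + p \<le> s" "C \<ge> 0"
  shows "wsum p b" "wnorm p b \<le> C * wnorm s a"
proof -
  have "(\<Sum>k\<in>F. wt k ^ p * cmod (b k)) \<le> C * wnorm s a" if "finite F" for F
  proof -
    have "(\<Sum>k\<in>F. wt k ^ p * cmod (b k)) \<le> (\<Sum>k\<in>F. C * (wt k ^ s * cmod (a k)))"
    proof (intro sum_mono)
      fix k
      have "wt k ^ p * cmod (b k) \<le> wt k ^ p * (C * wt k ^ r * cmod (a k))"
        by (intro mult_left_mono assms) auto
      also have "\<dots> = C * (wt k ^ (r + p) * cmod (a k))" by (simp add: power_add mult_ac)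
      also have "\<dots> \<le> C * (wt k ^ s * cmod (a k))"
        by (intro mult_left_mono mult_right_mono wt_pow_mono assms) auto
      finally show "wt k ^ p * cmod (b k) \<le> C * (wt k ^ s * cmod (a k))" .
    qed
    also have "\<dots> \<le> C * wnorm s a"
      unfolding sum_distrib_left[symmetric]
      by (intro mult_left_mono wnorm_finite_sum_le assms that)
    finally show ?thesis .
  qed
  from wsumI[OF this] show "wsum p b" "wnorm p b \<le> C * wnorm s a" by auto
qed

lemma wsum_add:
  assumes "wsum s a" "wsum s b"
  shows "wsum s (\<lambda>k. a k + b k)" "wnorm s (\<lambda>k. a k + b k) \<le> wnorm s a + wnorm s b"
proof -
  have "(\<Sum>k\<in>F. wt k ^ s * cmod (a k + b k)) \<le> wnorm s a + wnorm s b" if "finite F" for F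
  proof -
    have "(\<Sum>k\<in>F. wt k ^ s * cmod (a k + b k)) \<le> (\<Sum>k\<in>F. wt k ^ s * cmod (a k) + wt k ^ s * cmod (b k))"
      unfolding distrib_left[symmetric] by (intro sum_mono mult_left_mono norm_triangle_ineq) auto
    also have "\<dots> \<le> wnorm s a + wnorm s b"
      unfolding sum.distrib by (intro add_mono wnorm_finite_sum_le assms that)
    finally show ?thesis .
  qed
  from wsumI[OF this] show "wsum s (\<lambda>k. a k + b k)" "wnorm s (\<lambda>k. a k + b k) \<le> wnorm s a + wnorm s b"
    by auto
qed

text \<open>Cauchy-Schwarz against \<open>1 / wt k ^ 2\<close>. The price is two derivatives, since
  in three dimensions \<open>1 / wt k ^ 4\<close> is summable.\<close>

lemma wsum_of_square_sum:
  assumes "\<And>F. finite F \<Longrightarrow> (\<Sum>k\<in>F. wt k ^ (2 * s + 4) * (cmod (a k))\<^sup>2) \<le> B"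
  shows "wsum s a" "wnorm s a \<le> sqrt (wt4sum * B)"
proof -
  have "(\<Sum>k\<in>F. wt k ^ s * cmod (a k)) \<le> sqrt (wt4sum * B)" if "finite F" for F
  proof (rule real_le_rsqrt)
    have e: "wt k ^ s * cmod (a k) = (1 / wt k ^ 2) * (wt k ^ (s + 2) * cmod (a k))" for k
      using wt_pos[of k] by (simp add: power_add field_simps power2_eq_square)
    have "(\<Sum>k\<in>F. wt k ^ s * cmod (a k))\<^sup>2 \<le>
        (\<Sum>k\<in>F. (1 / wt k ^ 2)\<^sup>2) * (\<Sum>k\<in>F. (wt k ^ (s + 2) * cmod (a k))\<^sup>2)"
      unfolding e by (rule Cauchy_Schwarz_ineq_sum)
    also have "\<dots> = (\<Sum>k\<in>F. 1 / wt k ^ 4) * (\<Sum>k\<in>F. wt k ^ (2 * s + 4) * (cmod (a k))\<^sup>2)"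
      by (simp add: power_mult_distrib power_divide power_mult[symmetric] power_add mult_ac)
    also have "\<dots> \<le> wt4sum * B"
      using assms[OF that] sum_wt4_le[OF that] wt4sum_nonneg
      by (intro mult_mono) (auto intro!: sum_nonneg)
    finally show "(\<Sum>k\<in>F. wt k ^ s * cmod (a k))\<^sup>2 \<le> wt4sum * B" .
  qed
  from wsumI[OF this] show "wsum s a" "wnorm s a \<le> sqrt (wt4sum * B)" by auto
qed

section \<open>Absolutely convergent Fourier series\<close>

text \<open>Polymorphic in the field, since the same convolution is formed of complex coefficients
  and of their real weighted moduli, which majorise it in \<open>wsum_conv\<close>.\<close>

definition conv :: "(freq \<Rightarrow> 'a :: {banach, real_normed_field}) \<Rightarrow> (freq \<Rightarrow> 'a) \<Rightarrow> freq \<Rightarrow> 'a" where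
  "conv a b k = (\<Sum>\<^sub>\<infinity>j. a j * b (k - j))"

text \<open>Fubini for the absolutely summable double family u(j) v(l), read after the shear that
  sends (j, l) to (j + l, j).\<close>

lemma conv_has_sum:
  fixes u v :: "freq \<Rightarrow> 'a :: {banach, real_normed_field}"
  assumes u: "(\<lambda>k. norm (u k)) summable_on UNIV" and v: "(\<lambda>k. norm (v k)) summable_on UNIV"
  shows "((\<lambda>j. u j * v (k - j)) has_sum conv u v k) UNIV" (is ?A)
    and "(\<lambda>j. norm (u j * v (k - j))) summable_on UNIV" (is ?B)
    and "(conv u v has_sum (infsum u UNIV * infsum v UNIV)) UNIV" (is ?C)
proof -
  have P: "(\<lambda>p. norm (u (fst p) * v (snd p))) summable_on UNIV \<times> UNIV"
    by (rule abs_summable_prod[OF u v])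
  have us: "u summable_on UNIV" and vs: "v summable_on UNIV"
    using u v by (auto intro: abs_summable_summable)
  have hs: "((\<lambda>p. u (fst p) * v (snd p)) has_sum (infsum u UNIV * infsum v UNIV)) (UNIV \<times> UNIV)"
  proof (rule has_sum_SigmaI)
    show "((\<lambda>y. u (fst (x, y)) * v (snd (x, y))) has_sum u x * infsum v UNIV) UNIV" for x
      using has_sum_cmult_right[OF has_sum_infsum[OF vs], of "u x"] by simp
    show "((\<lambda>x. u x * infsum v UNIV) has_sum infsum u UNIV * infsum v UNIV) UNIV"
      by (rule has_sum_cmult_left[OF has_sum_infsum[OF us]])
    show "(\<lambda>p. u (fst p) * v (snd p)) summable_on UNIV \<times> UNIV"
      by (rule abs_summable_summable[OF P])
  qed
  have Q: "((\<lambda>p. u (snd p) * v (fst p - snd p)) has_sum (infsum u UNIV * infsum v UNIV)) (UNIV \<times> UNIV)"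
    using hs by (subst has_sum_reindex_bij_witness[where i = "\<lambda>p. (fst p + snd p, fst p)" and j = "\<lambda>p. (snd p, fst p - snd p)" and T = "UNIV \<times> UNIV" and h = "\<lambda>p. u (fst p) * v (snd p)"]) auto
  have "(\<lambda>p. norm (u (snd p) * v (fst p - snd p))) summable_on UNIV \<times> UNIV"
    using P by (subst summable_on_reindex_bij_witness[where i = "\<lambda>p. (fst p + snd p, fst p)" and j = "\<lambda>p. (snd p, fst p - snd p)" and T = "UNIV \<times> UNIV" and h = "\<lambda>p. norm (u (fst p) * v (snd p))"]) auto
  then have "\<forall>k. (\<lambda>j. norm (u j * v (k - j))) summable_on UNIV"
    using Infinite_Sum.abs_summable_on_Sigma_iff[of "\<lambda>p. u (snd p) * v (fst p - snd p)" UNIV "\<lambda>_. UNIV"] by simp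
  then have B: "(\<lambda>j. norm (u j * v (l - j))) summable_on UNIV" for l by blast
  then show ?B .
  have A: "((\<lambda>j. u j * v (l - j)) has_sum conv u v l) UNIV" for l
    unfolding conv_def by (rule has_sum_infsum[OF abs_summable_summable[OF B]])
  then show ?A .
  show ?C
    by (rule has_sum_SigmaD[OF Q]) (use A in auto)
qed

text \<open>Submultiplicativity of \<open>wt\<close> moves the weight inside the convolution: the
  weighted modulus is dominated by a convolution of weighted moduli, whose total sum is the
  product.\<close>

lemma wsum_conv:
  assumes "wsum s a" "wsum s b"
  shows "wsum s (conv a b)" "wnorm s (conv a b) \<le> wnorm s a * wnorm s b"
proof -
  let ?u = "\<lambda>k. wt k ^ s * cmod (a k)" and ?v = "\<lambda>k. wt k ^ s * cmod (b k)"
  have u: "(\<lambda>k. norm (?u k)) summable_on UNIV" and v: "(\<lambda>k. norm (?v k)) summable_on UNIV"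
    using assms by (auto simp: wsum_def)
  have a: "(\<lambda>k. norm (a k)) summable_on UNIV" and b: "(\<lambda>k. norm (b k)) summable_on UNIV"
    using assms wsum_abs_summable by auto
  have le: "wt k ^ s * cmod (conv a b k) \<le> conv ?u ?v k" for k
  proof -
    have "norm (of_real (wt k ^ s) * conv a b k) \<le> conv ?u ?v k"
    proof (rule norm_infsum_le)
      show "((\<lambda>j. of_real (wt k ^ s) * (a j * b (k - j))) has_sum of_real (wt k ^ s) * conv a b k) UNIV"
        by (rule has_sum_cmult_right[OF conv_has_sum(1)[OF a b]])
      show "((\<lambda>j. ?u j * ?v (k - j)) has_sum conv ?u ?v k) UNIV"
        by (rule conv_has_sum(1)[OF u v])
      show "norm (complex_of_real (wt k ^ s) * (a j * b (k - j))) \<le> ?u j * ?v (k - j)" for j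
      proof -
        have "wt k ^ s \<le> wt j ^ s * wt (k - j) ^ s" using wt_pow_add_le[of j "k - j" s] by simp
        then have "wt k ^ s * (cmod (a j) * cmod (b (k - j))) \<le> (wt j ^ s * wt (k - j) ^ s) * (cmod (a j) * cmod (b (k - j)))"
          by (rule mult_right_mono) auto
        then show ?thesis by (simp add: norm_mult norm_power mult_ac)
      qed
    qed
    then show ?thesis by (simp add: norm_mult norm_power)
  qed
  have "(\<Sum>k\<in>F. wt k ^ s * cmod (conv a b k)) \<le> wnorm s a * wnorm s b" if "finite F" for F
  proof -
    have "(\<Sum>k\<in>F. wt k ^ s * cmod (conv a b k)) \<le> (\<Sum>k\<in>F. conv ?u ?v k)"
      by (intro sum_mono le)
    also have "\<dots> \<le> infsum ?u UNIV * infsum ?v UNIV"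
    proof (rule finite_sum_le_has_sum[OF conv_has_sum(3)[OF u v] that])
      show "conv ?u ?v k \<ge> 0" for k
        using le[of k] by (smt (verit) mult_nonneg_nonneg norm_ge_zero wt_pow_nonneg)
    qed auto
    finally show ?thesis by (simp add: wnorm_def)
  qed
  from wsumI[OF this] show "wsum s (conv a b)" "wnorm s (conv a b) \<le> wnorm s a * wnorm s b" by auto
qed

definition ek :: "freq \<Rightarrow> real \<Rightarrow> real \<Rightarrow> real \<Rightarrow> complex" where
  "ek k x y z = cis (2 * pi * (real_of_int (fst k) * x + real_of_int (fst (snd k)) * y + real_of_int (snd (snd k)) * z))"

lemma norm_ek [simp]: "cmod (ek k x y z) = 1"
  by (simp add: ek_def)

lemma ek_add: "ek (j + k) x y z = ek j x y z * ek k x y z"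
  by (simp add: ek_def cis_mult algebra_simps)

text \<open>Ties g to an absolutely convergent series that represents it at every point. Carrying
  function and coefficients together lets each derivative and product be computed on both sides at
  once.\<close>

definition wien :: "nat \<Rightarrow> (freq \<Rightarrow> complex) \<Rightarrow> sfun \<Rightarrow> bool" where
  "wien s a g \<longleftrightarrow> wsum s a \<and> (\<forall>x y z. ((\<lambda>k. a k * ek k x y z) has_sum complex_of_real (g x y z)) UNIV)"

lemma wien_mono: "wien r a g \<Longrightarrow> s \<le> r \<Longrightarrow> wien s a g"
  using wsum_mono by (auto simp: wien_def)

lemma wien_add:
  assumes "wien s a f" "wien s b g"
  shows "wien s (\<lambda>k. a k + b k) (\<lambda>x y z. f x y z + g x y z)"
  unfolding wien_def distrib_right of_real_add
  using assms wsum_add(1)[of s a b] by (auto simp: wien_def intro!: has_sum_add)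

lemma wien_cmult:
  assumes "wien s a f"
  shows "wien s (\<lambda>k. complex_of_real c * a k) (\<lambda>x y z. c * f x y z)"
  unfolding wien_def mult.assoc of_real_mult
  using assms wsum_dominated(1)[of s a "\<lambda>k. complex_of_real c * a k" "\<bar>c\<bar>" 0 s]
  by (auto simp: wien_def norm_mult intro!: has_sum_cmult_right)

lemma wien_mult:
  assumes "wien s a f" "wien s b g"
  shows "wien s (conv a b) (\<lambda>x y z. f x y z * g x y z)"
proof -
  have wa: "wsum s a" and wb: "wsum s b" using assms by (auto simp: wien_def)
  have "((\<lambda>k. conv a b k * ek k x y z) has_sum complex_of_real (f x y z * g x y z)) UNIV" for x y z
  proof -
    let ?u = "\<lambda>k. a k * ek k x y z" and ?v = "\<lambda>k. b k * ek k x y z"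
    have u: "(\<lambda>k. norm (?u k)) summable_on UNIV" and v: "(\<lambda>k. norm (?v k)) summable_on UNIV"
      using wa wb wsum_abs_summable by (auto simp: norm_mult)
    have "conv ?u ?v k = conv a b k * ek k x y z" for k
    proof -
      have "?u j * ?v (k - j) = a j * b (k - j) * ek k x y z" for j
        using ek_add[of j "k - j" x y z] by (simp add: mult_ac)
      then show ?thesis unfolding conv_def by (simp only: infsum_cmult_left')
    qed
    then have "conv ?u ?v = (\<lambda>k. conv a b k * ek k x y z)" by blast
    moreover have "infsum ?u UNIV = complex_of_real (f x y z)" "infsum ?v UNIV = complex_of_real (g x y z)"
      using assms by (auto simp: wien_def intro!: infsumI)
    ultimately show ?thesis using conv_has_sum(3)[OF u v] by (simp only: of_real_mult)
  qed
  then show ?thesis using wsum_conv[OF wa wb] by (auto simp: wien_def)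
qed

lemma wien_bound:
  assumes "wien s a g"
  shows "\<bar>g x y z\<bar> \<le> wnorm s a"
proof -
  have w: "wsum s a" using assms by (simp add: wien_def)
  have "norm (complex_of_real (g x y z)) \<le> wnorm s a"
  proof (rule norm_infsum_le)
    show "((\<lambda>k. a k * ek k x y z) has_sum complex_of_real (g x y z)) UNIV"
      using assms by (simp add: wien_def)
    show "((\<lambda>k. wt k ^ s * cmod (a k)) has_sum wnorm s a) UNIV"
      unfolding wnorm_def using w by (simp add: wsum_def)
    show "norm (a k * ek k x y z) \<le> wt k ^ s * cmod (a k)" for k
      using mult_right_mono[OF wt_pow_ge_1, of "cmod (a k)" k s] by (simp add: norm_mult)
  qed
  then show ?thesis by simp
qed

section \<open>Fourier coefficients of continuous functions\<close>

text \<open>A fixed enumeration turns unordered sums over frequencies into series, on which termwise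
  differentiation and uniform convergence operate.\<close>

definition enum_mode :: "nat \<Rightarrow> freq" where
  "enum_mode = from_nat_into UNIV"

lemma bij_enum_mode: "bij enum_mode"
proof -
  have "infinite (UNIV :: (freq) set)"
    by (simp add: finite_prod infinite_UNIV_int)
  then show ?thesis
    unfolding enum_mode_def by (intro bij_betw_from_nat_into) auto
qed

lemma has_sum_imp_sums_enum: "(f has_sum S) UNIV \<Longrightarrow> (\<lambda>n. f (enum_mode n)) sums S"
  using has_sum_reindex_bij_betw[OF bij_enum_mode, of f S] by (intro has_sum_imp_sums) simp

lemma summable_enum:
  fixes f :: "freq \<Rightarrow> 'a :: {comm_monoid_add, t2_space}"
  assumes "f summable_on UNIV"
  shows "summable (\<lambda>n. f (enum_mode n))" "suminf (\<lambda>n. f (enum_mode n)) = infsum f UNIV"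
  using has_sum_imp_sums_enum[OF has_sum_infsum[OF assms]] sums_iff by auto

lemma has_real_derivative_trig_series:
  fixes b :: "freq \<Rightarrow> complex" and \<theta> :: "freq \<Rightarrow> real"
  assumes b: "(\<lambda>k. cmod (b k)) summable_on UNIV" and tb: "(\<lambda>k. \<bar>\<theta> k\<bar> * cmod (b k)) summable_on UNIV"
    and sum: "\<And>s. ((\<lambda>k. Re (b k * cis (\<theta> k * s))) has_sum g s) UNIV"
  shows "(g has_real_derivative (\<Sum>\<^sub>\<infinity>k. Re (\<i> * of_real (\<theta> k) * b k * cis (\<theta> k * s)))) (at s)"
proof -
  let ?f = "\<lambda>n s. Re (b (enum_mode n) * cis (\<theta> (enum_mode n) * s))"
  let ?f' = "\<lambda>n s. Re (\<i> * of_real (\<theta> (enum_mode n)) * b (enum_mode n) * cis (\<theta> (enum_mode n) * s))"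
  have g: "g s = (\<Sum>n. ?f n s)" for s
    using has_sum_imp_sums_enum[OF sum, of s] sums_unique by blast
  have bound: "\<bar>Re (\<i> * of_real (\<theta> k) * b k * cis (\<theta> k * s))\<bar> \<le> \<bar>\<theta> k\<bar> * cmod (b k)" for k s
    using abs_Re_le_cmod[of "\<i> * of_real (\<theta> k) * b k * cis (\<theta> k * s)"] by (simp add: norm_mult)
  have s': "(\<lambda>k. Re (\<i> * of_real (\<theta> k) * b k * cis (\<theta> k * s))) summable_on UNIV"
    by (rule abs_summable_summable, rule Infinite_Sum.abs_summable_on_comparison_test'[OF tb])
      (use bound in simp)
  have "((\<lambda>s. \<Sum>n. ?f n s) has_real_derivative (\<Sum>n. ?f' n s)) (at s)"
  proof (rule has_field_derivative_series'(2)[where S = UNIV and x0 = s])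
    show "(?f n has_real_derivative ?f' n x) (at x within UNIV)" for n x
      by (auto intro!: derivative_eq_intros simp: algebra_simps)
    show "uniformly_convergent_on UNIV (\<lambda>n x. \<Sum>i<n. ?f' i x)"
      by (rule Weierstrass_m_test'[OF _ summable_enum(1)[OF tb]]) (use bound in simp)
    show "summable (\<lambda>n. ?f n s)"
      using has_sum_imp_sums_enum[OF sum, of s] by (simp add: sums_iff)
  qed auto
  moreover have "(\<Sum>n. ?f' n s) = (\<Sum>\<^sub>\<infinity>k. Re (\<i> * of_real (\<theta> k) * b k * cis (\<theta> k * s)))"
    by (rule summable_enum(2)[OF s'])
  ultimately show ?thesis by (simp add: g[abs_def])
qed

lemma trig_series_deriv:
  fixes b :: "freq \<Rightarrow> complex" and \<theta> :: "freq \<Rightarrow> real"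
  assumes b: "(\<lambda>k. cmod (b k)) summable_on UNIV" and tb: "(\<lambda>k. \<bar>\<theta> k\<bar> * cmod (b k)) summable_on UNIV"
    and sum: "\<And>s. ((\<lambda>k. b k * cis (\<theta> k * s)) has_sum complex_of_real (g s)) UNIV"
  shows "((\<lambda>k. \<i> * of_real (\<theta> k) * b k * cis (\<theta> k * s)) has_sum complex_of_real (deriv g s)) UNIV"
proof -
  let ?h = "\<lambda>k. \<i> * of_real (\<theta> k) * b k * cis (\<theta> k * s)"
  have sm: "?h summable_on UNIV"
    by (rule abs_summable_summable, rule Infinite_Sum.abs_summable_on_comparison_test'[OF tb])
      (simp add: norm_mult)
  have "((\<lambda>k. Re (b k * cis (\<theta> k * s))) has_sum g s) UNIV" for s
    using has_sum_Re[OF sum, of s] by simp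
  from has_real_derivative_trig_series[OF b tb this]
  have re: "deriv g s = (\<Sum>\<^sub>\<infinity>k. Re (?h k))" by (intro DERIV_imp_deriv)
  \<comment> \<open>Multiplying by -i turns imaginary parts into real parts. These sum to the zero
    function for all s, so the termwise derivative of that real series is zero as well.\<close>
  have "((\<lambda>k. Re ((- \<i> * b k) * cis (\<theta> k * s))) has_sum (\<lambda>_. 0) s) UNIV" for s
    using has_sum_Im[OF sum, of s] by simp
  from has_real_derivative_trig_series[of "\<lambda>k. - \<i> * b k" \<theta> "\<lambda>_. 0" s, OF _ _ this]
  have "((\<lambda>_. 0) has_real_derivative (\<Sum>\<^sub>\<infinity>k. Re (\<i> * of_real (\<theta> k) * (- \<i> * b k) * cis (\<theta> k * s)))) (at s)"
    using b tb by (simp add: norm_mult)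
  then have "(\<Sum>\<^sub>\<infinity>k. Re (\<i> * of_real (\<theta> k) * (- \<i> * b k) * cis (\<theta> k * s))) = 0"
    using DERIV_unique[OF _ DERIV_const] by blast
  moreover have "Re (\<i> * of_real (\<theta> k) * (- \<i> * b k) * cis (\<theta> k * s)) = Im (?h k)" for k
    by (simp add: algebra_simps)
  ultimately have im: "(\<Sum>\<^sub>\<infinity>k. Im (?h k)) = 0" by simp
  have "infsum ?h UNIV = complex_of_real (deriv g s)"
    using re im infsum_Re[OF sm] infsum_Im[OF sm] by (simp add: complex_eq_iff)
  then show ?thesis using has_sum_infsum[OF sm] by simp
qed

text \<open>One argument for the three partial derivatives: (X, Y, Z) runs along a coordinate line
  and b absorbs the constant phase of the two frozen coordinates.\<close>

lemma wien_d_aux: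
  assumes "wien (Suc s) a g" "\<And>k. \<bar>\<theta> k\<bar> \<le> 2 * pi * wt k"
    and split: "\<And>k x. a k * ek k (X x) (Y x) (Z x) = b k * cis (\<theta> k * x)"
    and nb: "\<And>k. cmod (b k) = cmod (a k)"
  shows "((\<lambda>k. \<i> * of_real (\<theta> k) * a k * ek k (X x) (Y x) (Z x)) has_sum complex_of_real (deriv (\<lambda>x. g (X x) (Y x) (Z x)) x)) UNIV"
    and "wsum s (\<lambda>k. \<i> * of_real (\<theta> k) * a k)"
proof -
  have w: "wsum (Suc s) a" using assms by (simp add: wien_def)
  show "wsum s (\<lambda>k. \<i> * of_real (\<theta> k) * a k)"
    by (rule wsum_dominated(1)[OF w, where C = "2 * pi" and r = 1])
      (use assms(2) in \<open>auto simp: norm_mult intro!: mult_right_mono\<close>)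
  then have "(\<lambda>k. \<bar>\<theta> k\<bar> * cmod (b k)) summable_on UNIV"
    using wsum_abs_summable[of s "\<lambda>k. \<i> * of_real (\<theta> k) * a k"] by (simp add: norm_mult nb)
  moreover have "(\<lambda>k. cmod (b k)) summable_on UNIV"
    using wsum_abs_summable[OF w] by (simp add: nb)
  moreover have "((\<lambda>k. b k * cis (\<theta> k * x)) has_sum complex_of_real (g (X x) (Y x) (Z x))) UNIV" for x
    unfolding split[symmetric] using assms(1) by (simp add: wien_def)
  ultimately have "((\<lambda>k. \<i> * of_real (\<theta> k) * b k * cis (\<theta> k * x)) has_sum complex_of_real (deriv (\<lambda>x. g (X x) (Y x) (Z x)) x)) UNIV"
    by (intro trig_series_deriv)
  then show "((\<lambda>k. \<i> * of_real (\<theta> k) * a k * ek k (X x) (Y x) (Z x)) has_sum complex_of_real (deriv (\<lambda>x. g (X x) (Y x) (Z x)) x)) UNIV"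
    by (simp only: mult.assoc split)
qed

lemma wien_dx:
  assumes "wien (Suc s) a g"
  shows "wien s (\<lambda>k. \<i> * complex_of_real (2 * pi * real_of_int (fst k)) * a k) (dxc g)"
proof -
  note aux = wien_d_aux[OF assms, where \<theta> = "\<lambda>k. 2 * pi * real_of_int (fst k)"]
  have b: "\<bar>2 * pi * real_of_int (fst k)\<bar> \<le> 2 * pi * wt k" for k
    by (simp add: abs_mult wt_def)
  have "((\<lambda>k. \<i> * complex_of_real (2 * pi * real_of_int (fst k)) * a k * ek k x y z) has_sum complex_of_real (dxc g x y z)) UNIV" for x y z
    unfolding dxc_def
    by (rule aux(1)[where X = "\<lambda>x. x" and Y = "\<lambda>x. y" and Z = "\<lambda>x. z" and
        b = "\<lambda>k. a k * cis (2 * pi * (real_of_int (fst (snd k)) * y + real_of_int (snd (snd k)) * z))", OF b])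
      (simp_all add: ek_def cis_mult norm_mult algebra_simps)
  moreover have "wsum s (\<lambda>k. \<i> * complex_of_real (2 * pi * real_of_int (fst k)) * a k)"
    by (rule aux(2)[where X = "\<lambda>x. x" and Y = "\<lambda>x. 0" and Z = "\<lambda>x. 0" and b = a, OF b])
      (simp_all add: ek_def mult_ac)
  ultimately show ?thesis by (auto simp: wien_def)
qed

lemma wien_dy:
  assumes "wien (Suc s) a g"
  shows "wien s (\<lambda>k. \<i> * complex_of_real (2 * pi * real_of_int (fst (snd k))) * a k) (dyc g)"
proof -
  note aux = wien_d_aux[OF assms, where \<theta> = "\<lambda>k. 2 * pi * real_of_int (fst (snd k))"]
  have b: "\<bar>2 * pi * real_of_int (fst (snd k))\<bar> \<le> 2 * pi * wt k" for k
    by (simp add: abs_mult wt_def)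
  have "((\<lambda>k. \<i> * complex_of_real (2 * pi * real_of_int (fst (snd k))) * a k * ek k x y z) has_sum complex_of_real (dyc g x y z)) UNIV" for x y z
    unfolding dyc_def
    by (rule aux(1)[where X = "\<lambda>t. x" and Y = "\<lambda>t. t" and Z = "\<lambda>t. z" and
        b = "\<lambda>k. a k * cis (2 * pi * (real_of_int (fst k) * x + real_of_int (snd (snd k)) * z))", OF b])
      (simp_all add: ek_def cis_mult norm_mult algebra_simps)
  moreover have "wsum s (\<lambda>k. \<i> * complex_of_real (2 * pi * real_of_int (fst (snd k))) * a k)"
    by (rule aux(2)[where X = "\<lambda>x. 0" and Y = "\<lambda>x. x" and Z = "\<lambda>x. 0" and b = a, OF b])
      (simp_all add: ek_def mult_ac)
  ultimately show ?thesis by (auto simp: wien_def)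
qed

lemma wien_dz:
  assumes "wien (Suc s) a g"
  shows "wien s (\<lambda>k. \<i> * complex_of_real (2 * pi * real_of_int (snd (snd k))) * a k) (dzc g)"
proof -
  note aux = wien_d_aux[OF assms, where \<theta> = "\<lambda>k. 2 * pi * real_of_int (snd (snd k))"]
  have b: "\<bar>2 * pi * real_of_int (snd (snd k))\<bar> \<le> 2 * pi * wt k" for k
    by (simp add: abs_mult wt_def)
  have "((\<lambda>k. \<i> * complex_of_real (2 * pi * real_of_int (snd (snd k))) * a k * ek k x y z) has_sum complex_of_real (dzc g x y z)) UNIV" for x y z
    unfolding dzc_def
    by (rule aux(1)[where X = "\<lambda>t. x" and Y = "\<lambda>t. y" and Z = "\<lambda>t. t" and
        b = "\<lambda>k. a k * cis (2 * pi * (real_of_int (fst k) * x + real_of_int (fst (snd k)) * y))", OF b])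
      (simp_all add: ek_def cis_mult norm_mult algebra_simps)
  moreover have "wsum s (\<lambda>k. \<i> * complex_of_real (2 * pi * real_of_int (snd (snd k))) * a k)"
    by (rule aux(2)[where X = "\<lambda>x. 0" and Y = "\<lambda>x. 0" and Z = "\<lambda>x. x" and b = a, OF b])
      (simp_all add: ek_def mult_ac)
  ultimately show ?thesis by (auto simp: wien_def)
qed

definition ekp :: "freq \<Rightarrow> real \<times> real \<times> real \<Rightarrow> complex" where
  "ekp k p = ek k (fst p) (fst (snd p)) (snd (snd p))"

lemma norm_ekp [simp]: "cmod (ekp k p) = 1"
  by (simp add: ekp_def)

lemma ekp_0 [simp]: "ekp 0 p = 1"
  by (simp add: ekp_def ek_def)

lemma ekp_add: "ekp (j + k) p = ekp j p * ekp k p"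
  by (simp add: ekp_def ek_add)

lemma cnj_ek: "cnj (ek k x y z) = ek (- k) x y z"
  by (simp add: ek_def cis_cnj algebra_simps)

lemma cnj_ekp: "cnj (ekp k p) = ekp (- k) p"
  by (simp add: ekp_def cnj_ek)

lemma continuous_on_ekp [continuous_intros]: "continuous_on S (ekp k)"
  unfolding ekp_def ek_def by (intro continuous_intros)

lemma box3_cbox: "box3 = cbox (0, 0, 0) (1, 1, 1)"
  by (simp add: box3_def cbox_Pair_eq)

lemma integral_cis_period: "integral {0..1} (\<lambda>x. cis (2 * pi * real_of_int n * x)) = (if n = 0 then 1 else 0)"
proof (cases "n = 0")
  case False
  let ?c = "2 * pi * real_of_int n"
  have c: "?c \<noteq> 0" using False by simp
  have "((\<lambda>x. cis (?c * x)) has_integral (cis (?c * 1) / (\<i> * of_real ?c) - cis (?c * 0) / (\<i> * of_real ?c))) {0..1}"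
  proof (rule fundamental_theorem_of_calculus)
    show "((\<lambda>x. cis (?c * x) / (\<i> * of_real ?c)) has_vector_derivative cis (?c * x)) (at x within {0..1})" for x
    proof -
      have e: "(\<lambda>x. cis (?c * x)) = (\<lambda>x. exp (of_real x * (\<i> * of_real ?c)))"
        by (simp add: cis_conv_exp mult_ac)
      have "((\<lambda>x. exp (of_real x * (\<i> * of_real ?c))) has_vector_derivative (\<i> * of_real ?c) * exp (of_real x * (\<i> * of_real ?c))) (at x within {0..1})"
        using exp_times_scaleR_commute[of x "\<i> * of_real ?c"]
          exp_scaleR_has_vector_derivative_right[of "\<i> * of_real ?c" x "{0..1}"]
        by (simp add: scaleR_conv_of_real mult_ac)
      then have "((\<lambda>x. cis (?c * x)) has_vector_derivative (\<i> * of_real ?c) * cis (?c * x)) (at x within {0..1})"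
        unfolding e[symmetric] using fun_cong[OF e, of x] by simp
      from has_vector_derivative_divide[OF this, of "\<i> * of_real ?c"] show ?thesis using c by simp
    qed
  qed simp
  moreover have "cis (?c * 1) = 1" using cis_int_ratio_eq_1[of 1 n] by simp
  ultimately show ?thesis using False by (simp add: integral_unique)
qed simp

lemma integral_ekp: "integral box3 (ekp k) = (if k = 0 then 1 else 0)"
proof -
  let ?e = "\<lambda>n x. cis (2 * pi * real_of_int n * x)"
  have e: "ekp k (x, y, z) = ?e (fst k) x * (?e (fst (snd k)) y * ?e (snd (snd k)) z)" for x y z
    by (simp add: ekp_def ek_def cis_mult algebra_simps)
  have "integral box3 (ekp k) = integral (cbox 0 1) (\<lambda>x. integral (cbox (0, 0) (1, 1)) (\<lambda>q. ekp k (x, q)))"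
    unfolding box3_cbox by (rule integral_prod_continuous[OF continuous_on_ekp])
  also have "\<dots> = integral (cbox 0 1) (\<lambda>x. integral (cbox 0 1) (\<lambda>y. integral (cbox 0 1) (\<lambda>z. ekp k (x, y, z))))"
  proof (rule integral_cong)
    fix x :: real
    have "continuous_on (cbox (0, 0) (1, 1)) (\<lambda>q. ekp k (x, q))"
      by (rule continuous_on_compose2[OF continuous_on_ekp]) (auto intro!: continuous_intros)
    from integral_prod_continuous[OF this]
    show "integral (cbox (0, 0) (1, 1)) (\<lambda>q. ekp k (x, q)) = integral (cbox 0 1) (\<lambda>y. integral (cbox 0 1) (\<lambda>z. ekp k (x, y, z)))" .
  qed
  also have "\<dots> = (if k = 0 then 1 else 0)"
    by (simp add: e integral_cis_period prod_eq_iff)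
  finally show ?thesis .
qed

lemma wien_uniform_limit:
  assumes "wien s a g"
  shows "uniform_limit UNIV (\<lambda>n p. \<Sum>i<n. a (enum_mode i) * ekp (enum_mode i) p) (\<lambda>p. complex_of_real (unc g p)) sequentially"
proof -
  have w: "(\<lambda>k. cmod (a k)) summable_on UNIV" using assms wsum_abs_summable by (auto simp: wien_def)
  have "uniform_limit UNIV (\<lambda>n p. \<Sum>i<n. a (enum_mode i) * ekp (enum_mode i) p) (\<lambda>p. suminf (\<lambda>i. a (enum_mode i) * ekp (enum_mode i) p)) sequentially"
    by (rule Weierstrass_m_test[OF _ summable_enum(1)[OF w]]) (simp add: norm_mult)
  moreover have "suminf (\<lambda>i. a (enum_mode i) * ekp (enum_mode i) p) = complex_of_real (unc g p)" for p
    using has_sum_imp_sums_enum[of "\<lambda>k. a k * ekp k p" "complex_of_real (unc g p)"] assms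
    by (cases p) (auto simp: wien_def ekp_def unc_def sums_iff)
  ultimately show ?thesis by simp
qed

lemma wien_continuous:
  assumes "wien s a g"
  shows "continuous_on UNIV (unc g)"
proof -
  have "continuous_on UNIV (\<lambda>p. complex_of_real (unc g p))"
    by (rule uniform_limit_theorem[OF _ wien_uniform_limit[OF assms]])
      (auto intro!: always_eventually continuous_intros)
  then have "continuous_on UNIV (\<lambda>p. Re (complex_of_real (unc g p)))"
    by (rule continuous_on_Re)
  then show ?thesis by simp
qed

lemma fcoef_eq_integral:
  assumes "continuous_on UNIV (unc g)"
  shows "fcoef g k = integral box3 (\<lambda>p. complex_of_real (unc g p) * cnj (ekp k p))"
proof -
  have eq: "fcoef g k = set_lebesgue_integral lebesgue box3 (\<lambda>p. complex_of_real (unc g p) * cnj (ekp k p))"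
    by (simp add: fcoef_def unc_def ekp_def ek_def cis_cnj case_prod_unfold algebra_simps)
  have "continuous_on box3 (\<lambda>p. complex_of_real (unc g p) * cnj (ekp k p))"
    by (intro continuous_intros continuous_on_subset[OF assms]) auto
  then have "(\<lambda>p. complex_of_real (unc g p) * cnj (ekp k p)) absolutely_integrable_on box3"
    unfolding box3_cbox by (rule absolutely_integrable_continuous)
  from set_lebesgue_integral_eq_integral(2)[OF this] show ?thesis using eq by simp
qed

text \<open>The series converges uniformly, so it may be integrated against the conjugate
  exponential term by term, and orthogonality leaves one term.\<close>

lemma wien_fcoef:
  assumes "wien s a g"
  shows "fcoef g l = a l"
proof -
  let ?F = "\<lambda>n p. (\<Sum>i<n. a (enum_mode i) * ekp (enum_mode i) p) * cnj (ekp l p)"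
  let ?G = "\<lambda>p. complex_of_real (unc g p) * cnj (ekp l p)"
  have "uniform_limit box3 ?F ?G sequentially"
  proof (rule uniform_limitI)
    fix e :: real assume "e > 0"
    from uniform_limitD[OF wien_uniform_limit[OF assms] this]
    show "\<forall>\<^sub>F n in sequentially. \<forall>p\<in>box3. dist (?F n p) (?G p) < e"
      by (rule eventually_mono) (auto simp: dist_norm left_diff_distrib[symmetric] norm_mult)
  qed
  moreover have cF: "continuous_on box3 (?F n)" for n
    by (intro continuous_intros)
  ultimately obtain I J where IJ: "\<And>n. (?F n has_integral I n) box3" "(?G has_integral J) box3" "I \<longlonglongrightarrow> J"
    unfolding box3_cbox by (rule uniform_limit_integral_cbox) auto
  have I: "I n = (\<Sum>i<n. if enum_mode i = l then a l else 0)" for n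
  proof -
    have int: "ekp k integrable_on box3" for k
      unfolding box3_cbox by (intro integrable_continuous continuous_intros)
    have "?F n = (\<lambda>p. \<Sum>i<n. a (enum_mode i) * ekp (enum_mode i - l) p)"
      by (simp add: fun_eq_iff sum_distrib_right cnj_ekp diff_conv_add_uminus ekp_add mult.assoc del: add_uminus_conv_diff)
    then have "I n = integral box3 (\<lambda>p. \<Sum>i<n. a (enum_mode i) * ekp (enum_mode i - l) p)"
      using IJ(1)[of n] by (simp add: integral_unique)
    also have "\<dots> = (\<Sum>i<n. a (enum_mode i) * integral box3 (ekp (enum_mode i - l)))"
      by (subst integral_sum) (auto intro!: integrable_on_mult_right int)
    also have "\<dots> = (\<Sum>i<n. if enum_mode i = l then a l else 0)"
      by (intro sum.cong) (auto simp: integral_ekp)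
    finally show ?thesis .
  qed
  obtain i0 where i0: "enum_mode i0 = l" using bij_enum_mode by (metis bij_pointE)
  have "I n = a l" if "n > i0" for n
  proof -
    have "I n = (\<Sum>i<n. if i = i0 then a l else 0)"
      unfolding I using bij_enum_mode i0 by (intro sum.cong) (auto simp: bij_def inj_def)
    then show ?thesis using that by simp
  qed
  then have "I \<longlonglongrightarrow> a l"
    by (intro tendsto_eventually eventually_sequentiallyI[of "Suc i0"]) auto
  then have "J = a l" using IJ(3) LIMSEQ_unique by blast
  then show ?thesis
    using IJ(2) fcoef_eq_integral[OF wien_continuous[OF assms]] by (simp add: integral_unique)
qed

section \<open>A localising kernel of trigonometric polynomials\<close>

lemma integral_box3_add:
  assumes "continuous_on box3 f" "continuous_on box3 (g :: _ \<Rightarrow> complex)"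
  shows "integral box3 (\<lambda>p. f p + g p) = integral box3 f + integral box3 g"
  using assms unfolding box3_cbox by (intro integral_add integrable_continuous)

text \<open>A raised cosine in direction j with values in [0, 1] and its peak at phase
  \<alpha>.\<close>

definition tf :: "freq \<Rightarrow> real \<Rightarrow> real \<times> real \<times> real \<Rightarrow> real" where
  "tf j \<alpha> p = (1 + cos (2 * pi * (real_of_int (fst j) * fst p + real_of_int (fst (snd j)) * fst (snd p) + real_of_int (snd (snd j)) * snd (snd p)) - \<alpha>)) / 2"

lemma tf_complex: "complex_of_real (tf j \<alpha> p) = 1/2 + (cis (- \<alpha>) / 4 * ekp j p + cis \<alpha> / 4 * ekp (- j) p)"
proof -
  let ?b = "2 * pi * (real_of_int (fst j) * fst p + real_of_int (fst (snd j)) * fst (snd p) + real_of_int (snd (snd j)) * snd (snd p))"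
  have e: "ekp j p = cis ?b" "ekp (- j) p = cis (- ?b)"
    by (simp_all add: ekp_def ek_def algebra_simps)
  have "cis (- \<alpha>) / 4 * ekp j p + cis \<alpha> / 4 * ekp (- j) p = (cis (?b - \<alpha>) + cis (- (?b - \<alpha>))) / 4"
    unfolding e by (simp add: cis_mult add_divide_distrib algebra_simps)
  also have "cis t + cis (- t) = complex_of_real (2 * cos t)" for t
    by (simp add: complex_eq_iff)
  finally show ?thesis by (simp add: tf_def add_divide_distrib del: cos_diff)
qed

lemma continuous_on_tf [continuous_intros]: "continuous_on S (tf j \<alpha>)"
  unfolding tf_def by (intro continuous_intros) auto

text \<open>\<open>tf\<close> has only the frequencies 0, j and -j, so each coefficient of the
  product is a combination of three coefficients of h.\<close>

lemma integral_tf_zero: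
  assumes h: "continuous_on box3 (h :: _ \<Rightarrow> real)" and z: "\<And>k. integral box3 (\<lambda>p. complex_of_real (h p) * ekp k p) = 0"
  shows "integral box3 (\<lambda>p. complex_of_real (h p * tf j \<alpha> p) * ekp k p) = 0"
proof -
  let ?H = "\<lambda>k p. complex_of_real (h p) * ekp k p"
  have c: "continuous_on box3 (\<lambda>p. d * ?H k p)" for d k by (intro continuous_intros h)
  have i: "integral box3 (\<lambda>p. d * ?H k p) = 0" for d k using z[of k] by simp
  have "(\<lambda>p. complex_of_real (h p * tf j \<alpha> p) * ekp k p) =
     (\<lambda>p. 1/2 * ?H k p + (cis (- \<alpha>) / 4 * ?H (k + j) p + cis \<alpha> / 4 * ?H (k + (- j)) p))"
    unfolding of_real_mult tf_complex ekp_add by (simp add: fun_eq_iff algebra_simps)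
  then show ?thesis
    by (simp only: integral_box3_add[OF c continuous_on_add[OF c c]] integral_box3_add[OF c c] i) simp
qed

text \<open>The condition |t| \<le> 1 - d keeps t at distance at least d from the neighbouring
  periodic peaks at 1 and -1.\<close>

lemma peak_bounds:
  fixes t d :: real
  assumes "0 < d" "d \<le> 1/2"
  shows "\<bar>t\<bar> \<le> d \<Longrightarrow> cos (2 * pi * d) \<le> cos (2 * pi * t)"
    and "d \<le> \<bar>t\<bar> \<Longrightarrow> \<bar>t\<bar> \<le> 1 - d \<Longrightarrow> cos (2 * pi * t) \<le> cos (2 * pi * d)"
    and "cos (2 * pi * d) < 1"
proof -
  have abs: "cos (2 * pi * t) = cos (2 * pi * \<bar>t\<bar>)"
    by (cases "t \<ge> 0") (auto simp: abs_if)
  have d: "0 < 2 * pi * d" "2 * pi * d \<le> pi" using assms by auto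
  show "cos (2 * pi * d) \<le> cos (2 * pi * t)" if "\<bar>t\<bar> \<le> d"
    unfolding abs by (rule cos_monotone_0_pi_le) (use that d in auto)
  show "cos (2 * pi * d) < 1"
    using cos_monotone_0_pi[of 0 "2 * pi * d"] d by simp
  show "cos (2 * pi * t) \<le> cos (2 * pi * d)" if t: "d \<le> \<bar>t\<bar>" "\<bar>t\<bar> \<le> 1 - d"
  proof (cases "\<bar>t\<bar> \<le> 1/2")
    case True
    then have "2 * pi * \<bar>t\<bar> \<le> pi" by simp
    then show ?thesis unfolding abs
      by (intro cos_monotone_0_pi_le) (use t d in auto)
  next
    case False
    have "cos (2 * pi * \<bar>t\<bar>) = cos (2 * pi - 2 * pi * \<bar>t\<bar>)" by simp
    also have "\<dots> = cos (2 * pi * (1 - \<bar>t\<bar>))" by (simp add: algebra_simps)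
    also have "\<dots> \<le> cos (2 * pi * d)"
    proof (rule cos_monotone_0_pi_le)
      show "2 * pi * d \<le> 2 * pi * (1 - \<bar>t\<bar>)" using t by (intro mult_left_mono) auto
      have "2 * pi * (1 - \<bar>t\<bar>) \<le> 2 * pi * (1/2)" using False by (intro mult_left_mono) auto
      then show "2 * pi * (1 - \<bar>t\<bar>) \<le> pi" by simp
    qed (use d in auto)
    finally show ?thesis using abs by simp
  qed
qed

text \<open>The powers of the nonnegative trigonometric polynomial \<open>q\<close> concentrate at \<open>y\<close>, so
  \<open>G y > 0\<close> would force \<open>\<integral> G q\<^sup>n > 0\<close> for large \<open>n\<close>.\<close>

lemma vanishing_coefficients_le_0:
  fixes G :: "real \<times> real \<times> real \<Rightarrow> real"
  assumes cont: "continuous_on box3 G" and zero: "\<And>k. integral box3 (\<lambda>p. complex_of_real (G p) * ekp k p) = 0"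
    and y: "0 < a" "a < 1" "0 < b" "b < 1" "0 < c" "c < 1"
  shows "G (a, b, c) \<le> 0"
proof (rule ccontr)
  assume "\<not> G (a, b, c) \<le> 0"
  then have Gy: "G (a, b, c) > 0" by simp
  define \<eta> where "\<eta> = G (a, b, c) / 2"
  have \<eta>: "\<eta> > 0" using Gy by (simp add: \<eta>_def)
  define q where "q p = tf (1, 0, 0) (2 * pi * a) p * tf (0, 1, 0) (2 * pi * b) p * tf (0, 0, 1) (2 * pi * c) p" for p
  define f where "f t = (1 + cos (2 * pi * t)) / 2" for t :: real
  have q: "q p = f (fst p - a) * f (fst (snd p) - b) * f (snd (snd p) - c)" for p
    by (simp add: q_def f_def tf_def right_diff_distrib)
  have half: "- 1 \<le> u \<Longrightarrow> 0 \<le> (1 + u) / 2" "u \<le> 1 \<Longrightarrow> (1 + u) / 2 \<le> 1" for u :: real by simp_all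
  have f0: "0 \<le> f t" for t unfolding f_def by (rule half(1)[OF cos_ge_minus_one])
  have f1: "f t \<le> 1" for t unfolding f_def by (rule half(2)[OF cos_le_one])
  note f01 = f0 f1
  have prod3: "u * v * w \<le> u \<and> u * v * w \<le> v \<and> u * v * w \<le> w"
    if "0 \<le> u" "u \<le> 1" "0 \<le> v" "v \<le> 1" "0 \<le> w" "w \<le> 1" for u v w :: real
  proof -
    have "u * v \<le> u" "u * v \<le> v" "0 \<le> u * v" using that by (simp_all add: mult_left_le mult_left_le_one_le)
    moreover have "u * v * w \<le> u * v" using \<open>0 \<le> u * v\<close> that by (simp add: mult_left_le)
    moreover have "u * v * w \<le> w" using \<open>0 \<le> u * v\<close> \<open>u * v \<le> u\<close> that by (intro mult_left_le_one_le) linarith+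
    ultimately show ?thesis by linarith
  qed
  have q0: "0 \<le> q p" for p unfolding q using f01 by simp
  have cq: "continuous_on S q" for S unfolding q_def by (intro continuous_intros)
  have zq: "continuous_on box3 (\<lambda>p. G p * q p ^ n) \<and> (\<forall>k. integral box3 (\<lambda>p. complex_of_real (G p * q p ^ n) * ekp k p) = 0)" for n
  proof (induction n)
    case 0
    then show ?case using cont zero by simp
  next
    case (Suc n)
    let ?h = "\<lambda>p. G p * q p ^ n"
    let ?t1 = "tf (1, 0, 0) (2 * pi * a)" and ?t2 = "tf (0, 1, 0) (2 * pi * b)" and ?t3 = "tf (0, 0, 1) (2 * pi * c)"
    have c0: "continuous_on box3 ?h" by (rule conjunct1[OF Suc.IH])
    have z0: "integral box3 (\<lambda>p. complex_of_real (?h p) * ekp k p) = 0" for k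
      by (rule spec[OF conjunct2[OF Suc.IH]])
    have c1: "continuous_on box3 (\<lambda>p. ?h p * ?t1 p)" by (intro continuous_intros c0)
    have z1: "integral box3 (\<lambda>p. complex_of_real (?h p * ?t1 p) * ekp k p) = 0" for k
      by (rule integral_tf_zero[OF c0 z0])
    have c2: "continuous_on box3 (\<lambda>p. ?h p * ?t1 p * ?t2 p)" by (intro continuous_intros c1)
    have z2: "integral box3 (\<lambda>p. complex_of_real (?h p * ?t1 p * ?t2 p) * ekp k p) = 0" for k
      by (rule integral_tf_zero[OF c1 z1])
    have z3: "integral box3 (\<lambda>p. complex_of_real (?h p * ?t1 p * ?t2 p * ?t3 p) * ekp k p) = 0" for k
      by (rule integral_tf_zero[OF c2 z2])
    have e: "G p * q p ^ Suc n = ?h p * ?t1 p * ?t2 p * ?t3 p" for p by (simp add: q_def mult_ac)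
    show ?case unfolding e using z3 by (auto intro!: continuous_intros cont cq)
  qed
  have int0: "((\<lambda>p. G p * q p ^ n) has_integral 0) box3" for n
  proof -
    have "(\<lambda>p. G p * q p ^ n) integrable_on box3"
      using zq unfolding box3_cbox by (intro integrable_continuous) auto
    then have h: "((\<lambda>p. G p * q p ^ n) has_integral integral box3 (\<lambda>p. G p * q p ^ n)) box3" by blast
    have "((\<lambda>p. complex_of_real (G p * q p ^ n)) has_integral complex_of_real (integral box3 (\<lambda>p. G p * q p ^ n))) box3"
      using has_integral_linear[OF h bounded_linear_of_real] by (simp add: o_def)
    moreover have "integral box3 (\<lambda>p. complex_of_real (G p * q p ^ n)) = 0"
      using spec[OF conjunct2[OF zq[of n]], of 0] by simp
    ultimately have "complex_of_real (integral box3 (\<lambda>p. G p * q p ^ n)) = 0"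
      by (subst integral_unique[symmetric])
    then have "integral box3 (\<lambda>p. G p * q p ^ n) = 0" by (simp only: of_real_eq_0_iff)
    then show ?thesis using h by simp
  qed
  obtain M where M: "\<And>p. p \<in> box3 \<Longrightarrow> \<bar>G p\<bar> \<le> M"
  proof -
    have "compact (G ` box3)"
      by (intro compact_continuous_image cont) (simp add: box3_cbox compact_cbox)
    then obtain M where "\<forall>x\<in>G ` box3. norm x \<le> M"
      using compact_imp_bounded bounded_iff by metis
    then show ?thesis using that by auto
  qed
  have yb: "(a, b, c) \<in> box3" using y by (simp add: box3_def)
  have M0: "M \<ge> 0" using M[OF yb] by linarith
  obtain d0 where d0: "d0 > 0" "\<And>p. p \<in> box3 \<Longrightarrow> dist p (a, b, c) < d0 \<Longrightarrow> dist (G p) (G (a, b, c)) < \<eta>"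
    using cont yb \<eta> unfolding continuous_on_iff by metis
  \<comment> \<open>Below the continuity radius, and such that coordinate differences inside the box
    stay at most 1 - d: a point far from the peak then cannot come close to a periodic copy of
    it.\<close>
  define d where "d = Min {d0 / 4, a, 1 - a, b, 1 - b, c, 1 - c}"
  have d: "0 < d" "d \<le> d0 / 4" "d \<le> a" "a \<le> 1 - d" "d \<le> b" "b \<le> 1 - d" "d \<le> c" "c \<le> 1 - d" "d \<le> 1/2"
    using y d0 by (auto simp: d_def min_def)
  have near: "G p \<ge> \<eta>" if "p \<in> box3" "\<bar>fst p - a\<bar> \<le> d" "\<bar>fst (snd p) - b\<bar> \<le> d" "\<bar>snd (snd p) - c\<bar> \<le> d" for p
  proof -
    have "dist p (a, b, c) = norm (fst p - a, fst (snd p) - b, snd (snd p) - c)"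
      by (cases p) (simp add: dist_norm)
    also have "\<dots> \<le> norm (fst p - a) + (norm (fst (snd p) - b) + norm (snd (snd p) - c))"
      using norm_Pair_le[of "fst p - a" "(fst (snd p) - b, snd (snd p) - c)"]
        norm_Pair_le[of "fst (snd p) - b" "snd (snd p) - c"] by linarith
    also have "\<dots> < d0" using that d d0 by simp
    finally have "dist (G p) (G (a, b, c)) < \<eta>" using d0 that by blast
    then show ?thesis using abs_ge_minus_self[of "G p - G (a, b, c)"]
      unfolding dist_real_def \<eta>_def by linarith
  qed
  define r where "r = f d"
  have r: "r < 1" "r \<ge> 0" using peak_bounds(3)[OF d(1) d(9)] f01 by (auto simp: r_def f_def)
  \<comment> \<open>One factor far from its peak already makes q at most r, whereas near y all three
    factors are large. As f(s)^3 tends to 1 > r, there is a small cube on which q exceeds r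
    strictly.\<close>
  have "isCont (\<lambda>s. f s ^ 3) 0" unfolding f_def by (intro continuous_intros) auto
  moreover have "f 0 ^ 3 = 1" by (simp add: f_def)
  ultimately have "((\<lambda>s. f s ^ 3) \<longlongrightarrow> 1) (at 0)" by (metis isCont_def)
  then have "\<forall>\<^sub>F s in at 0. f s ^ 3 > r" using r(1) by (rule order_tendstoD)
  then obtain e0 where e0: "e0 > 0" "\<And>s. s \<noteq> 0 \<Longrightarrow> dist s 0 < e0 \<Longrightarrow> f s ^ 3 > r"
    unfolding eventually_at by blast
  define e where "e = min (e0 / 2) d"
  have e: "0 < e" "e \<le> d" "e \<le> 1/2" "f e ^ 3 > r" using e0 d by (auto simp: e_def intro!: e0(2))
  define \<rho> where "\<rho> = f e ^ 3"
  define V where "V = cbox (a - e, b - e, c - e) (a + e, b + e, c + e)"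
  have V: "p \<in> V \<longleftrightarrow> \<bar>fst p - a\<bar> \<le> e \<and> \<bar>fst (snd p) - b\<bar> \<le> e \<and> \<bar>snd (snd p) - c\<bar> \<le> e" for p
    by (cases p) (auto simp: V_def abs_le_iff)
  have Vb: "V \<subseteq> box3" using d e by (auto simp: V_def box3_def)
  have "measure lborel V = (2 * e) * ((2 * e) * (2 * e))"
    unfolding V_def content_Pair using e by simp
  then have cV: "measure lborel V > 0" using e by simp
  \<comment> \<open>On V the integrand is at least \<eta> \<rho>^n, elsewhere at least -M r^n. Since
    the whole integral is 0, this bounds \<rho>^n by a multiple of r^n, which fails for large n
    because r < \<rho>.\<close>
  have key: "\<eta> * \<rho> ^ n * measure lborel V \<le> M * r ^ n" for n
  proof -
    let ?L = "\<lambda>p. (if p \<in> V then \<eta> * \<rho> ^ n else 0) - M * r ^ n"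
    have h1: "((\<lambda>p. if p \<in> V then \<eta> * \<rho> ^ n else 0) has_integral measure lborel V *\<^sub>R (\<eta> * \<rho> ^ n)) box3"
      using Vb has_integral_const[of "\<eta> * \<rho> ^ n"] unfolding V_def by (subst has_integral_restrict) auto
    have h2: "((\<lambda>p. M * r ^ n) has_integral measure lborel box3 *\<^sub>R (M * r ^ n)) box3"
      unfolding box3_cbox by (rule has_integral_const)
    have "measure lborel box3 = 1" unfolding box3_cbox content_Pair by simp
    then have "(?L has_integral (measure lborel V * (\<eta> * \<rho> ^ n) - M * r ^ n)) box3"
      using has_integral_diff[OF h1 h2] by simp
    moreover have "?L p \<le> G p * q p ^ n" if p: "p \<in> box3" for p
    proof (cases "\<bar>fst p - a\<bar> \<le> d \<and> \<bar>fst (snd p) - b\<bar> \<le> d \<and> \<bar>snd (snd p) - c\<bar> \<le> d")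
      case True
      have G: "G p \<ge> \<eta>" using near p True by blast
      have Mr: "0 \<le> M * r ^ n" using M0 r by simp
      show ?thesis
      proof (cases "p \<in> V")
        case pV: True
        have "f e \<le> f (fst p - a)" "f e \<le> f (fst (snd p) - b)" "f e \<le> f (snd (snd p) - c)"
          using pV V peak_bounds(1)[OF e(1) e(3)] by (auto simp: f_def)
        then have "\<rho> \<le> q p" unfolding \<rho>_def q power3_eq_cube using f01 by (intro mult_mono) auto
        then have "\<rho> ^ n \<le> q p ^ n" using f01 by (intro power_mono) (auto simp: \<rho>_def)
        then have "\<eta> * \<rho> ^ n \<le> G p * q p ^ n"
          using G \<eta> f01 by (intro mult_mono) (auto simp: \<rho>_def)
        then show ?thesis using pV Mr by simp
      next
        case False
        moreover have "0 \<le> G p * q p ^ n" using G \<eta> q0[of p] by (intro mult_nonneg_nonneg) auto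
        ultimately show ?thesis using Mr by simp
      qed
    next
      case False
      have pb: "0 \<le> fst p" "fst p \<le> 1" "0 \<le> fst (snd p)" "fst (snd p) \<le> 1" "0 \<le> snd (snd p)" "snd (snd p) \<le> 1"
        using p by (auto simp: box3_def)
      have pV: "p \<notin> V" using False e by (auto simp: V)
      have far: "f t \<le> r" if "\<not> \<bar>t\<bar> \<le> d" "\<bar>t\<bar> \<le> 1 - d" for t
        using peak_bounds(2)[OF d(1) d(9), of t] that by (auto simp: f_def r_def)
      have "f (fst p - a) \<le> r \<or> f (fst (snd p) - b) \<le> r \<or> f (snd (snd p) - c) \<le> r"
        using False far[of "fst p - a"] far[of "fst (snd p) - b"] far[of "snd (snd p) - c"] pb d by linarith
      moreover have "q p \<le> f (fst p - a)" "q p \<le> f (fst (snd p) - b)" "q p \<le> f (snd (snd p) - c)"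
        unfolding q using prod3[OF f0 f1 f0 f1 f0 f1] by blast+
      ultimately have "q p \<le> r" by linarith
      then have "q p ^ n \<le> r ^ n" using q0 by (intro power_mono)
      then have "\<bar>G p\<bar> * q p ^ n \<le> M * r ^ n" using M[OF p] M0 q0 by (intro mult_mono) auto
      moreover have "- (\<bar>G p\<bar> * q p ^ n) \<le> G p * q p ^ n"
        using mult_right_mono[of "- \<bar>G p\<bar>" "G p" "q p ^ n"] q0[of p] by simp
      ultimately show ?thesis using pV by simp
    qed
    ultimately have "measure lborel V * (\<eta> * \<rho> ^ n) - M * r ^ n \<le> 0"
      by (intro has_integral_le[OF _ int0[of n]])
    then show ?thesis by (simp add: mult_ac)
  qed
  have "r < \<rho>" using e by (simp add: \<rho>_def)
  with r have \<rho>: "\<rho> > 0" "r / \<rho> < 1" "0 \<le> r / \<rho>" by auto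
  have "\<eta> * measure lborel V \<le> M * (r / \<rho>) ^ n" for n
    using key[of n] \<rho> by (simp add: power_divide field_simps)
  moreover have "(\<lambda>n. M * (r / \<rho>) ^ n) \<longlonglongrightarrow> M * 0"
    by (intro tendsto_mult tendsto_const LIMSEQ_realpow_zero \<rho>)
  ultimately have "\<eta> * measure lborel V \<le> 0"
    by (intro LIMSEQ_le_const[of "\<lambda>n. M * (r / \<rho>) ^ n" 0]) auto
  then show False using \<eta> cV by (simp add: mult_le_0_iff)
qed

text \<open>Both G and -G are nonpositive inside the cube; continuity carries the equality to its
  boundary.\<close>

lemma vanishing_coefficients_eq_0:
  fixes G :: "real \<times> real \<times> real \<Rightarrow> real"
  assumes cont: "continuous_on UNIV G" and zero: "\<And>k. integral box3 (\<lambda>p. complex_of_real (G p) * ekp k p) = 0"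
    and p: "p \<in> box3"
  shows "G p = 0"
proof -
  have cb: "continuous_on box3 G" using cont continuous_on_subset by blast
  have zero': "integral box3 (\<lambda>p. complex_of_real (- G p) * ekp k p) = 0" for k
    using zero[of k] by simp
  have "{p. G p = 0} \<supseteq> closure (box (0, 0, 0) (1, 1, 1))"
  proof (rule closure_minimal)
    show "closed {p. G p = 0}" by (rule closed_Collect_eq) (use cont in auto)
    show "box (0, 0, 0) (1, 1, 1) \<subseteq> {p. G p = 0}"
    proof
      fix q :: "real \<times> real \<times> real" assume q: "q \<in> box (0, 0, 0) (1, 1, 1)"
      obtain a b c where abc: "q = (a, b, c)" by (cases q)
      have "0 < a" "a < 1" "0 < b" "b < 1" "0 < c" "c < 1"
        using q unfolding abc by (auto simp: mem_box Basis_prod_def)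
      then have "G q \<le> 0" "- G q \<le> 0"
        unfolding abc using vanishing_coefficients_le_0[OF cb zero, of a b c]
          vanishing_coefficients_le_0[OF continuous_on_minus[OF cb] zero', of a b c]
        by auto
      then show "q \<in> {p. G p = 0}" by simp
    qed
  qed
  moreover have "closure (box (0, 0, 0) (1, 1, 1)) = box3"
    unfolding box3_cbox by (rule closure_box) (auto simp: box_ne_empty Basis_prod_def)
  ultimately show ?thesis using p by blast
qed

section \<open>Fourier inversion and Bessel's inequality\<close>

lemma periodic_shift_int:
  fixes f :: "real \<Rightarrow> 'a"
  assumes "\<And>x. f (x + 1) = f x"
  shows "f (x + of_int n) = f x"
proof (induction n arbitrary: x rule: int_induct[where k = 0])
  case (step1 i)
  then show ?case using assms[of "x + of_int i"] by (simp add: add_ac)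
next
  case (step2 i)
  then show ?case using assms[of "x + of_int (i - 1)"] by (simp add: algebra_simps)
qed simp

lemma periodic3_frac:
  assumes "periodic3 g"
  shows "g x y z = g (frac x) (frac y) (frac z)"
proof -
  have "g (frac x + of_int \<lfloor>x\<rfloor>) y z = g (frac x) y z" for y z
    by (rule periodic_shift_int) (use assms in \<open>auto simp: periodic3_def\<close>)
  moreover have "g x' (frac y + of_int \<lfloor>y\<rfloor>) z = g x' (frac y) z" for x' z
    by (rule periodic_shift_int) (use assms in \<open>auto simp: periodic3_def\<close>)
  moreover have "g x' y' (frac z + of_int \<lfloor>z\<rfloor>) = g x' y' (frac z)" for x' y'
    by (rule periodic_shift_int) (use assms in \<open>auto simp: periodic3_def\<close>)
  ultimately show ?thesis by (simp add: frac_def)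
qed

lemma frac_box3: "(frac x, frac y, frac z) \<in> box3"
  by (auto simp: box3_def frac_ge_0 intro: less_imp_le[OF frac_lt_1])

lemma integral_box3_cnj:
  assumes "continuous_on box3 f"
  shows "integral box3 (\<lambda>p. cnj (f p)) = cnj (integral box3 f)"
proof -
  have "f integrable_on box3" using assms unfolding box3_cbox by (intro integrable_continuous)
  then have "(f has_integral integral box3 f) box3" by blast
  from has_integral_linear[OF this bounded_linear_cnj] show ?thesis
    by (simp add: o_def integral_unique)
qed

lemma fcoef_minus:
  assumes "continuous_on UNIV (unc g)"
  shows "fcoef g (- k) = cnj (fcoef g k)"
proof -
  have "continuous_on box3 (\<lambda>p. complex_of_real (unc g p) * cnj (ekp k p))"
    by (intro continuous_intros continuous_on_subset[OF assms]) auto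
  from integral_box3_cnj[OF this] show ?thesis
    by (simp add: fcoef_eq_integral[OF assms] cnj_ekp)
qed

lemma fcoef_diff:
  assumes "continuous_on UNIV (unc f)" "continuous_on UNIV (unc g)"
  shows "fcoef (\<lambda>x y z. f x y z - g x y z) k = fcoef f k - fcoef g k"
    and "continuous_on UNIV (unc (\<lambda>x y z. f x y z - g x y z))"
proof -
  have u: "unc (\<lambda>x y z. f x y z - g x y z) = (\<lambda>p. unc f p - unc g p)"
    by (simp add: unc_def fun_eq_iff)
  show c: "continuous_on UNIV (unc (\<lambda>x y z. f x y z - g x y z))"
    unfolding u by (intro continuous_intros assms)
  have i: "(\<lambda>p. complex_of_real (unc h p) * cnj (ekp k p)) integrable_on box3" if "continuous_on UNIV (unc h)" for h
    unfolding box3_cbox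
    by (intro integrable_continuous continuous_intros continuous_on_subset[OF that]) auto
  show "fcoef (\<lambda>x y z. f x y z - g x y z) k = fcoef f k - fcoef g k"
    unfolding fcoef_eq_integral[OF c] fcoef_eq_integral[OF assms(1)] fcoef_eq_integral[OF assms(2)] u
    by (simp add: left_diff_distrib integral_diff i assms)
qed

lemma fcoef_cmult:
  assumes "continuous_on UNIV (unc f)"
  shows "fcoef (\<lambda>x y z. c * f x y z) k = of_real c * fcoef f k"
    and "continuous_on UNIV (unc (\<lambda>x y z. c * f x y z))"
proof -
  have u: "unc (\<lambda>x y z. c * f x y z) = (\<lambda>p. c * unc f p)"
    by (simp add: unc_def fun_eq_iff)
  show c: "continuous_on UNIV (unc (\<lambda>x y z. c * f x y z))"
    unfolding u by (intro continuous_intros assms)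
  show "fcoef (\<lambda>x y z. c * f x y z) k = of_real c * fcoef f k"
    unfolding fcoef_eq_integral[OF c] fcoef_eq_integral[OF assms] u by (simp add: mult.assoc)
qed

text \<open>The sum S of the Fourier series is continuous, periodic and has the coefficients of g,
  so g - S has only vanishing coefficients. This ties the samples of the solution to regularity that
  is given on coefficients.\<close>

theorem fourier_inversion:
  assumes g: "in_C0per g" and w: "wsum s (fcoef g)"
  shows "wien s (fcoef g) g"
proof -
  have cg: "continuous_on UNIV (unc g)" and pg: "periodic3 g" using g by (auto simp: in_C0per_def)
  define S where "S x y z = Re (\<Sum>\<^sub>\<infinity>k. fcoef g k * ek k x y z)" for x y z
  have sm: "(\<lambda>k. fcoef g k * ek k x y z) summable_on UNIV" for x y z
    by (rule abs_summable_summable) (use wsum_abs_summable[OF w] in \<open>simp add: norm_mult\<close>)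
  have "cnj (\<Sum>\<^sub>\<infinity>k. fcoef g k * ek k x y z) = (\<Sum>\<^sub>\<infinity>k. fcoef g k * ek k x y z)" for x y z
  proof -
    have "cnj (\<Sum>\<^sub>\<infinity>k. fcoef g k * ek k x y z) = (\<Sum>\<^sub>\<infinity>k. fcoef g (- k) * ek (- k) x y z)"
      by (simp only: infsum_cnj[symmetric] complex_cnj_mult fcoef_minus[OF cg] cnj_ek)
    also have "\<dots> = (\<Sum>\<^sub>\<infinity>k. fcoef g k * ek k x y z)"
      by (rule infsum_reindex_bij_witness[where i = uminus and j = uminus]) auto
    finally show ?thesis .
  qed
  then have "complex_of_real (S x y z) = (\<Sum>\<^sub>\<infinity>k. fcoef g k * ek k x y z)" for x y z
    unfolding S_def by (intro of_real_Re) (simp only: Reals_cnj_iff)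
  then have wS: "wien s (fcoef g) S"
    using w sm by (auto simp: wien_def intro!: has_sum_infsum)
  have cS: "continuous_on UNIV (unc S)" by (rule wien_continuous[OF wS])
  have ekper: "ek k (x + 1) y z = ek k x y z" "ek k x (y + 1) z = ek k x y z" "ek k x y (z + 1) = ek k x y z" for k x y z
  proof -
    have c: "cis (2 * pi * (u + real_of_int n)) = cis (2 * pi * u)" for u n
      using cis_int_ratio_eq_1[of 1 n] by (simp add: distrib_left cis_mult[symmetric])
    let ?u = "real_of_int (fst k) * x + real_of_int (fst (snd k)) * y + real_of_int (snd (snd k)) * z"
    have "real_of_int (fst k) * (x + 1) + real_of_int (fst (snd k)) * y + real_of_int (snd (snd k)) * z = ?u + real_of_int (fst k)"
      "real_of_int (fst k) * x + real_of_int (fst (snd k)) * (y + 1) + real_of_int (snd (snd k)) * z = ?u + real_of_int (fst (snd k))"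
      "real_of_int (fst k) * x + real_of_int (fst (snd k)) * y + real_of_int (snd (snd k)) * (z + 1) = ?u + real_of_int (snd (snd k))"
      by (simp_all add: algebra_simps)
    then show "ek k (x + 1) y z = ek k x y z" "ek k x (y + 1) z = ek k x y z" "ek k x y (z + 1) = ek k x y z"
      unfolding ek_def by (simp_all only: c)
  qed
  have pS: "periodic3 S" by (auto simp: periodic3_def S_def ekper)
  define G where "G p = unc g p - unc S p" for p
  have "G p = 0" if "p \<in> box3" for p
  proof (rule vanishing_coefficients_eq_0[OF _ _ that])
    show "continuous_on UNIV G" unfolding G_def by (intro continuous_intros cg cS)
    show "integral box3 (\<lambda>p. complex_of_real (G p) * ekp k p) = 0" for k
      using fcoef_eq_integral[OF fcoef_diff(2)[OF cg cS], of "- k"] fcoef_diff(1)[OF cg cS, of "- k"]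
        wien_fcoef[OF wS, of "- k"]
      by (simp add: cnj_ekp G_def unc_def case_prod_unfold)
  qed
  then have box: "g (frac x) (frac y) (frac z) = S (frac x) (frac y) (frac z)" for x y z
    using frac_box3[of x y z] by (auto simp: G_def unc_def)
  have "g x y z = S x y z" for x y z
    using box[of x y z] periodic3_frac[OF pg, of x y z] periodic3_frac[OF pS, of x y z] by simp
  then have "g = S" by (simp add: fun_eq_iff)
  then show ?thesis using wS by simp
qed

lemma C0_norm_bound:
  assumes "in_C0per g"
  shows "\<bar>g x y z\<bar> \<le> C0_norm g" "C0_norm g \<ge> 0"
proof -
  have c: "continuous_on box3 (\<lambda>p. \<bar>unc g p\<bar>)"
    using assms by (intro continuous_intros) (auto simp: in_C0per_def intro: continuous_on_subset)
  have "compact ((\<lambda>p. \<bar>unc g p\<bar>) ` box3)"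
    by (intro compact_continuous_image c) (simp add: box3_cbox compact_cbox)
  then have bdd: "bdd_above ((\<lambda>p. \<bar>unc g p\<bar>) ` box3)"
    by (intro bounded_imp_bdd_above compact_imp_bounded)
  have "\<bar>g x y z\<bar> = \<bar>unc g (frac x, frac y, frac z)\<bar>"
    using periodic3_frac[of g x y z] assms by (simp add: unc_def in_C0per_def)
  also have "\<dots> \<le> C0_norm g"
    unfolding C0_norm_def using frac_box3[of x y z] by (intro cSUP_upper bdd)
  finally show "\<bar>g x y z\<bar> \<le> C0_norm g" .
  then show "C0_norm g \<ge> 0" by linarith
qed

text \<open>With it a pointwise bound on a Taylor remainder in time becomes an l2 bound over all
  modes at once, which a separate bound for each mode would not give.\<close>

theorem bessel_inequality:
  assumes c: "continuous_on UNIV (unc g)" and B: "\<And>x y z. \<bar>g x y z\<bar> \<le> B" and F: "finite F"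
  shows "(\<Sum>k\<in>F. (cmod (fcoef g k))\<^sup>2) \<le> B\<^sup>2"
proof -
  define S where "S p = (\<Sum>k\<in>F. fcoef g k * ekp k p)" for p
  let ?s = "\<Sum>k\<in>F. (cmod (fcoef g k))\<^sup>2"
  have cb: "continuous_on box3 (unc g)" using c continuous_on_subset by blast
  have cS: "continuous_on box3 S" unfolding S_def by (intro continuous_intros)
  have int: "f integrable_on box3" if "continuous_on box3 f" for f :: "_ \<Rightarrow> complex"
    using that unfolding box3_cbox by (rule integrable_continuous)
  have 1: "integral box3 (\<lambda>p. complex_of_real (unc g p) * cnj (S p)) = complex_of_real ?s"
  proof -
    have "integral box3 (\<lambda>p. complex_of_real (unc g p) * cnj (S p)) =
        integral box3 (\<lambda>p. \<Sum>k\<in>F. cnj (fcoef g k) * (complex_of_real (unc g p) * cnj (ekp k p)))"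
      by (simp add: S_def sum_distrib_left mult_ac)
    also have "\<dots> = (\<Sum>k\<in>F. cnj (fcoef g k) * fcoef g k)"
      by (subst integral_sum[OF F]) (auto intro!: int continuous_intros cb simp: fcoef_eq_integral[OF c])
    also have "\<dots> = complex_of_real ?s"
      by (simp add: complex_norm_square mult.commute del: of_real_power)
    finally show ?thesis .
  qed
  have 2: "integral box3 (\<lambda>p. S p * cnj (S p)) = complex_of_real ?s"
  proof -
    have "integral box3 (\<lambda>p. S p * cnj (S p)) =
        integral box3 (\<lambda>p. \<Sum>k\<in>F. \<Sum>l\<in>F. fcoef g k * cnj (fcoef g l) * ekp (k - l) p)"
      by (simp add: S_def sum_product diff_conv_add_uminus ekp_add cnj_ekp mult_ac del: add_uminus_conv_diff)
    also have "\<dots> = (\<Sum>k\<in>F. \<Sum>l\<in>F. fcoef g k * cnj (fcoef g l) * integral box3 (ekp (k - l)))"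
      by (subst integral_sum[OF F], auto intro!: int continuous_intros sum.cong,
          subst integral_sum[OF F], auto intro!: int continuous_intros)
    also have "\<dots> = (\<Sum>k\<in>F. \<Sum>l\<in>F. if l = k then fcoef g k * cnj (fcoef g k) else 0)"
      by (intro sum.cong) (auto simp: integral_ekp)
    also have "\<dots> = complex_of_real ?s"
      using F by (simp add: complex_norm_square del: of_real_power)
    finally show ?thesis .
  qed
  \<comment> \<open>The real part of \<open>?h\<close> is g^2 - |g - S|^2, while its integral is the
    partial sum of squares.\<close>
  let ?h = "\<lambda>p. 2 * (complex_of_real (unc g p) * cnj (S p)) - S p * cnj (S p)"
  have "(?h has_integral (2 * complex_of_real ?s - complex_of_real ?s)) box3"
  proof -
    have i1: "(\<lambda>p. complex_of_real (unc g p) * cnj (S p)) integrable_on box3"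
      and i2: "(\<lambda>p. S p * cnj (S p)) integrable_on box3"
      by (intro int continuous_intros cb cS)+
    show ?thesis
      using has_integral_diff[OF has_integral_mult_right[of _ _ _ 2, OF integrable_integral[OF i1]] integrable_integral[OF i2]]
      unfolding 1 2 .
  qed
  from has_integral_linear[OF this bounded_linear_Re]
  have "((\<lambda>p. Re (?h p)) has_integral ?s) box3" by (simp add: o_def)
  moreover have "((\<lambda>p. B\<^sup>2) has_integral (measure lborel box3 *\<^sub>R B\<^sup>2)) box3"
    unfolding box3_cbox by (rule has_integral_const)
  moreover have "Re (?h p) \<le> B\<^sup>2" for p
  proof -
    have gB: "(unc g p)\<^sup>2 \<le> B\<^sup>2" using power_mono[of "\<bar>unc g p\<bar>" B 2] B by (cases p) (auto simp: unc_def)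
    have "0 \<le> (unc g p - Re (S p))\<^sup>2 + (Im (S p))\<^sup>2" by simp
    then have "Re (?h p) \<le> (unc g p)\<^sup>2" by (simp add: power2_eq_square algebra_simps)
    then show ?thesis using gB by linarith
  qed
  ultimately have "?s \<le> measure lborel box3 *\<^sub>R B\<^sup>2" by (rule has_integral_le)
  then show ?thesis unfolding box3_cbox content_Pair by simp
qed

section \<open>Aliasing\<close>

lemma ek_grid: "ek l (real_of_int (fst p) * hh K) (real_of_int (fst (snd p)) * hh K) (real_of_int (snd (snd p)) * hh K) = chi K l p"
  using NN_real_pos[of K] by (simp add: ek_def chi_def idot_def hh_def field_simps)

lemma has_sum_finite_sum:
  fixes f :: "'a \<Rightarrow> 'b \<Rightarrow> 'c :: topological_comm_monoid_add"
  assumes "finite A" "\<And>k. k \<in> A \<Longrightarrow> (f k has_sum S k) U"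
  shows "((\<lambda>l. \<Sum>k\<in>A. f k l) has_sum (\<Sum>k\<in>A. S k)) U"
  using assms by (induction A rule: finite_induct) (auto intro!: has_sum_add)

text \<open>The aliasing formula: summing the sampled series over the grid keeps the frequencies
  congruent to k and drops the others by orthogonality.\<close>

lemma hat_QN_has_sum:
  assumes "wien s a g"
  shows "((\<lambda>l. if divs (NN K) (l - k) then a l else 0) has_sum hat K (QN K g) k) UNIV"
proof -
  let ?c = "1 / complex_of_int (NN K ^ 3)"
  have "((\<lambda>l. \<Sum>p\<in>cell K. ?c * cnj (chi K k p) * (a l * chi K l p)) has_sum
      (\<Sum>p\<in>cell K. ?c * cnj (chi K k p) * complex_of_real (gv (QN K g) p))) UNIV"
  proof (intro has_sum_finite_sum has_sum_cmult_right)
    fix p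
    show "((\<lambda>l. a l * chi K l p) has_sum complex_of_real (gv (QN K g) p)) UNIV"
      using assms unfolding wien_def gv_def QN_def ek_grid[symmetric] by blast
  qed simp
  moreover have "(\<Sum>p\<in>cell K. ?c * cnj (chi K k p) * (a l * chi K l p)) = (if divs (NN K) (l - k) then a l else 0)" for l
  proof -
    have "(\<Sum>p\<in>cell K. ?c * cnj (chi K k p) * (a l * chi K l p)) = ?c * a l * (\<Sum>p\<in>cell K. chi K (l - k) p)"
      by (simp add: sum_distrib_left chi_diff mult_ac)
    then show ?thesis using NN_pos[of K] by (simp add: sum_chi_cell)
  qed
  moreover have "(\<Sum>p\<in>cell K. ?c * cnj (chi K k p) * complex_of_real (gv (QN K g) p)) = hat K (QN K g) k"
    by (simp add: hat_eq sum_distrib_left mult_ac)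
  ultimately show ?thesis by simp
qed

text \<open>A residue in [-K, K] has least modulus in its class, because N > 2K.\<close>

lemma abs_le_alias:
  fixes k l :: int
  assumes "\<bar>k\<bar> \<le> int K" "NN K dvd l - k"
  shows "\<bar>k\<bar> \<le> \<bar>l\<bar>"
proof (cases "l = k")
  case False
  then have "NN K \<le> \<bar>l - k\<bar>" using assms(2) dvd_imp_le_int[of "l - k" "NN K"] NN_pos[of K] by auto
  then show ?thesis using assms(1) by (simp add: NN_def)
qed simp

lemma modes_iff: "k \<in> modes K \<longleftrightarrow> \<bar>fst k\<bar> \<le> int K \<and> \<bar>fst (snd k)\<bar> \<le> int K \<and> \<bar>snd (snd k)\<bar> \<le> int K"
  by (cases k) (auto simp: modes_def)

lemma wt_le_alias:
  assumes "k \<in> modes K" "divs (NN K) (l - k)"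
  shows "wt k \<le> wt l"
proof -
  have "\<bar>fst k\<bar> \<le> \<bar>fst l\<bar>" "\<bar>fst (snd k)\<bar> \<le> \<bar>fst (snd l)\<bar>" "\<bar>snd (snd k)\<bar> \<le> \<bar>snd (snd l)\<bar>"
    using assms by (auto simp: modes_iff divs_def intro!: abs_le_alias[of _ K])
  then have "real_of_int \<bar>fst k\<bar> \<le> real_of_int \<bar>fst l\<bar>" "real_of_int \<bar>fst (snd k)\<bar> \<le> real_of_int \<bar>fst (snd l)\<bar>"
    "real_of_int \<bar>snd (snd k)\<bar> \<le> real_of_int \<bar>snd (snd l)\<bar>" by linarith+
  then show ?thesis unfolding wt_def by simp
qed

text \<open>The source of the powers of h: an unresolved frequency has a component of modulus at
  least K + 1 \<ge> 1 / (2h).\<close>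

lemma hh_wt_outside:
  assumes "l \<notin> modes K"
  shows "1 \<le> 2 * hh K * wt l"
proof -
  have "int K + 1 \<le> \<bar>fst l\<bar> \<or> int K + 1 \<le> \<bar>fst (snd l)\<bar> \<or> int K + 1 \<le> \<bar>snd (snd l)\<bar>"
    using assms by (auto simp: modes_iff)
  then have "real K + 1 \<le> \<bar>real_of_int (fst l)\<bar> \<or> real K + 1 \<le> \<bar>real_of_int (fst (snd l))\<bar> \<or> real K + 1 \<le> \<bar>real_of_int (snd (snd l))\<bar>"
    by linarith
  then have "real K + 1 \<le> wt l" unfolding wt_def by linarith
  moreover have "1 \<le> 2 * hh K * (real K + 1)" by (simp add: hh_def NN_def field_simps)
  moreover have "2 * hh K * (real K + 1) \<le> 2 * hh K * wt l"
    using hh_pos[of K] \<open>real K + 1 \<le> wt l\<close> by (intro mult_left_mono) auto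
  ultimately show ?thesis by linarith
qed

lemma alias_diff_has_sum:
  assumes "wien s a g" "k \<in> modes K"
  shows "((\<lambda>l. if divs (NN K) (l - k) \<and> l \<notin> modes K then a l else 0) has_sum (hat K (QN K g) k - a k)) UNIV"
proof -
  have "((\<lambda>l. if l = k then a l else 0) has_sum a k) UNIV"
    by (rule has_sum_finite_neutralI[where B = "{k}"]) auto
  then have "((\<lambda>l. - (if l = k then a l else 0)) has_sum - a k) UNIV"
    by (simp only: has_sum_uminus minus_minus)
  from has_sum_add[OF hat_QN_has_sum[OF assms(1), of K k] this]
  have "((\<lambda>l. (if divs (NN K) (l - k) then a l else 0) + - (if l = k then a l else 0)) has_sum (hat K (QN K g) k - a k)) UNIV"
    by simp
  moreover have "(if divs (NN K) (l - k) then a l else 0) + - (if l = k then a l else 0) =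
      (if divs (NN K) (l - k) \<and> l \<notin> modes K then a l else 0)" for l
  proof (cases "l \<in> modes K")
    case True
    then show ?thesis using divs_modes[OF True assms(2)] by simp
  next
    case False
    then have "l \<noteq> k" using assms(2) by blast
    then show ?thesis using False by simp
  qed
  ultimately show ?thesis by (simp only:)
qed

text \<open>Every frequency l is congruent to at most one k in \<open>modes K\<close>, so exchanging
  the sum over modes with the sum over aliases counts nothing twice.\<close>

lemma sum_alias_indicator_le:
  fixes x :: real
  assumes "x \<ge> 0"
  shows "(\<Sum>k\<in>modes K. if divs (NN K) (l - k) \<and> P then x else 0) \<le> (if P then x else 0)"
proof (cases "\<exists>k0\<in>modes K. divs (NN K) (l - k0)")
  case True
  then obtain k0 where k0: "k0 \<in> modes K" "divs (NN K) (l - k0)" by blast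
  have uniq: "k = k0" if "k \<in> modes K" "divs (NN K) (l - k)" for k
  proof -
    have "divs (NN K) (k - k0)"
      using k0(2) that(2) dvd_diff[of "NN K" "fst (l - k0)" "fst (l - k)"]
        dvd_diff[of "NN K" "fst (snd (l - k0))" "fst (snd (l - k))"]
        dvd_diff[of "NN K" "snd (snd (l - k0))" "snd (snd (l - k))"]
      unfolding divs_def by simp
    then show ?thesis using divs_modes[OF that(1) k0(1)] by simp
  qed
  have "(\<Sum>k\<in>modes K. if divs (NN K) (l - k) \<and> P then x else 0) = (\<Sum>k\<in>modes K. if k = k0 then (if P then x else 0) else 0)"
  proof (rule sum.cong[OF refl])
    fix k assume "k \<in> modes K"
    then have "divs (NN K) (l - k) \<longleftrightarrow> k = k0" using uniq k0(2) by blast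
    then show "(if divs (NN K) (l - k) \<and> P then x else 0) = (if k = k0 then (if P then x else 0) else 0)" by simp
  qed
  also have "\<dots> = (if P then x else 0)" using k0 by simp
  finally show ?thesis by simp
next
  case False
  then have "(\<Sum>k\<in>modes K. if divs (NN K) (l - k) \<and> P then x else 0) = 0" by (intro sum.neutral) simp
  then show ?thesis using assms by simp
qed

text \<open>An unresolved frequency l contributes with a factor (2 h \<open>wt l\<close>)^r \<ge> 1
  to spare, and aliasing moves it to a mode of no larger weight. With r = 0 the bound says that
  sampling is stable.\<close>

lemma alias_bound:
  assumes "wien (s + r) a g"
  shows "(\<Sum>k\<in>modes K. wt k ^ s * cmod (hat K (QN K g) k - a k)) \<le> (2 * hh K) ^ r * wnorm (s + r) a"
proof -
  let ?f = "\<lambda>k l. if divs (NN K) (l - k) \<and> l \<notin> modes K then wt l ^ s * cmod (a l) else 0"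
  have w: "wsum (s + r) a" using assms by (simp add: wien_def)
  have ws: "(\<lambda>l. wt l ^ s * cmod (a l)) summable_on UNIV" using wsum_mono(1)[OF w, of s] by (simp add: wsum_def)
  have fs: "?f k summable_on UNIV" for k
    by (rule summable_on_comparison_test[OF ws]) auto
  have "wt k ^ s * cmod (hat K (QN K g) k - a k) \<le> infsum (?f k) UNIV" if k: "k \<in> modes K" for k
  proof -
    have "norm (of_real (wt k ^ s) * (hat K (QN K g) k - a k)) \<le> infsum (?f k) UNIV"
    proof (rule norm_infsum_le[OF has_sum_cmult_right[OF alias_diff_has_sum[OF assms k]] has_sum_infsum[OF fs]])
      fix l
      show "norm (complex_of_real (wt k ^ s) * (if divs (NN K) (l - k) \<and> l \<notin> modes K then a l else 0)) \<le> ?f k l"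
        using power_mono[OF wt_le_alias[OF k, of l] wt_nonneg, of s]
        by (auto simp: norm_mult norm_power intro!: mult_right_mono)
    qed
    then show ?thesis by (simp add: norm_mult norm_power)
  qed
  then have "(\<Sum>k\<in>modes K. wt k ^ s * cmod (hat K (QN K g) k - a k)) \<le> (\<Sum>k\<in>modes K. infsum (?f k) UNIV)"
    by (rule sum_mono)
  also have "\<dots> \<le> (2 * hh K) ^ r * wnorm (s + r) a"
  proof (rule has_sum_mono)
    show "((\<lambda>l. \<Sum>k\<in>modes K. ?f k l) has_sum (\<Sum>k\<in>modes K. infsum (?f k) UNIV)) UNIV"
      by (intro has_sum_finite_sum has_sum_infsum fs) simp
    show "((\<lambda>l. (2 * hh K) ^ r * (wt l ^ (s + r) * cmod (a l))) has_sum (2 * hh K) ^ r * wnorm (s + r) a) UNIV"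
      unfolding wnorm_def using w by (intro has_sum_cmult_right has_sum_infsum) (simp add: wsum_def)
    fix l
    have "(\<Sum>k\<in>modes K. ?f k l) \<le> (if l \<notin> modes K then wt l ^ s * cmod (a l) else 0)"
      by (rule sum_alias_indicator_le) simp
    also have "\<dots> \<le> (2 * hh K) ^ r * (wt l ^ (s + r) * cmod (a l))"
    proof (cases "l \<in> modes K")
      case False
      have "1 * (wt l ^ s * cmod (a l)) \<le> (2 * hh K * wt l) ^ r * (wt l ^ s * cmod (a l))"
        using hh_wt_outside[OF False] by (intro mult_right_mono one_le_power) auto
      then show ?thesis using False by (simp add: power_mult_distrib power_add mult_ac)
    qed (use hh_pos[of K] in simp)
    finally show "(\<Sum>k\<in>modes K. ?f k l) \<le> (2 * hh K) ^ r * (wt l ^ (s + r) * cmod (a l))" .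
  qed
  finally show ?thesis .
qed

text \<open>Along the alias class l = k + N j the weight grows with both k and j, so powers of
  \<open>wt k\<close> / \<open>wt l\<close> can be summed over j uniformly in k and K. The 6 is 3/2
  * 2 * 2, from \<open>wt k\<close> \<le> 3 N / 2, \<open>wt j\<close> \<le> 2 m and N m \<le> 2
  \<open>wt l\<close>.\<close>

lemma wt_mult_le_alias:
  assumes "k \<in> modes K" "l = k + (NN K * fst j, NN K * fst (snd j), NN K * snd (snd j))"
  shows "wt k * wt j \<le> 6 * wt l"
proof (cases "j = 0")
  case True
  then have "l = k" "wt j = 1" using assms by (auto simp: prod_eq_iff wt_def)
  then show ?thesis using wt_nonneg[of k] by simp
next
  case False
  let ?N = "real_of_int (NN K)"
  define m where "m = \<bar>real_of_int (fst j)\<bar> + \<bar>real_of_int (fst (snd j))\<bar> + \<bar>real_of_int (snd (snd j))\<bar>"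
  have m1: "m \<ge> 1"
  proof -
    have "fst j \<noteq> 0 \<or> fst (snd j) \<noteq> 0 \<or> snd (snd j) \<noteq> 0" using False by (auto simp: prod_eq_iff)
    then have "\<bar>fst j\<bar> + \<bar>fst (snd j)\<bar> + \<bar>snd (snd j)\<bar> \<ge> 1" by linarith
    then show ?thesis unfolding m_def by linarith
  qed
  have comp: "?N * \<bar>real_of_int b\<bar> \<le> 2 * \<bar>real_of_int (a + NN K * b)\<bar>" if "\<bar>a\<bar> \<le> int K" for a b :: int
  proof (cases "b = 0")
    case False
    have "NN K * \<bar>b\<bar> \<le> \<bar>a + NN K * b\<bar> + \<bar>a\<bar>"
      using abs_triangle_ineq[of "a + NN K * b" "- a"] NN_pos[of K] by (simp add: abs_mult)
    moreover have "2 * \<bar>a\<bar> \<le> NN K * \<bar>b\<bar>"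
    proof -
      have "NN K * 1 \<le> NN K * \<bar>b\<bar>" using False NN_pos[of K] by (intro mult_left_mono) auto
      moreover have "2 * \<bar>a\<bar> \<le> NN K * 1" using that by (simp add: NN_def)
      ultimately show ?thesis by (rule order_trans[rotated])
    qed
    moreover have "2 * u \<le> n \<Longrightarrow> n \<le> v + u \<Longrightarrow> n \<le> 2 * v" for u v n :: int by linarith
    ultimately have "NN K * \<bar>b\<bar> \<le> 2 * \<bar>a + NN K * b\<bar>" by blast
    then have "real_of_int (NN K * \<bar>b\<bar>) \<le> real_of_int (2 * \<bar>a + NN K * b\<bar>)" by (simp only: of_int_le_iff)
    then show ?thesis by simp
  qed simp
  have Nm: "?N * m \<le> 2 * wt l"
    using comp[of "fst k" "fst j"] comp[of "fst (snd k)" "fst (snd j)"] comp[of "snd (snd k)" "snd (snd j)"] assms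
    unfolding m_def wt_def distrib_left by (simp add: modes_iff)
  have wk: "wt k \<le> 3/2 * ?N"
  proof -
    have "real_of_int \<bar>fst k\<bar> \<le> real K" "real_of_int \<bar>fst (snd k)\<bar> \<le> real K" "real_of_int \<bar>snd (snd k)\<bar> \<le> real K"
      using assms(1) unfolding modes_iff by linarith+
    then show ?thesis unfolding wt_def NN_def by simp
  qed
  have wj: "wt j = 1 + m" by (simp add: wt_def m_def)
  have "wt j \<le> 2 * m" using m1 unfolding wj by linarith
  with wk have "wt k * wt j \<le> (3/2 * ?N) * (2 * m)"
    using NN_real_pos[of K] by (intro mult_mono) auto
  also have "\<dots> = 3 * (?N * m)" by simp
  also have "\<dots> \<le> 6 * wt l" using Nm by linarith
  finally show ?thesis .
qed

text \<open>Sampling is bounded in H^s itself, by Cauchy-Schwarz within each alias class. Going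
  through \<open>alias_bound\<close> would cost the two derivatives of the embedding, which cannot
  be spared for the initial value at s = 10.\<close>

lemma alias_l2_bound:
  assumes g: "wien 0 a g" and B: "\<And>F. finite F \<Longrightarrow> (\<Sum>k\<in>F. wt k ^ (2 * s) * (cmod (a k))\<^sup>2) \<le> B" and s: "s \<ge> 2"
  shows "(\<Sum>k\<in>modes K. wt k ^ (2 * s) * (cmod (hat K (QN K g) k))\<^sup>2) \<le> 6 ^ (2 * s) * wt4sum * B"
proof -
  let ?C = "6 ^ (2 * s) * wt4sum"
  have C0: "?C \<ge> 0" using wt4sum_nonneg by simp
  define v where "v l = wt l ^ (2 * s) * (cmod (a l))\<^sup>2" for l
  have v0: "v l \<ge> 0" for l by (simp add: v_def)
  have vs: "v summable_on UNIV" and vB: "infsum v UNIV \<le> B"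
    using nonneg_summable_bound[of v B] B v0 by (auto simp: v_def)
  let ?f = "\<lambda>k l. if divs (NN K) (l - k) \<and> True then v l else 0"
  have fs: "?f k summable_on UNIV" for k
    by (rule summable_on_comparison_test[OF vs]) (auto simp: v0)
  have "wt k ^ (2 * s) * (cmod (hat K (QN K g) k))\<^sup>2 \<le> ?C * infsum (?f k) UNIV" if k: "k \<in> modes K" for k
  proof -
    define Q where "Q = infsum (?f k) UNIV"
    have Q0: "Q \<ge> 0" unfolding Q_def by (rule infsum_nonneg) (auto simp: v0)
    let ?h = "\<lambda>l. if divs (NN K) (l - k) then wt k ^ s * cmod (a l) else 0"
    have fin: "sum ?h F \<le> sqrt (?C * Q)" if F: "finite F" for F
    proof (rule real_le_rsqrt)
      let ?G = "{l \<in> F. divs (NN K) (l - k)}"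
      have finG: "finite ?G" using F by simp
      \<comment> \<open>The multiple of N that separates l from k; it parametrises the alias class
        injectively.\<close>
      define jj where "jj l = (fst (l - k) div NN K, fst (snd (l - k)) div NN K, snd (snd (l - k)) div NN K)" for l
      have jl: "l = k + (NN K * fst (jj l), NN K * fst (snd (jj l)), NN K * snd (snd (jj l)))" if "l \<in> ?G" for l
        using that by (auto simp: jj_def divs_def prod_eq_iff)
      have inj: "inj_on jj ?G"
      proof (rule inj_onI)
        fix x y assume x: "x \<in> ?G" and y: "y \<in> ?G" and e: "jj x = jj y"
        have "x = k + (NN K * fst (jj x), NN K * fst (snd (jj x)), NN K * snd (snd (jj x)))" by (rule jl[OF x])
        also have "\<dots> = k + (NN K * fst (jj y), NN K * fst (snd (jj y)), NN K * snd (snd (jj y)))" by (simp only: e)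
        also have "\<dots> = y" by (rule jl[OF y, symmetric])
        finally show "x = y" .
      qed
      have "sum ?h F = (\<Sum>l\<in>?G. wt k ^ s * cmod (a l))"
        using F by (simp add: sum.inter_filter)
      also have "\<dots> = (\<Sum>l\<in>?G. (wt k ^ s / wt l ^ s) * (wt l ^ s * cmod (a l)))"
        using wt_pos by (intro sum.cong) (auto simp: less_imp_neq[symmetric])
      finally have "(sum ?h F)\<^sup>2 \<le> (\<Sum>l\<in>?G. (wt k ^ s / wt l ^ s)\<^sup>2) * (\<Sum>l\<in>?G. (wt l ^ s * cmod (a l))\<^sup>2)"
        using Cauchy_Schwarz_ineq_sum[of "\<lambda>l. wt k ^ s / wt l ^ s" "\<lambda>l. wt l ^ s * cmod (a l)" ?G] by simp
      also have "(\<Sum>l\<in>?G. (wt l ^ s * cmod (a l))\<^sup>2) = (\<Sum>l\<in>?G. ?f k l)"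
        by (intro sum.cong) (auto simp: v_def power_mult_distrib power_mult[symmetric] mult.commute)
      also have "(\<Sum>l\<in>?G. (wt k ^ s / wt l ^ s)\<^sup>2) * (\<Sum>l\<in>?G. ?f k l) \<le> ?C * Q"
      proof (rule mult_mono)
        show "(\<Sum>l\<in>?G. ?f k l) \<le> Q"
          unfolding Q_def by (rule finite_sum_le_infsum[OF fs finG]) (auto simp: v0)
        show "(\<Sum>l\<in>?G. (wt k ^ s / wt l ^ s)\<^sup>2) \<le> ?C"
        proof -
          have "(wt k ^ s / wt l ^ s)\<^sup>2 \<le> 6 ^ (2 * s) * (1 / wt (jj l) ^ 4)" if "l \<in> ?G" for l
          proof -
            have "wt k / wt l \<le> 6 / wt (jj l)"
              using wt_mult_le_alias[OF k jl[OF that]] wt_pos[of l] wt_pos[of "jj l"] by (simp add: field_simps)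
            then have "(wt k / wt l) ^ (2 * s) \<le> (6 / wt (jj l)) ^ (2 * s)"
              by (intro power_mono) auto
            also have "\<dots> = 6 ^ (2 * s) * (1 / wt (jj l) ^ (2 * s))" by (simp add: power_divide)
            also have "\<dots> \<le> 6 ^ (2 * s) * (1 / wt (jj l) ^ 4)"
              using wt_pow_mono[of 4 "2 * s" "jj l"] s wt_pos[of "jj l"] by (intro mult_left_mono divide_left_mono) simp_all
            finally show ?thesis by (simp add: power_divide power_mult[symmetric] mult.commute)
          qed
          then have "(\<Sum>l\<in>?G. (wt k ^ s / wt l ^ s)\<^sup>2) \<le> (\<Sum>l\<in>?G. 6 ^ (2 * s) * (1 / wt (jj l) ^ 4))"
            by (rule sum_mono)
          also have "\<dots> = 6 ^ (2 * s) * (\<Sum>j\<in>jj ` ?G. 1 / wt j ^ 4)"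
            by (simp add: sum_distrib_left sum.reindex[OF inj])
          also have "\<dots> \<le> ?C"
            using finG by (intro mult_left_mono sum_wt4_le) auto
          finally show ?thesis .
        qed
      qed (use C0 v0 in \<open>auto intro!: sum_nonneg\<close>)
      finally show "(sum ?h F)\<^sup>2 \<le> ?C * Q" .
    qed
    have hs: "?h summable_on UNIV" and hi: "infsum ?h UNIV \<le> sqrt (?C * Q)"
      using nonneg_summable_bound[of ?h "sqrt (?C * Q)"] fin by auto
    have "norm (of_real (wt k ^ s) * hat K (QN K g) k) \<le> infsum ?h UNIV"
      by (rule norm_infsum_le[OF has_sum_cmult_right[OF hat_QN_has_sum[OF g]] has_sum_infsum[OF hs]])
        (auto simp: norm_mult norm_power)
    then have "wt k ^ s * cmod (hat K (QN K g) k) \<le> sqrt (?C * Q)"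
      using hi by (simp add: norm_mult norm_power)
    then have "(wt k ^ s * cmod (hat K (QN K g) k))\<^sup>2 \<le> (sqrt (?C * Q))\<^sup>2"
      by (rule power_mono) simp
    then show ?thesis using C0 Q0 by (simp add: Q_def power_mult_distrib power_mult[symmetric] mult.commute)
  qed
  then have "(\<Sum>k\<in>modes K. wt k ^ (2 * s) * (cmod (hat K (QN K g) k))\<^sup>2) \<le> (\<Sum>k\<in>modes K. ?C * infsum (?f k) UNIV)"
    by (rule sum_mono)
  also have "\<dots> = ?C * (\<Sum>k\<in>modes K. infsum (?f k) UNIV)" by (simp add: sum_distrib_left)
  also have "\<dots> \<le> ?C * B"
  proof (rule mult_left_mono[OF _ C0])
    have "(\<Sum>k\<in>modes K. infsum (?f k) UNIV) \<le> infsum v UNIV"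
    proof (rule has_sum_mono)
      show "((\<lambda>l. \<Sum>k\<in>modes K. ?f k l) has_sum (\<Sum>k\<in>modes K. infsum (?f k) UNIV)) UNIV"
        by (intro has_sum_finite_sum has_sum_infsum fs) simp
      show "(v has_sum infsum v UNIV) UNIV" by (rule has_sum_infsum[OF vs])
      show "(\<Sum>k\<in>modes K. ?f k l) \<le> v l" for l
        using sum_alias_indicator_le[OF v0, of K l True l] by simp
    qed
    then show "(\<Sum>k\<in>modes K. infsum (?f k) UNIV) \<le> B" using vB by linarith
  qed
  finally show ?thesis .
qed

section \<open>Time integrals\<close>

lemma integrable_lebesgue_on_iff: 
  fixes f :: "'a :: euclidean_space \<Rightarrow> 'b :: {banach, second_countable_topology}"
  shows "S \<in> sets lebesgue \<Longrightarrow> integrable (lebesgue_on S) f \<longleftrightarrow> set_integrable lebesgue S f"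
  unfolding set_integrable_def by (subst Bochner_Integration.integrable_restrict_space) auto

lemma absolutely_integrable_of_square:
  fixes f :: "real \<Rightarrow> 'a :: euclidean_space"
  assumes m: "f \<in> borel_measurable (lebesgue_on {0..T})" and g: "integrable (lebesgue_on {0..T}) g"
    and le: "\<And>t. t \<in> {0..T} \<Longrightarrow> (norm (f t))\<^sup>2 \<le> g t"
  shows "f absolutely_integrable_on {0..T}"
proof -
  have "(\<lambda>_. 1 :: real) absolutely_integrable_on {0..T}"
    by (rule absolutely_integrable_continuous_real) simp
  then have "integrable (lebesgue_on {0..T}) (\<lambda>_. 1 :: real)" by (simp add: integrable_lebesgue_on_iff)
  then have "integrable (lebesgue_on {0..T}) (\<lambda>t. 1 + g t)" using g by (rule Bochner_Integration.integrable_add)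
  then have "integrable (lebesgue_on {0..T}) f"
  proof (rule Bochner_Integration.integrable_bound[OF _ m])
    show "AE t in lebesgue_on {0..T}. norm (f t) \<le> norm (1 + g t)"
    proof (rule AE_I2)
      fix t assume "t \<in> space (lebesgue_on {0..T})"
      then have t: "(norm (f t))\<^sup>2 \<le> g t" using le by simp
      have "0 \<le> (norm (f t) - 1)\<^sup>2" by simp
      then have "2 * norm (f t) \<le> 1 + (norm (f t))\<^sup>2" by (simp add: power2_eq_square algebra_simps)
      then have "norm (f t) \<le> 1 + g t" using t norm_ge_zero[of "f t"] by linarith
      then show "norm (f t) \<le> norm (1 + g t)" by simp
    qed
  qed
  then show ?thesis by (simp add: integrable_lebesgue_on_iff)
qed

lemma absolutely_integrable_sub:
  fixes v :: "real \<Rightarrow> 'a :: euclidean_space"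
  assumes "v absolutely_integrable_on {0..T}" "0 \<le> s" "t \<le> T"
  shows "v absolutely_integrable_on {s..t}"
  using assms by (intro set_integrable_subset[OF assms(1)]) auto

lemma indefinite_integral_increment:
  fixes v :: "real \<Rightarrow> 'a :: euclidean_space"
  assumes vi: "v absolutely_integrable_on {0..T}"
    and u: "\<And>t. t \<in> {0..T} \<Longrightarrow> u t = u 0 + set_lebesgue_integral lebesgue {0..t} v"
    and st: "0 \<le> s" "s \<le> t" "t \<le> T"
  shows "u t - u s = integral {s..t} v"
proof -
  have eq: "u r = u 0 + integral {0..r} v" if "r \<in> {0..T}" for r
    using u[OF that] set_lebesgue_integral_eq_integral(2)[OF absolutely_integrable_sub[OF vi, of 0 r]] that by simp
  have "v integrable_on {0..t}"
    using absolutely_integrable_sub[OF vi, of 0 t] st set_lebesgue_integral_eq_integral(1) by auto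
  from Henstock_Kurzweil_Integration.integral_combine[OF st(1) st(2) this]
  have "integral {0..t} v = integral {0..s} v + integral {s..t} v" by simp
  then show ?thesis using eq[of s] eq[of t] st by simp
qed

text \<open>The right-hand side is an integral over a window containing s and t in either order, so
  one bound serves all pairs in the window.\<close>

lemma increment_norm_le:
  fixes v :: "real \<Rightarrow> 'a :: euclidean_space"
  assumes vi: "v absolutely_integrable_on {0..T}"
    and u: "\<And>t. t \<in> {0..T} \<Longrightarrow> u t = u 0 + set_lebesgue_integral lebesgue {0..t} v"
    and Z: "Z absolutely_integrable_on {0..T}" "\<And>t. t \<in> {0..T} \<Longrightarrow> norm (v t) \<le> Z t"
    and ab: "0 \<le> a" "b \<le> T" and st: "s \<in> {a..b}" "t \<in> {a..b}"
  shows "norm (u t - u s) \<le> integral {a..b} Z"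
proof -
  have main: "norm (u t - u s) \<le> integral {a..b} Z" if "s \<le> t" "s \<in> {a..b}" "t \<in> {a..b}" for s t
  proof -
    have i1: "v integrable_on {s..t}" and i2: "Z integrable_on {s..t}" and i3: "Z integrable_on {a..b}"
      using that ab absolutely_integrable_sub[OF vi, of s t] absolutely_integrable_sub[OF Z(1), of s t]
        absolutely_integrable_sub[OF Z(1), of a b] by (auto intro: set_lebesgue_integral_eq_integral(1))
    have "norm (u t - u s) = norm (integral {s..t} v)"
      using indefinite_integral_increment[OF vi u, of s t] that ab by simp
    also have "\<dots> \<le> integral {s..t} Z"
      by (rule integral_norm_bound_integral[OF i1 i2]) (use Z(2) that ab in auto)
    also have "\<dots> \<le> integral {a..b} Z"
    proof (rule integral_subset_le[OF _ i2 i3])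
      show "\<forall>x\<in>{a..b}. 0 \<le> Z x"
        using ab by (auto intro!: order_trans[OF norm_ge_zero Z(2)])
    qed (use that in auto)
    finally show ?thesis .
  qed
  show ?thesis
  proof (cases "s \<le> t")
    case True then show ?thesis using main st by blast
  next
    case False then show ?thesis using main[of t s] st by (simp add: norm_minus_commute)
  qed
qed

text \<open>Nonnegativity of the variance: integrate (Z - a)^2 with a the mean of Z.\<close>

lemma cauchy_schwarz_integral:
  fixes Z :: "real \<Rightarrow> real"
  assumes "s \<le> t" and Z: "Z integrable_on {s..t}" and Z2: "(\<lambda>x. (Z x)\<^sup>2) integrable_on {s..t}"
  shows "(integral {s..t} Z)\<^sup>2 \<le> (t - s) * integral {s..t} (\<lambda>x. (Z x)\<^sup>2)"
proof (cases "s = t")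
  case True then show ?thesis by simp
next
  case False
  then have st: "s < t" using assms by simp
  define a where "a = integral {s..t} Z / (t - s)"
  have I: "integral {s..t} Z = a * (t - s)" using st by (simp add: a_def)
  have "((\<lambda>x. (Z x)\<^sup>2 - 2 * a * Z x + a\<^sup>2) has_integral
      (integral {s..t} (\<lambda>x. (Z x)\<^sup>2) - 2 * a * integral {s..t} Z + (t - s) *\<^sub>R a\<^sup>2)) {s..t}"
    using has_integral_const_real[of "a\<^sup>2" s t] st
    by (intro has_integral_add has_integral_diff has_integral_mult_right integrable_integral Z Z2) simp
  moreover have "(Z x)\<^sup>2 - 2 * a * Z x + a\<^sup>2 = (Z x - a)\<^sup>2" for x by (simp add: power2_eq_square algebra_simps)
  ultimately have "0 \<le> integral {s..t} (\<lambda>x. (Z x)\<^sup>2) - 2 * a * integral {s..t} Z + (t - s) * a\<^sup>2"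
    using has_integral_nonneg[of "\<lambda>x. (Z x - a)\<^sup>2"] by simp
  then have "(t - s) * a\<^sup>2 \<le> integral {s..t} (\<lambda>x. (Z x)\<^sup>2)" unfolding I by (simp add: power2_eq_square algebra_simps)
  then have "(t - s) * ((t - s) * a\<^sup>2) \<le> (t - s) * integral {s..t} (\<lambda>x. (Z x)\<^sup>2)"
    using st by (intro mult_left_mono) auto
  then show ?thesis unfolding I by (simp add: power2_eq_square mult_ac)
qed

section \<open>Differentiability of indefinite integrals and Taylor remainders\<close>

lemma indefinite_integral_continuous:
  fixes v :: "real \<Rightarrow> 'a :: euclidean_space"
  assumes vi: "v absolutely_integrable_on {0..T}"
    and u: "\<And>t. t \<in> {0..T} \<Longrightarrow> u t = u 0 + set_lebesgue_integral lebesgue {0..t} v"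
  shows "continuous_on {0..T} u"
proof -
  have A: "continuous_on {0..T} (\<lambda>t. u 0 + integral {0..t} v)"
    using set_lebesgue_integral_eq_integral(1)[OF vi]
    by (intro continuous_intros indefinite_integral_continuous_1)
  have E: "u t = u 0 + integral {0..t} v" if "t \<in> {0..T}" for t
    using indefinite_integral_increment[OF vi u, of 0 t] that by (simp add: algebra_simps)
  show ?thesis by (rule continuous_on_eq[OF A]) (rule E[symmetric])
qed

lemma indefinite_integral_derivative:
  fixes v :: "real \<Rightarrow> 'a :: euclidean_space"
  assumes vi: "continuous_on {0..T} v"
    and u: "\<And>t. t \<in> {0..T} \<Longrightarrow> u t = u 0 + set_lebesgue_integral lebesgue {0..t} v"
    and t: "t \<in> {0..T}"
  shows "(u has_vector_derivative v t) (at t within {0..T})"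
proof -
  have ai: "v absolutely_integrable_on {0..T}" by (rule absolutely_integrable_continuous_real[OF vi])
  have eq: "u t = u 0 + integral {0..t} v" if "t \<in> {0..T}" for t
    using indefinite_integral_increment[OF ai u, of 0 t] that by (simp add: algebra_simps)
  have D: "((\<lambda>t. u 0 + integral {0..t} v) has_vector_derivative (0 + v t)) (at t within {0..T})"
    by (intro has_vector_derivative_add has_vector_derivative_const integral_has_vector_derivative vi t)
  from has_vector_derivative_transform[OF t eq D] show ?thesis by simp
qed

text \<open>The mean value inequality for y(s) - s V. The reference slope V is arbitrary; only the
  distance of the derivative from V matters.\<close>

lemma first_order_remainder:
  fixes y :: "real \<Rightarrow> 'a :: real_normed_vector"
  assumes d: "\<And>s. s \<in> {l..h} \<Longrightarrow> (y has_vector_derivative v s) (at s within {l..h})"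
    and b: "\<And>s. s \<in> {l..h} \<Longrightarrow> norm (v s - V) \<le> I" and st: "s \<in> {l..h}" "t \<in> {l..h}"
  shows "norm (y s - y t - (s - t) *\<^sub>R V) \<le> I * \<bar>s - t\<bar>"
proof -
  let ?f = "\<lambda>s. y s - s *\<^sub>R V"
  have "norm (?f s - ?f t) \<le> I * norm (s - t)"
  proof (rule differentiable_bound[where S = "{l..h}" and f' = "\<lambda>s h. h *\<^sub>R (v s - V)"])
    fix x assume x: "x \<in> {l..h}"
    have "((\<lambda>s. s *\<^sub>R V) has_vector_derivative V) (at x within {l..h})"
      by (auto intro!: derivative_eq_intros)
    from has_vector_derivative_diff[OF d[OF x] this]
    show "(?f has_derivative (\<lambda>h. h *\<^sub>R (v x - V))) (at x within {l..h})"
      by (simp add: has_vector_derivative_def)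
    show "onorm (\<lambda>h. h *\<^sub>R (v x - V)) \<le> I"
    proof (rule onorm_le)
      show "norm (r *\<^sub>R (v x - V)) \<le> I * norm r" for r
        using mult_left_mono[OF b[OF x], of "\<bar>r\<bar>"] by (simp add: mult.commute)
    qed
  qed (use st in auto)
  then show ?thesis by (simp add: scaleR_left_diff_distrib algebra_simps)
qed

text \<open>Two uses of \<open>first_order_remainder\<close>, for v and then for u minus a parabola.
  The oscillation of the second derivative replaces a bound on the third, which is controlled only
  in the mean square over time.\<close>

lemma second_order_remainder:
  fixes u v w :: "real \<Rightarrow> real"
  assumes u: "\<And>s. s \<in> {l..h} \<Longrightarrow> (u has_vector_derivative v s) (at s within {l..h})"
    and v: "\<And>s. s \<in> {l..h} \<Longrightarrow> (v has_vector_derivative w s) (at s within {l..h})"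
    and b: "\<And>s. s \<in> {l..h} \<Longrightarrow> \<bar>w s - W\<bar> \<le> I" and st: "s \<in> {l..h}" "t \<in> {l..h}"
  shows "\<bar>u s - u t - (s - t) * v t - (s - t)\<^sup>2 / 2 * W\<bar> \<le> (h - l) * I * \<bar>s - t\<bar>"
proof -
  let ?y = "\<lambda>s. u s - (s - t)\<^sup>2 / 2 * W"
  have I0: "I \<ge> 0" using b[OF st(1)] by linarith
  have "norm (?y s - ?y t - (s - t) *\<^sub>R v t) \<le> ((h - l) * I) * \<bar>s - t\<bar>"
  proof (rule first_order_remainder[where l = l and h = h and v = "\<lambda>s. v s - (s - t) * W"])
    fix x assume x: "x \<in> {l..h}"
    have "((\<lambda>s. (s - t)\<^sup>2 / 2 * W) has_vector_derivative ((x - t) * W)) (at x within {l..h})"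
      unfolding has_real_derivative_iff_has_vector_derivative[symmetric]
      by (auto intro!: derivative_eq_intros)
    from has_vector_derivative_diff[OF u[OF x] this]
    show "(?y has_vector_derivative v x - (x - t) * W) (at x within {l..h})" .
    have "norm (v x - v t - (x - t) *\<^sub>R W) \<le> I * \<bar>x - t\<bar>"
      by (rule first_order_remainder[OF v _ x st(2)]) (use b in auto)
    also have "\<dots> \<le> I * (h - l)" using x st I0 by (intro mult_left_mono) auto
    finally show "norm (v x - (x - t) * W - v t) \<le> (h - l) * I" by (simp add: algebra_simps)
  qed (use st in auto)
  then show ?thesis by (simp add: algebra_simps)
qed

text \<open>Applied to finite sums of modes, which are continuous in time, to turn a bound for
  almost every time into one at every time, hence at the grid times.\<close>

lemma continuous_le_of_AE_le:
  fixes S :: "real \<Rightarrow> real"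
  assumes c: "continuous_on {0..T} S" and ae: "AE t in lebesgue. t \<in> {0..T} \<longrightarrow> S t \<le> B" and T: "0 < T"
    and t: "t \<in> {0..T}"
  shows "S t \<le> B"
proof (rule ccontr)
  assume "\<not> S t \<le> B"
  then have gt: "S t > B" by simp
  obtain N where N: "negligible N" "{t. \<not> (t \<in> {0..T} \<longrightarrow> S t \<le> B)} \<subseteq> N"
    using ae unfolding eventually_ae_filter_negligible by blast
  obtain e where e: "e > 0" "\<And>s. s \<in> {0..T} \<Longrightarrow> dist s t < e \<Longrightarrow> dist (S s) (S t) < S t - B"
    using c t gt unfolding continuous_on_iff by (metis diff_gt_0_iff_gt)
  define l where "l = max 0 (t - e)"
  define h where "h = min T (t + e)"
  have lh: "l < h" using T t e by (auto simp: l_def h_def)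
  have "{l<..<h} \<subseteq> N"
  proof
    fix s assume s: "s \<in> {l<..<h}"
    then have sT: "s \<in> {0..T}" "dist s t < e" by (auto simp: l_def h_def dist_real_def)
    then have "dist (S s) (S t) < S t - B" using e by blast
    then have "S s > B" unfolding dist_real_def by linarith
    then show "s \<in> N" using N sT by auto
  qed
  then have "negligible {l<..<h}" using N(1) negligible_subset by blast
  moreover have "open {l<..<h}" "{l<..<h} \<noteq> {}" using lh by auto
  ultimately show False using open_not_negligible by blast
qed

section \<open>The nonlinear flux in Fourier variables\<close>

definition gx :: "(freq \<Rightarrow> complex) \<Rightarrow> freq \<Rightarrow> complex" where
  "gx a k = \<i> * complex_of_real (2 * pi * real_of_int (fst k)) * a k"
definition gy :: "(freq \<Rightarrow> complex) \<Rightarrow> freq \<Rightarrow> complex" where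
  "gy a k = \<i> * complex_of_real (2 * pi * real_of_int (fst (snd k))) * a k"
definition gz :: "(freq \<Rightarrow> complex) \<Rightarrow> freq \<Rightarrow> complex" where
  "gz a k = \<i> * complex_of_real (2 * pi * real_of_int (snd (snd k))) * a k"

definition qco :: "(freq \<Rightarrow> complex) \<Rightarrow> freq \<Rightarrow> complex" where
  "qco a = (\<lambda>k. conv (gx a) (gx a) k + conv (gy a) (gy a) k + conv (gz a) (gz a) k)"

definition fx :: "(freq \<Rightarrow> complex) \<Rightarrow> freq \<Rightarrow> complex" where
  "fx a = conv (qco a) (gx a)"
definition fy :: "(freq \<Rightarrow> complex) \<Rightarrow> freq \<Rightarrow> complex" where
  "fy a = conv (qco a) (gy a)"
definition fz :: "(freq \<Rightarrow> complex) \<Rightarrow> freq \<Rightarrow> complex" where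
  "fz a = conv (qco a) (gz a)"

definition nlco :: "(freq \<Rightarrow> complex) \<Rightarrow> freq \<Rightarrow> complex" where
  "nlco a = (\<lambda>k. gx (fx a) k + gy (fy a) k + gz (fz a) k)"

definition muco :: "real \<Rightarrow> (freq \<Rightarrow> complex) \<Rightarrow> freq \<Rightarrow> complex" where
  "muco \<epsilon> a k = - nlco a k + complex_of_real (1 - \<epsilon> - 2 * kap k + (kap k)\<^sup>2) * a k"

lemma norm_g_le: "cmod (gx a k) \<le> 2 * pi * wt k * cmod (a k)" "cmod (gy a k) \<le> 2 * pi * wt k * cmod (a k)"
    "cmod (gz a k) \<le> 2 * pi * wt k * cmod (a k)"
  by (auto simp: gx_def gy_def gz_def norm_mult abs_mult wt_def intro!: mult_right_mono)

lemma wsum_g: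
  assumes "wsum (Suc s) a"
  shows "wsum s (gx a)" "wsum s (gy a)" "wsum s (gz a)"
    "wnorm s (gx a) \<le> 2 * pi * wnorm (Suc s) a" "wnorm s (gy a) \<le> 2 * pi * wnorm (Suc s) a" "wnorm s (gz a) \<le> 2 * pi * wnorm (Suc s) a"
  using wsum_dominated[OF assms, of "gx a" "2 * pi" 1 s] wsum_dominated[OF assms, of "gy a" "2 * pi" 1 s]
    wsum_dominated[OF assms, of "gz a" "2 * pi" 1 s] norm_g_le by auto

lemma wien_g:
  assumes "wien (Suc s) a g"
  shows "wien s (gx a) (dxc g)" "wien s (gy a) (dyc g)" "wien s (gz a) (dzc g)"
  unfolding gx_def[abs_def] gy_def[abs_def] gz_def[abs_def]
  by (rule wien_dx[OF assms] wien_dy[OF assms] wien_dz[OF assms])+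

lemma wsum_f:
  assumes "wsum (Suc s) a"
  shows "wsum s (fx a)" "wsum s (fy a)" "wsum s (fz a)"
    "wnorm s (fx a) \<le> 3 * (2 * pi * wnorm (Suc s) a) ^ 3" "wnorm s (fy a) \<le> 3 * (2 * pi * wnorm (Suc s) a) ^ 3"
    "wnorm s (fz a) \<le> 3 * (2 * pi * wnorm (Suc s) a) ^ 3"
proof -
  let ?G = "2 * pi * wnorm (Suc s) a"
  note g = wsum_g[OF assms]
  have G0: "?G \<ge> 0" using wnorm_nonneg by simp
  have c2: "wsum s (conv u v)" "wnorm s (conv u v) \<le> ?G * ?G" if "wsum s u" "wsum s v" "wnorm s u \<le> ?G" "wnorm s v \<le> ?G" for u v
  proof -
    show "wsum s (conv u v)" by (rule wsum_conv(1)[OF that(1,2)])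
    have "wnorm s (conv u v) \<le> wnorm s u * wnorm s v" by (rule wsum_conv(2)[OF that(1,2)])
    also have "\<dots> \<le> ?G * ?G" using that wnorm_nonneg G0 by (intro mult_mono) auto
    finally show "wnorm s (conv u v) \<le> ?G * ?G" .
  qed
  have q: "wsum s (qco a)" "wnorm s (qco a) \<le> 3 * (?G * ?G)"
  proof -
    note xx = c2[OF g(1) g(1) g(4) g(4)] and yy = c2[OF g(2) g(2) g(5) g(5)] and zz = c2[OF g(3) g(3) g(6) g(6)]
    show "wsum s (qco a)" unfolding qco_def by (intro wsum_add(1) xx yy zz)
    have "wnorm s (qco a) \<le> wnorm s (\<lambda>k. conv (gx a) (gx a) k + conv (gy a) (gy a) k) + wnorm s (conv (gz a) (gz a))"
      unfolding qco_def by (rule wsum_add(2)[OF wsum_add(1)[OF xx(1) yy(1)] zz(1)])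
    also have "wnorm s (\<lambda>k. conv (gx a) (gx a) k + conv (gy a) (gy a) k) \<le> wnorm s (conv (gx a) (gx a)) + wnorm s (conv (gy a) (gy a))"
      by (rule wsum_add(2)[OF xx(1) yy(1)])
    finally show "wnorm s (qco a) \<le> 3 * (?G * ?G)" using xx(2) yy(2) zz(2) by linarith
  qed
  have c3: "wnorm s (conv (qco a) v) \<le> 3 * ?G ^ 3" if "wsum s v" "wnorm s v \<le> ?G" for v
  proof -
    have "wnorm s (conv (qco a) v) \<le> wnorm s (qco a) * wnorm s v" by (rule wsum_conv(2)[OF q(1) that(1)])
    also have "\<dots> \<le> (3 * (?G * ?G)) * ?G" using that q wnorm_nonneg G0 by (intro mult_mono) auto
    finally show ?thesis by (simp add: power3_eq_cube mult_ac)
  qed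
  show "wsum s (fx a)" "wsum s (fy a)" "wsum s (fz a)"
    unfolding fx_def fy_def fz_def by (intro wsum_conv(1) q g)+
  show "wnorm s (fx a) \<le> 3 * ?G ^ 3" "wnorm s (fy a) \<le> 3 * ?G ^ 3" "wnorm s (fz a) \<le> 3 * ?G ^ 3"
    unfolding fx_def fy_def fz_def by (intro c3 g)+
qed

lemma wien_f:
  assumes "wien (Suc s) a g"
  defines "q \<equiv> (\<lambda>x y z. (dxc g x y z)\<^sup>2 + (dyc g x y z)\<^sup>2 + (dzc g x y z)\<^sup>2)"
  shows "wien s (fx a) (\<lambda>x y z. q x y z * dxc g x y z)" "wien s (fy a) (\<lambda>x y z. q x y z * dyc g x y z)"
    "wien s (fz a) (\<lambda>x y z. q x y z * dzc g x y z)"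
proof -
  note g = wien_g[OF assms(1)]
  have q: "wien s (qco a) q"
    unfolding q_def qco_def power2_eq_square by (intro wien_add wien_mult g)
  show "wien s (fx a) (\<lambda>x y z. q x y z * dxc g x y z)" "wien s (fy a) (\<lambda>x y z. q x y z * dyc g x y z)"
    "wien s (fz a) (\<lambda>x y z. q x y z * dzc g x y z)"
    unfolding fx_def fy_def fz_def by (intro wien_mult q g)+
qed

lemma wien_nlc:
  assumes "wien (Suc (Suc s)) a g"
  shows "wien s (nlco a) (nlc g)"
  unfolding nlco_def nlc_def Let_def
  by (intro wien_add wien_g wien_f assms)

lemma wien_lapc:
  assumes "wien (Suc (Suc s)) a g"
  shows "wien s (\<lambda>k. - complex_of_real (kap k) * a k) (lapc g)"
proof -
  have "wien s (\<lambda>k. gx (gx a) k + gy (gy a) k + gz (gz a) k) (lapc g)"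
    unfolding lapc_def by (intro wien_add wien_g assms)
  moreover have "gx (gx a) k + gy (gy a) k + gz (gz a) k = - complex_of_real (kap k) * a k" for k
    by (simp add: gx_def gy_def gz_def kap_def power2_eq_square algebra_simps)
  ultimately show ?thesis by simp
qed

lemma wien_muc:
  assumes "wien 4 a g"
  shows "wien 0 (muco \<epsilon> a) (muc \<epsilon> g)"
proof -
  have w: "wien 0 a g" "wien (Suc (Suc 0)) a g" "wien (Suc (Suc 2)) a g"
    using assms wien_mono[OF assms] by (auto simp: numeral_eq_Suc)
  let ?L = "\<lambda>b k. - complex_of_real (kap k) * b k"
  have l1: "wien 0 (?L a) (lapc g)" by (rule wien_lapc[OF w(2)])
  have l2: "wien 0 (?L (?L a)) (lapc (lapc g))"
    by (rule wien_lapc) (use wien_lapc[OF w(3)] in \<open>simp add: numeral_eq_Suc\<close>)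
  have n: "wien 0 (nlco a) (nlc g)" by (rule wien_nlc[OF w(2)])
  have "wien 0 (\<lambda>k. complex_of_real (- 1) * nlco a k + complex_of_real (- \<epsilon>) * a k +
      ((a k + complex_of_real 2 * ?L a k) + ?L (?L a) k))
     (\<lambda>x y z. (- 1) * nlc g x y z + (- \<epsilon>) * g x y z + ((g x y z + 2 * lapc g x y z) + lapc (lapc g) x y z))"
    by (intro wien_add wien_cmult n w l1 l2)
  moreover have "complex_of_real (- 1) * nlco a k + complex_of_real (- \<epsilon>) * a k +
      ((a k + complex_of_real 2 * ?L a k) + ?L (?L a) k) = muco \<epsilon> a k" for k
    by (simp add: muco_def power2_eq_square algebra_simps)
  moreover have "(\<lambda>x y z. (- 1) * nlc g x y z + (- \<epsilon>) * g x y z + ((g x y z + 2 * lapc g x y z) + lapc (lapc g) x y z)) = muc \<epsilon> g"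
    by (simp add: muc_def fun_eq_iff)
  ultimately show ?thesis by (simp only:)
qed

text \<open>Meant for gradients p and r with matching components u and v. The 9 is 6 + 3: the sum of
  squares changes by at most 6 G \<eta> and is itself at most 3 G^2.\<close>

lemma cubic_lipschitz:
  fixes p1 p2 p3 r1 r2 r3 u v G \<eta> :: real
  assumes "\<bar>p1\<bar> \<le> G" "\<bar>p2\<bar> \<le> G" "\<bar>p3\<bar> \<le> G" "\<bar>r1\<bar> \<le> G" "\<bar>r2\<bar> \<le> G" "\<bar>r3\<bar> \<le> G" "\<bar>u\<bar> \<le> G"
    and "\<bar>p1 - r1\<bar> \<le> \<eta>" "\<bar>p2 - r2\<bar> \<le> \<eta>" "\<bar>p3 - r3\<bar> \<le> \<eta>" "\<bar>u - v\<bar> \<le> \<eta>"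
  shows "\<bar>(p1\<^sup>2 + p2\<^sup>2 + p3\<^sup>2) * u - (r1\<^sup>2 + r2\<^sup>2 + r3\<^sup>2) * v\<bar> \<le> 9 * G\<^sup>2 * \<eta>"
proof -
  have G0: "G \<ge> 0" by (rule order_trans[OF abs_ge_zero assms(1)])
  have e0: "\<eta> \<ge> 0" by (rule order_trans[OF abs_ge_zero assms(8)])
  have sq: "\<bar>p\<^sup>2 - r\<^sup>2\<bar> \<le> 2 * G * \<eta>" if "\<bar>p\<bar> \<le> G" "\<bar>r\<bar> \<le> G" "\<bar>p - r\<bar> \<le> \<eta>" for p r
  proof -
    have "\<bar>p\<^sup>2 - r\<^sup>2\<bar> = \<bar>p + r\<bar> * \<bar>p - r\<bar>" by (simp add: power2_eq_square abs_mult[symmetric] algebra_simps)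
    also have "\<dots> \<le> (2 * G) * \<eta>" using that by (intro mult_mono) auto
    finally show ?thesis by simp
  qed
  have r2: "r\<^sup>2 \<le> G\<^sup>2" if "\<bar>r\<bar> \<le> G" for r using power_mono[OF that, of 2] by simp
  have d: "\<bar>(p1\<^sup>2 + p2\<^sup>2 + p3\<^sup>2) - (r1\<^sup>2 + r2\<^sup>2 + r3\<^sup>2)\<bar> \<le> 6 * G * \<eta>"
  proof -
    have "\<bar>(a - a') + (b - b') + (c - c')\<bar> \<le> 3 * d" if "\<bar>a - a'\<bar> \<le> d" "\<bar>b - b'\<bar> \<le> d" "\<bar>c - c'\<bar> \<le> d"
      for a a' b b' c c' d :: real using that by linarith
    from this[OF sq[OF assms(1,4,8)] sq[OF assms(2,5,9)] sq[OF assms(3,6,10)]] show ?thesis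
      by (simp add: algebra_simps)
  qed
  have tri: "\<bar>x * y + z * w\<bar> \<le> \<bar>x\<bar> * \<bar>y\<bar> + \<bar>z\<bar> * \<bar>w\<bar>" for x y z w :: real
    using abs_triangle_ineq[of "x * y" "z * w"] by (simp add: abs_mult)
  have split: "x * u - z * v = (x - z) * u + z * (u - v)" for x z by (simp add: algebra_simps)
  have "\<bar>(p1\<^sup>2 + p2\<^sup>2 + p3\<^sup>2) * u - (r1\<^sup>2 + r2\<^sup>2 + r3\<^sup>2) * v\<bar> \<le>
      \<bar>((p1\<^sup>2 + p2\<^sup>2 + p3\<^sup>2) - (r1\<^sup>2 + r2\<^sup>2 + r3\<^sup>2))\<bar> * \<bar>u\<bar> + \<bar>r1\<^sup>2 + r2\<^sup>2 + r3\<^sup>2\<bar> * \<bar>u - v\<bar>"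
    unfolding split[of "p1\<^sup>2 + p2\<^sup>2 + p3\<^sup>2"] by (rule tri)
  also have "\<dots> \<le> (6 * G * \<eta>) * G + (3 * G\<^sup>2) * \<eta>"
  proof (intro add_mono mult_mono)
    show "\<bar>r1\<^sup>2 + r2\<^sup>2 + r3\<^sup>2\<bar> \<le> 3 * G\<^sup>2" using r2[OF assms(4)] r2[OF assms(5)] r2[OF assms(6)] by simp
  qed (use d assms(7,11) G0 e0 in auto)
  also have "\<dots> = 9 * G\<^sup>2 * \<eta>" by (simp add: power2_eq_square algebra_simps)
  finally show ?thesis .
qed

section \<open>Regularity of the exact solution in Fourier variables\<close>

lemma L2_C0_absolutely_integrable:
  assumes "L2_C0 T v"
  shows "(\<lambda>t. v t x y z) absolutely_integrable_on {0..T}"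
proof (rule absolutely_integrable_of_square[where g = "\<lambda>t. (C0_norm (v t))\<^sup>2"])
  show "(norm (v t x y z))\<^sup>2 \<le> (C0_norm (v t))\<^sup>2" if "t \<in> {0..T}" for t
    using assms that power_mono[OF C0_norm_bound(1)[of "v t" x y z], of 2] by (simp add: L2_C0_def)
qed (use assms in \<open>auto simp: L2_C0_def\<close>)

lemma wderiv_C0_eq:
  "wderiv_C0 T u v \<Longrightarrow> t \<in> {0..T} \<Longrightarrow> u t x y z = u 0 x y z + set_lebesgue_integral lebesgue {0..t} (\<lambda>\<tau>. v \<tau> x y z)"
  unfolding wderiv_C0_def by blast

lemma wderiv_Hper_eq:
  "wderiv_Hper T u v \<Longrightarrow> t \<in> {0..T} \<Longrightarrow> fcoef (u t) k = fcoef (u 0) k + set_lebesgue_integral lebesgue {0..t} (\<lambda>\<tau>. fcoef (v \<tau>) k)"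
  unfolding wderiv_Hper_def by blast

lemma hweight_ge_1: "1 \<le> hweight s k"
proof -
  have "hweight s k = (1 + real_of_int ((fst k)\<^sup>2 + (fst (snd k))\<^sup>2 + (snd (snd k))\<^sup>2)) ^ s"
    by (simp add: hweight_def case_prod_unfold)
  moreover have "1 \<le> 1 + real_of_int ((fst k)\<^sup>2 + (fst (snd k))\<^sup>2 + (snd (snd k))\<^sup>2)" by simp
  ultimately show ?thesis by (simp only: one_le_power)
qed

lemma Hper_finite_sum_le:
  assumes "in_Hper s g" "finite F"
  shows "(\<Sum>k\<in>F. hweight s k * (cmod (fcoef g k))\<^sup>2) \<le> Hper_sq s g"
proof -
  have "0 \<le> hweight s k * (cmod (fcoef g k))\<^sup>2" for k using hweight_ge_1[of s k] by simp
  then show ?thesis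
    unfolding Hper_sq_def using assms by (intro finite_sum_le_infsum) (simp_all add: in_Hper_def)
qed

lemma Hper_wt_sum_le:
  assumes "in_Hper s g" "finite F"
  shows "(\<Sum>k\<in>F. wt k ^ (2 * s) * (cmod (fcoef g k))\<^sup>2) \<le> 4 ^ s * Hper_sq s g"
proof -
  have "(\<Sum>k\<in>F. wt k ^ (2 * s) * (cmod (fcoef g k))\<^sup>2) \<le> (\<Sum>k\<in>F. 4 ^ s * hweight s k * (cmod (fcoef g k))\<^sup>2)"
    by (intro sum_mono mult_right_mono wt_pow_le_hweight) auto
  also have "\<dots> = 4 ^ s * (\<Sum>k\<in>F. hweight s k * (cmod (fcoef g k))\<^sup>2)" by (simp add: sum_distrib_left mult.assoc)
  also have "\<dots> \<le> 4 ^ s * Hper_sq s g" using assms by (intro mult_left_mono Hper_finite_sum_le) auto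
  finally show ?thesis .
qed

lemma Hper_coef_sq_le:
  assumes "in_Hper s g"
  shows "(cmod (fcoef g k))\<^sup>2 \<le> Hper_sq s g"
proof -
  have "1 * (cmod (fcoef g k))\<^sup>2 \<le> hweight s k * (cmod (fcoef g k))\<^sup>2"
    by (intro mult_right_mono hweight_ge_1) auto
  then show ?thesis using Hper_finite_sum_le[OF assms, of "{k}"] by simp
qed

lemma L2_Hper_absolutely_integrable:
  assumes "L2_Hper s T v"
  shows "(\<lambda>t. fcoef (v t) k) absolutely_integrable_on {0..T}"
    and "(\<lambda>t. (cmod (fcoef (v t) k))\<^sup>2) absolutely_integrable_on {0..T}"
    and "(\<lambda>t. Hper_sq s (v t)) absolutely_integrable_on {0..T}"
proof -
  have m: "(\<lambda>t. fcoef (v t) k) \<in> borel_measurable (lebesgue_on {0..T})" and g: "integrable (lebesgue_on {0..T}) (\<lambda>t. Hper_sq s (v t))"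
    using assms unfolding L2_Hper_def by blast+
  have le: "(norm (fcoef (v t) k))\<^sup>2 \<le> Hper_sq s (v t)" if "t \<in> {0..T}" for t
    using assms that Hper_coef_sq_le unfolding L2_Hper_def by blast
  show "(\<lambda>t. fcoef (v t) k) absolutely_integrable_on {0..T}"
    by (rule absolutely_integrable_of_square[OF m g le])
  show "(\<lambda>t. Hper_sq s (v t)) absolutely_integrable_on {0..T}"
    using g by (simp add: integrable_lebesgue_on_iff)
  have "integrable (lebesgue_on {0..T}) (\<lambda>t. (cmod (fcoef (v t) k))\<^sup>2)"
  proof (rule Bochner_Integration.integrable_bound[OF g])
    show "(\<lambda>t. (cmod (fcoef (v t) k))\<^sup>2) \<in> borel_measurable (lebesgue_on {0..T})"
      using m by measurable
    show "AE t in lebesgue_on {0..T}. norm ((cmod (fcoef (v t) k))\<^sup>2) \<le> norm (Hper_sq s (v t))"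
    proof (rule AE_I2)
      fix t assume "t \<in> space (lebesgue_on {0..T})"
      then have "(norm (fcoef (v t) k))\<^sup>2 \<le> Hper_sq s (v t)" using le by simp
      then show "norm ((cmod (fcoef (v t) k))\<^sup>2) \<le> norm (Hper_sq s (v t))" by simp
    qed
  qed
  then show "(\<lambda>t. (cmod (fcoef (v t) k))\<^sup>2) absolutely_integrable_on {0..T}"
    by (simp add: integrable_lebesgue_on_iff)
qed

lemma Hper_integral_sum_le:
  assumes v: "L2_Hper s T v" and ab: "0 \<le> a" "b \<le> T" and F: "finite F"
  shows "(\<Sum>k\<in>F. wt k ^ (2 * s) * integral {a..b} (\<lambda>t. (cmod (fcoef (v t) k))\<^sup>2)) \<le> 4 ^ s * integral {a..b} (\<lambda>t. Hper_sq s (v t))"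
proof -
  have i: "(\<lambda>t. (cmod (fcoef (v t) k))\<^sup>2) integrable_on {a..b}" for k
    using set_lebesgue_integral_eq_integral(1)[OF absolutely_integrable_sub[OF L2_Hper_absolutely_integrable(2)[OF v] ab]] .
  have iH: "(\<lambda>t. Hper_sq s (v t)) integrable_on {a..b}"
    using set_lebesgue_integral_eq_integral(1)[OF absolutely_integrable_sub[OF L2_Hper_absolutely_integrable(3)[OF v] ab]] .
  have "(\<Sum>k\<in>F. wt k ^ (2 * s) * integral {a..b} (\<lambda>t. (cmod (fcoef (v t) k))\<^sup>2)) =
      integral {a..b} (\<lambda>t. \<Sum>k\<in>F. wt k ^ (2 * s) * (cmod (fcoef (v t) k))\<^sup>2)"
    using F i by (subst integral_sum) (auto intro!: integrable_on_mult_right)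
  also have "\<dots> \<le> integral {a..b} (\<lambda>t. 4 ^ s * Hper_sq s (v t))"
  proof (rule integral_le)
    show "(\<lambda>t. \<Sum>k\<in>F. wt k ^ (2 * s) * (cmod (fcoef (v t) k))\<^sup>2) integrable_on {a..b}"
      by (intro integrable_sum F integrable_on_mult_right i)
    show "(\<lambda>t. 4 ^ s * Hper_sq s (v t)) integrable_on {a..b}" by (intro integrable_on_mult_right iH)
    show "(\<Sum>k\<in>F. wt k ^ (2 * s) * (cmod (fcoef (v t) k))\<^sup>2) \<le> 4 ^ s * Hper_sq s (v t)" if "t \<in> {a..b}" for t
    proof (rule Hper_wt_sum_le[OF _ F])
      have "t \<in> {0..T}" using that ab by auto
      then show "in_Hper s (v t)" using v unfolding L2_Hper_def by blast
    qed
  qed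
  finally show ?thesis by simp
qed

lemma fcoef_norm_le:
  assumes "continuous_on UNIV (unc g)" "\<And>x y z. \<bar>g x y z\<bar> \<le> B"
  shows "cmod (fcoef g k) \<le> B"
proof -
  have "B \<ge> 0" using assms(2)[of 0 0 0] by linarith
  then show ?thesis using bessel_inequality[OF assms, of "{k}"] by (simp add: power2_le_iff_abs_le)
qed

lemma fcoef_lincomb4:
  assumes "continuous_on UNIV (unc f)" "continuous_on UNIV (unc g)" "continuous_on UNIV (unc h)" "continuous_on UNIV (unc e)"
  shows "fcoef (\<lambda>x y z. \<alpha> * f x y z - \<beta> * g x y z - \<gamma> * h x y z - \<delta> * e x y z) k =
      of_real \<alpha> * fcoef f k - of_real \<beta> * fcoef g k - of_real \<gamma> * fcoef h k - of_real \<delta> * fcoef e k"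
    and "continuous_on UNIV (unc (\<lambda>x y z. \<alpha> * f x y z - \<beta> * g x y z - \<gamma> * h x y z - \<delta> * e x y z))"
proof -
  note c = fcoef_cmult(2)[OF assms(1), of \<alpha>] fcoef_cmult(2)[OF assms(2), of \<beta>] fcoef_cmult(2)[OF assms(3), of \<gamma>] fcoef_cmult(2)[OF assms(4), of \<delta>]
  note d = fcoef_diff(2)[OF c(1) c(2)] note e = fcoef_diff(2)[OF d c(3)]
  show "fcoef (\<lambda>x y z. \<alpha> * f x y z - \<beta> * g x y z - \<gamma> * h x y z - \<delta> * e x y z) k =
      of_real \<alpha> * fcoef f k - of_real \<beta> * fcoef g k - of_real \<gamma> * fcoef h k - of_real \<delta> * fcoef e k"
    unfolding fcoef_diff(1)[OF e c(4)] fcoef_diff(1)[OF d c(3)] fcoef_diff(1)[OF c(1) c(2)]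
      fcoef_cmult(1)[OF assms(1)] fcoef_cmult(1)[OF assms(2)] fcoef_cmult(1)[OF assms(3)] fcoef_cmult(1)[OF assms(4)] ..
  show "continuous_on UNIV (unc (\<lambda>x y z. \<alpha> * f x y z - \<beta> * g x y z - \<gamma> * h x y z - \<delta> * e x y z))"
    by (rule fcoef_diff(2)[OF e c(4)])
qed

text \<open>\<open>D1\<close>, \<open>D2\<close>, \<open>D3\<close> are the time derivatives of \<open>Phi\<close> in the \<open>C\<^sup>0\<close> scale, \<open>E1\<close>, \<open>E2\<close> those in the
  \<open>H\<^sup>4\<close> scale, and \<open>P\<close> is the one in the equation; they are only known to agree in Fourier coefficients
  for almost every time.\<close>

locale spfc =
  fixes Phi D1 D2 D3 E1 E2 P :: "real \<Rightarrow> sfun" and T \<epsilon> :: real and m :: nat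
  assumes T_pos: "0 < T" and eps: "0 < \<epsilon>" "\<epsilon> < 1"
    and C0: "L2_C0 T Phi" "L2_C0 T D1" "L2_C0 T D2" "L2_C0 T D3"
    and C0w: "wderiv_C0 T Phi D1" "wderiv_C0 T D1 D2" "wderiv_C0 T D2 D3"
    and H: "L2_Hper 4 T E1" "L2_Hper 4 T E2"
    and Hw: "wderiv_Hper T Phi E1" "wderiv_Hper T E1 E2"
    and P: "wderiv_Hper T Phi P"
    and pde: "AE t in lebesgue. t \<in> {0..T} \<longrightarrow> (\<forall>k. fcoef (P t) k = - complex_of_real (kap k) * fcoef (muc \<epsilon> (Phi t)) k)"
    and linf: "Linf_Hper (m + 6) T Phi"
begin

definition c :: "real \<Rightarrow> freq \<Rightarrow> complex" where "c t k = fcoef (Phi t) k"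
definition d :: "real \<Rightarrow> freq \<Rightarrow> complex" where "d t k = fcoef (D1 t) k"
text \<open>The squared sup norm of the third time derivative is only integrable in time. Truncation
  errors are therefore bounded by integrals of \<open>Z1\<close> or \<open>Z2\<close> over windows
  of two steps, which are summed later.\<close>

definition Z2 :: "real \<Rightarrow> real" where "Z2 t = (C0_norm (D3 t))\<^sup>2"
definition Z1 :: "real \<Rightarrow> real" where "Z1 t = sqrt (Z2 t)"
text \<open>A bound on the second time derivative that is uniform in time and space: its initial
  size plus the total change that \<open>D3\<close> permits.\<close>

definition W0 :: real where "W0 = C0_norm (D2 0) + integral {0..T} Z1"
definition H2 :: "real \<Rightarrow> real" where "H2 t = Hper_sq 4 (E2 t)"

section \<open>Truncation errors in time, pointwise and in Fourier coefficients\<close>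

lemma Phi_C0: "t \<in> {0..T} \<Longrightarrow> in_C0per (Phi t)" and D1_C0: "t \<in> {0..T} \<Longrightarrow> in_C0per (D1 t)"
  using C0 by (auto simp: L2_C0_def)

lemma Phi_cont: "t \<in> {0..T} \<Longrightarrow> continuous_on UNIV (unc (Phi t))" and D1_cont: "t \<in> {0..T} \<Longrightarrow> continuous_on UNIV (unc (D1 t))"
  using Phi_C0 D1_C0 by (auto simp: in_C0per_def)

lemma Z2_ai: "Z2 absolutely_integrable_on {0..T}"
  using C0(4) unfolding Z2_def[abs_def] by (simp add: L2_C0_def integrable_lebesgue_on_iff)

lemma Z2_nonneg: "Z2 t \<ge> 0" by (simp add: Z2_def)

lemma Z1_ai: "Z1 absolutely_integrable_on {0..T}"
proof (rule absolutely_integrable_of_square[where g = Z2])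
  have i: "integrable (lebesgue_on {0..T}) Z2" using Z2_ai by (simp add: integrable_lebesgue_on_iff)
  then show "integrable (lebesgue_on {0..T}) Z2" .
  show "Z1 \<in> borel_measurable (lebesgue_on {0..T})"
    unfolding Z1_def[abs_def] using borel_measurable_integrable[OF i] by measurable
qed (simp add: Z1_def Z2_nonneg)

lemma D3_le_Z1: "t \<in> {0..T} \<Longrightarrow> norm (D3 t x y z) \<le> Z1 t"
  using C0_norm_bound(1)[of "D3 t" x y z] C0_norm_bound(2)[of "D3 t"] C0(4) by (simp add: L2_C0_def Z1_def Z2_def)

lemma Phi_deriv: "t \<in> {0..T} \<Longrightarrow> ((\<lambda>t. Phi t x y z) has_vector_derivative D1 t x y z) (at t within {0..T})"
proof (rule indefinite_integral_derivative[OF _ wderiv_C0_eq[OF C0w(1)]])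
  show "continuous_on {0..T} (\<lambda>t. D1 t x y z)"
    by (rule indefinite_integral_continuous[OF L2_C0_absolutely_integrable[OF C0(3)] wderiv_C0_eq[OF C0w(2)]])
qed

lemma D1_deriv: "t \<in> {0..T} \<Longrightarrow> ((\<lambda>t. D1 t x y z) has_vector_derivative D2 t x y z) (at t within {0..T})"
proof (rule indefinite_integral_derivative[OF _ wderiv_C0_eq[OF C0w(2)]])
  show "continuous_on {0..T} (\<lambda>t. D2 t x y z)"
    by (rule indefinite_integral_continuous[OF L2_C0_absolutely_integrable[OF C0(4)] wderiv_C0_eq[OF C0w(3)]])
qed

lemma D2_increment:
  assumes "0 \<le> a" "b \<le> T" "s \<in> {a..b}" "t \<in> {a..b}"
  shows "\<bar>D2 t x y z - D2 s x y z\<bar> \<le> integral {a..b} Z1"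
  using increment_norm_le[OF L2_C0_absolutely_integrable[OF C0(4)] wderiv_C0_eq[OF C0w(3)] Z1_ai D3_le_Z1 assms]
  by simp

lemma D2_bound: "t \<in> {0..T} \<Longrightarrow> \<bar>D2 t x y z\<bar> \<le> W0"
proof -
  assume t: "t \<in> {0..T}"
  have "\<bar>D2 t x y z - D2 0 x y z\<bar> \<le> integral {0..T} Z1" by (rule D2_increment) (use t T_pos in auto)
  moreover have "\<bar>D2 0 x y z\<bar> \<le> C0_norm (D2 0)"
    using C0(3) T_pos by (intro C0_norm_bound) (simp add: L2_C0_def)
  ultimately show ?thesis unfolding W0_def by linarith
qed

lemma W0_nonneg: "W0 \<ge> 0"
  using D2_bound[of 0 0 0 0] T_pos by simp

lemma D1_lipschitz: "s \<in> {0..T} \<Longrightarrow> t \<in> {0..T} \<Longrightarrow> \<bar>D1 s x y z - D1 t x y z\<bar> \<le> W0 * \<bar>s - t\<bar>"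
  using first_order_remainder[where y = "\<lambda>t. D1 t x y z" and v = "\<lambda>t. D2 t x y z" and l = 0 and h = T and V = 0 and I = W0,
      OF D1_deriv] D2_bound by simp

lemma Phi_taylor:
  assumes "s \<in> {0..T}" "t \<in> {0..T}"
  shows "\<bar>Phi s x y z - Phi t x y z - (s - t) * D1 t x y z\<bar> \<le> W0 * (s - t)\<^sup>2"
proof -
  let ?I = "{min s t..max s t}"
  have sub: "?I \<subseteq> {0..T}" using assms by auto
  have "norm (Phi s x y z - Phi t x y z - (s - t) *\<^sub>R D1 t x y z) \<le> (W0 * \<bar>s - t\<bar>) * \<bar>s - t\<bar>"
  proof (rule first_order_remainder[where l = "min s t" and h = "max s t"])
    fix r assume r: "r \<in> ?I"
    then have rT: "r \<in> {0..T}" using sub by blast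
    show "((\<lambda>t. Phi t x y z) has_vector_derivative D1 r x y z) (at r within ?I)"
      by (rule has_vector_derivative_within_subset[OF Phi_deriv[OF rT] sub])
    have "\<bar>D1 r x y z - D1 t x y z\<bar> \<le> W0 * \<bar>r - t\<bar>" by (rule D1_lipschitz[OF rT assms(2)])
    also have "\<dots> \<le> W0 * \<bar>s - t\<bar>" using r W0_nonneg by (intro mult_left_mono) auto
    finally show "norm (D1 r x y z - D1 t x y z) \<le> W0 * \<bar>s - t\<bar>" by simp
  qed auto
  then show ?thesis by (simp add: power2_eq_square mult.assoc)
qed

text \<open>The BDF2 quotient is exact for quadratic polynomials in time, so only the remainders
  \<open>e1\<close> and \<open>e2\<close> at the two older levels survive; 6 = 2 * 2 + 4 / 2. The
  signs are written to match \<open>fcoef_lincomb4\<close>.\<close>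

lemma Phi_bdf:
  assumes "\<tau> > 0" "0 \<le> t - 2 * \<tau>" "t \<le> T"
  shows "\<bar>3 / (2 * \<tau>) * Phi t x y z - 2 / \<tau> * Phi (t - \<tau>) x y z - (- 1 / (2 * \<tau>)) * Phi (t - 2 * \<tau>) x y z - 1 * D1 t x y z\<bar>
    \<le> 6 * \<tau> * integral {t - 2 * \<tau>..t} Z1"
proof -
  let ?J = "integral {t - 2 * \<tau>..t} Z1"
  let ?I = "{t - 2 * \<tau>..t}"
  have sub: "?I \<subseteq> {0..T}" using assms by auto
  have rem: "\<bar>Phi s x y z - Phi t x y z - (s - t) * D1 t x y z - (s - t)\<^sup>2 / 2 * D2 t x y z\<bar> \<le> (t - (t - 2 * \<tau>)) * ?J * \<bar>s - t\<bar>"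
    if s: "s \<in> ?I" for s
  proof (rule second_order_remainder[where v = "\<lambda>t. D1 t x y z" and w = "\<lambda>t. D2 t x y z"])
    fix r assume r: "r \<in> ?I"
    then have rT: "r \<in> {0..T}" using sub by blast
    show "((\<lambda>t. Phi t x y z) has_vector_derivative D1 r x y z) (at r within ?I)"
      by (rule has_vector_derivative_within_subset[OF Phi_deriv[OF rT] sub])
    show "((\<lambda>t. D1 t x y z) has_vector_derivative D2 r x y z) (at r within ?I)"
      by (rule has_vector_derivative_within_subset[OF D1_deriv[OF rT] sub])
    show "\<bar>D2 r x y z - D2 t x y z\<bar> \<le> ?J" by (rule D2_increment) (use assms r in auto)
  qed (use s assms in auto)
  define u v w u1 u2 where "u = Phi t x y z" and "v = D1 t x y z" and "w = D2 t x y z"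
    and "u1 = Phi (t - \<tau>) x y z" and "u2 = Phi (t - 2 * \<tau>) x y z"
  define e1 where "e1 = u1 - u + \<tau> * v - \<tau>\<^sup>2 / 2 * w"
  define e2 where "e2 = u2 - u + 2 * \<tau> * v - 2 * \<tau>\<^sup>2 * w"
  have "\<bar>e1\<bar> \<le> 2 * \<tau> * ?J * \<tau>"
    using rem[of "t - \<tau>"] assms by (simp add: e1_def u_def v_def w_def u1_def)
  moreover have "\<bar>e2\<bar> \<le> 2 * \<tau> * ?J * (2 * \<tau>)"
    using rem[of "t - 2 * \<tau>"] assms by (simp add: e2_def u_def v_def w_def u2_def power_mult_distrib)
  ultimately have b: "\<bar>- 2 * e1 + e2 / 2\<bar> \<le> 6 * \<tau> * ?J * \<tau>" by linarith
  have "3 / (2 * \<tau>) * u - 2 / \<tau> * u1 - (- 1 / (2 * \<tau>)) * u2 - 1 * v = (- 2 * e1 + e2 / 2) / \<tau>"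
    using assms(1) by (simp add: e1_def e2_def field_simps power2_eq_square)
  then have "\<bar>3 / (2 * \<tau>) * u - 2 / \<tau> * u1 - (- 1 / (2 * \<tau>)) * u2 - 1 * v\<bar> = \<bar>- 2 * e1 + e2 / 2\<bar> / \<tau>"
    using assms(1) by (simp only: abs_divide abs_of_pos)
  also have "\<dots> \<le> 6 * \<tau> * ?J" using b assms(1) by (simp add: divide_le_eq)
  finally show ?thesis unfolding u_def v_def u1_def u2_def .
qed

text \<open>In the first step the value at -\<tau> is an Euler extrapolation with slope
  \<open>D1 0\<close>, and the quotient is only first-order accurate. The 5/2 is 3/2 + 1, from the
  Taylor remainder and the change of \<open>D1\<close> over the step.\<close>

lemma Phi_first:
  assumes "\<tau> > 0" "\<tau> \<le> T"
  shows "\<bar>3 / (2 * \<tau>) * Phi \<tau> x y z - 3 / (2 * \<tau>) * Phi 0 x y z - 1/2 * D1 0 x y z - 1 * D1 \<tau> x y z\<bar> \<le> 5/2 * W0 * \<tau>"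
proof -
  have "\<bar>Phi \<tau> x y z - Phi 0 x y z - (\<tau> - 0) * D1 0 x y z\<bar> \<le> W0 * (\<tau> - 0)\<^sup>2"
    by (rule Phi_taylor) (use assms T_pos in auto)
  then have e: "\<bar>Phi \<tau> x y z - Phi 0 x y z - \<tau> * D1 0 x y z\<bar> / \<tau> \<le> W0 * \<tau>"
    using assms(1) by (simp add: divide_le_eq power2_eq_square mult.assoc)
  have l: "\<bar>D1 0 x y z - D1 \<tau> x y z\<bar> \<le> W0 * \<tau>"
    using D1_lipschitz[of 0 \<tau> x y z] assms T_pos by simp
  have a: "\<bar>(Phi \<tau> x y z - Phi 0 x y z - \<tau> * D1 0 x y z) / \<tau>\<bar> \<le> W0 * \<tau>"
    unfolding abs_divide using e assms(1) by simp
  have eq: "3 / (2 * \<tau>) * Phi \<tau> x y z - 3 / (2 * \<tau>) * Phi 0 x y z - 1/2 * D1 0 x y z - 1 * D1 \<tau> x y z =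
     3/2 * ((Phi \<tau> x y z - Phi 0 x y z - \<tau> * D1 0 x y z) / \<tau>) + (D1 0 x y z - D1 \<tau> x y z)"
    using assms(1) by (simp add: field_simps)
  have "\<bar>3/2 * a + b\<bar> \<le> 5/2 * W0 * \<tau>" if "\<bar>a\<bar> \<le> W0 * \<tau>" "\<bar>b\<bar> \<le> W0 * \<tau>" for a b
    using that by linarith
  from this[OF a l] show ?thesis unfolding eq .
qed

lemma Z_cs:
  assumes "\<tau> > 0" "0 \<le> t - 2 * \<tau>" "t \<le> T"
  shows "(integral {t - 2 * \<tau>..t} Z1)\<^sup>2 \<le> 2 * \<tau> * integral {t - 2 * \<tau>..t} Z2"
proof -
  have e: "(\<lambda>x. (Z1 x)\<^sup>2) = Z2" by (simp add: Z1_def Z2_nonneg fun_eq_iff)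
  have "(integral {t - 2 * \<tau>..t} Z1)\<^sup>2 \<le> (t - (t - 2 * \<tau>)) * integral {t - 2 * \<tau>..t} (\<lambda>x. (Z1 x)\<^sup>2)"
  proof (rule cauchy_schwarz_integral)
    show "Z1 integrable_on {t - 2 * \<tau>..t}"
      by (rule set_lebesgue_integral_eq_integral(1)[OF absolutely_integrable_sub[OF Z1_ai]]) (use assms in auto)
    show "(\<lambda>x. (Z1 x)\<^sup>2) integrable_on {t - 2 * \<tau>..t}" unfolding e
      by (rule set_lebesgue_integral_eq_integral(1)[OF absolutely_integrable_sub[OF Z2_ai]]) (use assms in auto)
  qed (use assms in auto)
  then show ?thesis unfolding e by simp
qed

text \<open>Bessel's inequality for the pointwise bound. Cauchy-Schwarz over the window of length 2
  \<tau> supplies the third power of \<tau>, hence fourth order once the steps are summed with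
  weight \<tau>.\<close>

lemma c_bdf:
  assumes \<tau>: "\<tau> > 0" "0 \<le> t - 2 * \<tau>" "t \<le> T" and F: "finite F"
  shows "(\<Sum>k\<in>F. (cmod ((3/2 * c t k - 2 * c (t - \<tau>) k + 1/2 * c (t - 2 * \<tau>) k) / of_real \<tau> - d t k))\<^sup>2)
    \<le> 72 * \<tau> ^ 3 * integral {t - 2 * \<tau>..t} Z2"
proof -
  have tt: "t \<in> {0..T}" "t - \<tau> \<in> {0..T}" "t - 2 * \<tau> \<in> {0..T}" using \<tau> by auto
  note lc = fcoef_lincomb4[OF Phi_cont[OF tt(1)] Phi_cont[OF tt(2)] Phi_cont[OF tt(3)] D1_cont[OF tt(1)],
      of "3 / (2 * \<tau>)" "2 / \<tau>" "- 1 / (2 * \<tau>)" 1]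
  have e: "fcoef (\<lambda>x y z. 3 / (2 * \<tau>) * Phi t x y z - 2 / \<tau> * Phi (t - \<tau>) x y z - (- 1 / (2 * \<tau>)) * Phi (t - 2 * \<tau>) x y z - 1 * D1 t x y z) k
     = (3/2 * c t k - 2 * c (t - \<tau>) k + 1/2 * c (t - 2 * \<tau>) k) / of_real \<tau> - d t k" for k
    unfolding lc(1) c_def d_def using \<tau>(1) by (simp add: field_simps)
  have "(\<Sum>k\<in>F. (cmod ((3/2 * c t k - 2 * c (t - \<tau>) k + 1/2 * c (t - 2 * \<tau>) k) / of_real \<tau> - d t k))\<^sup>2)
     \<le> (6 * \<tau> * integral {t - 2 * \<tau>..t} Z1)\<^sup>2"
    using bessel_inequality[OF lc(2) Phi_bdf[OF \<tau>] F] unfolding e .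
  also have "\<dots> = 36 * \<tau>\<^sup>2 * (integral {t - 2 * \<tau>..t} Z1)\<^sup>2" by (simp add: power_mult_distrib)
  also have "\<dots> \<le> 36 * \<tau>\<^sup>2 * (2 * \<tau> * integral {t - 2 * \<tau>..t} Z2)"
    by (intro mult_left_mono Z_cs[OF \<tau>]) simp
  also have "\<dots> = 72 * \<tau> ^ 3 * integral {t - 2 * \<tau>..t} Z2" by (simp add: power3_eq_cube power2_eq_square)
  finally show ?thesis .
qed

lemma c_first:
  assumes \<tau>: "\<tau> > 0" "\<tau> \<le> T" and F: "finite F"
  shows "(\<Sum>k\<in>F. (cmod (3/2 * (c \<tau> k - c 0 k) / of_real \<tau> - 1/2 * d 0 k - d \<tau> k))\<^sup>2) \<le> (5/2 * W0 * \<tau>)\<^sup>2"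
proof -
  have tt: "\<tau> \<in> {0..T}" "0 \<in> {0..T}" using \<tau> by auto
  note lc = fcoef_lincomb4[OF Phi_cont[OF tt(1)] Phi_cont[OF tt(2)] D1_cont[OF tt(2)] D1_cont[OF tt(1)],
      of "3 / (2 * \<tau>)" "3 / (2 * \<tau>)" "1/2" 1]
  have e: "fcoef (\<lambda>x y z. 3 / (2 * \<tau>) * Phi \<tau> x y z - 3 / (2 * \<tau>) * Phi 0 x y z - 1/2 * D1 0 x y z - 1 * D1 \<tau> x y z) k
     = 3/2 * (c \<tau> k - c 0 k) / of_real \<tau> - 1/2 * d 0 k - d \<tau> k" for k
    unfolding lc(1) c_def d_def using \<tau>(1) by (simp add: field_simps)
  show ?thesis using bessel_inequality[OF lc(2) Phi_first[OF \<tau>] F] unfolding e .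
qed

lemma c_taylor:
  assumes "s \<in> {0..T}" "t \<in> {0..T}"
  shows "cmod (c s k - c t k - of_real (s - t) * d t k) \<le> W0 * (s - t)\<^sup>2"
proof -
  note lc = fcoef_lincomb4[OF Phi_cont[OF assms(1)] Phi_cont[OF assms(2)] D1_cont[OF assms(2)] D1_cont[OF assms(2)], of 1 1 "s - t" 0]
  have "cmod (fcoef (\<lambda>x y z. 1 * Phi s x y z - 1 * Phi t x y z - (s - t) * D1 t x y z - 0 * D1 t x y z) k) \<le> W0 * (s - t)\<^sup>2"
    by (rule fcoef_norm_le[OF lc(2)]) (use Phi_taylor[OF assms] in simp)
  then show ?thesis unfolding lc(1) c_def d_def by simp
qed

text \<open>The quadratic Taylor bound is uniform in space, so it passes to each coefficient and
  yields the derivative directly.\<close>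

lemma c_deriv:
  assumes t: "t \<in> {0..T}"
  shows "((\<lambda>t. c t k) has_vector_derivative d t k) (at t within {0..T})"
  unfolding has_vector_derivative_def has_derivative_within_alt
proof (intro conjI allI impI)
  show "bounded_linear (\<lambda>x. x *\<^sub>R d t k)" by (rule bounded_linear_scaleR_left)
  fix e :: real assume e: "e > 0"
  show "\<exists>\<delta>>0. \<forall>s\<in>{0..T}. norm (s - t) < \<delta> \<longrightarrow> norm (c s k - c t k - (s - t) *\<^sub>R d t k) \<le> e * norm (s - t)"
  proof (intro exI conjI ballI impI)
    show "e / (W0 + 1) > 0" using e W0_nonneg by simp
    fix s assume s: "s \<in> {0..T}" "norm (s - t) < e / (W0 + 1)"
    have "W0 * \<bar>s - t\<bar> \<le> (W0 + 1) * \<bar>s - t\<bar>" by (simp add: distrib_right)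
    also have "\<dots> \<le> e" using s(2) W0_nonneg by (simp add: field_simps)
    finally have "W0 * \<bar>s - t\<bar> * \<bar>s - t\<bar> \<le> e * \<bar>s - t\<bar>" by (intro mult_right_mono) auto
    then show "norm (c s k - c t k - (s - t) *\<^sub>R d t k) \<le> e * norm (s - t)"
      using c_taylor[OF s(1) t, of k] by (simp add: scaleR_conv_of_real power2_eq_square abs_mult[symmetric] mult.assoc)
  qed
qed

lemma c_continuous: "continuous_on {0..T} (\<lambda>t. c t k)"
  using c_deriv has_vector_derivative_continuous continuous_on_eq_continuous_within by blast

text \<open>The modes of \<open>E1\<close> are continuous in time because they are integrals of
  those of \<open>E2\<close>, so both sides are the classical derivative of the same mode. This
  makes the H^4 bound on \<open>E2\<close> available for d.\<close>

lemma E1_eq_d: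
  assumes t: "t \<in> {0..T}"
  shows "fcoef (E1 t) k = d t k"
proof -
  have cE: "continuous_on {0..T} (\<lambda>t. fcoef (E1 t) k)"
    by (rule indefinite_integral_continuous[OF L2_Hper_absolutely_integrable(1)[OF H(2)] wderiv_Hper_eq[OF Hw(2)]])
  have "((\<lambda>t. c t k) has_vector_derivative fcoef (E1 t) k) (at t within {0..T})"
    unfolding c_def by (rule indefinite_integral_derivative[OF cE wderiv_Hper_eq[OF Hw(1)] t])
  from vector_derivative_unique_within_closed_interval[unfolded box_real, OF T_pos t this c_deriv[OF t]]
  show ?thesis .
qed

lemma d_increment:
  assumes "0 \<le> a" "b \<le> T" "s \<in> {a..b}" "t \<in> {a..b}"
  shows "cmod (d t k - d s k) \<le> integral {a..b} (\<lambda>t. cmod (fcoef (E2 t) k))"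
proof -
  have "(\<lambda>t. cmod (fcoef (E2 t) k)) absolutely_integrable_on {0..T}"
    using L2_Hper_absolutely_integrable(1)[OF H(2)] by (rule set_integrable_norm)
  from increment_norm_le[OF L2_Hper_absolutely_integrable(1)[OF H(2)] wderiv_Hper_eq[OF Hw(2)] this _ assms]
  show ?thesis using E1_eq_d[of t] E1_eq_d[of s] assms by simp
qed

lemma E2_cs:
  assumes "0 \<le> a" "a \<le> b" "b \<le> T"
  shows "(integral {a..b} (\<lambda>t. cmod (fcoef (E2 t) k)))\<^sup>2 \<le> (b - a) * integral {a..b} (\<lambda>t. (cmod (fcoef (E2 t) k))\<^sup>2)"
proof (rule cauchy_schwarz_integral[OF assms(2)])
  have "(\<lambda>t. cmod (fcoef (E2 t) k)) absolutely_integrable_on {0..T}"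
    using L2_Hper_absolutely_integrable(1)[OF H(2)] by (rule set_integrable_norm)
  then show "(\<lambda>t. cmod (fcoef (E2 t) k)) integrable_on {a..b}"
    using set_lebesgue_integral_eq_integral(1)[OF absolutely_integrable_sub] assms by blast
  show "(\<lambda>t. (cmod (fcoef (E2 t) k))\<^sup>2) integrable_on {a..b}"
    using set_lebesgue_integral_eq_integral(1)[OF absolutely_integrable_sub[OF L2_Hper_absolutely_integrable(2)[OF H(2)]]] assms by blast
qed

text \<open>A uniform H^4 bound for the time derivative, from its initial value and the time
  integral of \<open>E2\<close>. The factors 2 come from squaring a sum, T from Cauchy-Schwarz, 4^4
  from passing from \<open>hweight\<close> to \<open>wt\<close>.\<close>

definition Bd :: real where "Bd = 2 * (4 ^ 4 * Hper_sq 4 (E1 0)) + 2 * T * (4 ^ 4 * integral {0..T} H2)"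

lemma d_bound:
  assumes t: "t \<in> {0..T}" and F: "finite F"
  shows "(\<Sum>k\<in>F. wt k ^ 8 * (cmod (d t k))\<^sup>2) \<le> Bd"
proof -
  let ?I = "\<lambda>k. integral {0..T} (\<lambda>t. (cmod (fcoef (E2 t) k))\<^sup>2)"
  have sq: "(cmod (d t k))\<^sup>2 \<le> 2 * (cmod (fcoef (E1 0) k))\<^sup>2 + 2 * T * ?I k" for k
  proof -
    have "cmod (d t k - d 0 k) \<le> integral {0..T} (\<lambda>t. cmod (fcoef (E2 t) k))"
      by (rule d_increment) (use t T_pos in auto)
    then have "(cmod (d t k - d 0 k))\<^sup>2 \<le> (integral {0..T} (\<lambda>t. cmod (fcoef (E2 t) k)))\<^sup>2" by (rule power_mono) simp
    also have "\<dots> \<le> (T - 0) * ?I k" by (rule E2_cs) (use T_pos in auto)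
    finally have 1: "(cmod (d t k - d 0 k))\<^sup>2 \<le> T * ?I k" by simp
    have "cmod (d t k) \<le> cmod (d 0 k) + cmod (d t k - d 0 k)" using norm_triangle_ineq[of "d 0 k" "d t k - d 0 k"] by simp
    then have "(cmod (d t k))\<^sup>2 \<le> (cmod (d 0 k) + cmod (d t k - d 0 k))\<^sup>2" by (rule power_mono) simp
    also have "\<dots> \<le> 2 * (cmod (d 0 k))\<^sup>2 + 2 * (cmod (d t k - d 0 k))\<^sup>2"
    proof -
      have "(x + y)\<^sup>2 \<le> 2 * x\<^sup>2 + 2 * y\<^sup>2" for x y :: real using zero_le_power2[of "x - y"] by (simp add: power2_eq_square algebra_simps)
      then show ?thesis .
    qed
    finally show ?thesis using 1 E1_eq_d[of 0 k] T_pos by simp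
  qed
  have e4: "(8::nat) = 2 * 4" by simp
  have "(\<Sum>k\<in>F. wt k ^ 8 * (cmod (d t k))\<^sup>2) \<le> (\<Sum>k\<in>F. wt k ^ 8 * (2 * (cmod (fcoef (E1 0) k))\<^sup>2 + 2 * T * ?I k))"
    by (intro sum_mono mult_left_mono sq) simp
  also have "\<dots> = 2 * (\<Sum>k\<in>F. wt k ^ (2 * 4) * (cmod (fcoef (E1 0) k))\<^sup>2) + 2 * T * (\<Sum>k\<in>F. wt k ^ (2 * 4) * ?I k)"
    by (simp add: sum.distrib sum_distrib_left algebra_simps)
  also have "\<dots> \<le> Bd"
    unfolding Bd_def H2_def
  proof (intro add_mono mult_left_mono)
    have "in_Hper 4 (E1 0)" using H(1) T_pos unfolding L2_Hper_def by auto
    then show "(\<Sum>k\<in>F. wt k ^ (2 * 4) * (cmod (fcoef (E1 0) k))\<^sup>2) \<le> 4 ^ 4 * Hper_sq 4 (E1 0)" by (rule Hper_wt_sum_le[OF _ F])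
    show "(\<Sum>k\<in>F. wt k ^ (2 * 4) * ?I k) \<le> 4 ^ 4 * integral {0..T} (\<lambda>t. Hper_sq 4 (E2 t))"
      by (rule Hper_integral_sum_le[OF H(2) _ _ F]) auto
  qed (use T_pos in auto)
  finally show ?thesis .
qed

lemma Bd_nonneg: "Bd \<ge> 0"
  using d_bound[of 0 "{}"] T_pos by simp

text \<open>This is the extrapolation error of the explicit term. Both first-order remainders are
  taken at the middle level, where the slopes cancel.\<close>

lemma c_second_difference:
  assumes \<tau>: "\<tau> > 0" "0 \<le> t - 2 * \<tau>" "t \<le> T" and F: "finite F"
  shows "(\<Sum>k\<in>F. wt k ^ 8 * (cmod (c t k - 2 * c (t - \<tau>) k + c (t - 2 * \<tau>) k))\<^sup>2) \<le> 4 ^ 4 * (8 * \<tau> ^ 3 * integral {t - 2 * \<tau>..t} H2)"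
proof -
  let ?I = "{t - 2 * \<tau>..t}"
  let ?J = "\<lambda>k. integral ?I (\<lambda>t. (cmod (fcoef (E2 t) k))\<^sup>2)"
  have sub: "?I \<subseteq> {0..T}" using \<tau> by auto
  have sq: "(cmod (c t k - 2 * c (t - \<tau>) k + c (t - 2 * \<tau>) k))\<^sup>2 \<le> 8 * \<tau> ^ 3 * ?J k" for k
  proof -
    let ?M = "integral ?I (\<lambda>t. cmod (fcoef (E2 t) k))"
    have rem: "norm (c s k - c (t - \<tau>) k - (s - (t - \<tau>)) *\<^sub>R d (t - \<tau>) k) \<le> ?M * \<bar>s - (t - \<tau>)\<bar>" if s: "s \<in> ?I" for s
    proof (rule first_order_remainder[where l = "t - 2 * \<tau>" and h = t])
      fix r assume r: "r \<in> ?I"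
      then have rT: "r \<in> {0..T}" using sub by blast
      show "((\<lambda>t. c t k) has_vector_derivative d r k) (at r within ?I)"
        by (rule has_vector_derivative_within_subset[OF c_deriv[OF rT] sub])
      show "norm (d r k - d (t - \<tau>) k) \<le> ?M" by (rule d_increment) (use \<tau> r in auto)
    qed (use s \<tau> in auto)
    let ?a = "c t k - c (t - \<tau>) k - \<tau> *\<^sub>R d (t - \<tau>) k" and ?b = "c (t - 2 * \<tau>) k - c (t - \<tau>) k - (- \<tau>) *\<^sub>R d (t - \<tau>) k"
    have a: "norm ?a \<le> ?M * \<tau>" using rem[of t] \<tau> by simp
    have b: "norm ?b \<le> ?M * \<tau>" using rem[of "t - 2 * \<tau>"] \<tau> by simp
    have eq: "c t k - 2 * c (t - \<tau>) k + c (t - 2 * \<tau>) k = ?a + ?b" by simp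
    have "cmod (c t k - 2 * c (t - \<tau>) k + c (t - 2 * \<tau>) k) \<le> norm ?a + norm ?b"
      unfolding eq by (rule norm_triangle_ineq)
    also have "\<dots> \<le> ?M * \<tau> + ?M * \<tau>" using a b by (rule add_mono)
    also have "\<dots> = 2 * \<tau> * ?M" by simp
    finally have "cmod (c t k - 2 * c (t - \<tau>) k + c (t - 2 * \<tau>) k) \<le> 2 * \<tau> * ?M" .
    then have "(cmod (c t k - 2 * c (t - \<tau>) k + c (t - 2 * \<tau>) k))\<^sup>2 \<le> (2 * \<tau> * ?M)\<^sup>2" by (rule power_mono) simp
    also have "\<dots> = 4 * \<tau>\<^sup>2 * ?M\<^sup>2" by (simp add: power_mult_distrib)
    also have "\<dots> \<le> 4 * \<tau>\<^sup>2 * ((t - (t - 2 * \<tau>)) * ?J k)"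
      by (intro mult_left_mono E2_cs) (use \<tau> in auto)
    finally show ?thesis by (simp add: power3_eq_cube power2_eq_square)
  qed
  have "(\<Sum>k\<in>F. wt k ^ 8 * (cmod (c t k - 2 * c (t - \<tau>) k + c (t - 2 * \<tau>) k))\<^sup>2) \<le> (\<Sum>k\<in>F. wt k ^ 8 * (8 * \<tau> ^ 3 * ?J k))"
    by (intro sum_mono mult_left_mono sq) simp
  also have "\<dots> = 8 * \<tau> ^ 3 * (\<Sum>k\<in>F. wt k ^ (2 * 4) * ?J k)" by (simp add: sum_distrib_left mult_ac)
  also have "\<dots> \<le> 8 * \<tau> ^ 3 * (4 ^ 4 * integral ?I (\<lambda>t. Hper_sq 4 (E2 t)))"
    by (intro mult_left_mono Hper_integral_sum_le[OF H(2) _ _ F]) (use \<tau> in auto)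
  finally show ?thesis by (simp add: H2_def[abs_def] mult_ac)
qed

lemma d_continuous: "continuous_on {0..T} (\<lambda>t. d t k)"
proof -
  have "continuous_on {0..T} (\<lambda>t. fcoef (E1 t) k)"
    by (rule indefinite_integral_continuous[OF L2_Hper_absolutely_integrable(1)[OF H(2)] wderiv_Hper_eq[OF Hw(2)]])
  then show ?thesis by (rule continuous_on_eq) (rule E1_eq_d)
qed

text \<open>Serves both the stabilising term of the scheme and the Lipschitz continuity of the
  gradient in time.\<close>

lemma c_difference:
  assumes st: "0 \<le> s" "s \<le> t" "t \<le> T" and F: "finite F"
  shows "(\<Sum>k\<in>F. wt k ^ 8 * (cmod (c t k - c s k))\<^sup>2) \<le> (t - s)\<^sup>2 * Bd"
proof -
  have sub: "{s..t} \<subseteq> {0..T}" using st by auto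
  let ?J = "\<lambda>k. integral {s..t} (\<lambda>t. (cmod (d t k))\<^sup>2)"
  have cd: "continuous_on {s..t} (\<lambda>t. d t k)" for k by (rule continuous_on_subset[OF d_continuous sub])
  have i2: "(\<lambda>t. (cmod (d t k))\<^sup>2) integrable_on {s..t}" for k
    by (intro integrable_continuous_real continuous_intros cd)
  have sq: "(cmod (c t k - c s k))\<^sup>2 \<le> (t - s) * ?J k" for k
  proof -
    have i1: "(\<lambda>t. cmod (d t k)) integrable_on {s..t}" by (intro integrable_continuous_real continuous_intros cd)
    have "((\<lambda>t. d t k) has_integral (c t k - c s k)) {s..t}"
      by (rule fundamental_theorem_of_calculus[OF st(2)])
        (use sub in \<open>blast intro: has_vector_derivative_within_subset[OF c_deriv]\<close>)
    then have "c t k - c s k = integral {s..t} (\<lambda>t. d t k)" by (simp add: integral_unique)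
    then have "cmod (c t k - c s k) \<le> integral {s..t} (\<lambda>t. cmod (d t k))"
      using integral_norm_bound_integral[OF integrable_continuous_real[OF cd] i1] by simp
    then have "(cmod (c t k - c s k))\<^sup>2 \<le> (integral {s..t} (\<lambda>t. cmod (d t k)))\<^sup>2" by (rule power_mono) simp
    also have "\<dots> \<le> (t - s) * ?J k" by (rule cauchy_schwarz_integral[OF st(2) i1 i2])
    finally show ?thesis .
  qed
  have "(\<Sum>k\<in>F. wt k ^ 8 * (cmod (c t k - c s k))\<^sup>2) \<le> (\<Sum>k\<in>F. wt k ^ 8 * ((t - s) * ?J k))"
    by (intro sum_mono mult_left_mono sq) simp
  also have "\<dots> = (t - s) * (\<Sum>k\<in>F. wt k ^ 8 * ?J k)" by (simp add: sum_distrib_left mult_ac)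
  also have "(\<Sum>k\<in>F. wt k ^ 8 * ?J k) = integral {s..t} (\<lambda>t. \<Sum>k\<in>F. wt k ^ 8 * (cmod (d t k))\<^sup>2)"
    using F i2 by (subst integral_sum) (auto intro!: integrable_on_mult_right)
  also have "\<dots> \<le> integral {s..t} (\<lambda>t. Bd)"
  proof (rule integral_le)
    show "(\<lambda>t. \<Sum>k\<in>F. wt k ^ 8 * (cmod (d t k))\<^sup>2) integrable_on {s..t}"
      by (intro integrable_sum F integrable_on_mult_right i2)
  qed (use d_bound[OF _ F] sub in auto)
  also have "\<dots> = (t - s) * Bd" using st by simp
  finally show ?thesis using st by (simp add: mult_left_mono power2_eq_square mult.assoc)
qed

end

section \<open>The equation in every mode and at every time\<close>

context spfc
begin

text \<open>Of the m + 6 derivatives two are spent on the embedding into the Wiener scale. The bound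
  for almost every time is made valid at every time on finite partial sums, before the embedding is
  applied.\<close>

lemma c_wnorm_bounded: "\<exists>B\<ge>0. \<forall>t\<in>{0..T}. wsum (m + 4) (c t) \<and> wnorm (m + 4) (c t) \<le> B"
proof -
  obtain B where B: "AE t in lebesgue. t \<in> {0..T} \<longrightarrow> in_Hper (m + 6) (Phi t) \<and> Hper_sq (m + 6) (Phi t) \<le> B"
    using linf unfolding Linf_Hper_def by blast
  let ?B = "4 ^ (m + 6) * B"
  have "(\<Sum>k\<in>F. wt k ^ (2 * (m + 4) + 4) * (cmod (c t k))\<^sup>2) \<le> ?B" if t: "t \<in> {0..T}" and F: "finite F" for t F
  proof (rule continuous_le_of_AE_le[OF _ _ T_pos t])
    show "continuous_on {0..T} (\<lambda>t. \<Sum>k\<in>F. wt k ^ (2 * (m + 4) + 4) * (cmod (c t k))\<^sup>2)"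
      by (intro continuous_intros c_continuous)
    show "AE t in lebesgue. t \<in> {0..T} \<longrightarrow> (\<Sum>k\<in>F. wt k ^ (2 * (m + 4) + 4) * (cmod (c t k))\<^sup>2) \<le> ?B"
      using B
    proof (rule AE_mp, intro AE_I2 impI)
      fix t assume "t \<in> {0..T} \<longrightarrow> in_Hper (m + 6) (Phi t) \<and> Hper_sq (m + 6) (Phi t) \<le> B" "t \<in> {0..T}"
      then have h: "in_Hper (m + 6) (Phi t)" "Hper_sq (m + 6) (Phi t) \<le> B" by blast+
      have e: "2 * (m + 4) + 4 = 2 * (m + 6)" by simp
      have "(\<Sum>k\<in>F. wt k ^ (2 * (m + 6)) * (cmod (fcoef (Phi t) k))\<^sup>2) \<le> 4 ^ (m + 6) * Hper_sq (m + 6) (Phi t)"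
        by (rule Hper_wt_sum_le[OF h(1) F])
      also have "\<dots> \<le> ?B" using h(2) by (intro mult_left_mono) auto
      finally show "(\<Sum>k\<in>F. wt k ^ (2 * (m + 4) + 4) * (cmod (c t k))\<^sup>2) \<le> ?B" unfolding e c_def .
    qed
  qed
  from wsum_of_square_sum[OF this] have w: "wsum (m + 4) (c t)" "wnorm (m + 4) (c t) \<le> sqrt (wt4sum * ?B)" if "t \<in> {0..T}" for t
    using that by blast+
  show ?thesis
  proof (intro exI conjI ballI)
    have "0 \<le> wnorm (m + 4) (c 0)" by (rule wnorm_nonneg)
    also have "\<dots> \<le> sqrt (wt4sum * ?B)" by (rule w(2)) (use T_pos in auto)
    finally show "0 \<le> sqrt (wt4sum * ?B)" .
  qed (use w in auto)
qed

text \<open>One witness of \<open>c_wnorm_bounded\<close>, fixed so that later constants can refer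
  to it without quantifying over time again.\<close>

definition Bc :: real where "Bc = (SOME B. B \<ge> 0 \<and> (\<forall>t\<in>{0..T}. wsum (m + 4) (c t) \<and> wnorm (m + 4) (c t) \<le> B))"

lemma Bc: "Bc \<ge> 0" "t \<in> {0..T} \<Longrightarrow> wsum (m + 4) (c t)" "t \<in> {0..T} \<Longrightarrow> wnorm (m + 4) (c t) \<le> Bc"
proof -
  have "Bc \<ge> 0 \<and> (\<forall>t\<in>{0..T}. wsum (m + 4) (c t) \<and> wnorm (m + 4) (c t) \<le> Bc)"
    unfolding Bc_def by (rule someI_ex) (use c_wnorm_bounded in blast)
  then show "Bc \<ge> 0" "t \<in> {0..T} \<Longrightarrow> wsum (m + 4) (c t)" "t \<in> {0..T} \<Longrightarrow> wnorm (m + 4) (c t) \<le> Bc" by blast+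
qed

lemma c_wien: "t \<in> {0..T} \<Longrightarrow> wien (m + 4) (c t) (Phi t)"
  using fourier_inversion[OF Phi_C0, of t "m + 4"] Bc(2)[of t] unfolding c_def[abs_def] by blast

lemma c_wnorm_le: "t \<in> {0..T} \<Longrightarrow> s \<le> m + 4 \<Longrightarrow> wsum s (c t)" "t \<in> {0..T} \<Longrightarrow> s \<le> m + 4 \<Longrightarrow> wnorm s (c t) \<le> Bc"
  using wsum_mono[OF Bc(2)] Bc(3) by (blast intro: order_trans)+

lemma c_minus: "t \<in> {0..T} \<Longrightarrow> c t (- k) = cnj (c t k)"
  unfolding c_def by (rule fcoef_minus[OF Phi_cont])

lemma fcoef_muc: "t \<in> {0..T} \<Longrightarrow> fcoef (muc \<epsilon> (Phi t)) k = muco \<epsilon> (c t) k"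
  by (rule wien_fcoef[OF wien_muc[OF wien_mono[OF c_wien]]]) auto

lemma c_wnorm1_lipschitz:
  assumes "s \<in> {0..T}" "t \<in> {0..T}"
  shows "wsum 1 (\<lambda>k. c t k - c s k)" "wnorm 1 (\<lambda>k. c t k - c s k) \<le> sqrt (wt4sum * Bd) * \<bar>t - s\<bar>"
proof -
  have main: "(\<Sum>k\<in>F. wt k ^ 8 * (cmod (c t k - c s k))\<^sup>2) \<le> (t - s)\<^sup>2 * Bd" if F: "finite F" for F
  proof (cases "s \<le> t")
    case True
    then show ?thesis using c_difference[of s t F] assms F by simp
  next
    case False
    then show ?thesis using c_difference[of t s F] assms F by (simp add: norm_minus_commute power2_commute)
  qed
  have sq: "(\<Sum>k\<in>F. wt k ^ (2 * 1 + 4) * (cmod (c t k - c s k))\<^sup>2) \<le> (t - s)\<^sup>2 * Bd" if F: "finite F" for F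
  proof -
    have "(\<Sum>k\<in>F. wt k ^ (2 * 1 + 4) * (cmod (c t k - c s k))\<^sup>2) \<le> (\<Sum>k\<in>F. wt k ^ 8 * (cmod (c t k - c s k))\<^sup>2)"
      by (intro sum_mono mult_right_mono wt_pow_mono) auto
    then show ?thesis using main[OF F] by linarith
  qed
  from wsum_of_square_sum[OF sq] show "wsum 1 (\<lambda>k. c t k - c s k)" by blast
  have "wnorm 1 (\<lambda>k. c t k - c s k) \<le> sqrt (wt4sum * ((t - s)\<^sup>2 * Bd))" by (rule wsum_of_square_sum(2)[OF sq])
  also have "\<dots> = sqrt (wt4sum * Bd) * \<bar>t - s\<bar>" by (simp add: real_sqrt_mult mult_ac)
  finally show "wnorm 1 (\<lambda>k. c t k - c s k) \<le> sqrt (wt4sum * Bd) * \<bar>t - s\<bar>" .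
qed

lemma grad_lipschitz:
  assumes s: "s \<in> {0..T}" and t: "t \<in> {0..T}"
  defines "\<eta> \<equiv> 2 * pi * (sqrt (wt4sum * Bd) * \<bar>t - s\<bar>)"
  shows "\<bar>dxc (Phi t) x y z - dxc (Phi s) x y z\<bar> \<le> \<eta>" "\<bar>dyc (Phi t) x y z - dyc (Phi s) x y z\<bar> \<le> \<eta>"
    "\<bar>dzc (Phi t) x y z - dzc (Phi s) x y z\<bar> \<le> \<eta>"
proof -
  have w: "wien (Suc 0) (c r) (Phi r)" if "r \<in> {0..T}" for r
    using wien_mono[OF c_wien[OF that]] by simp
  let ?a = "\<lambda>k. c t k - c s k"
  have wa: "wsum (Suc 0) ?a" "wnorm (Suc 0) ?a \<le> sqrt (wt4sum * Bd) * \<bar>t - s\<bar>"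
    using c_wnorm1_lipschitz[OF s t] by simp_all
  have gen: "\<bar>f x y z - g x y z\<bar> \<le> \<eta>"
    if "wien 0 a f" "wien 0 b g" and ab: "\<And>k. a k - b k = G k" and G: "wnorm 0 G \<le> 2 * pi * wnorm (Suc 0) ?a" for a b f g G
  proof -
    have W: "wien 0 (\<lambda>k. a k + complex_of_real (- 1) * b k) (\<lambda>x y z. f x y z + (- 1) * g x y z)"
      by (intro wien_add wien_cmult that)
    have E: "(\<lambda>k. a k + complex_of_real (- 1) * b k) = G" unfolding ab[symmetric, abs_def] by simp
    have "\<bar>f x y z + (- 1) * g x y z\<bar> \<le> wnorm 0 G" using wien_bound[OF W, of x y z] unfolding E .
    also have "\<dots> \<le> \<eta>" unfolding \<eta>_def by (rule order_trans[OF G mult_left_mono[OF wa(2)]]) simp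
    finally show ?thesis by simp
  qed
  show "\<bar>dxc (Phi t) x y z - dxc (Phi s) x y z\<bar> \<le> \<eta>"
    by (rule gen[OF wien_g(1)[OF w[OF t]] wien_g(1)[OF w[OF s]] _ wsum_g(4)[OF wa(1)]]) (simp add: gx_def algebra_simps)
  show "\<bar>dyc (Phi t) x y z - dyc (Phi s) x y z\<bar> \<le> \<eta>"
    by (rule gen[OF wien_g(2)[OF w[OF t]] wien_g(2)[OF w[OF s]] _ wsum_g(5)[OF wa(1)]]) (simp add: gy_def algebra_simps)
  show "\<bar>dzc (Phi t) x y z - dzc (Phi s) x y z\<bar> \<le> \<eta>"
    by (rule gen[OF wien_g(3)[OF w[OF t]] wien_g(3)[OF w[OF s]] _ wsum_g(6)[OF wa(1)]]) (simp add: gz_def algebra_simps)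
qed

lemma grad_bound:
  assumes t: "t \<in> {0..T}"
  shows "\<bar>dxc (Phi t) x y z\<bar> \<le> 2 * pi * Bc" "\<bar>dyc (Phi t) x y z\<bar> \<le> 2 * pi * Bc" "\<bar>dzc (Phi t) x y z\<bar> \<le> 2 * pi * Bc"
proof -
  have w: "wien (Suc 0) (c t) (Phi t)" using wien_mono[OF c_wien[OF t]] by simp
  have b: "wnorm (Suc 0) (c t) \<le> Bc" by (rule c_wnorm_le(2)[OF t]) simp
  have ws: "wsum (Suc 0) (c t)" using w by (simp add: wien_def)
  have "2 * pi * wnorm (Suc 0) (c t) \<le> 2 * pi * Bc" using b by simp
  then show "\<bar>dxc (Phi t) x y z\<bar> \<le> 2 * pi * Bc" "\<bar>dyc (Phi t) x y z\<bar> \<le> 2 * pi * Bc" "\<bar>dzc (Phi t) x y z\<bar> \<le> 2 * pi * Bc"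
    using wien_bound[OF wien_g(1)[OF w], of x y z] wien_bound[OF wien_g(2)[OF w], of x y z] wien_bound[OF wien_g(3)[OF w], of x y z]
      wsum_g(4-6)[OF ws] by linarith+
qed

text \<open>The gradient is Lipschitz in time uniformly in space, hence so is the cubic flux.
  Continuity of the right-hand side of the equation is what allows \<open>d_eq\<close> to hold at
  every time.\<close>

lemma flux_continuous:
  shows "continuous_on {0..T} (\<lambda>t. fx (c t) k)" "continuous_on {0..T} (\<lambda>t. fy (c t) k)" "continuous_on {0..T} (\<lambda>t. fz (c t) k)"
proof -
  define G where "G = 2 * pi * Bc"
  define \<eta> where "\<eta> s t = 2 * pi * (sqrt (wt4sum * Bd) * \<bar>t - s\<bar>)" for s t :: real
  define L where "L = 9 * G\<^sup>2 * (2 * pi * sqrt (wt4sum * Bd))"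
  have L0: "L \<ge> 0" using wt4sum_nonneg Bd_nonneg by (simp add: L_def)
  have w: "wien (Suc 0) (c r) (Phi r)" if "r \<in> {0..T}" for r
    using wien_mono[OF c_wien[OF that]] by simp
  have cont: "continuous_on {0..T} (\<lambda>t. f t k)"
    if "\<And>s t. s \<in> {0..T} \<Longrightarrow> t \<in> {0..T} \<Longrightarrow> cmod (f t k - f s k) \<le> L * \<bar>t - s\<bar>" for f :: "real \<Rightarrow> freq \<Rightarrow> complex"
  proof (rule lipschitz_on_continuous_on)
    show "L-lipschitz_on {0..T} (\<lambda>t. f t k)"
      by (rule lipschitz_onI) (use that L0 in \<open>auto simp: dist_norm\<close>)
  qed
  have lip: "cmod (a t k - a s k) \<le> L * \<bar>t - s\<bar>"
    if s: "s \<in> {0..T}" and t: "t \<in> {0..T}"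
      and a: "\<And>r. r \<in> {0..T} \<Longrightarrow> wien 0 (a r) (\<lambda>x y z. ((dxc (Phi r) x y z)\<^sup>2 + (dyc (Phi r) x y z)\<^sup>2 + (dzc (Phi r) x y z)\<^sup>2) * D r x y z)"
      and D: "\<And>r x y z. r \<in> {0..T} \<Longrightarrow> \<bar>D r x y z\<bar> \<le> G" "\<And>x y z. \<bar>D t x y z - D s x y z\<bar> \<le> \<eta> s t" for a :: "real \<Rightarrow> freq \<Rightarrow> complex" and D s t
  proof -
    have "cmod (fcoef (\<lambda>x y z. ((dxc (Phi t) x y z)\<^sup>2 + (dyc (Phi t) x y z)\<^sup>2 + (dzc (Phi t) x y z)\<^sup>2) * D t x y z
        - ((dxc (Phi s) x y z)\<^sup>2 + (dyc (Phi s) x y z)\<^sup>2 + (dzc (Phi s) x y z)\<^sup>2) * D s x y z) k) \<le> 9 * G\<^sup>2 * \<eta> s t"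
    proof (rule fcoef_norm_le[OF fcoef_diff(2)[OF wien_continuous[OF a[OF t]] wien_continuous[OF a[OF s]]]])
      fix x y z
      show "\<bar>((dxc (Phi t) x y z)\<^sup>2 + (dyc (Phi t) x y z)\<^sup>2 + (dzc (Phi t) x y z)\<^sup>2) * D t x y z
        - ((dxc (Phi s) x y z)\<^sup>2 + (dyc (Phi s) x y z)\<^sup>2 + (dzc (Phi s) x y z)\<^sup>2) * D s x y z\<bar> \<le> 9 * G\<^sup>2 * \<eta> s t"
        by (rule cubic_lipschitz)
          (use grad_bound[OF t, of x y z] grad_bound[OF s, of x y z] grad_lipschitz[OF s t, of x y z] D(1)[OF t, of x y z] D(2)[of x y z]
            in \<open>simp_all only: G_def \<eta>_def\<close>)
    qed
    then have "cmod (a t k - a s k) \<le> 9 * G\<^sup>2 * \<eta> s t"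
      unfolding fcoef_diff(1)[OF wien_continuous[OF a[OF t]] wien_continuous[OF a[OF s]]]
        wien_fcoef[OF a[OF t]] wien_fcoef[OF a[OF s]] .
    also have "\<dots> = L * \<bar>t - s\<bar>" by (simp add: L_def \<eta>_def mult_ac)
    finally show ?thesis .
  qed
  show "continuous_on {0..T} (\<lambda>t. fx (c t) k)"
  proof (rule cont)
    fix s t assume st: "s \<in> {0..T}" "t \<in> {0..T}"
    show "cmod (fx (c t) k - fx (c s) k) \<le> L * \<bar>t - s\<bar>"
      by (rule lip[where a = "\<lambda>r. fx (c r)" and D = "\<lambda>r. dxc (Phi r)", OF st wien_f(1)[OF w]
        grad_bound(1)[folded G_def] grad_lipschitz(1)[OF st, folded \<eta>_def]])
  qed
  show "continuous_on {0..T} (\<lambda>t. fy (c t) k)"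
  proof (rule cont)
    fix s t assume st: "s \<in> {0..T}" "t \<in> {0..T}"
    show "cmod (fy (c t) k - fy (c s) k) \<le> L * \<bar>t - s\<bar>"
      by (rule lip[where a = "\<lambda>r. fy (c r)" and D = "\<lambda>r. dyc (Phi r)", OF st wien_f(2)[OF w]
        grad_bound(2)[folded G_def] grad_lipschitz(2)[OF st, folded \<eta>_def]])
  qed
  show "continuous_on {0..T} (\<lambda>t. fz (c t) k)"
  proof (rule cont)
    fix s t assume st: "s \<in> {0..T}" "t \<in> {0..T}"
    show "cmod (fz (c t) k - fz (c s) k) \<le> L * \<bar>t - s\<bar>"
      by (rule lip[where a = "\<lambda>r. fz (c r)" and D = "\<lambda>r. dzc (Phi r)", OF st wien_f(3)[OF w]
        grad_bound(3)[folded G_def] grad_lipschitz(3)[OF st, folded \<eta>_def]])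
  qed
qed

text \<open>P and the right-hand side agree for almost every time, so they have the same indefinite
  integral; the continuous one is then the classical derivative of the mode. The case t = 0 starts
  the elliptic bootstrap.\<close>

lemma d_eq:
  assumes t: "t \<in> {0..T}"
  shows "d t k = - complex_of_real (kap k) * muco \<epsilon> (c t) k"
proof -
  let ?r = "\<lambda>t. - complex_of_real (kap k) * muco \<epsilon> (c t) k"
  have cont: "continuous_on {0..T} ?r"
    unfolding muco_def nlco_def gx_def gy_def gz_def by (intro continuous_intros c_continuous flux_continuous)
  have eq: "c t k = c 0 k + set_lebesgue_integral lebesgue {0..t} ?r" if t: "t \<in> {0..T}" for t
  proof -
    have tt: "s \<in> {0..T}" if "s \<in> {0..t}" for s using that t by auto
    have eq': "AE s in lebesgue. s \<in> {0..t} \<longrightarrow> fcoef (P s) k = ?r s"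
      using pde
    proof (rule AE_mp, intro AE_I2 impI)
      fix s assume a: "s \<in> {0..T} \<longrightarrow> (\<forall>k. fcoef (P s) k = - complex_of_real (kap k) * fcoef (muc \<epsilon> (Phi s)) k)" and s: "s \<in> {0..t}"
      from a tt[OF s] have "fcoef (P s) k = - complex_of_real (kap k) * fcoef (muc \<epsilon> (Phi s)) k" by blast
      then show "fcoef (P s) k = ?r s" unfolding fcoef_muc[OF tt[OF s]] .
    qed
    have i1: "?r absolutely_integrable_on {0..t}"
      by (rule absolutely_integrable_sub[OF absolutely_integrable_continuous_real[OF cont]]) (use t in auto)
    have "set_lebesgue_integral lebesgue {0..t} (\<lambda>s. fcoef (P s) k) = set_lebesgue_integral lebesgue {0..t} ?r"
    proof -
      have N: "\<exists>N. negligible N \<and> {s. \<not> (s \<in> {0..t} \<longrightarrow> fcoef (P s) k = ?r s)} \<subseteq> N"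
        using eq' unfolding eventually_ae_filter_negligible .
      then obtain N where N: "negligible N" "{s. \<not> (s \<in> {0..t} \<longrightarrow> fcoef (P s) k = ?r s)} \<subseteq> N" by blast
      have sp: "?r s = fcoef (P s) k" if "s \<in> {0..t} - N" for s
      proof -
        have "s \<in> {0..t} \<longrightarrow> fcoef (P s) k = ?r s" using N(2) that by blast
        then show ?thesis using that by simp
      qed
      have i2: "(\<lambda>s. fcoef (P s) k) absolutely_integrable_on {0..t}"
        by (rule absolutely_integrable_spike[OF i1 N(1)]) (use sp in simp)
      have "integral {0..t} ?r = integral {0..t} (\<lambda>s. fcoef (P s) k)"
        by (rule integral_spike[OF N(1)]) (use sp in simp)
      then show ?thesis
        using set_lebesgue_integral_eq_integral(2)[OF i1] set_lebesgue_integral_eq_integral(2)[OF i2] by simp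
    qed
    then show ?thesis using wderiv_Hper_eq[OF P t, of k] unfolding c_def[of t] c_def[of 0] by (simp only:)
  qed
  have "((\<lambda>t. c t k) has_vector_derivative ?r t) (at t within {0..T})"
    by (rule indefinite_integral_derivative[OF cont eq t])
  from vector_derivative_unique_within_closed_interval[unfolded box_real, OF T_pos t c_deriv[OF t] this]
  show ?thesis .
qed

end

section \<open>Elliptic regularity of the initial value\<close>

lemma sum_square_le_square_sum:
  fixes f :: "'a \<Rightarrow> real"
  assumes "\<And>k. k \<in> F \<Longrightarrow> f k \<ge> 0"
  shows "(\<Sum>k\<in>F. (f k)\<^sup>2) \<le> (\<Sum>k\<in>F. f k)\<^sup>2"
proof -
  have "(L2_set f F)\<^sup>2 \<le> (\<Sum>k\<in>F. f k)\<^sup>2"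
    by (intro power_mono L2_set_le_sum L2_set_nonneg assms)
  then show ?thesis by (simp add: L2_set_def sum_nonneg)
qed

context spfc
begin

text \<open>At t = 0 the equation is solved for its leading term \<open>kap k ^ 3 * c 0 k\<close>.
  From \<open>kap k\<close> \<le> 64 \<open>wt k ^ 2\<close> and 2 pi < 8 come 512 = 64 * 8 and 8256
  = 2 * 64^2 + 64.\<close>

lemma elliptic_mode:
  "wt k ^ 6 * cmod (c 0 k) \<le> cmod (d 0 k) + 512 * (wt k ^ 3 * (cmod (fx (c 0) k) + cmod (fy (c 0) k) + cmod (fz (c 0) k)))
     + 8256 * (wt k ^ 4 * cmod (c 0 k))"
proof (cases "k = 0")
  case True
  have "wt k = 1" using True by (simp add: wt_def)
  then show ?thesis by simp
next
  case False
  let ?f = "cmod (fx (c 0) k) + cmod (fy (c 0) k) + cmod (fz (c 0) k)"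
  let ?K = "complex_of_real (kap k)"
  have d0: "d 0 k = - ?K * muco \<epsilon> (c 0) k" using d_eq[of 0 k] T_pos by simp
  have eq: "?K ^ 3 * c 0 k = - d 0 k + ?K * nlco (c 0) k + (complex_of_real (2 * (kap k)\<^sup>2 - (1 - \<epsilon>) * kap k)) * c 0 k"
    unfolding d0 muco_def by (simp add: power3_eq_cube power2_eq_square algebra_simps)
  have w: "wt k ^ 2 \<le> wt k ^ 4" by (rule wt_pow_mono) simp
  have k1: "kap k \<le> 64 * wt k ^ 2" by (rule kap_le_wt)
  then have k1': "kap k \<le> 64 * wt k ^ 4" using w by linarith
  have "(kap k)\<^sup>2 \<le> (64 * wt k ^ 2)\<^sup>2" using k1 by (intro power_mono) auto
  then have k2: "(kap k)\<^sup>2 \<le> 4096 * wt k ^ 4" by (simp add: power_mult_distrib power_mult[symmetric])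
  have a1: "\<bar>2 * (kap k)\<^sup>2 - (1 - \<epsilon>) * kap k\<bar> \<le> 8256 * wt k ^ 4"
  proof -
    have "0 \<le> (1 - \<epsilon>) * kap k" using eps by simp
    moreover have "(1 - \<epsilon>) * kap k \<le> 1 * kap k" by (rule mult_right_mono) (use eps in auto)
    ultimately show ?thesis using k1' k2 zero_le_power2[of "kap k"] by linarith
  qed
  have n: "cmod (nlco (c 0) k) \<le> 8 * wt k * ?f"
  proof -
    have p: "2 * pi * wt k * x \<le> 8 * wt k * x" if "x \<ge> 0" for x
      using pi_less_4 that by (intro mult_right_mono) auto
    have "cmod (nlco (c 0) k) \<le> cmod (gx (fx (c 0)) k) + cmod (gy (fy (c 0)) k) + cmod (gz (fz (c 0)) k)"
      unfolding nlco_def using norm_triangle_ineq[of "gx (fx (c 0)) k + gy (fy (c 0)) k" "gz (fz (c 0)) k"]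
        norm_triangle_ineq[of "gx (fx (c 0)) k" "gy (fy (c 0)) k"] by linarith
    also have "\<dots> \<le> 8 * wt k * cmod (fx (c 0) k) + 8 * wt k * cmod (fy (c 0) k) + 8 * wt k * cmod (fz (c 0) k)"
      by (intro add_mono order_trans[OF norm_g_le(1) p] order_trans[OF norm_g_le(2) p] order_trans[OF norm_g_le(3) p]) auto
    finally show ?thesis by (simp add: distrib_left)
  qed
  have "wt k ^ 6 \<le> kap k ^ 3"
    using power_mono[OF wt_sq_le_kap[OF False], of 3] by (simp add: power_mult[symmetric])
  then have "wt k ^ 6 * cmod (c 0 k) \<le> cmod (?K ^ 3 * c 0 k)"
    by (simp add: norm_mult norm_power mult_right_mono)
  also have "\<dots> \<le> cmod (d 0 k) + kap k * cmod (nlco (c 0) k) + \<bar>2 * (kap k)\<^sup>2 - (1 - \<epsilon>) * kap k\<bar> * cmod (c 0 k)"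
    unfolding eq using norm_triangle_ineq[of "- d 0 k + ?K * nlco (c 0) k" "(complex_of_real (2 * (kap k)\<^sup>2 - (1 - \<epsilon>) * kap k)) * c 0 k"]
      norm_triangle_ineq[of "- d 0 k" "?K * nlco (c 0) k"] by (simp only: norm_mult norm_minus_cancel norm_of_real abs_of_nonneg[OF kap_nonneg])
  also have "\<dots> \<le> cmod (d 0 k) + (64 * wt k ^ 2) * (8 * wt k * ?f) + (8256 * wt k ^ 4) * cmod (c 0 k)"
    by (intro add_mono order_refl mult_mono k1 n mult_right_mono a1) auto
  finally show ?thesis by (simp add: power3_eq_cube power2_eq_square mult_ac)
qed

lemma d0_wsum: "wsum 2 (d 0)"
proof -
  have "(\<Sum>k\<in>F. wt k ^ (2 * 2 + 4) * (cmod (d 0 k))\<^sup>2) \<le> Bd" if "finite F" for F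
    using d_bound[OF _ that, of 0] T_pos by simp
  from wsum_of_square_sum(1)[OF this] show ?thesis .
qed

text \<open>Weight r + 6 on the left requires weight r + 3 on the flux, hence r + 4 on c, so each
  round gains two derivatives. The restriction r \<le> 2 is the regularity of \<open>d 0\<close> in
  the Wiener scale.\<close>

lemma elliptic_step:
  assumes w: "wsum (r + 4) (c 0)" and r: "r \<le> 2"
  shows "wsum (r + 6) (c 0)"
proof -
  have e: "r + 4 = Suc (r + 3)" by simp
  note f = wsum_f[OF w[unfolded e]]
  let ?B = "wnorm r (d 0) + 512 * (wnorm (r + 3) (fx (c 0)) + wnorm (r + 3) (fy (c 0)) + wnorm (r + 3) (fz (c 0))) + 8256 * wnorm (r + 4) (c 0)"
  have "(\<Sum>k\<in>F. wt k ^ (r + 6) * cmod (c 0 k)) \<le> ?B" if F: "finite F" for F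
  proof -
    have "(\<Sum>k\<in>F. wt k ^ (r + 6) * cmod (c 0 k)) \<le>
      (\<Sum>k\<in>F. wt k ^ r * cmod (d 0 k) + 512 * (wt k ^ (r + 3) * cmod (fx (c 0) k) + wt k ^ (r + 3) * cmod (fy (c 0) k) + wt k ^ (r + 3) * cmod (fz (c 0) k))
        + 8256 * (wt k ^ (r + 4) * cmod (c 0 k)))"
      (is "_ \<le> sum ?g F")
    proof (rule sum_mono)
      fix k
      have "wt k ^ (r + 6) * cmod (c 0 k) = wt k ^ r * (wt k ^ 6 * cmod (c 0 k))" by (simp add: power_add mult_ac)
      also have "\<dots> \<le> wt k ^ r * (cmod (d 0 k) + 512 * (wt k ^ 3 * (cmod (fx (c 0) k) + cmod (fy (c 0) k) + cmod (fz (c 0) k)))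
          + 8256 * (wt k ^ 4 * cmod (c 0 k)))" by (intro mult_left_mono elliptic_mode) simp
      also have "\<dots> = ?g k" by (simp add: power_add distrib_left mult_ac)
      finally show "wt k ^ (r + 6) * cmod (c 0 k) \<le> ?g k" .
    qed
    also have "\<dots> = (\<Sum>k\<in>F. wt k ^ r * cmod (d 0 k)) + 512 * ((\<Sum>k\<in>F. wt k ^ (r + 3) * cmod (fx (c 0) k)) + (\<Sum>k\<in>F. wt k ^ (r + 3) * cmod (fy (c 0) k)) + (\<Sum>k\<in>F. wt k ^ (r + 3) * cmod (fz (c 0) k)))
       + 8256 * (\<Sum>k\<in>F. wt k ^ (r + 4) * cmod (c 0 k))"
      by (simp add: sum.distrib sum_distrib_left)
    also have "\<dots> \<le> ?B"
      by (intro add_mono mult_left_mono wnorm_finite_sum_le F f w wsum_mono(1)[OF d0_wsum r]) auto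
    finally show ?thesis .
  qed
  from wsumI(1)[OF this] show ?thesis .
qed

lemma c0_wsum8: "wsum 8 (c 0)"
proof -
  have "wsum (0 + 4) (c 0)" using c_wnorm_le(1)[of 0 4] T_pos by simp
  from elliptic_step[OF this] have "wsum (2 + 4) (c 0)" by simp
  from elliptic_step[OF this] show ?thesis by simp
qed

text \<open>The last round is done in l2: \<open>d 0\<close> is worth only two derivatives in the
  Wiener scale but four in the Sobolev scale, and 4 + 6 = 10.\<close>

lemma c0_H10: "\<exists>B. \<forall>F. finite F \<longrightarrow> (\<Sum>k\<in>F. wt k ^ (2 * 10) * (cmod (c 0 k))\<^sup>2) \<le> B"
proof -
  have "wsum (Suc 7) (c 0)" using c0_wsum8 by simp
  note f = wsum_f[OF this]
  let ?N = "wnorm 7 (fx (c 0)) + wnorm 7 (fy (c 0)) + wnorm 7 (fz (c 0))"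
  let ?u = "\<lambda>k. wt k ^ 7 * (cmod (fx (c 0) k) + cmod (fy (c 0) k) + cmod (fz (c 0) k))"
  let ?v = "\<lambda>k. wt k ^ 8 * cmod (c 0 k)"
  have "(\<Sum>k\<in>F. wt k ^ (2 * 10) * (cmod (c 0 k))\<^sup>2) \<le> 3 * Bd + 3 * 512\<^sup>2 * ?N\<^sup>2 + 3 * 8256\<^sup>2 * (wnorm 8 (c 0))\<^sup>2"
    if F: "finite F" for F
  proof -
    have "(\<Sum>k\<in>F. wt k ^ (2 * 10) * (cmod (c 0 k))\<^sup>2) \<le> (\<Sum>k\<in>F. 3 * (wt k ^ 8 * (cmod (d 0 k))\<^sup>2) + 3 * 512\<^sup>2 * (?u k)\<^sup>2 + 3 * 8256\<^sup>2 * (?v k)\<^sup>2)"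
    proof (rule sum_mono)
      fix k
      have sq3: "(x + y + z)\<^sup>2 \<le> 3 * x\<^sup>2 + 3 * y\<^sup>2 + 3 * z\<^sup>2" for x y z :: real
      proof -
        have "0 \<le> (x - y)\<^sup>2 + (y - z)\<^sup>2 + (x - z)\<^sup>2" by simp
        then show ?thesis by (simp add: power2_eq_square algebra_simps)
      qed
      have "wt k ^ 10 * cmod (c 0 k) = wt k ^ 4 * (wt k ^ 6 * cmod (c 0 k))" by (simp add: mult.assoc[symmetric] power_add[symmetric])
      also have "\<dots> \<le> wt k ^ 4 * (cmod (d 0 k) + 512 * (wt k ^ 3 * (cmod (fx (c 0) k) + cmod (fy (c 0) k) + cmod (fz (c 0) k)))
          + 8256 * (wt k ^ 4 * cmod (c 0 k)))" by (intro mult_left_mono elliptic_mode) simp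
      also have "\<dots> = wt k ^ 4 * cmod (d 0 k) + 512 * ((wt k ^ 4 * wt k ^ 3) * (cmod (fx (c 0) k) + cmod (fy (c 0) k) + cmod (fz (c 0) k))) + 8256 * ((wt k ^ 4 * wt k ^ 4) * cmod (c 0 k))"
        by (simp only: distrib_left mult_ac)
      also have "\<dots> = wt k ^ 4 * cmod (d 0 k) + 512 * ?u k + 8256 * ?v k"
        by (simp only: power_add[symmetric]) simp
      finally have "(wt k ^ 10 * cmod (c 0 k))\<^sup>2 \<le> (wt k ^ 4 * cmod (d 0 k) + 512 * ?u k + 8256 * ?v k)\<^sup>2"
        by (intro power_mono) auto
      also have "\<dots> \<le> 3 * (wt k ^ 4 * cmod (d 0 k))\<^sup>2 + 3 * (512 * ?u k)\<^sup>2 + 3 * (8256 * ?v k)\<^sup>2" by (rule sq3)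
      finally show "wt k ^ (2 * 10) * (cmod (c 0 k))\<^sup>2 \<le> 3 * (wt k ^ 8 * (cmod (d 0 k))\<^sup>2) + 3 * 512\<^sup>2 * (?u k)\<^sup>2 + 3 * 8256\<^sup>2 * (?v k)\<^sup>2"
        by (simp add: power_mult_distrib power_mult[symmetric] mult.assoc)
    qed
    also have "\<dots> = 3 * (\<Sum>k\<in>F. wt k ^ 8 * (cmod (d 0 k))\<^sup>2) + 3 * 512\<^sup>2 * (\<Sum>k\<in>F. (?u k)\<^sup>2) + 3 * 8256\<^sup>2 * (\<Sum>k\<in>F. (?v k)\<^sup>2)"
      by (simp only: sum.distrib sum_distrib_left)
    also have "\<dots> \<le> 3 * Bd + 3 * 512\<^sup>2 * ?N\<^sup>2 + 3 * 8256\<^sup>2 * (wnorm 8 (c 0))\<^sup>2"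
    proof (intro add_mono mult_left_mono)
      show "(\<Sum>k\<in>F. wt k ^ 8 * (cmod (d 0 k))\<^sup>2) \<le> Bd" using d_bound[OF _ F, of 0] T_pos by simp
      have "(\<Sum>k\<in>F. (?u k)\<^sup>2) \<le> (\<Sum>k\<in>F. ?u k)\<^sup>2" by (rule sum_square_le_square_sum) simp
      also have "\<dots> \<le> ?N\<^sup>2"
      proof (rule power_mono)
        have "(\<Sum>k\<in>F. ?u k) = (\<Sum>k\<in>F. wt k ^ 7 * cmod (fx (c 0) k)) + (\<Sum>k\<in>F. wt k ^ 7 * cmod (fy (c 0) k)) + (\<Sum>k\<in>F. wt k ^ 7 * cmod (fz (c 0) k))"
          by (simp only: sum.distrib distrib_left)
        also have "\<dots> \<le> ?N" by (intro add_mono wnorm_finite_sum_le f F)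
        finally show "(\<Sum>k\<in>F. ?u k) \<le> ?N" .
      qed (auto intro!: sum_nonneg)
      finally show "(\<Sum>k\<in>F. (?u k)\<^sup>2) \<le> ?N\<^sup>2" .
      have "(\<Sum>k\<in>F. (?v k)\<^sup>2) \<le> (\<Sum>k\<in>F. ?v k)\<^sup>2" by (rule sum_square_le_square_sum) simp
      also have "\<dots> \<le> (wnorm 8 (c 0))\<^sup>2" by (intro power_mono wnorm_finite_sum_le c0_wsum8 F sum_nonneg) auto
      finally show "(\<Sum>k\<in>F. (?v k)\<^sup>2) \<le> (wnorm 8 (c 0))\<^sup>2" .
    qed auto
    finally show ?thesis .
  qed
  then show ?thesis by blast
qed

end

section \<open>Discrete fluxes\<close>

definition FxN :: "nat \<Rightarrow> grid \<Rightarrow> grid" where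
  "FxN K f = (\<lambda>i j k. ((DxN K f i j k)\<^sup>2 + (DyN K f i j k)\<^sup>2 + (DzN K f i j k)\<^sup>2) * DxN K f i j k)"
definition FyN :: "nat \<Rightarrow> grid \<Rightarrow> grid" where
  "FyN K f = (\<lambda>i j k. ((DxN K f i j k)\<^sup>2 + (DyN K f i j k)\<^sup>2 + (DzN K f i j k)\<^sup>2) * DyN K f i j k)"
definition FzN :: "nat \<Rightarrow> grid \<Rightarrow> grid" where
  "FzN K f = (\<lambda>i j k. ((DxN K f i j k)\<^sup>2 + (DyN K f i j k)\<^sup>2 + (DzN K f i j k)\<^sup>2) * DzN K f i j k)"

lemma gv_F:
  "gv (FxN K f) p = ((gv (DxN K f) p)\<^sup>2 + (gv (DyN K f) p)\<^sup>2 + (gv (DzN K f) p)\<^sup>2) * gv (DxN K f) p"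
  "gv (FyN K f) p = ((gv (DxN K f) p)\<^sup>2 + (gv (DyN K f) p)\<^sup>2 + (gv (DzN K f) p)\<^sup>2) * gv (DyN K f) p"
  "gv (FzN K f) p = ((gv (DxN K f) p)\<^sup>2 + (gv (DyN K f) p)\<^sup>2 + (gv (DzN K f) p)\<^sup>2) * gv (DzN K f) p"
  by (simp_all add: gv_def FxN_def FyN_def FzN_def)

lemma hat_D:
  assumes "k \<in> modes K"
  shows "hat K (DxN K f) k = gx (hat K f) k" "hat K (DyN K f) k = gy (hat K f) k" "hat K (DzN K f) k = gz (hat K f) k"
  using hat_DxN[OF assms] hat_DyN[OF assms] hat_DzN[OF assms] by (simp_all add: gx_def gy_def gz_def)

lemma hat_nlN:
  assumes "k \<in> modes K"
  shows "hat K (nlN K f) k = gx (hat K (FxN K f)) k + gy (hat K (FyN K f)) k + gz (hat K (FzN K f)) k"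
proof -
  have "nlN K f = (\<lambda>i j k. DxN K (FxN K f) i j k + DyN K (FyN K f) i j k + DzN K (FzN K f) i j k)"
    unfolding nlN_def Let_def FxN_def FyN_def FzN_def ..
  then show ?thesis using hat_D[OF assms] by (simp only: hat_add)
qed

lemma gv_abs_le:
  assumes "p \<in> cell K"
  shows "\<bar>gv f p\<bar> \<le> (\<Sum>k\<in>modes K. cmod (hat K f k))"
proof -
  have "cmod (complex_of_real (gv f p)) \<le> (\<Sum>k\<in>modes K. cmod (hat K f k * chi K k p))"
    unfolding hat_inversion[OF assms] by (rule norm_sum)
  then show ?thesis by (simp add: norm_mult)
qed

lemma card_cell: "hh K ^ 3 * real (card (cell K)) = 1"
proof -
  have "real (card (cell K)) = real_of_int (NN K) ^ 3"
    using NN_pos[of K] by (simp add: cell_def card_cartesian_product power3_eq_cube)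
  then show ?thesis using NN_real_pos[of K] by (simp add: hh_def power_divide)
qed

lemma gip_self_le_sup:
  assumes "\<And>p. p \<in> cell K \<Longrightarrow> \<bar>gv f p\<bar> \<le> B"
  shows "gip K f f \<le> B\<^sup>2"
proof -
  have "gip K f f \<le> hh K ^ 3 * (\<Sum>p\<in>cell K. B\<^sup>2)"
    unfolding gip_def
  proof (intro mult_left_mono sum_mono)
    fix p assume "p \<in> cell K"
    from power_mono[OF assms[OF this] abs_ge_zero, of 2] show "gv f p * gv f p \<le> B\<^sup>2" by (simp add: power2_eq_square)
  qed (use hh_pos[of K] in simp)
  also have "\<dots> = (hh K ^ 3 * real (card (cell K))) * B\<^sup>2" by simp
  also have "\<dots> = B\<^sup>2" by (simp only: card_cell mult_1)
  finally show ?thesis .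
qed

lemma hat_cong: "(\<And>p. p \<in> cell K \<Longrightarrow> gv f p = gv g p) \<Longrightarrow> hat K f k = hat K g k"
  by (simp add: hat_eq cong: sum.cong)

text \<open>Realises a grid function as samples of a trigonometric polynomial with the same
  coefficients, so that the convolution algebra applies to pointwise products on the grid.\<close>

lemma sampled_trig_interpolant:
  fixes f :: grid and K s :: nat
  defines "b \<equiv> (\<lambda>k. if k \<in> modes K then hat K f k else 0)"
  obtains g where "wien s b g" "\<And>p. p \<in> cell K \<Longrightarrow> gv (QN K g) p = gv f p"
    "wnorm s b = (\<Sum>k\<in>modes K. wt k ^ s * cmod (hat K f k))"
proof -
  define g where "g x y z = Re (\<Sum>k\<in>modes K. b k * ek k x y z)" for x y z
  have bm: "b (- k) = cnj (b k)" for k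
    using modes_minus[of k K] modes_minus[of "- k" K] by (auto simp: b_def hat_minus)
  have hs: "((\<lambda>k. wt k ^ s * cmod (b k)) has_sum (\<Sum>k\<in>modes K. wt k ^ s * cmod (hat K f k))) UNIV"
    by (rule has_sum_finite_neutralI[where B = "modes K"]) (simp_all add: b_def)
  have real: "complex_of_real (g x y z) = (\<Sum>k\<in>modes K. b k * ek k x y z)" for x y z
  proof -
    let ?S = "\<Sum>k\<in>modes K. b k * ek k x y z"
    have "cnj ?S = (\<Sum>k\<in>modes K. b (- k) * ek (- k) x y z)" by (simp only: cnj_sum complex_cnj_mult bm cnj_ek)
    also have "\<dots> = ?S"
      by (rule sum.reindex_bij_witness[where i = uminus and j = uminus]) (simp_all add: modes_minus)
    finally have "?S \<in> \<real>" by (simp only: Reals_cnj_iff)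
    then show ?thesis unfolding g_def by (rule of_real_Re)
  qed
  have "((\<lambda>k. b k * ek k x y z) has_sum complex_of_real (g x y z)) UNIV" for x y z
    unfolding real by (rule has_sum_finite_neutralI[where B = "modes K"]) (simp_all add: b_def)
  then have "wien s b g" using hs by (auto simp: wien_def wsum_def has_sum_iff)
  moreover have "gv (QN K g) p = gv f p" if p: "p \<in> cell K" for p
  proof -
    have "complex_of_real (gv (QN K g) p) = (\<Sum>k\<in>modes K. b k * chi K k p)"
      unfolding gv_def QN_def real ek_grid ..
    also have "\<dots> = complex_of_real (gv f p)" unfolding hat_inversion[OF p] by (intro sum.cong) (simp_all add: b_def)
    finally show ?thesis by (simp only: of_real_eq_iff)
  qed
  moreover have "wnorm s b = (\<Sum>k\<in>modes K. wt k ^ s * cmod (hat K f k))"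
    unfolding wnorm_def by (rule infsumI[OF hs])
  ultimately show ?thesis by (rule that)
qed

lemma interpolant_gradient:
  assumes g: "wien (Suc s) b g" and b: "\<And>k. b k = (if k \<in> modes K then hat K f k else 0)" and p: "p \<in> cell K"
  shows "gv (QN K (dxc g)) p = gv (DxN K f) p" "gv (QN K (dyc g)) p = gv (DyN K f) p" "gv (QN K (dzc g)) p = gv (DzN K f) p"
proof -
  have gen: "gv (QN K h) p = gv F p" if h: "wien s a h" and a: "\<And>k. k \<notin> modes K \<Longrightarrow> a k = 0" and F: "\<And>k. k \<in> modes K \<Longrightarrow> hat K F k = a k" for a h F
  proof -
    have "((\<lambda>k. a k * chi K k p) has_sum complex_of_real (gv (QN K h) p)) UNIV"
      using h unfolding wien_def gv_def QN_def ek_grid[symmetric] by blast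
    moreover have "((\<lambda>k. a k * chi K k p) has_sum complex_of_real (gv F p)) UNIV"
      unfolding hat_inversion[OF p] by (rule has_sum_finite_neutralI[where B = "modes K"]) (simp_all add: a F)
    ultimately have "complex_of_real (gv (QN K h) p) = complex_of_real (gv F p)" by (rule has_sum_unique)
    then show ?thesis by (simp only: of_real_eq_iff)
  qed
  show "gv (QN K (dxc g)) p = gv (DxN K f) p"
    by (rule gen[OF wien_g(1)[OF g]]) (simp_all add: hat_D gx_def b)
  show "gv (QN K (dyc g)) p = gv (DyN K f) p"
    by (rule gen[OF wien_g(2)[OF g]]) (simp_all add: hat_D gy_def b)
  show "gv (QN K (dzc g)) p = gv (DzN K f) p"
    by (rule gen[OF wien_g(3)[OF g]]) (simp_all add: hat_D gz_def b)
qed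

text \<open>The discrete flux is the sampled flux of the interpolant. The convolution bound has
  constant 3, and the aliasing error with r = 0 at most doubles it.\<close>

lemma discrete_flux_wnorm:
  fixes f :: grid and K s :: nat
  defines "S \<equiv> (\<Sum>k\<in>modes K. wt k ^ Suc s * cmod (hat K f k))"
  shows "(\<Sum>k\<in>modes K. wt k ^ s * cmod (hat K (FxN K f) k)) \<le> 6 * (2 * pi * S) ^ 3"
    "(\<Sum>k\<in>modes K. wt k ^ s * cmod (hat K (FyN K f) k)) \<le> 6 * (2 * pi * S) ^ 3"
    "(\<Sum>k\<in>modes K. wt k ^ s * cmod (hat K (FzN K f) k)) \<le> 6 * (2 * pi * S) ^ 3"
proof -
  define b where "b = (\<lambda>k. if k \<in> modes K then hat K f k else 0)"
  obtain g where g: "wien (Suc s) b g" and S: "wnorm (Suc s) b = S"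
    by (rule sampled_trig_interpolant[where K = K and s = "Suc s" and f = f]) (simp add: b_def S_def)
  have wb: "wsum (Suc s) b" using g by (simp add: wien_def)
  have bk: "b k = (if k \<in> modes K then hat K f k else 0)" for k by (simp add: b_def)
  note gr = interpolant_gradient[OF g bk]
  have gen: "(\<Sum>k\<in>modes K. wt k ^ s * cmod (hat K F k)) \<le> 6 * (2 * pi * S) ^ 3"
    if h: "wien s a h" and F: "\<And>p. p \<in> cell K \<Longrightarrow> gv F p = gv (QN K h) p" and a: "wnorm s a \<le> 3 * (2 * pi * wnorm (Suc s) b) ^ 3" for a h F
  proof -
    have e: "hat K F k = hat K (QN K h) k" for k by (rule hat_cong[OF F])
    have wa: "wsum s a" using h by (simp add: wien_def)
    have "(\<Sum>k\<in>modes K. wt k ^ s * cmod (hat K F k)) \<le> (\<Sum>k\<in>modes K. wt k ^ s * cmod (hat K (QN K h) k - a k) + wt k ^ s * cmod (a k))"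
    proof (unfold e distrib_left[symmetric], intro sum_mono mult_left_mono)
      fix k
      show "cmod (hat K (QN K h) k) \<le> cmod (hat K (QN K h) k - a k) + cmod (a k)"
        using norm_triangle_ineq[of "hat K (QN K h) k - a k" "a k"] by (simp only: diff_add_cancel)
    qed simp
    also have "\<dots> = (\<Sum>k\<in>modes K. wt k ^ s * cmod (hat K (QN K h) k - a k)) + (\<Sum>k\<in>modes K. wt k ^ s * cmod (a k))"
      by (rule sum.distrib)
    also have "\<dots> \<le> wnorm s a + wnorm s a"
      using alias_bound[of s 0 a h K] h by (intro add_mono wnorm_finite_sum_le wa) auto
    also have "\<dots> \<le> 6 * (2 * pi * S) ^ 3" using a S by simp
    finally show ?thesis .
  qed
  have gvQ: "gv (QN K (\<lambda>x y z. u x y z * v x y z)) p = gv (QN K u) p * gv (QN K v) p"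
    "gv (QN K (\<lambda>x y z. u x y z + v x y z)) p = gv (QN K u) p + gv (QN K v) p"
    "gv (QN K (\<lambda>x y z. (u x y z)\<^sup>2)) p = (gv (QN K u) p)\<^sup>2" for u v p
    by (simp_all add: gv_def QN_def)
  show "(\<Sum>k\<in>modes K. wt k ^ s * cmod (hat K (FxN K f) k)) \<le> 6 * (2 * pi * S) ^ 3"
    by (rule gen[OF wien_f(1)[OF g] _ wsum_f(4)[OF wb]]) (simp add: gvQ gv_F gr)
  show "(\<Sum>k\<in>modes K. wt k ^ s * cmod (hat K (FyN K f) k)) \<le> 6 * (2 * pi * S) ^ 3"
    by (rule gen[OF wien_f(2)[OF g] _ wsum_f(5)[OF wb]]) (simp add: gvQ gv_F gr)
  show "(\<Sum>k\<in>modes K. wt k ^ s * cmod (hat K (FzN K f) k)) \<le> 6 * (2 * pi * S) ^ 3"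
    by (rule gen[OF wien_f(3)[OF g] _ wsum_f(6)[OF wb]]) (simp add: gvQ gv_F gr)
qed

text \<open>Both the truncated Fourier series of the exact solution and its grid samples satisfy
  the closeness hypothesis \<open>close\<close>.\<close>

lemma flux_consistency:
  assumes g: "wien (r + 1) a g" and B: "wnorm (r + 1) a \<le> B"
    and close: "(\<Sum>k\<in>modes K. wt k * cmod (hat K \<psi> k - a k)) \<le> (2 * hh K) ^ r * B"
  defines "\<eta> \<equiv> 4 * pi * (2 * hh K) ^ r * B"
  defines "E \<equiv> 9 * (2 * pi * B + \<eta>)\<^sup>2 * \<eta> + (2 * hh K) ^ r * (3 * (2 * pi * B) ^ 3)"
  shows "L2_set (\<lambda>k. cmod (fx a k - hat K (FxN K \<psi>) k)) (modes K) \<le> E"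
    "L2_set (\<lambda>k. cmod (fy a k - hat K (FyN K \<psi>) k)) (modes K) \<le> E"
    "L2_set (\<lambda>k. cmod (fz a k - hat K (FzN K \<psi>) k)) (modes K) \<le> E"
proof -
  have g': "wien (Suc r) a g" using g by simp
  have B': "wnorm (Suc r) a \<le> B" using B by simp
  have w: "wsum (Suc r) a" using g' by (simp add: wien_def)
  have B0: "B \<ge> 0" using wnorm_nonneg[of "r + 1" a] B by linarith
  have h0: "0 \<le> (2 * hh K) ^ r" using hh_pos[of K] by simp
  have \<eta>0: "\<eta> \<ge> 0" unfolding \<eta>_def using B0 h0 by simp
  \<comment> \<open>Half of \<eta> comes from the closeness of \<psi> to a, the other half from
    aliasing in the sampled exact gradient.\<close>
  have sup: "\<bar>gv F p - gv (QN K h) p\<bar> \<le> \<eta> \<and> \<bar>gv F p\<bar> \<le> 2 * pi * B + \<eta> \<and> \<bar>gv (QN K h) p\<bar> \<le> 2 * pi * B + \<eta>"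
    if p: "p \<in> cell K" and h: "wien r (G a) h" and n: "wnorm r (G a) \<le> 2 * pi * wnorm (Suc r) a"
      and F: "\<And>k. k \<in> modes K \<Longrightarrow> hat K F k = G (hat K \<psi>) k"
      and G: "\<And>k. cmod (G (hat K \<psi>) k - G a k) \<le> 2 * pi * wt k * cmod (hat K \<psi> k - a k)" for p h G F
  proof -
    have "\<bar>gv (\<lambda>i j k. F i j k - QN K h i j k) p\<bar> \<le> (\<Sum>k\<in>modes K. cmod (hat K (\<lambda>i j k. F i j k - QN K h i j k) k))"
      by (rule gv_abs_le[OF p])
    also have "\<dots> \<le> (\<Sum>k\<in>modes K. 2 * pi * (wt k * cmod (hat K \<psi> k - a k)) + wt k ^ 0 * cmod (hat K (QN K h) k - G a k))"
    proof (rule sum_mono)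
      fix k assume k: "k \<in> modes K"
      have "hat K (\<lambda>i j k. F i j k - QN K h i j k) k = (G (hat K \<psi>) k - G a k) - (hat K (QN K h) k - G a k)"
        unfolding hat_diff F[OF k] by simp
      then show "cmod (hat K (\<lambda>i j k. F i j k - QN K h i j k) k) \<le> 2 * pi * (wt k * cmod (hat K \<psi> k - a k)) + wt k ^ 0 * cmod (hat K (QN K h) k - G a k)"
        using norm_triangle_ineq4[of "G (hat K \<psi>) k - G a k" "hat K (QN K h) k - G a k"] G[of k] by simp
    qed
    also have "\<dots> = 2 * pi * (\<Sum>k\<in>modes K. wt k * cmod (hat K \<psi> k - a k)) + (\<Sum>k\<in>modes K. wt k ^ 0 * cmod (hat K (QN K h) k - G a k))"
      by (simp only: sum.distrib sum_distrib_left)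
    also have "\<dots> \<le> 2 * pi * ((2 * hh K) ^ r * B) + (2 * hh K) ^ r * (2 * pi * B)"
    proof (intro add_mono mult_left_mono close)
      have "(\<Sum>k\<in>modes K. wt k ^ 0 * cmod (hat K (QN K h) k - G a k)) \<le> (2 * hh K) ^ r * wnorm r (G a)"
        using alias_bound[of 0 r "G a" h K] h by simp
      also have "\<dots> \<le> (2 * hh K) ^ r * (2 * pi * B)"
        by (rule mult_left_mono[OF order_trans[OF n mult_left_mono[OF B']] h0]) simp
      finally show "(\<Sum>k\<in>modes K. wt k ^ 0 * cmod (hat K (QN K h) k - G a k)) \<le> (2 * hh K) ^ r * (2 * pi * B)" .
    qed simp
    also have "\<dots> = \<eta>" by (simp add: \<eta>_def mult_ac)
    finally have 1: "\<bar>gv F p - gv (QN K h) p\<bar> \<le> \<eta>" by (simp add: gv_def)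
    have "\<bar>gv (QN K h) p\<bar> \<le> wnorm r (G a)" unfolding gv_def QN_def by (rule wien_bound[OF h])
    then have 2: "\<bar>gv (QN K h) p\<bar> \<le> 2 * pi * B"
      by (rule order_trans[OF order_trans[OF _ n] mult_left_mono[OF B']]) simp
    show ?thesis using 1 2 \<eta>0 by linarith
  qed
  have lin: "cmod (gx u k - gx v k) \<le> 2 * pi * wt k * cmod (u k - v k)" "cmod (gy u k - gy v k) \<le> 2 * pi * wt k * cmod (u k - v k)"
    "cmod (gz u k - gz v k) \<le> 2 * pi * wt k * cmod (u k - v k)" for u v k
    using norm_g_le[of "\<lambda>k. u k - v k" k] by (simp_all add: gx_def gy_def gz_def right_diff_distrib)
  note gs = wien_g[OF g'] and ns = wsum_g(4-6)[OF w]
  have sx: "\<bar>gv (DxN K \<psi>) p - gv (QN K (dxc g)) p\<bar> \<le> \<eta> \<and> \<bar>gv (DxN K \<psi>) p\<bar> \<le> 2 * pi * B + \<eta> \<and> \<bar>gv (QN K (dxc g)) p\<bar> \<le> 2 * pi * B + \<eta>"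
    if "p \<in> cell K" for p by (rule sup[OF that gs(1) ns(1) hat_D(1) lin(1)])
  have sy: "\<bar>gv (DyN K \<psi>) p - gv (QN K (dyc g)) p\<bar> \<le> \<eta> \<and> \<bar>gv (DyN K \<psi>) p\<bar> \<le> 2 * pi * B + \<eta> \<and> \<bar>gv (QN K (dyc g)) p\<bar> \<le> 2 * pi * B + \<eta>"
    if "p \<in> cell K" for p by (rule sup[OF that gs(2) ns(2) hat_D(2) lin(2)])
  have sz: "\<bar>gv (DzN K \<psi>) p - gv (QN K (dzc g)) p\<bar> \<le> \<eta> \<and> \<bar>gv (DzN K \<psi>) p\<bar> \<le> 2 * pi * B + \<eta> \<and> \<bar>gv (QN K (dzc g)) p\<bar> \<le> 2 * pi * B + \<eta>"
    if "p \<in> cell K" for p by (rule sup[OF that gs(3) ns(3) hat_D(3) lin(3)])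
  \<comment> \<open>The two summands of E: the difference of the fluxes at the grid points, measured
    in the maximum norm, and the aliasing of the exact flux.\<close>
  have fin: "L2_set (\<lambda>k. cmod (a' k - hat K F k)) (modes K) \<le> E"
    if h: "wien r a' h" and n: "wnorm r a' \<le> 3 * (2 * pi * wnorm (Suc r) a) ^ 3"
      and p: "\<And>p. p \<in> cell K \<Longrightarrow> \<bar>gv F p - gv (QN K h) p\<bar> \<le> 9 * (2 * pi * B + \<eta>)\<^sup>2 * \<eta>" for a' h F
  proof -
    let ?D = "\<lambda>i j k. F i j k - QN K h i j k"
    have E1: "L2_set (\<lambda>k. cmod (hat K ?D k)) (modes K) \<le> 9 * (2 * pi * B + \<eta>)\<^sup>2 * \<eta>"
    proof -
      have "gip K ?D ?D \<le> (9 * (2 * pi * B + \<eta>)\<^sup>2 * \<eta>)\<^sup>2"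
        by (rule gip_self_le_sup) (use p in \<open>simp add: gv_def\<close>)
      then show ?thesis unfolding L2_set_def gip_self using \<eta>0 by (intro real_le_lsqrt) auto
    qed
    have E2: "L2_set (\<lambda>k. cmod (hat K (QN K h) k - a' k)) (modes K) \<le> (2 * hh K) ^ r * (3 * (2 * pi * B) ^ 3)"
    proof -
      have "L2_set (\<lambda>k. cmod (hat K (QN K h) k - a' k)) (modes K) \<le> (\<Sum>k\<in>modes K. cmod (hat K (QN K h) k - a' k))"
        by (rule L2_set_le_sum) simp
      also have "\<dots> \<le> (2 * hh K) ^ r * wnorm r a'" using alias_bound[of 0 r a' h K] h by simp
      also have "\<dots> \<le> (2 * hh K) ^ r * (3 * (2 * pi * B) ^ 3)"
      proof (rule mult_left_mono[OF order_trans[OF n] h0])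
        have "(2 * pi * wnorm (Suc r) a) ^ 3 \<le> (2 * pi * B) ^ 3"
          using B' wnorm_nonneg[of "Suc r" a] by (intro power_mono mult_left_mono) auto
        then show "3 * (2 * pi * wnorm (Suc r) a) ^ 3 \<le> 3 * (2 * pi * B) ^ 3" by simp
      qed
      finally show ?thesis .
    qed
    have "L2_set (\<lambda>k. cmod (a' k - hat K F k)) (modes K) \<le> L2_set (\<lambda>k. cmod (hat K ?D k) + cmod (hat K (QN K h) k - a' k)) (modes K)"
    proof (rule L2_set_mono)
      fix k
      have eq: "a' k - hat K F k = - hat K ?D k - (hat K (QN K h) k - a' k)" by (simp add: hat_diff)
      show "cmod (a' k - hat K F k) \<le> cmod (hat K ?D k) + cmod (hat K (QN K h) k - a' k)"
        unfolding eq using norm_triangle_ineq4[of "- hat K ?D k" "hat K (QN K h) k - a' k"] by (simp only: norm_minus_cancel)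
    qed simp
    also have "\<dots> \<le> L2_set (\<lambda>k. cmod (hat K ?D k)) (modes K) + L2_set (\<lambda>k. cmod (hat K (QN K h) k - a' k)) (modes K)"
      by (rule L2_set_triangle_ineq)
    also have "\<dots> \<le> E" unfolding E_def using E1 E2 by (rule add_mono)
    finally show ?thesis .
  qed
  have gvq: "gv (QN K (\<lambda>x y z. ((dxc g x y z)\<^sup>2 + (dyc g x y z)\<^sup>2 + (dzc g x y z)\<^sup>2) * v x y z)) p =
     ((gv (QN K (dxc g)) p)\<^sup>2 + (gv (QN K (dyc g)) p)\<^sup>2 + (gv (QN K (dzc g)) p)\<^sup>2) * gv (QN K v) p" for v p
    by (simp add: gv_def QN_def)
  show "L2_set (\<lambda>k. cmod (fx a k - hat K (FxN K \<psi>) k)) (modes K) \<le> E"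
    by (rule fin[OF wien_f(1)[OF g'] wsum_f(4)[OF w]], unfold gvq gv_F, rule cubic_lipschitz) (simp_all only: sx sy sz)
  show "L2_set (\<lambda>k. cmod (fy a k - hat K (FyN K \<psi>) k)) (modes K) \<le> E"
    by (rule fin[OF wien_f(2)[OF g'] wsum_f(5)[OF w]], unfold gvq gv_F, rule cubic_lipschitz) (simp_all only: sx sy sz)
  show "L2_set (\<lambda>k. cmod (fz a k - hat K (FzN K \<psi>) k)) (modes K) \<le> E"
    by (rule fin[OF wien_f(3)[OF g'] wsum_f(6)[OF w]], unfold gvq gv_F, rule cubic_lipschitz) (simp_all only: sx sy sz)
qed

section \<open>Energy stability of the scheme\<close>

definition muN :: "nat \<Rightarrow> real \<Rightarrow> grid \<Rightarrow> grid" where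
  "muN K \<epsilon> f = (\<lambda>i j k. - nlN K f i j k + (1 - \<epsilon>) * f i j k + 2 * LapN K f i j k + LapN K (LapN K f) i j k)"

lemma hat_muN:
  assumes "k \<in> modes K"
  shows "hat K (muN K \<epsilon> f) k = - hat K (nlN K f) k + complex_of_real (1 - \<epsilon> - 2 * kap k + (kap k)\<^sup>2) * hat K f k"
  unfolding muN_def by (simp add: hat_simps assms power2_eq_square algebra_simps)

text \<open>Cauchy-Schwarz over the three components. The divergence costs one factor
  \<open>kap k\<close> in the square, which \<open>absorb_flux\<close> later pays out of the
  dissipation.\<close>

lemma flux_divergence_le:
  "cmod (gx u k + gy v k + gz w k) ^ 2 \<le> kap k * ((cmod (u k))\<^sup>2 + (cmod (v k))\<^sup>2 + (cmod (w k))\<^sup>2)"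
proof -
  define a b c' where "a = 2 * pi * real_of_int (fst k)" and "b = 2 * pi * real_of_int (fst (snd k))" and "c' = 2 * pi * real_of_int (snd (snd k))"
  have n: "cmod (gx u k) = \<bar>a\<bar> * cmod (u k)" "cmod (gy v k) = \<bar>b\<bar> * cmod (v k)" "cmod (gz w k) = \<bar>c'\<bar> * cmod (w k)"
    unfolding gx_def gy_def gz_def a_def b_def c'_def norm_mult norm_ii norm_of_real by simp_all
  have "cmod (gx u k + gy v k + gz w k) \<le> cmod (gx u k) + cmod (gy v k) + cmod (gz w k)"
    using norm_triangle_ineq[of "gx u k + gy v k" "gz w k"] norm_triangle_ineq[of "gx u k" "gy v k"] by linarith
  then have "cmod (gx u k + gy v k + gz w k) ^ 2 \<le> (\<bar>a\<bar> * cmod (u k) + \<bar>b\<bar> * cmod (v k) + \<bar>c'\<bar> * cmod (w k))\<^sup>2"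
    unfolding n by (rule power_mono) simp
  also have "\<dots> \<le> (\<bar>a\<bar>\<^sup>2 + \<bar>b\<bar>\<^sup>2 + \<bar>c'\<bar>\<^sup>2) * ((cmod (u k))\<^sup>2 + (cmod (v k))\<^sup>2 + (cmod (w k))\<^sup>2)"
  proof -
    have "(x * p + y * q + z * r)\<^sup>2 \<le> (x\<^sup>2 + y\<^sup>2 + z\<^sup>2) * (p\<^sup>2 + q\<^sup>2 + r\<^sup>2)" for x y z p q r :: real
    proof -
      have "0 \<le> (x * q - y * p)\<^sup>2 + (x * r - z * p)\<^sup>2 + (y * r - z * q)\<^sup>2" by simp
      then show ?thesis by (simp add: power2_eq_square algebra_simps)
    qed
    then show ?thesis .
  qed
  also have "\<bar>a\<bar>\<^sup>2 + \<bar>b\<bar>\<^sup>2 + \<bar>c'\<bar>\<^sup>2 = kap k" by (simp add: a_def b_def c'_def kap_def power2_eq_square algebra_simps)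
  finally show ?thesis .
qed

definition gradsq :: "nat \<Rightarrow> grid \<Rightarrow> freq \<Rightarrow> real" where
  "gradsq K f p = (gv (DxN K f) p)\<^sup>2 + (gv (DyN K f) p)\<^sup>2 + (gv (DzN K f) p)\<^sup>2"

text \<open>The fourth power of the discrete L^4 norm of the gradient; a quarter of it is the
  nonlinear part of the energy.\<close>

definition q4 :: "nat \<Rightarrow> grid \<Rightarrow> real" where
  "q4 K f = hh K ^ 3 * (\<Sum>p\<in>cell K. (gradsq K f p)\<^sup>2)"

lemma gradsq_nonneg: "gradsq K f p \<ge> 0" by (simp add: gradsq_def)

lemma q4_nonneg: "q4 K f \<ge> 0"
  unfolding q4_def using hh_pos[of K] by (intro mult_nonneg_nonneg sum_nonneg) auto

lemma gradient_sup_le: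
  fixes f :: grid
  assumes "p \<in> cell K"
  defines "S \<equiv> 2 * pi * (\<Sum>k\<in>modes K. wt k * cmod (hat K f k))"
  shows "\<bar>gv (DxN K f) p\<bar> \<le> S" "\<bar>gv (DyN K f) p\<bar> \<le> S" "\<bar>gv (DzN K f) p\<bar> \<le> S"
proof -
  have gen: "\<bar>gv F p\<bar> \<le> S" if "\<And>k. k \<in> modes K \<Longrightarrow> cmod (hat K F k) \<le> 2 * pi * wt k * cmod (hat K f k)" for F
  proof -
    have "\<bar>gv F p\<bar> \<le> (\<Sum>k\<in>modes K. cmod (hat K F k))" by (rule gv_abs_le[OF assms(1)])
    also have "\<dots> \<le> (\<Sum>k\<in>modes K. 2 * pi * wt k * cmod (hat K f k))" by (rule sum_mono[OF that])
    also have "\<dots> = S" by (simp add: S_def sum_distrib_left mult.assoc)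
    finally show ?thesis .
  qed
  show "\<bar>gv (DxN K f) p\<bar> \<le> S" "\<bar>gv (DyN K f) p\<bar> \<le> S" "\<bar>gv (DzN K f) p\<bar> \<le> S"
    by (rule gen, simp only: hat_D norm_g_le)+
qed

lemma q4_le_sup:
  assumes "(\<Sum>k\<in>modes K. wt k * cmod (hat K f k)) \<le> S"
  shows "q4 K f \<le> (12 * pi\<^sup>2 * S\<^sup>2)\<^sup>2"
proof -
  have S0: "0 \<le> (\<Sum>k\<in>modes K. wt k * cmod (hat K f k))" by (intro sum_nonneg) simp
  have "gradsq K f p \<le> 12 * pi\<^sup>2 * S\<^sup>2" if p: "p \<in> cell K" for p
  proof -
    have le: "2 * pi * (\<Sum>k\<in>modes K. wt k * cmod (hat K f k)) \<le> 2 * pi * S" using assms by simp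
    have "x\<^sup>2 \<le> (2 * pi * S)\<^sup>2" if "\<bar>x\<bar> \<le> 2 * pi * (\<Sum>k\<in>modes K. wt k * cmod (hat K f k))" for x
      using power_mono[OF order_trans[OF that le], of 2] by simp
    from this[OF gradient_sup_le(1)[OF p]] this[OF gradient_sup_le(2)[OF p]] this[OF gradient_sup_le(3)[OF p]]
    show ?thesis unfolding gradsq_def by (simp add: power_mult_distrib)
  qed
  then have "q4 K f \<le> hh K ^ 3 * (\<Sum>p\<in>cell K. (12 * pi\<^sup>2 * S\<^sup>2)\<^sup>2)"
    unfolding q4_def using hh_pos[of K] gradsq_nonneg by (intro mult_left_mono sum_mono power_mono) auto
  also have "\<dots> = (hh K ^ 3 * real (card (cell K))) * (12 * pi\<^sup>2 * S\<^sup>2)\<^sup>2" by simp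
  also have "\<dots> = (12 * pi\<^sup>2 * S\<^sup>2)\<^sup>2" by (simp only: card_cell mult_1)
  finally show ?thesis .
qed

text \<open>Convexity of \<open>\<nabla>\<phi> \<mapsto> |\<nabla>\<phi>|\<^sup>4 / 4\<close> tested with the increment of the scheme.\<close>

lemma energy_pairing:
  "(\<Sum>k\<in>modes K. Re (hat K (nlN K f) k * cnj (hat K f k - hat K g k))) \<le> - (q4 K f - q4 K g) / 4"
proof -
  have skew: "(\<Sum>k\<in>modes K. Re (\<i> * complex_of_real (r k) * hat K F k * cnj (hat K f k - hat K g k))) = gip K F G - gip K F G'"
    if G: "\<And>k. k \<in> modes K \<Longrightarrow> hat K G k = \<i> * complex_of_real (r k) * hat K g k"
      and G': "\<And>k. k \<in> modes K \<Longrightarrow> hat K G' k = \<i> * complex_of_real (r k) * hat K f k" for r F G G'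
  proof -
    have "Re (\<i> * complex_of_real (r k) * hat K F k * cnj (hat K f k - hat K g k)) =
        Re (hat K F k * cnj (hat K G k)) - Re (hat K F k * cnj (hat K G' k))" if "k \<in> modes K" for k
      unfolding G[OF that] G'[OF that]
      by (simp add: algebra_simps)
    then show ?thesis unfolding gip_Re sum_subtractf[symmetric] by (rule sum.cong[OF refl])
  qed
  have x: "(\<Sum>k\<in>modes K. Re (gx (hat K (FxN K f)) k * cnj (hat K f k - hat K g k))) = gip K (FxN K f) (DxN K g) - gip K (FxN K f) (DxN K f)"
    unfolding gx_def by (rule skew) (simp_all only: hat_DxN)
  have y: "(\<Sum>k\<in>modes K. Re (gy (hat K (FyN K f)) k * cnj (hat K f k - hat K g k))) = gip K (FyN K f) (DyN K g) - gip K (FyN K f) (DyN K f)"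
    unfolding gy_def by (rule skew) (simp_all only: hat_DyN)
  have z: "(\<Sum>k\<in>modes K. Re (gz (hat K (FzN K f)) k * cnj (hat K f k - hat K g k))) = gip K (FzN K f) (DzN K g) - gip K (FzN K f) (DzN K f)"
    unfolding gz_def by (rule skew) (simp_all only: hat_DzN)
  have "(\<Sum>k\<in>modes K. Re (hat K (nlN K f) k * cnj (hat K f k - hat K g k))) =
     (\<Sum>k\<in>modes K. Re (gx (hat K (FxN K f)) k * cnj (hat K f k - hat K g k)) + Re (gy (hat K (FyN K f)) k * cnj (hat K f k - hat K g k))
       + Re (gz (hat K (FzN K f)) k * cnj (hat K f k - hat K g k)))"
    by (intro sum.cong refl) (simp only: hat_nlN distrib_right plus_complex.sel)
  also have "\<dots> = (gip K (FxN K f) (DxN K g) - gip K (FxN K f) (DxN K f)) + (gip K (FyN K f) (DyN K g) - gip K (FyN K f) (DyN K f))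
      + (gip K (FzN K f) (DzN K g) - gip K (FzN K f) (DzN K f))"
    by (simp only: sum.distrib x y z)
  also have "\<dots> = hh K ^ 3 * (\<Sum>p\<in>cell K. gradsq K f p * (gv (DxN K f) p * (gv (DxN K g) p - gv (DxN K f) p)
      + gv (DyN K f) p * (gv (DyN K g) p - gv (DyN K f) p) + gv (DzN K f) p * (gv (DzN K g) p - gv (DzN K f) p)))"
    unfolding gip_def right_diff_distrib[symmetric] distrib_left[symmetric] sum_subtractf[symmetric] sum.distrib[symmetric] gv_F gradsq_def
    by (simp only: mult.assoc distrib_left right_diff_distrib)
  also have "\<dots> \<le> hh K ^ 3 * (\<Sum>p\<in>cell K. ((gradsq K g p)\<^sup>2 - (gradsq K f p)\<^sup>2) / 4)"
  proof (intro mult_left_mono sum_mono)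
    fix p
    \<comment> \<open>The gradient inequality of the convex function |p|^4 / 4, by two applications
      of 2 x y \<le> x^2 + y^2: once to the vectors p and r, once to their squared lengths.\<close>
    have conv: "P * (p1 * (r1 - p1) + p2 * (r2 - p2) + p3 * (r3 - p3)) \<le> (R\<^sup>2 - P\<^sup>2) / 4"
      if P: "P = p1\<^sup>2 + p2\<^sup>2 + p3\<^sup>2" and R: "R = r1\<^sup>2 + r2\<^sup>2 + r3\<^sup>2" for P R p1 p2 p3 r1 r2 r3 :: real
    proof -
      have "0 \<le> (p1 - r1)\<^sup>2 + (p2 - r2)\<^sup>2 + (p3 - r3)\<^sup>2" by simp
      then have "p1 * (r1 - p1) + p2 * (r2 - p2) + p3 * (r3 - p3) \<le> (R - P) / 2"
        unfolding P R by (simp add: power2_eq_square algebra_simps)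
      then have "P * (p1 * (r1 - p1) + p2 * (r2 - p2) + p3 * (r3 - p3)) \<le> P * ((R - P) / 2)"
        by (rule mult_left_mono) (simp add: P)
      also have "\<dots> = (2 * (P * R) - 2 * P\<^sup>2) / 4" by (simp add: field_simps power2_eq_square)
      also have "\<dots> \<le> (R\<^sup>2 - P\<^sup>2) / 4"
        using zero_le_power2[of "R - P"] by (intro divide_right_mono) (simp_all add: power2_eq_square algebra_simps)
      finally show ?thesis .
    qed
    show "gradsq K f p * (gv (DxN K f) p * (gv (DxN K g) p - gv (DxN K f) p) + gv (DyN K f) p * (gv (DyN K g) p - gv (DyN K f) p)
        + gv (DzN K f) p * (gv (DzN K g) p - gv (DzN K f) p)) \<le> ((gradsq K g p)\<^sup>2 - (gradsq K f p)\<^sup>2) / 4"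
      by (rule conv) (simp_all only: gradsq_def)
  qed (use hh_pos[of K] in simp)
  also have "\<dots> = - (q4 K f - q4 K g) / 4"
    unfolding q4_def sum_divide_distrib[symmetric] sum_subtractf by (simp add: algebra_simps)
  finally show ?thesis .
qed

lemma Re_mult_cnj: "Re (u * cnj v) = u \<bullet> v"
  by (simp add: inner_complex_def)

text \<open>The scheme is divided by \<kappa>, as for the H^(-1) inner product, and tested with z -
  y. The weight on increments is what the products with the previous increment e cost: 1 / (4
  \<kappa> dt) from the BDF2 quotient, \<kappa> from the extrapolated term.\<close>

lemma energy_mode:
  fixes z y x N :: complex and \<kappa> dt A a :: real
  assumes \<kappa>: "\<kappa> \<ge> 2" and dt: "dt > 0" and A: "A \<ge> 0" and a: "a \<ge> 0"
    and eq: "(3/2 * z - 2 * y + 1/2 * x) / complex_of_real dt =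
      - complex_of_real \<kappa> * (- N + complex_of_real a * z - 2 * (complex_of_real \<kappa> * (2 * y - x)) + complex_of_real (A * dt * \<kappa>) * (z - y) + complex_of_real (\<kappa>\<^sup>2) * z)"
  shows "(a/2 + \<kappa>\<^sup>2/2 - \<kappa>) * ((cmod z)\<^sup>2 - (cmod y)\<^sup>2) + (\<kappa> + 1 / (4 * \<kappa> * dt)) * (cmod (z - y))\<^sup>2
     - (\<kappa> + 1 / (4 * \<kappa> * dt)) * (cmod (y - x))\<^sup>2 \<le> Re (N * cnj (z - y))"
proof -
  define D e where "D = z - y" and "e = y - x"
  have z: "z = y + D" and x: "x = y - e" by (simp_all add: D_def e_def)
  define r where "r = 1 / (\<kappa> * dt)"
  have r0: "r > 0" using \<kappa> dt by (simp add: r_def)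
  have k0: "complex_of_real \<kappa> \<noteq> 0" "complex_of_real dt \<noteq> 0" using \<kappa> dt by auto
  define X where "X = 3/2 * D - 1/2 * e"
  have h: "r *\<^sub>R X = N - complex_of_real a * z + 2 * (complex_of_real \<kappa> * (y + e)) - complex_of_real (A * dt * \<kappa>) * D - complex_of_real (\<kappa>\<^sup>2) * z"
  proof -
    have X: "3/2 * z - 2 * y + 1/2 * x = X" by (simp add: X_def D_def e_def field_simps)
    have ye: "2 * y - x = y + e" by (simp add: e_def)
    have "X / complex_of_real dt = complex_of_real \<kappa> * (N - complex_of_real a * z + 2 * (complex_of_real \<kappa> * (y + e)) - complex_of_real (A * dt * \<kappa>) * D - complex_of_real (\<kappa>\<^sup>2) * z)"
      using eq unfolding X ye D_def[symmetric] by (simp add: algebra_simps)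
    then have "X / complex_of_real dt / complex_of_real \<kappa> = N - complex_of_real a * z + 2 * (complex_of_real \<kappa> * (y + e)) - complex_of_real (A * dt * \<kappa>) * D - complex_of_real (\<kappa>\<^sup>2) * z"
      using k0 by (simp only: nonzero_mult_div_cancel_left not_False_eq_True)
    moreover have "X / complex_of_real dt / complex_of_real \<kappa> = r *\<^sub>R X"
      by (simp add: r_def scaleR_conv_of_real)
    ultimately show ?thesis by simp
  qed
  have N: "N = r *\<^sub>R X + a *\<^sub>R z - (2 * \<kappa>) *\<^sub>R (y + e) + (A * dt * \<kappa>) *\<^sub>R D + \<kappa>\<^sup>2 *\<^sub>R z"
    unfolding h by (simp add: scaleR_conv_of_real algebra_simps)
  have i1: "z \<bullet> D = ((cmod z)\<^sup>2 - (cmod y)\<^sup>2 + (cmod D)\<^sup>2) / 2"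
    unfolding z by (simp add: power2_norm_eq_inner inner_add_left inner_add_right inner_commute)
  have i2: "y \<bullet> D = ((cmod z)\<^sup>2 - (cmod y)\<^sup>2 - (cmod D)\<^sup>2) / 2"
    unfolding z by (simp add: power2_norm_eq_inner inner_add_left inner_add_right inner_commute)
  have "0 \<le> (cmod (e - D))\<^sup>2" by simp
  then have i3: "e \<bullet> D \<le> ((cmod e)\<^sup>2 + (cmod D)\<^sup>2) / 2"
    by (simp add: power2_norm_eq_inner inner_diff_left inner_diff_right inner_commute)
  have i4: "D \<bullet> D = (cmod D)\<^sup>2" by (simp add: power2_norm_eq_inner)
  define sz sy sD se eD where "sz = (cmod z)\<^sup>2" and "sy = (cmod y)\<^sup>2" and "sD = (cmod D)\<^sup>2" and "se = (cmod e)\<^sup>2" and "eD = e \<bullet> D"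
  have sD0: "sD \<ge> 0" by (simp add: sD_def)
  have half: "X \<bullet> D = 3/2 * sD - 1/2 * eD"
    unfolding X_def sD_def eD_def i4[symmetric] by (simp add: inner_complex_def algebra_simps)
  have "Re (N * cnj (z - y)) = r * (3/2 * sD - 1/2 * eD) + a * ((sz - sy + sD) / 2) - 2 * \<kappa> * ((sz - sy - sD) / 2 + eD) + A * dt * \<kappa> * sD + \<kappa>\<^sup>2 * ((sz - sy + sD) / 2)"
    unfolding Re_mult_cnj D_def[symmetric] N
    by (simp add: inner_add_left inner_diff_left half i1 i2 i4 sz_def sy_def sD_def eD_def distrib_left)
  also have "\<dots> = (a/2 + \<kappa>\<^sup>2/2 - \<kappa>) * (sz - sy) + (3/2 * r + a/2 + \<kappa> + A * dt * \<kappa> + \<kappa>\<^sup>2/2) * sD - (r/2 + 2 * \<kappa>) * eD"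
    by (simp add: field_simps)
  also have "\<dots> \<ge> (a/2 + \<kappa>\<^sup>2/2 - \<kappa>) * (sz - sy) + (3/2 * r + a/2 + \<kappa> + A * dt * \<kappa> + \<kappa>\<^sup>2/2) * sD - (r/2 + 2 * \<kappa>) * ((se + sD) / 2)"
    (is "_ \<ge> ?R")
    using mult_left_mono[OF i3, of "r/2 + 2 * \<kappa>"] r0 \<kappa> unfolding se_def sD_def eD_def by simp
  finally have 1: "?R \<le> Re (N * cnj (z - y))" .
  have eqR: "?R = (a/2 + \<kappa>\<^sup>2/2 - \<kappa>) * (sz - sy) + (5/4 * r + a/2 + A * dt * \<kappa> + \<kappa>\<^sup>2/2) * sD - (\<kappa> + r/4) * se"
    by (simp add: field_simps)
  \<comment> \<open>After paying for the current increment, the weight \<kappa> must be restored,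
    and the implicit biharmonic term supplies \<kappa>^2 / 2 for it; this is the use of \<kappa>
    \<ge> 2.\<close>
  have le: "(\<kappa> + r/4) * sD \<le> (5/4 * r + a/2 + A * dt * \<kappa> + \<kappa>\<^sup>2/2) * sD"
  proof (rule mult_right_mono[OF _ sD0])
    have "\<kappa> * 2 \<le> \<kappa> * \<kappa>" using \<kappa> by (intro mult_left_mono) auto
    then have "\<kappa> \<le> \<kappa>\<^sup>2 / 2" by (simp add: power2_eq_square)
    moreover have "0 \<le> A * dt * \<kappa>" using A dt \<kappa> by simp
    ultimately show "\<kappa> + r/4 \<le> 5/4 * r + a/2 + A * dt * \<kappa> + \<kappa>\<^sup>2/2" using a r0 by linarith
  qed
  have r4: "1 / (4 * \<kappa> * dt) = r / 4" by (simp add: r_def)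
  have "(a/2 + \<kappa>\<^sup>2/2 - \<kappa>) * (sz - sy) + (\<kappa> + r/4) * sD - (\<kappa> + r/4) * se \<le> ?R"
    unfolding eqR by (intro diff_right_mono add_left_mono le)
  also note 1
  finally show ?thesis unfolding r4 sz_def sy_def sD_def se_def D_def e_def .
qed

lemma scheme_mode:
  assumes s: "bdf2_scheme K M dt \<epsilon> A Phi0 phi" and n: "0 \<le> n" "n < int M" and k: "k \<in> modes K"
  shows "(3/2 * hat K (phi (n+1)) k - 2 * hat K (phi n) k + 1/2 * hat K (phi (n-1)) k) / complex_of_real dt =
    - complex_of_real (kap k) * (- hat K (nlN K (phi (n+1))) k + complex_of_real (1 - \<epsilon>) * hat K (phi (n+1)) k
      - 2 * (complex_of_real (kap k) * (2 * hat K (phi n) k - hat K (phi (n-1)) k))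
      + complex_of_real (A * dt * kap k) * (hat K (phi (n+1)) k - hat K (phi n) k) + complex_of_real ((kap k)\<^sup>2) * hat K (phi (n+1)) k)"
proof -
  have "(\<lambda>i j k. (3/2 * phi (n+1) i j k - 2 * phi n i j k + 1/2 * phi (n-1) i j k) / dt)
      = LapN K (\<lambda>i j k. - nlN K (phi (n+1)) i j k + (1 - \<epsilon>) * phi (n+1) i j k
           + 2 * LapN K (\<lambda>i j k. 2 * phi n i j k - phi (n-1) i j k) i j k
           - A * dt * LapN K (\<lambda>i j k. phi (n+1) i j k - phi n i j k) i j k
           + LapN K (LapN K (phi (n+1))) i j k)"
    using s n unfolding bdf2_scheme_def Let_def by blast
  from arg_cong[OF this, of "\<lambda>f. hat K f k"] show ?thesis
    by (simp add: hat_simps k power2_eq_square algebra_simps)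
qed

lemma scheme_start:
  assumes s: "bdf2_scheme K M dt \<epsilon> A Phi0 phi" and k: "k \<in> modes K"
  shows "phi 0 = QN K Phi0" "hat K (phi (-1)) k = hat K (phi 0) k + complex_of_real (dt * kap k) * hat K (muN K \<epsilon> (phi 0)) k"
proof -
  show "phi 0 = QN K Phi0" using s unfolding bdf2_scheme_def Let_def by blast
  have "phi (-1) = (\<lambda>i j k. phi 0 i j k - dt * LapN K (muN K \<epsilon> (phi 0)) i j k)"
    using s unfolding bdf2_scheme_def Let_def muN_def by blast
  then show "hat K (phi (-1)) k = hat K (phi 0) k + complex_of_real (dt * kap k) * hat K (muN K \<epsilon> (phi 0)) k"
    by (simp add: hat_simps k)
qed

text \<open>V is the energy without its zero mode, W the increments stored by the two-step scheme.
  Division by \<open>kap\<close> forces the omission of the zero mode. As \<open>kap\<close> \<ge>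
  36 elsewhere, the quadratic part of V is nonnegative and V + W controls \<open>q4\<close>.\<close>

lemma energy_decay:
  assumes s: "bdf2_scheme K M dt \<epsilon> A Phi0 phi" and dt: "dt > 0" and A: "A \<ge> 0" and eps: "\<epsilon> \<le> 1"
    and n: "n \<le> M"
  defines "V \<equiv> (\<lambda>n. (\<Sum>k\<in>modes K - {0}. ((1 - \<epsilon>)/2 + (kap k)\<^sup>2/2 - kap k) * (cmod (hat K (phi n) k))\<^sup>2) + q4 K (phi n) / 4)"
  defines "W \<equiv> (\<lambda>n. \<Sum>k\<in>modes K - {0}. (kap k + 1 / (4 * kap k * dt)) * (cmod (hat K (phi n) k - hat K (phi (n-1)) k))\<^sup>2)"
  shows "V (int n) + W (int n) \<le> V 0 + W 0" "q4 K (phi (int n)) \<le> 4 * (V 0 + W 0)"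
proof -
  show le: "V (int n) + W (int n) \<le> V 0 + W 0" using n
  proof (induction n)
    case (Suc n)
    let ?n = "int n"
    let ?z = "\<lambda>k. hat K (phi (?n + 1)) k" and ?y = "\<lambda>k. hat K (phi ?n) k" and ?x = "\<lambda>k. hat K (phi (?n - 1)) k" and ?N = "\<lambda>k. hat K (nlN K (phi (?n + 1))) k"
    let ?al = "\<lambda>k. (1 - \<epsilon>)/2 + (kap k)\<^sup>2/2 - kap k" and ?be = "\<lambda>k. kap k + 1 / (4 * kap k * dt)"
    have "(\<Sum>k\<in>modes K - {0}. ?al k * ((cmod (?z k))\<^sup>2 - (cmod (?y k))\<^sup>2) + ?be k * (cmod (?z k - ?y k))\<^sup>2 - ?be k * (cmod (?y k - ?x k))\<^sup>2)
       \<le> (\<Sum>k\<in>modes K - {0}. Re (?N k * cnj (?z k - ?y k)))"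
    proof (rule sum_mono)
      fix k assume k: "k \<in> modes K - {0}"
      show "?al k * ((cmod (?z k))\<^sup>2 - (cmod (?y k))\<^sup>2) + ?be k * (cmod (?z k - ?y k))\<^sup>2 - ?be k * (cmod (?y k - ?x k))\<^sup>2 \<le> Re (?N k * cnj (?z k - ?y k))"
        by (rule energy_mode[OF _ dt A _ scheme_mode[OF s]]) (use k kap_ge[of k] eps Suc.prems in auto)
    qed
    also have "\<dots> = (\<Sum>k\<in>modes K. Re (?N k * cnj (?z k - ?y k)))"
    \<comment> \<open>The nonlinear term is a divergence, so its zero mode vanishes and may be
      restored to the sum.\<close>
    proof (rule sum.mono_neutral_left)
      show "\<forall>k\<in>modes K - (modes K - {0}). Re (?N k * cnj (?z k - ?y k)) = 0"
      proof
        fix k assume "k \<in> modes K - (modes K - {0})"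
        then have "k = 0" "k \<in> modes K" by auto
        then show "Re (?N k * cnj (?z k - ?y k)) = 0" by (simp add: hat_nlN gx_def gy_def gz_def)
      qed
    qed auto
    also have "\<dots> \<le> - (q4 K (phi (?n + 1)) - q4 K (phi ?n)) / 4" by (rule energy_pairing)
    finally have "(\<Sum>k\<in>modes K - {0}. ?al k * (cmod (?z k))\<^sup>2) - (\<Sum>k\<in>modes K - {0}. ?al k * (cmod (?y k))\<^sup>2)
        + (\<Sum>k\<in>modes K - {0}. ?be k * (cmod (?z k - ?y k))\<^sup>2) - (\<Sum>k\<in>modes K - {0}. ?be k * (cmod (?y k - ?x k))\<^sup>2)
       \<le> - (q4 K (phi (?n + 1)) - q4 K (phi ?n)) / 4"
      by (simp only: sum.distrib sum_subtractf right_diff_distrib)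
    then have "V (?n + 1) + W (?n + 1) \<le> V ?n + W ?n" unfolding V_def W_def by simp
    then show ?case using Suc by (simp add: add.commute)
  qed simp
  have nn: "0 \<le> (1 - \<epsilon>)/2 + (kap k)\<^sup>2/2 - kap k" if "k \<noteq> 0" for k
  proof -
    have "kap k * 36 \<le> kap k * kap k" using kap_ge[OF that] by (intro mult_left_mono) auto
    moreover have "0 \<le> u \<Longrightarrow> x * 36 \<le> y \<Longrightarrow> 0 \<le> x \<Longrightarrow> 0 \<le> u + y / 2 - x" for u x y :: real by linarith
    moreover have "0 \<le> (1 - \<epsilon>)/2" using eps by simp
    ultimately show ?thesis using kap_nonneg[of k] unfolding power2_eq_square by blast
  qed
  have "0 \<le> (\<Sum>k\<in>modes K - {0}. ((1 - \<epsilon>)/2 + (kap k)\<^sup>2/2 - kap k) * (cmod (hat K (phi (int n)) k))\<^sup>2)"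
    by (intro sum_nonneg mult_nonneg_nonneg nn) auto
  moreover have "0 \<le> W (int n)" unfolding W_def using dt by (intro sum_nonneg mult_nonneg_nonneg add_nonneg_nonneg) auto
  moreover have "0 \<le> u \<Longrightarrow> 0 \<le> w \<Longrightarrow> u + q / 4 + w \<le> R \<Longrightarrow> q \<le> 4 * R" for u w q R :: real by linarith
  ultimately show "q4 K (phi (int n)) \<le> 4 * (V 0 + W 0)" using le unfolding V_def by blast
qed

section \<open>Energy of the starting values, uniformly in the mesh\<close>

context spfc
begin

lemma zero_in [simp]: "0 \<in> {0..T}" using T_pos by simp

lemma phi0_weighted: "(\<Sum>k\<in>modes K. wt k ^ 8 * cmod (hat K (QN K (Phi 0)) k)) \<le> 2 * wnorm 8 (c 0)"
proof -
  have w: "wien 8 (c 0) (Phi 0)" using c_wien[OF zero_in] c0_wsum8 by (simp add: wien_def)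
  have "(\<Sum>k\<in>modes K. wt k ^ 8 * cmod (hat K (QN K (Phi 0)) k)) \<le> (\<Sum>k\<in>modes K. wt k ^ 8 * cmod (hat K (QN K (Phi 0)) k - c 0 k) + wt k ^ 8 * cmod (c 0 k))"
  proof (unfold distrib_left[symmetric], intro sum_mono mult_left_mono)
    fix k
    show "cmod (hat K (QN K (Phi 0)) k) \<le> cmod (hat K (QN K (Phi 0)) k - c 0 k) + cmod (c 0 k)"
      using norm_triangle_ineq[of "hat K (QN K (Phi 0)) k - c 0 k" "c 0 k"] by (simp only: diff_add_cancel)
  qed simp
  also have "\<dots> = (\<Sum>k\<in>modes K. wt k ^ 8 * cmod (hat K (QN K (Phi 0)) k - c 0 k)) + (\<Sum>k\<in>modes K. wt k ^ 8 * cmod (c 0 k))" by (rule sum.distrib)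
  also have "\<dots> \<le> wnorm 8 (c 0) + wnorm 8 (c 0)"
    using alias_bound[of 8 0 "c 0" "Phi 0" K] w by (intro add_mono wnorm_finite_sum_le c0_wsum8) auto
  finally show ?thesis by simp
qed

text \<open>The potential has order four, so with \<open>kap k ^ 6\<close> this is an H^10 bound on
  the samples; the weight is dictated by the term dt \<open>kap k ^ 3\<close> \<mu> of the first
  residual. The flux part has lower order and fits the Wiener scale. In the symbol bound 4225 = 64^2
  + 2 * 64 + 1.\<close>

lemma initial_mu_bound:
  "\<exists>B\<ge>0. \<forall>K. (\<Sum>k\<in>modes K. kap k ^ 6 * (cmod (hat K (muN K \<epsilon> (QN K (Phi 0))) k))\<^sup>2) \<le> B"
proof -
  obtain B10 where B10: "\<And>F. finite F \<Longrightarrow> (\<Sum>k\<in>F. wt k ^ (2 * 10) * (cmod (c 0 k))\<^sup>2) \<le> B10" using c0_H10 by blast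
  define S where "S = 2 * wnorm 8 (c 0)"
  define F where "F = 18 * (2 * pi * S) ^ 3"
  define C where "C = 6 ^ (2 * 10) * wt4sum * B10"
  let ?B = "2 * (64 ^ 3 * 8)\<^sup>2 * F\<^sup>2 + 2 * (64 ^ 3 * 4225)\<^sup>2 * C"
  have main: "(\<Sum>k\<in>modes K. kap k ^ 6 * (cmod (hat K (muN K \<epsilon> (QN K (Phi 0))) k))\<^sup>2) \<le> ?B" for K
  proof -
    let ?p = "QN K (Phi 0)"
    let ?u = "\<lambda>k. wt k ^ 7 * cmod (hat K (FxN K ?p) k) + wt k ^ 7 * cmod (hat K (FyN K ?p) k) + wt k ^ 7 * cmod (hat K (FzN K ?p) k)"
    let ?v = "\<lambda>k. wt k ^ 10 * cmod (hat K ?p k)"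
    have mode: "kap k ^ 6 * (cmod (hat K (muN K \<epsilon> ?p) k))\<^sup>2 \<le> 2 * (64 ^ 3 * 8)\<^sup>2 * (?u k)\<^sup>2 + 2 * (64 ^ 3 * 4225)\<^sup>2 * (wt k ^ (2 * 10) * (cmod (hat K ?p k))\<^sup>2)" if k: "k \<in> modes K" for k
    proof -
      let ?f = "cmod (hat K (FxN K ?p) k) + cmod (hat K (FyN K ?p) k) + cmod (hat K (FzN K ?p) k)"
      have k3: "kap k ^ 3 \<le> 64 ^ 3 * wt k ^ 6"
        using power_mono[OF kap_le_wt kap_nonneg, of k 3] by (simp add: power_mult_distrib power_mult[symmetric])
      have n: "cmod (hat K (nlN K ?p) k) \<le> 8 * wt k * ?f"
      proof -
        have p: "2 * pi * wt k * x \<le> 8 * wt k * x" if "x \<ge> 0" for x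
          using pi_less_4 that by (intro mult_right_mono) auto
        have "cmod (hat K (nlN K ?p) k) \<le> cmod (gx (hat K (FxN K ?p)) k) + cmod (gy (hat K (FyN K ?p)) k) + cmod (gz (hat K (FzN K ?p)) k)"
          unfolding hat_nlN[OF k] using norm_triangle_ineq[of "gx (hat K (FxN K ?p)) k + gy (hat K (FyN K ?p)) k" "gz (hat K (FzN K ?p)) k"]
            norm_triangle_ineq[of "gx (hat K (FxN K ?p)) k" "gy (hat K (FyN K ?p)) k"] by linarith
        also have "\<dots> \<le> 8 * wt k * cmod (hat K (FxN K ?p) k) + 8 * wt k * cmod (hat K (FyN K ?p) k) + 8 * wt k * cmod (hat K (FzN K ?p) k)"
          by (intro add_mono order_trans[OF norm_g_le(1) p] order_trans[OF norm_g_le(2) p] order_trans[OF norm_g_le(3) p]) auto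
        finally show ?thesis by (simp add: distrib_left)
      qed
      have l: "\<bar>1 - \<epsilon> - 2 * kap k + (kap k)\<^sup>2\<bar> \<le> 4225 * wt k ^ 4"
      proof -
        have w: "wt k ^ 2 \<le> wt k ^ 4" by (rule wt_pow_mono) simp
        have "kap k \<le> 64 * wt k ^ 4" using kap_le_wt[of k] w by linarith
        moreover have "(kap k)\<^sup>2 \<le> 4096 * wt k ^ 4"
          using power_mono[OF kap_le_wt kap_nonneg, of k 2] by (simp add: power_mult_distrib power_mult[symmetric])
        ultimately show ?thesis using eps wt_pow_ge_1[of k 4] kap_nonneg[of k] zero_le_power2[of "kap k"] by linarith
      qed
      have "kap k ^ 3 * cmod (hat K (muN K \<epsilon> ?p) k) \<le> (64 ^ 3 * wt k ^ 6) * (8 * wt k * ?f + 4225 * wt k ^ 4 * cmod (hat K ?p k))"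
      proof (rule mult_mono[OF k3])
        have "cmod (hat K (muN K \<epsilon> ?p) k) \<le> cmod (hat K (nlN K ?p) k) + \<bar>1 - \<epsilon> - 2 * kap k + (kap k)\<^sup>2\<bar> * cmod (hat K ?p k)"
          unfolding hat_muN[OF k] using norm_triangle_ineq[of "- hat K (nlN K ?p) k" "complex_of_real (1 - \<epsilon> - 2 * kap k + (kap k)\<^sup>2) * hat K ?p k"]
          by (simp only: norm_minus_cancel norm_mult norm_of_real)
        also have "\<dots> \<le> 8 * wt k * ?f + 4225 * wt k ^ 4 * cmod (hat K ?p k)"
          by (intro add_mono n mult_right_mono l) simp
        finally show "cmod (hat K (muN K \<epsilon> ?p) k) \<le> 8 * wt k * ?f + 4225 * wt k ^ 4 * cmod (hat K ?p k)" .
      qed auto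
      also have "\<dots> = 64 ^ 3 * 8 * ((wt k ^ 6 * wt k) * ?f) + 64 ^ 3 * 4225 * ((wt k ^ 6 * wt k ^ 4) * cmod (hat K ?p k))"
        by (simp only: distrib_left mult_ac)
      also have "\<dots> = 64 ^ 3 * 8 * ?u k + 64 ^ 3 * 4225 * ?v k"
        by (simp only: power_add[symmetric] power_Suc2[symmetric] distrib_left) simp
      finally have "(kap k ^ 3 * cmod (hat K (muN K \<epsilon> ?p) k))\<^sup>2 \<le> (64 ^ 3 * 8 * ?u k + 64 ^ 3 * 4225 * ?v k)\<^sup>2"
        by (intro power_mono) auto
      also have "\<dots> \<le> 2 * (64 ^ 3 * 8 * ?u k)\<^sup>2 + 2 * (64 ^ 3 * 4225 * ?v k)\<^sup>2"
      proof -
        have "(x + y)\<^sup>2 \<le> 2 * x\<^sup>2 + 2 * y\<^sup>2" for x y :: real using zero_le_power2[of "x - y"] by (simp add: power2_eq_square algebra_simps)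
        then show ?thesis .
      qed
      finally show ?thesis by (simp only: power_mult_distrib power_mult[symmetric] mult.assoc) simp
    qed
    have "(\<Sum>k\<in>modes K. kap k ^ 6 * (cmod (hat K (muN K \<epsilon> ?p) k))\<^sup>2) \<le> 2 * (64 ^ 3 * 8)\<^sup>2 * (\<Sum>k\<in>modes K. (?u k)\<^sup>2) + 2 * (64 ^ 3 * 4225)\<^sup>2 * (\<Sum>k\<in>modes K. wt k ^ (2 * 10) * (cmod (hat K ?p k))\<^sup>2)"
      unfolding sum_distrib_left sum.distrib[symmetric] by (rule sum_mono[OF mode])
    also have "\<dots> \<le> ?B"
    proof (intro add_mono mult_left_mono)
      have "(\<Sum>k\<in>modes K. (?u k)\<^sup>2) \<le> (\<Sum>k\<in>modes K. ?u k)\<^sup>2" by (rule sum_square_le_square_sum) simp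
      also have "\<dots> \<le> F\<^sup>2"
      proof (rule power_mono)
        let ?S = "\<Sum>k\<in>modes K. wt k ^ Suc 7 * cmod (hat K ?p k)"
        have S: "0 \<le> ?S" "?S \<le> S" using phi0_weighted[of K] by (auto simp: S_def intro!: sum_nonneg)
        have "(\<Sum>k\<in>modes K. ?u k) \<le> 18 * (2 * pi * ?S) ^ 3"
          unfolding sum.distrib using discrete_flux_wnorm[of 7 K ?p] by linarith
        also have "\<dots> \<le> F" unfolding F_def using S by (intro mult_left_mono power_mono) auto
        finally show "(\<Sum>k\<in>modes K. ?u k) \<le> F" .
      qed (auto intro!: sum_nonneg add_nonneg_nonneg)
      finally show "(\<Sum>k\<in>modes K. (?u k)\<^sup>2) \<le> F\<^sup>2" .
      show "(\<Sum>k\<in>modes K. wt k ^ (2 * 10) * (cmod (hat K ?p k))\<^sup>2) \<le> C"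
        unfolding C_def by (rule alias_l2_bound[OF wien_mono[OF c_wien[OF zero_in]]]) (use B10 in auto)
    qed auto
    finally show ?thesis .
  qed
  moreover have "0 \<le> ?B" using main[of 0] by (rule order_trans[rotated]) (auto intro!: sum_nonneg)
  ultimately show ?thesis by blast
qed

text \<open>The stored increments carry a factor 1 / dt, but the ghost increment is dt
  \<open>kap k\<close> \<mu>, so at the start they are of order dt and bounded by
  \<open>initial_mu_bound\<close>. One Q serves all K, M and A.\<close>

lemma q4_bound:
  "\<exists>Q\<ge>0. \<forall>K M A phi n. M > 0 \<longrightarrow> A \<ge> 0 \<longrightarrow> bdf2_scheme K M (T / real M) \<epsilon> A (Phi 0) phi \<longrightarrow> n \<le> M \<longrightarrow> q4 K (phi (int n)) \<le> Q"
proof -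
  obtain B where B: "B \<ge> 0" "\<And>K. (\<Sum>k\<in>modes K. kap k ^ 6 * (cmod (hat K (muN K \<epsilon> (QN K (Phi 0))) k))\<^sup>2) \<le> B"
    using initial_mu_bound by blast
  define S where "S = 2 * wnorm 8 (c 0)"
  let ?Q = "4 * ((4097 * S\<^sup>2 + (12 * pi\<^sup>2 * S\<^sup>2)\<^sup>2 / 4) + (T\<^sup>2 + T) * B)"
  have "q4 K (phi (int n)) \<le> ?Q"
    if M: "M > 0" and A: "A \<ge> 0" and s: "bdf2_scheme K M (T / real M) \<epsilon> A (Phi 0) phi" and n: "n \<le> M" for K M A phi n
  proof -
    let ?dt = "T / real M"
    have dt: "?dt > 0" "?dt \<le> T" using M T_pos by (auto simp: divide_le_eq)
    have p0: "phi 0 = QN K (Phi 0)" using scheme_start(1)[OF s, of 0] by (simp add: modes_def zero_prod_def)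
    let ?V = "(\<Sum>k\<in>modes K - {0}. ((1 - \<epsilon>)/2 + (kap k)\<^sup>2/2 - kap k) * (cmod (hat K (phi 0) k))\<^sup>2) + q4 K (phi 0) / 4"
    let ?W = "\<Sum>k\<in>modes K - {0}. (kap k + 1 / (4 * kap k * ?dt)) * (cmod (hat K (phi 0) k - hat K (phi (0-1)) k))\<^sup>2"
    have "q4 K (phi (int n)) \<le> 4 * (?V + ?W)"
      using energy_decay(2)[OF s dt(1) A _ n] eps by simp
    also have "\<dots> \<le> ?Q"
    proof (intro mult_left_mono add_mono)
      have S1: "(\<Sum>k\<in>modes K. wt k ^ 2 * cmod (hat K (phi 0) k)) \<le> S" "(\<Sum>k\<in>modes K. wt k * cmod (hat K (phi 0) k)) \<le> S"
      proof -
        have "(\<Sum>k\<in>modes K. wt k ^ s * cmod (hat K (phi 0) k)) \<le> (\<Sum>k\<in>modes K. wt k ^ 8 * cmod (hat K (phi 0) k))" if "s \<le> 8" for s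
          by (intro sum_mono mult_right_mono wt_pow_mono that) simp
        from this[of 2] this[of 1] show "(\<Sum>k\<in>modes K. wt k ^ 2 * cmod (hat K (phi 0) k)) \<le> S" "(\<Sum>k\<in>modes K. wt k * cmod (hat K (phi 0) k)) \<le> S"
          using phi0_weighted[of K] unfolding p0 S_def by simp_all
      qed
      have "(\<Sum>k\<in>modes K - {0}. ((1 - \<epsilon>)/2 + (kap k)\<^sup>2/2 - kap k) * (cmod (hat K (phi 0) k))\<^sup>2) \<le> (\<Sum>k\<in>modes K - {0}. 4097 * (wt k ^ 2 * cmod (hat K (phi 0) k))\<^sup>2)"
      proof (rule sum_mono)
        fix k
        have k2: "(kap k)\<^sup>2 \<le> 4096 * wt k ^ 4"
          using power_mono[OF kap_le_wt kap_nonneg, of k 2] by (simp add: power_mult_distrib power_mult[symmetric])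
        have "(1 - \<epsilon>)/2 + (kap k)\<^sup>2/2 - kap k \<le> 4097 * wt k ^ 4"
        proof -
          have "(1 - \<epsilon>)/2 \<le> 1" "(kap k)\<^sup>2 / 2 \<le> (kap k)\<^sup>2" using eps by simp_all
          moreover have "x \<le> 1 \<Longrightarrow> y \<le> z \<Longrightarrow> z \<le> 4096 * w \<Longrightarrow> 1 \<le> w \<Longrightarrow> 0 \<le> v \<Longrightarrow> x + y - v \<le> 4097 * w" for x y z w v :: real by linarith
          ultimately show ?thesis using k2 wt_pow_ge_1[of k 4] kap_nonneg[of k] by blast
        qed
        then have "((1 - \<epsilon>)/2 + (kap k)\<^sup>2/2 - kap k) * (cmod (hat K (phi 0) k))\<^sup>2 \<le> 4097 * wt k ^ 4 * (cmod (hat K (phi 0) k))\<^sup>2"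
          by (rule mult_right_mono) simp
        then show "((1 - \<epsilon>)/2 + (kap k)\<^sup>2/2 - kap k) * (cmod (hat K (phi 0) k))\<^sup>2 \<le> 4097 * (wt k ^ 2 * cmod (hat K (phi 0) k))\<^sup>2"
          by (simp add: power_mult_distrib power_mult[symmetric] mult.assoc)
      qed
      also have "\<dots> \<le> (\<Sum>k\<in>modes K. 4097 * (wt k ^ 2 * cmod (hat K (phi 0) k))\<^sup>2)" by (rule sum_mono2) auto
      also have "\<dots> = 4097 * (\<Sum>k\<in>modes K. (wt k ^ 2 * cmod (hat K (phi 0) k))\<^sup>2)" by (simp only: sum_distrib_left)
      also have "\<dots> \<le> 4097 * S\<^sup>2"
      proof (rule mult_left_mono)
        have "(\<Sum>k\<in>modes K. (wt k ^ 2 * cmod (hat K (phi 0) k))\<^sup>2) \<le> (\<Sum>k\<in>modes K. wt k ^ 2 * cmod (hat K (phi 0) k))\<^sup>2" by (rule sum_square_le_square_sum) simp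
        also have "\<dots> \<le> S\<^sup>2" by (intro power_mono S1(1) sum_nonneg) simp
        finally show "(\<Sum>k\<in>modes K. (wt k ^ 2 * cmod (hat K (phi 0) k))\<^sup>2) \<le> S\<^sup>2" .
      qed simp
      finally show "(\<Sum>k\<in>modes K - {0}. ((1 - \<epsilon>)/2 + (kap k)\<^sup>2/2 - kap k) * (cmod (hat K (phi 0) k))\<^sup>2) \<le> 4097 * S\<^sup>2" .
      show "q4 K (phi 0) / 4 \<le> (12 * pi\<^sup>2 * S\<^sup>2)\<^sup>2 / 4" using q4_le_sup[OF S1(2)] by simp
      have "?W \<le> (\<Sum>k\<in>modes K - {0}. (T\<^sup>2 + T) * (kap k ^ 6 * (cmod (hat K (muN K \<epsilon> (QN K (Phi 0))) k))\<^sup>2))"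
      proof (rule sum_mono)
        fix k assume k: "k \<in> modes K - {0}"
        let ?m = "(cmod (hat K (muN K \<epsilon> (QN K (Phi 0))) k))\<^sup>2"
        have kk: "kap k \<ge> 36" using kap_ge k by blast
        have "hat K (phi 0) k - hat K (phi (0-1)) k = - (complex_of_real (?dt * kap k) * hat K (muN K \<epsilon> (QN K (Phi 0))) k)"
          using scheme_start[OF s, of k] k by simp
        then have e: "(cmod (hat K (phi 0) k - hat K (phi (0-1)) k))\<^sup>2 = ?dt\<^sup>2 * (kap k)\<^sup>2 * ?m"
          by (simp only: norm_minus_cancel norm_mult norm_of_real power_mult_distrib power2_abs)
        have "(\<kappa> + 1 / (4 * \<kappa> * \<tau>)) * (\<tau>\<^sup>2 * \<kappa>\<^sup>2 * x) = (\<tau>\<^sup>2 * \<kappa> ^ 3 + \<tau> * \<kappa> / 4) * x" if "\<kappa> > 0" "\<tau> > 0" for \<kappa> \<tau> x :: real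
          using that by (simp add: field_simps power2_eq_square power3_eq_cube)
        from this[OF _ dt(1), of "kap k" ?m]
        have "(kap k + 1 / (4 * kap k * ?dt)) * (?dt\<^sup>2 * (kap k)\<^sup>2 * ?m) = (?dt\<^sup>2 * kap k ^ 3 + ?dt * kap k / 4) * ?m"
          using kk by simp
        also have "\<dots> \<le> ((T\<^sup>2 + T) * kap k ^ 6) * ?m"
        proof (rule mult_right_mono)
          have p: "kap k ^ 3 \<le> kap k ^ 6" "kap k ^ 1 \<le> kap k ^ 6" using kk by (intro power_increasing; simp)+
          have "?dt\<^sup>2 * kap k ^ 3 \<le> T\<^sup>2 * kap k ^ 6" using dt p(1) kk by (intro mult_mono power_mono) auto
          moreover have "?dt * kap k \<le> T * kap k ^ 6" using dt p(2) kk T_pos by (intro mult_mono) auto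
          moreover have "x / 4 \<le> x" if "0 \<le> x" for x :: real using that by simp
          from this[of "?dt * kap k"] have "?dt * kap k / 4 \<le> ?dt * kap k" using dt kk by simp
          ultimately show "?dt\<^sup>2 * kap k ^ 3 + ?dt * kap k / 4 \<le> (T\<^sup>2 + T) * kap k ^ 6"
            unfolding distrib_right by (intro add_mono) (assumption, rule order_trans)
        qed simp
        finally show "(kap k + 1 / (4 * kap k * ?dt)) * (cmod (hat K (phi 0) k - hat K (phi (0-1)) k))\<^sup>2 \<le> (T\<^sup>2 + T) * (kap k ^ 6 * ?m)"
          unfolding e by (simp only: mult.assoc)
      qed
      also have "\<dots> \<le> (\<Sum>k\<in>modes K. (T\<^sup>2 + T) * (kap k ^ 6 * (cmod (hat K (muN K \<epsilon> (QN K (Phi 0))) k))\<^sup>2))"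
        using T_pos by (intro sum_mono2) auto
      also have "\<dots> \<le> (T\<^sup>2 + T) * B"
        unfolding sum_distrib_left[symmetric] using B(2)[of K] T_pos by (intro mult_left_mono) auto
      finally show "?W \<le> (T\<^sup>2 + T) * B" .
    qed simp
    finally show ?thesis .
  qed
  moreover have "0 \<le> ?Q" using B(1) T_pos by simp
  ultimately show ?thesis by blast
qed

end

section \<open>Error estimate\<close>

text \<open>Off a large finite set of frequencies the sum of \<open>1 / wt k ^ 4\<close> is small,
  and Cauchy-Schwarz gives a small multiple of the third-order norm; on the finite set the l2 norm
  suffices. The set is independent of K, hence so is C.\<close>

lemma wt_interpolation:
  assumes "\<delta> > 0"
  shows "\<exists>C\<ge>0. \<forall>K (u :: freq \<Rightarrow> complex).
    (\<Sum>k\<in>modes K. wt k * cmod (u k))\<^sup>2 \<le> \<delta> * (\<Sum>k\<in>modes K. kap k ^ 3 * (cmod (u k))\<^sup>2) + C * (\<Sum>k\<in>modes K. (cmod (u k))\<^sup>2)"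
proof -
  obtain F0 where F0: "finite F0" "dist (\<Sum>k\<in>F0. 1 / wt k ^ 4) wt4sum \<le> \<delta> / 2"
    using infsum_finite_approximation[OF summable_on_wt, of "\<delta> / 2"] assms unfolding wt4sum_def by auto
  \<comment> \<open>The zero mode goes to the finite part because \<open>kap 0 = 0\<close> cannot
    control it.\<close>
  define F1 where "F1 = insert 0 F0"
  have fF: "finite F1" using F0 by (simp add: F1_def)
  define C0 where "C0 = (\<Sum>k\<in>F1. (wt k)\<^sup>2)"
  have C0: "C0 \<ge> 0" unfolding C0_def by (intro sum_nonneg) simp
  have "(\<Sum>k\<in>modes K. wt k * cmod (u k))\<^sup>2 \<le> \<delta> * (\<Sum>k\<in>modes K. kap k ^ 3 * (cmod (u k))\<^sup>2) + (2 * C0) * (\<Sum>k\<in>modes K. (cmod (u k))\<^sup>2)"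
    for K and u :: "freq \<Rightarrow> complex"
  proof -
    let ?G = "modes K - F1" and ?L = "modes K \<inter> F1"
    let ?X = "\<Sum>k\<in>modes K. kap k ^ 3 * (cmod (u k))\<^sup>2" and ?Y = "\<Sum>k\<in>modes K. (cmod (u k))\<^sup>2"
    have tail: "(\<Sum>k\<in>?G. 1 / wt k ^ 4) \<le> \<delta> / 2"
    proof -
      have "(\<Sum>k\<in>?G. 1 / wt k ^ 4) + (\<Sum>k\<in>F0. 1 / wt k ^ 4) = (\<Sum>k\<in>?G \<union> F0. 1 / wt k ^ 4)"
        using F0 by (intro sum.union_disjoint[symmetric]) (auto simp: F1_def)
      also have "\<dots> \<le> wt4sum" using F0 by (intro sum_wt4_le) simp
      finally show ?thesis using F0(2) unfolding dist_real_def by linarith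
    qed
    have hi: "(\<Sum>k\<in>?G. wt k * cmod (u k))\<^sup>2 \<le> \<delta> / 2 * ?X"
    proof -
      have e: "wt k * cmod (u k) = (1 / wt k ^ 2) * (wt k ^ 3 * cmod (u k))" for k
        using wt_pos[of k] by (simp add: power2_eq_square power3_eq_cube)
      have "(\<Sum>k\<in>?G. wt k * cmod (u k))\<^sup>2 \<le> (\<Sum>k\<in>?G. (1 / wt k ^ 2)\<^sup>2) * (\<Sum>k\<in>?G. (wt k ^ 3 * cmod (u k))\<^sup>2)"
        unfolding e by (rule Cauchy_Schwarz_ineq_sum)
      also have "(\<Sum>k\<in>?G. (1 / wt k ^ 2)\<^sup>2) = (\<Sum>k\<in>?G. 1 / wt k ^ 4)" by (simp add: power_divide power_mult[symmetric])
      also have "(\<Sum>k\<in>?G. 1 / wt k ^ 4) * (\<Sum>k\<in>?G. (wt k ^ 3 * cmod (u k))\<^sup>2) \<le> \<delta> / 2 * ?X"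
      proof (rule mult_mono[OF tail])
        have "(\<Sum>k\<in>?G. (wt k ^ 3 * cmod (u k))\<^sup>2) \<le> (\<Sum>k\<in>?G. kap k ^ 3 * (cmod (u k))\<^sup>2)"
        proof (rule sum_mono)
          fix k assume "k \<in> ?G"
          then have "k \<noteq> 0" by (auto simp: F1_def)
          from power_mono[OF wt_sq_le_kap[OF this], of 3] have "wt k ^ 6 \<le> kap k ^ 3" by (simp add: power_mult[symmetric])
          from mult_right_mono[OF this, of "(cmod (u k))\<^sup>2"] show "(wt k ^ 3 * cmod (u k))\<^sup>2 \<le> kap k ^ 3 * (cmod (u k))\<^sup>2"
            by (simp add: power_mult_distrib power_mult[symmetric])
        qed
        also have "\<dots> \<le> ?X" by (rule sum_mono2) auto
        finally show "(\<Sum>k\<in>?G. (wt k ^ 3 * cmod (u k))\<^sup>2) \<le> ?X" .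
      qed (use assms in \<open>auto intro!: sum_nonneg\<close>)
      finally show ?thesis .
    qed
    have lo: "(\<Sum>k\<in>?L. wt k * cmod (u k))\<^sup>2 \<le> C0 * ?Y"
    proof -
      have "(\<Sum>k\<in>?L. wt k * cmod (u k))\<^sup>2 \<le> (\<Sum>k\<in>?L. (wt k)\<^sup>2) * (\<Sum>k\<in>?L. (cmod (u k))\<^sup>2)" by (rule Cauchy_Schwarz_ineq_sum)
      also have "\<dots> \<le> C0 * ?Y" unfolding C0_def using fF by (intro mult_mono sum_mono2) (auto intro!: sum_nonneg)
      finally show ?thesis .
    qed
    have "(\<Sum>k\<in>modes K. wt k * cmod (u k)) = (\<Sum>k\<in>?L. wt k * cmod (u k)) + (\<Sum>k\<in>?G. wt k * cmod (u k))"
      by (rule sum.Int_Diff) simp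
    moreover have "(x + y)\<^sup>2 \<le> 2 * x\<^sup>2 + 2 * y\<^sup>2" for x y :: real using zero_le_power2[of "x - y"] by (simp add: power2_eq_square algebra_simps)
    ultimately have "(\<Sum>k\<in>modes K. wt k * cmod (u k))\<^sup>2 \<le> 2 * (\<Sum>k\<in>?L. wt k * cmod (u k))\<^sup>2 + 2 * (\<Sum>k\<in>?G. wt k * cmod (u k))\<^sup>2" by (simp only:)
    also have "\<dots> \<le> 2 * (C0 * ?Y) + 2 * (\<delta> / 2 * ?X)" using hi lo by (intro add_mono mult_left_mono) auto
    finally show ?thesis by simp
  qed
  then show ?thesis using C0 by (intro exI[of _ "2 * C0"]) auto
qed

text \<open>In contrast to \<open>cubic_lipschitz\<close>, no bound on p or r is assumed: the
  maximum norm s falls on the difference only, and what remains is of fourth order in the gradients,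
  which the energy controls after summation over the grid.\<close>

lemma cubic_difference:
  fixes p1 p2 p3 r1 r2 r3 u v s :: real
  assumes "\<bar>p1 - r1\<bar> \<le> s" "\<bar>p2 - r2\<bar> \<le> s" "\<bar>p3 - r3\<bar> \<le> s" "\<bar>u - v\<bar> \<le> s" "v\<^sup>2 \<le> r1\<^sup>2 + r2\<^sup>2 + r3\<^sup>2"
  defines "P \<equiv> p1\<^sup>2 + p2\<^sup>2 + p3\<^sup>2" and "R \<equiv> r1\<^sup>2 + r2\<^sup>2 + r3\<^sup>2"
  shows "(P * u - R * v)\<^sup>2 \<le> 32 * s\<^sup>2 * (P\<^sup>2 + R\<^sup>2)"
proof -
  have s0: "s \<ge> 0" by (rule order_trans[OF abs_ge_zero assms(1)])
  have P0: "P \<ge> 0" and R0: "R \<ge> 0" by (auto simp: P_def R_def)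
  have tm: "\<bar>(p\<^sup>2 - r\<^sup>2) * v\<bar> \<le> s * (p\<^sup>2 + r\<^sup>2 + v\<^sup>2 / 2)" if "\<bar>p - r\<bar> \<le> s" for p r
  proof -
    have "0 \<le> (\<bar>p + r\<bar> - \<bar>v\<bar>)\<^sup>2" by simp
    then have 1: "\<bar>p + r\<bar> * \<bar>v\<bar> \<le> ((p + r)\<^sup>2 + v\<^sup>2) / 2" by (simp add: power2_diff)
    have 2: "(p + r)\<^sup>2 \<le> 2 * p\<^sup>2 + 2 * r\<^sup>2" using zero_le_power2[of "p - r"] by (simp add: power2_eq_square algebra_simps)
    have "\<bar>(p\<^sup>2 - r\<^sup>2) * v\<bar> = \<bar>p - r\<bar> * (\<bar>p + r\<bar> * \<bar>v\<bar>)" by (simp add: power2_eq_square abs_mult[symmetric] algebra_simps)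
    also have "\<dots> \<le> s * (p\<^sup>2 + r\<^sup>2 + v\<^sup>2 / 2)"
    proof (rule mult_mono[OF that])
      have "((p + r)\<^sup>2 + v\<^sup>2) / 2 \<le> (2 * p\<^sup>2 + 2 * r\<^sup>2 + v\<^sup>2) / 2" using 2 by (intro divide_right_mono) auto
      with 1 show "\<bar>p + r\<bar> * \<bar>v\<bar> \<le> p\<^sup>2 + r\<^sup>2 + v\<^sup>2 / 2" by (simp add: add_divide_distrib)
    qed (use s0 in auto)
    finally show ?thesis .
  qed
  have "\<bar>P * u - R * v\<bar> \<le> \<bar>P * (u - v)\<bar> + (\<bar>(p1\<^sup>2 - r1\<^sup>2) * v\<bar> + \<bar>(p2\<^sup>2 - r2\<^sup>2) * v\<bar> + \<bar>(p3\<^sup>2 - r3\<^sup>2) * v\<bar>)"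
  proof -
    have e: "P * u - R * v = P * (u - v) + ((p1\<^sup>2 - r1\<^sup>2) * v + (p2\<^sup>2 - r2\<^sup>2) * v + (p3\<^sup>2 - r3\<^sup>2) * v)"
      by (simp add: P_def R_def algebra_simps)
    have "\<bar>a + (b + c + d)\<bar> \<le> \<bar>a\<bar> + (\<bar>b\<bar> + \<bar>c\<bar> + \<bar>d\<bar>)" for a b c d :: real by linarith
    then show ?thesis unfolding e .
  qed
  also have "\<dots> \<le> P * s + (s * (p1\<^sup>2 + r1\<^sup>2 + v\<^sup>2 / 2) + s * (p2\<^sup>2 + r2\<^sup>2 + v\<^sup>2 / 2) + s * (p3\<^sup>2 + r3\<^sup>2 + v\<^sup>2 / 2))"
    using assms(4) P0 by (intro add_mono tm assms) (auto simp: abs_mult intro!: mult_left_mono)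
  also have "\<dots> = s * (2 * P + R + 3/2 * v\<^sup>2)" by (simp add: P_def R_def algebra_simps)
  also have "\<dots> \<le> s * (4 * (P + R))"
    using assms(5) P0 R0 s0 unfolding R_def[symmetric] by (intro mult_left_mono) auto
  finally have "\<bar>P * u - R * v\<bar>\<^sup>2 \<le> (s * (4 * (P + R)))\<^sup>2" by (rule power_mono) simp
  also have "\<dots> = s\<^sup>2 * (16 * (P + R)\<^sup>2)" by (simp only: power_mult_distrib) (simp add: power2_eq_square)
  also have "\<dots> \<le> s\<^sup>2 * (16 * (2 * (P\<^sup>2 + R\<^sup>2)))"
    using zero_le_power2[of "P - R"] by (intro mult_left_mono) (simp_all add: power2_eq_square algebra_simps)
  also have "\<dots> = 32 * s\<^sup>2 * (P\<^sup>2 + R\<^sup>2)" by (simp add: algebra_simps)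
  finally show ?thesis by simp
qed

lemma flux_difference:
  fixes f g :: grid and K :: nat
  defines "s \<equiv> 2 * pi * (\<Sum>k\<in>modes K. wt k * cmod (hat K f k - hat K g k))"
  shows "(\<Sum>k\<in>modes K. (cmod (hat K (FxN K f) k - hat K (FxN K g) k))\<^sup>2) \<le> 32 * s\<^sup>2 * (q4 K f + q4 K g)"
    "(\<Sum>k\<in>modes K. (cmod (hat K (FyN K f) k - hat K (FyN K g) k))\<^sup>2) \<le> 32 * s\<^sup>2 * (q4 K f + q4 K g)"
    "(\<Sum>k\<in>modes K. (cmod (hat K (FzN K f) k - hat K (FzN K g) k))\<^sup>2) \<le> 32 * s\<^sup>2 * (q4 K f + q4 K g)"
proof -
  have sup: "\<bar>gv F p - gv G p\<bar> \<le> s" if p: "p \<in> cell K"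
    and h: "\<And>k. k \<in> modes K \<Longrightarrow> cmod (hat K F k - hat K G k) \<le> 2 * pi * wt k * cmod (hat K f k - hat K g k)" for F G p
  proof -
    have "\<bar>gv (\<lambda>i j k. F i j k - G i j k) p\<bar> \<le> (\<Sum>k\<in>modes K. cmod (hat K (\<lambda>i j k. F i j k - G i j k) k))"
      by (rule gv_abs_le[OF p])
    also have "\<dots> \<le> (\<Sum>k\<in>modes K. 2 * pi * wt k * cmod (hat K f k - hat K g k))" unfolding hat_diff by (rule sum_mono[OF h])
    also have "\<dots> = s" by (simp add: s_def sum_distrib_left mult.assoc)
    finally show ?thesis by (simp add: gv_def)
  qed
  have lin: "cmod (gx u k - gx v k) \<le> 2 * pi * wt k * cmod (u k - v k)" "cmod (gy u k - gy v k) \<le> 2 * pi * wt k * cmod (u k - v k)"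
    "cmod (gz u k - gz v k) \<le> 2 * pi * wt k * cmod (u k - v k)" for u v k
    using norm_g_le[of "\<lambda>k. u k - v k" k] by (simp_all add: gx_def gy_def gz_def right_diff_distrib)
  have sx: "\<bar>gv (DxN K f) p - gv (DxN K g) p\<bar> \<le> s" if "p \<in> cell K" for p by (rule sup[OF that]) (simp only: hat_D lin)
  have sy: "\<bar>gv (DyN K f) p - gv (DyN K g) p\<bar> \<le> s" if "p \<in> cell K" for p by (rule sup[OF that]) (simp only: hat_D lin)
  have sz: "\<bar>gv (DzN K f) p - gv (DzN K g) p\<bar> \<le> s" if "p \<in> cell K" for p by (rule sup[OF that]) (simp only: hat_D lin)
  have gen: "(\<Sum>k\<in>modes K. (cmod (hat K F k - hat K G k))\<^sup>2) \<le> 32 * s\<^sup>2 * (q4 K f + q4 K g)"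
    if h: "\<And>p. p \<in> cell K \<Longrightarrow> (gv F p - gv G p)\<^sup>2 \<le> 32 * s\<^sup>2 * ((gradsq K f p)\<^sup>2 + (gradsq K g p)\<^sup>2)" for F G
  proof -
    let ?D = "\<lambda>i j k. F i j k - G i j k"
    have "(\<Sum>k\<in>modes K. (cmod (hat K F k - hat K G k))\<^sup>2) = gip K ?D ?D" unfolding gip_self hat_diff ..
    also have "\<dots> = hh K ^ 3 * (\<Sum>p\<in>cell K. (gv F p - gv G p)\<^sup>2)" by (simp add: gip_def gv_def power2_eq_square)
    also have "\<dots> \<le> hh K ^ 3 * (\<Sum>p\<in>cell K. 32 * s\<^sup>2 * ((gradsq K f p)\<^sup>2 + (gradsq K g p)\<^sup>2))"
      using hh_pos[of K] by (intro mult_left_mono sum_mono h) auto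
    also have "\<dots> = 32 * s\<^sup>2 * (q4 K f + q4 K g)"
      by (simp only: q4_def sum_distrib_left[symmetric] sum.distrib distrib_left mult_ac)
    finally show ?thesis .
  qed
  show "(\<Sum>k\<in>modes K. (cmod (hat K (FxN K f) k - hat K (FxN K g) k))\<^sup>2) \<le> 32 * s\<^sup>2 * (q4 K f + q4 K g)"
    "(\<Sum>k\<in>modes K. (cmod (hat K (FyN K f) k - hat K (FyN K g) k))\<^sup>2) \<le> 32 * s\<^sup>2 * (q4 K f + q4 K g)"
    "(\<Sum>k\<in>modes K. (cmod (hat K (FzN K f) k - hat K (FzN K g) k))\<^sup>2) \<le> 32 * s\<^sup>2 * (q4 K f + q4 K g)"
    by (rule gen, unfold gv_F gradsq_def, rule cubic_difference, simp_all only: sx sy sz, simp)+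
qed

section \<open>Error equation and energy estimates for single modes\<close>

lemma error_equation:
  fixes \<phi>z \<phi>y \<phi>x cz cy cx n nc \<kappa> a b :: complex
  assumes "(3/2 * \<phi>z - 2 * \<phi>y + 1/2 * \<phi>x) / dt =
      - \<kappa> * (- n + a * \<phi>z - 2 * (\<kappa> * (2 * \<phi>y - \<phi>x)) + b * (\<phi>z - \<phi>y) + \<kappa>2 * \<phi>z)"
  shows "(3/2 * (cz - \<phi>z) - 2 * (cy - \<phi>y) + 1/2 * (cx - \<phi>x)) / dt =
      - \<kappa> * (- (nc - n) + a * (cz - \<phi>z) - 2 * (\<kappa> * (2 * (cy - \<phi>y) - (cx - \<phi>x))) + b * ((cz - \<phi>z) - (cy - \<phi>y)) + \<kappa>2 * (cz - \<phi>z))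
      + ((3/2 * cz - 2 * cy + 1/2 * cx) / dt + \<kappa> * (- nc + a * cz - 2 * (\<kappa> * (2 * cy - cx)) + b * (cz - cy) + \<kappa>2 * cz))"
proof -
  have "(3/2 * (cz - \<phi>z) - 2 * (cy - \<phi>y) + 1/2 * (cx - \<phi>x)) / dt = (3/2 * cz - 2 * cy + 1/2 * cx) / dt - (3/2 * \<phi>z - 2 * \<phi>y + 1/2 * \<phi>x) / dt"
  proof -
    have "3/2 * (cz - \<phi>z) - 2 * (cy - \<phi>y) + 1/2 * (cx - \<phi>x) = (3/2 * cz - 2 * cy + 1/2 * cx) - (3/2 * \<phi>z - 2 * \<phi>y + 1/2 * \<phi>x)"
      by (simp add: field_simps)
    then show ?thesis by (simp only: diff_divide_distrib)
  qed
  then show ?thesis unfolding assms by (simp add: algebra_simps)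
qed

lemma error_mode:
  fixes z y x N \<tau> :: complex and \<kappa> dt A a :: real
  assumes \<kappa>: "\<kappa> \<ge> 0" and dt: "dt > 0" and A: "A \<ge> 0" and a: "a \<ge> 0"
    and eq: "(3/2 * z - 2 * y + 1/2 * x) / complex_of_real dt =
      - complex_of_real \<kappa> * (- N + complex_of_real a * z - 2 * (complex_of_real \<kappa> * (2 * y - x)) + complex_of_real (A * dt * \<kappa>) * (z - y) + complex_of_real (\<kappa>\<^sup>2) * z) + \<tau>"
  shows "1/4 * ((cmod z)\<^sup>2 + (cmod (2 * z - y))\<^sup>2) + A * dt\<^sup>2 / 2 * (\<kappa>\<^sup>2 * (cmod z)\<^sup>2) + dt * (\<kappa> ^ 3 * (cmod z)\<^sup>2)
     \<le> 1/4 * ((cmod y)\<^sup>2 + (cmod (2 * y - x))\<^sup>2) + A * dt\<^sup>2 / 2 * (\<kappa>\<^sup>2 * (cmod y)\<^sup>2)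
       + dt * (\<kappa> * (cmod N * cmod z) + 2 * \<kappa>\<^sup>2 * (cmod (2 * y - x) * cmod z) + cmod \<tau> * cmod z)"
proof -
  define B where "B = 3/2 * z - 2 * y + 1/2 * x"
  define w where "w = 2 * y - x"
  have dt0: "complex_of_real dt \<noteq> 0" using dt by simp
  have "B = complex_of_real dt * (B / complex_of_real dt)" using dt0 by simp
  also have "B / complex_of_real dt = - complex_of_real \<kappa> * (- N + complex_of_real a * z - 2 * (complex_of_real \<kappa> * w) + complex_of_real (A * dt * \<kappa>) * (z - y) + complex_of_real (\<kappa>\<^sup>2) * z) + \<tau>"
    unfolding B_def w_def by (rule eq)
  finally have B: "B = dt *\<^sub>R (\<kappa> *\<^sub>R N - (\<kappa> * a) *\<^sub>R z + (2 * \<kappa>\<^sup>2) *\<^sub>R w - (A * dt * \<kappa>\<^sup>2) *\<^sub>R (z - y) - (\<kappa> ^ 3) *\<^sub>R z + \<tau>)"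
    by (simp add: scaleR_conv_of_real power2_eq_square power3_eq_cube algebra_simps)
  have lhs: "1/4 * ((cmod z)\<^sup>2 + (cmod (2 * z - y))\<^sup>2) - 1/4 * ((cmod y)\<^sup>2 + (cmod w)\<^sup>2) \<le> B \<bullet> z"
  proof -
    \<comment> \<open>The last square in this identity is that of the second difference; dropping it
      leaves differences of the G-norm between consecutive levels.\<close>
    have "B \<bullet> z = 1/4 * ((cmod z)\<^sup>2 + (cmod (2 * z - y))\<^sup>2) - 1/4 * ((cmod y)\<^sup>2 + (cmod w)\<^sup>2) + 1/4 * (cmod (z - 2 * y + x))\<^sup>2"
      unfolding B_def w_def cmod_power2 inner_complex_def by (simp add: power2_eq_square field_simps)
    then show ?thesis by simp
  qed
  have zy: "((cmod z)\<^sup>2 - (cmod y)\<^sup>2) / 2 \<le> (z - y) \<bullet> z"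
  proof -
    have "(z - y) \<bullet> z = ((cmod z)\<^sup>2 - (cmod y)\<^sup>2) / 2 + (cmod (z - y))\<^sup>2 / 2"
      unfolding cmod_power2 inner_complex_def by (simp add: power2_eq_square field_simps)
    then show ?thesis by simp
  qed
  have zz: "z \<bullet> z = (cmod z)\<^sup>2" by (simp add: power2_norm_eq_inner)
  define i j l where "i = N \<bullet> z" and "j = w \<bullet> z" and "l = \<tau> \<bullet> z"
  have i: "i \<le> cmod N * cmod z" and j: "j \<le> cmod w * cmod z" and l: "l \<le> cmod \<tau> * cmod z"
    unfolding i_def j_def l_def by (rule norm_cauchy_schwarz)+
  have "B \<bullet> z = dt * (\<kappa> * i - \<kappa> * a * (cmod z)\<^sup>2 + 2 * \<kappa>\<^sup>2 * j - A * dt * \<kappa>\<^sup>2 * ((z - y) \<bullet> z) - \<kappa> ^ 3 * (cmod z)\<^sup>2 + l)"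
    unfolding B i_def j_def l_def zz[symmetric] by (simp add: inner_add_left inner_diff_left)
  also have "\<dots> \<le> dt * (\<kappa> * (cmod N * cmod z) - 0 + 2 * \<kappa>\<^sup>2 * (cmod w * cmod z) - A * dt * \<kappa>\<^sup>2 * (((cmod z)\<^sup>2 - (cmod y)\<^sup>2) / 2) - \<kappa> ^ 3 * (cmod z)\<^sup>2 + cmod \<tau> * cmod z)"
    using \<kappa> a dt A by (intro mult_left_mono add_mono diff_mono i j l zy order_refl) auto
  also have "\<dots> = dt * (\<kappa> * (cmod N * cmod z) + 2 * \<kappa>\<^sup>2 * (cmod w * cmod z) + cmod \<tau> * cmod z)
      - (A * dt\<^sup>2 / 2 * (\<kappa>\<^sup>2 * (cmod z)\<^sup>2) - A * dt\<^sup>2 / 2 * (\<kappa>\<^sup>2 * (cmod y)\<^sup>2)) - dt * (\<kappa> ^ 3 * (cmod z)\<^sup>2)"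
    by (simp add: field_simps power2_eq_square)
  finally have up: "B \<bullet> z \<le> dt * (\<kappa> * (cmod N * cmod z) + 2 * \<kappa>\<^sup>2 * (cmod w * cmod z) + cmod \<tau> * cmod z)
      - (A * dt\<^sup>2 / 2 * (\<kappa>\<^sup>2 * (cmod z)\<^sup>2) - A * dt\<^sup>2 / 2 * (\<kappa>\<^sup>2 * (cmod y)\<^sup>2)) - dt * (\<kappa> ^ 3 * (cmod z)\<^sup>2)" .
  have "L - L' \<le> b \<Longrightarrow> b \<le> r - (u - v) - q \<Longrightarrow> L + u + q \<le> L' + v + r" for L L' b r u v q :: real by linarith
  from this[OF lhs up] show ?thesis unfolding w_def .
qed

text \<open>By powers of \<kappa>: N is at most the root of \<kappa> S, so \<kappa> N z is at most
  \<kappa>^(3/2) |z| times the root of S, and Young's inequality produces exactly the dissipated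
  \<kappa>^3 z^2.\<close>

lemma absorb_flux:
  fixes \<kappa> z N S :: real
  assumes "\<kappa> \<ge> 0" "N\<^sup>2 \<le> \<kappa> * S" "S \<ge> 0"
  shows "\<kappa> * (N * z) \<le> 1/8 * (\<kappa> ^ 3 * z\<^sup>2) + 2 * S"
proof (cases "\<kappa> = 0")
  case True
  then show ?thesis using assms(3) by simp
next
  case False
  then have k: "\<kappa> > 0" using assms by simp
  have "0 \<le> (\<kappa>\<^sup>2 * z - 4 * N)\<^sup>2" by simp
  then have "8 * (\<kappa>\<^sup>2 * (N * z)) \<le> \<kappa> ^ 4 * z\<^sup>2 + 16 * N\<^sup>2" by (simp add: power2_eq_square power4_eq_xxxx algebra_simps)
  also have "\<dots> \<le> \<kappa> ^ 4 * z\<^sup>2 + 16 * (\<kappa> * S)" using assms(2) by simp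
  finally have "\<kappa> * (\<kappa> * (N * z)) \<le> \<kappa> * (1/8 * (\<kappa> ^ 3 * z\<^sup>2) + 2 * S)"
    by (simp add: power2_eq_square power3_eq_cube power4_eq_xxxx algebra_simps)
  then show ?thesis using k by (rule mult_left_le_imp_le)
qed

text \<open>The explicit term has order \<kappa>^2, so a small share of \<kappa>^3 suffices. In
  \<kappa> \<le> \<kappa>^3 / 1024 + 32 the 1024 makes the shares of the two old levels 1/16 and
  1/64, which \<open>bdf2_gronwall\<close> can carry over.\<close>

lemma absorb_explicit:
  fixes \<kappa> z w e f :: real
  assumes k: "\<kappa> \<ge> 0" and w: "w\<^sup>2 \<le> 8 * e\<^sup>2 + 2 * f\<^sup>2"
  shows "2 * \<kappa>\<^sup>2 * (w * z) \<le> 1/8 * (\<kappa> ^ 3 * z\<^sup>2) + 1/16 * (\<kappa> ^ 3 * e\<^sup>2) + 1/64 * (\<kappa> ^ 3 * f\<^sup>2) + 256 * w\<^sup>2"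
proof -
  have k3: "\<kappa> \<le> \<kappa> ^ 3 / 1024 + 32"
  proof (cases "\<kappa> \<le> 32")
    case True
    have "0 \<le> \<kappa> ^ 3 / 1024" using k by simp
    then show ?thesis using True by linarith
  next
    case False
    then have "32 * 32 \<le> \<kappa> * \<kappa>" by (intro mult_mono) auto
    then have "\<kappa> * 1024 \<le> \<kappa> * (\<kappa> * \<kappa>)" using k by (intro mult_left_mono) auto
    then show ?thesis by (simp add: power3_eq_cube)
  qed
  have "0 \<le> \<kappa> * (\<kappa> * z - 8 * w)\<^sup>2" using k by simp
  then have "2 * \<kappa>\<^sup>2 * (w * z) \<le> 1/8 * (\<kappa> ^ 3 * z\<^sup>2) + 8 * (\<kappa> * w\<^sup>2)" by (simp add: power2_eq_square power3_eq_cube algebra_simps)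
  also have "8 * (\<kappa> * w\<^sup>2) \<le> 8 * ((\<kappa> ^ 3 / 1024 + 32) * w\<^sup>2)" using k3 by (intro mult_left_mono mult_right_mono) auto
  also have "8 * ((\<kappa> ^ 3 / 1024 + 32) * w\<^sup>2) = 1/128 * (\<kappa> ^ 3 * w\<^sup>2) + 256 * w\<^sup>2" by (simp add: algebra_simps)
  also have "\<kappa> ^ 3 * w\<^sup>2 \<le> \<kappa> ^ 3 * (8 * e\<^sup>2 + 2 * f\<^sup>2)" using k w by (intro mult_left_mono) auto
  finally show ?thesis by (simp add: algebra_simps)
qed

lemma bdf2_gronwall:
  fixes S X \<rho> :: "nat \<Rightarrow> real"
  assumes nn: "\<And>n. S n \<ge> 0" "\<And>n. X n \<ge> 0" "\<And>n. \<rho> n \<ge> 0" and dt: "dt > 0" and C: "C \<ge> 0" "4 * C * dt \<le> 1" and M: "real M * dt = T" "M > 0"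
    and first: "3/4 * S 1 + 3/8 * (dt * X 1) \<le> S 0 + C * dt * (S 0 + S 1) + \<rho> 1"
    and step: "\<And>n. 1 \<le> n \<Longrightarrow> n < M \<Longrightarrow> S (Suc n) + 5/8 * (dt * X (Suc n)) \<le> S n + dt * (1/16 * X n + 1/64 * X (n - 1)) + C * dt * (S n + S (Suc n)) + \<rho> (Suc n)"
    and n: "n \<le> M"
  shows "S n + dt / 4 * (\<Sum>j\<in>{1..n}. X j) \<le> exp (8 * C * T) * (2 * S 0 + dt * X 0 + 4 * (\<Sum>j\<in>{1..M}. \<rho> j))"
proof -
  \<comment> \<open>The dissipation of older levels is stored in P: 1/8 pays the incoming 1/16 and
    the 1/32 to be kept, that 1/32 pays the 1/64, and 1/8 + 1/4 \<le> 5/8 leaves the sum. At n = 0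
    the factor 2 makes up for the 3/4 in the first step.\<close>
  define P where "P n = (if n = 0 then 2 * S 0 + dt * X 0 else S n + dt * (1/8 * X n + 1/32 * X (n - 1)) + dt / 4 * (\<Sum>j\<in>{1..n}. X j))" for n
  define x where "x = 2 * C * dt"
  have x: "x \<ge> 0" "x \<le> 1/2" using C dt by (auto simp: x_def)
  have sum0: "0 \<le> dt / 4 * (\<Sum>j\<in>{1..n}. X j)" for n using dt nn by (intro mult_nonneg_nonneg sum_nonneg) auto
  have dX: "0 \<le> dt * X n" for n using dt nn by simp
  have PS: "S n \<le> P n" "0 \<le> P n" for n
  proof -
    show "S n \<le> P n"
    proof (cases "n = 0")
      case True
      then show ?thesis using nn(1)[of 0] dX[of 0] by (simp add: P_def)
    next
      case False
      then show ?thesis using sum0[of n] dX[of n] dX[of "n - 1"] by (simp add: P_def distrib_left)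
    qed
    then show "0 \<le> P n" using nn(1)[of n] by linarith
  qed
  have rec: "P (Suc n) \<le> P n + x * (P n + P (Suc n)) + 2 * \<rho> (Suc n)" if "n < M" for n
  proof (cases "n = 0")
    case True
    have CS: "C * dt * (S 0 + S 1) \<le> C * dt * (P 0 + P 1)" using C dt PS by (intro mult_left_mono add_mono) auto
    have nnCP: "0 \<le> C * dt * (P 0 + P 1)" using C dt PS(2)[of 0] PS(2)[of 1] by simp
    have P1: "P 1 = S 1 + 3/8 * (dt * X 1) + 1/32 * (dt * X 0)" by (simp add: P_def algebra_simps)
    have P0: "P 0 = 2 * S 0 + dt * X 0" by (simp add: P_def)
    have xe: "x * (P 0 + P 1) = 2 * (C * dt * (P 0 + P 1))" by (simp add: x_def)
    have "P 1 \<le> P 0 + x * (P 0 + P 1) + 2 * \<rho> 1"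
      unfolding xe using first CS nnCP P1 P0 nn(1)[of 0] nn(3)[of 1] dX[of 0] dX[of 1] by linarith
    then show ?thesis using True by simp
  next
    case False
    have CS: "C * dt * (S n + S (Suc n)) \<le> C * dt * (P n + P (Suc n))" using C dt PS by (intro mult_left_mono add_mono) auto
    have nnCP: "0 \<le> C * dt * (P n + P (Suc n))" using C dt PS(2)[of n] PS(2)[of "Suc n"] by simp
    have P1: "P (Suc n) = S (Suc n) + 3/8 * (dt * X (Suc n)) + 1/32 * (dt * X n) + dt / 4 * (\<Sum>j\<in>{1..n}. X j)"
      by (simp add: P_def algebra_simps)
    have P0: "P n = S n + 1/8 * (dt * X n) + 1/32 * (dt * X (n - 1)) + dt / 4 * (\<Sum>j\<in>{1..n}. X j)"
      using False by (simp add: P_def algebra_simps)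
    have xe: "x * (P n + P (Suc n)) = 2 * (C * dt * (P n + P (Suc n)))" by (simp add: x_def)
    have st: "S (Suc n) + 5/8 * (dt * X (Suc n)) \<le> S n + 1/16 * (dt * X n) + 1/64 * (dt * X (n - 1)) + C * dt * (S n + S (Suc n)) + \<rho> (Suc n)"
      using step[of n] False that by (simp add: algebra_simps)
    show ?thesis unfolding xe using st CS nnCP P1 P0 nn(3)[of "Suc n"] dX[of n] dX[of "n - 1"] dX[of "Suc n"] by linarith
  qed
  \<comment> \<open>Solves the implicit recursion: for x \<le> 1/2 one has (1 + x) / (1 - x) \<le> 1
    + 4 x and 2 / (1 - x) \<le> 4. The smallness of dt enters here.\<close>
  have grow: "P (Suc n) \<le> (1 + 4 * x) * P n + 4 * \<rho> (Suc n)" if "n < M" for n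
  proof -
    have "(1 - x) * P (Suc n) \<le> (1 + x) * P n + 2 * \<rho> (Suc n)" using rec[OF that] by (simp add: algebra_simps)
    also have "\<dots> \<le> (1 - x) * ((1 + 4 * x) * P n + 4 * \<rho> (Suc n))"
    proof -
      have "0 \<le> 2 * x * (1 - 2 * x)" using x by simp
      then have "1 + x \<le> (1 - x) * (1 + 4 * x)" by (simp add: algebra_simps)
      then have "(1 + x) * P n \<le> ((1 - x) * (1 + 4 * x)) * P n" by (rule mult_right_mono[OF _ PS(2)])
      moreover have "2 * \<rho> (Suc n) \<le> (4 * (1 - x)) * \<rho> (Suc n)" using x nn(3) by (intro mult_right_mono) auto
      moreover have "(1 - x) * ((1 + 4 * x) * P n + 4 * \<rho> (Suc n)) = ((1 - x) * (1 + 4 * x)) * P n + (4 * (1 - x)) * \<rho> (Suc n)"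
        by (simp add: algebra_simps)
      ultimately show ?thesis by (simp only: add_mono)
    qed
    finally show ?thesis by (rule mult_left_le_imp_le) (use x in auto)
  qed
  have pw: "P n \<le> (1 + 4 * x) ^ n * (P 0 + 4 * (\<Sum>j\<in>{1..n}. \<rho> j))" if "n \<le> M" for n
    using that
  proof (induction n)
    case (Suc n)
    have g1: "1 \<le> (1 + 4 * x) ^ Suc n" using x by (intro one_le_power) auto
    have "P (Suc n) \<le> (1 + 4 * x) * P n + 4 * \<rho> (Suc n)" using Suc by (intro grow) auto
    also have "\<dots> \<le> (1 + 4 * x) * ((1 + 4 * x) ^ n * (P 0 + 4 * (\<Sum>j\<in>{1..n}. \<rho> j))) + (1 + 4 * x) ^ Suc n * (4 * \<rho> (Suc n))"
    proof (intro add_mono mult_left_mono)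
      show "P n \<le> (1 + 4 * x) ^ n * (P 0 + 4 * (\<Sum>j\<in>{1..n}. \<rho> j))" using Suc by simp
      show "4 * \<rho> (Suc n) \<le> (1 + 4 * x) ^ Suc n * (4 * \<rho> (Suc n))"
        using mult_right_mono[OF g1, of "4 * \<rho> (Suc n)"] nn(3)[of "Suc n"] by simp
    qed (use x in auto)
    also have "\<dots> = (1 + 4 * x) ^ Suc n * (P 0 + 4 * (\<Sum>j\<in>{1..Suc n}. \<rho> j))" by (simp add: algebra_simps)
    finally show ?case .
  qed simp
  have "P n \<le> (1 + 4 * x) ^ n * (P 0 + 4 * (\<Sum>j\<in>{1..n}. \<rho> j))" by (rule pw[OF n])
  also have "\<dots> \<le> exp (8 * C * T) * (P 0 + 4 * (\<Sum>j\<in>{1..M}. \<rho> j))"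
  proof (rule mult_mono)
    have "(1 + 4 * x) ^ n \<le> exp (4 * x) ^ n" using x by (intro power_mono) auto
    also have "\<dots> = exp (real n * (4 * x))" by (simp add: exp_of_nat_mult)
    also have "\<dots> \<le> exp (8 * C * T)"
    proof -
      have "real n * (4 * x) \<le> real M * (4 * x)" using n x by (intro mult_right_mono) auto
      also have "\<dots> = 8 * C * T" unfolding x_def M(1)[symmetric] by simp
      finally show ?thesis by simp
    qed
    finally show "(1 + 4 * x) ^ n \<le> exp (8 * C * T)" .
    have "(\<Sum>j\<in>{1..n}. \<rho> j) \<le> (\<Sum>j\<in>{1..M}. \<rho> j)" using n nn by (intro sum_mono2) auto
    then show "P 0 + 4 * (\<Sum>j\<in>{1..n}. \<rho> j) \<le> P 0 + 4 * (\<Sum>j\<in>{1..M}. \<rho> j)" by simp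
    show "0 \<le> P 0 + 4 * (\<Sum>j\<in>{1..n}. \<rho> j)" using PS(2)[of 0] nn by (intro add_nonneg_nonneg mult_nonneg_nonneg sum_nonneg) auto
  qed simp
  finally have "P n \<le> exp (8 * C * T) * (2 * S 0 + dt * X 0 + 4 * (\<Sum>j\<in>{1..M}. \<rho> j))" by (simp add: P_def)
  moreover have "S n + dt / 4 * (\<Sum>j\<in>{1..n}. X j) \<le> P n"
  proof (cases "n = 0")
    case True
    then show ?thesis using nn(1)[of 0] dX[of 0] by (simp add: P_def)
  next
    case False
    then show ?thesis using dX[of n] dX[of "n - 1"] by (simp add: P_def distrib_left)
  qed
  ultimately show ?thesis by linarith
qed

section \<open>Sums over time windows and over modes\<close>

lemma sum_consecutive_integrals:
  fixes f :: "real \<Rightarrow> real"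
  assumes f: "f integrable_on {0..T}" and dt: "dt \<ge> 0" and n: "real n * dt \<le> T"
  shows "(\<Sum>i<n. integral {real i * dt..real (Suc i) * dt} f) = integral {0..real n * dt} f"
  using n
proof (induction n)
  case (Suc n)
  have le: "real n * dt \<le> real (Suc n) * dt" using dt by (intro mult_right_mono) auto
  have "f integrable_on {0..real (Suc n) * dt}" by (rule integrable_on_subinterval[OF f]) (use Suc.prems in auto)
  from Henstock_Kurzweil_Integration.integral_combine[OF _ le this] dt
  have "integral {0..real n * dt} f + integral {real n * dt..real (Suc n) * dt} f = integral {0..real (Suc n) * dt} f" by simp
  moreover have "(\<Sum>i<n. integral {real i * dt..real (Suc i) * dt} f) = integral {0..real n * dt} f"
    by (rule Suc.IH) (use le Suc.prems in linarith)
  ultimately show ?case by simp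
qed simp

text \<open>Each window spans two steps, so every step lies in at most two windows.\<close>

lemma sum_overlapping_integrals:
  fixes f :: "real \<Rightarrow> real"
  assumes f: "f integrable_on {0..T}" and f0: "\<And>t. t \<in> {0..T} \<Longrightarrow> f t \<ge> 0" and dt: "dt \<ge> 0" and M: "real M * dt = T"
  shows "(\<Sum>n\<in>{1..<M}. integral {real (n - 1) * dt..real (Suc n) * dt} f) \<le> 2 * integral {0..T} f"
proof -
  let ?J = "\<lambda>i. integral {real i * dt..real (Suc i) * dt} f"
  have J0: "?J i \<ge> 0" if "i < M" for i
  proof (rule integral_nonneg)
    have sub: "{real i * dt..real (Suc i) * dt} \<subseteq> {0..T}"
    proof -
      have "real (Suc i) * dt \<le> real M * dt" using that dt by (intro mult_right_mono) auto
      then show ?thesis using dt M by auto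
    qed
    show "f integrable_on {real i * dt..real (Suc i) * dt}" by (rule integrable_on_subinterval[OF f sub])
    show "0 \<le> f t" if "t \<in> {real i * dt..real (Suc i) * dt}" for t using f0 sub that by blast
  qed
  have split: "integral {real (n - 1) * dt..real (Suc n) * dt} f = ?J (n - 1) + ?J n" if n: "n \<in> {1..<M}" for n
  proof -
    have e: "Suc (n - 1) = n" using n by simp
    have l1: "real (n - 1) * dt \<le> real n * dt" and l2: "real n * dt \<le> real (Suc n) * dt" using dt by (intro mult_right_mono; simp)+
    have l3: "real (Suc n) * dt \<le> T" unfolding M[symmetric] using n dt by (intro mult_right_mono) auto
    have "f integrable_on {real (n - 1) * dt..real (Suc n) * dt}" by (rule integrable_on_subinterval[OF f]) (use dt l3 in auto)
    from Henstock_Kurzweil_Integration.integral_combine[OF l1 l2 this] show ?thesis unfolding e by simp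
  qed
  have "(\<Sum>n\<in>{1..<M}. integral {real (n - 1) * dt..real (Suc n) * dt} f) = (\<Sum>n\<in>{1..<M}. ?J (n - 1)) + (\<Sum>n\<in>{1..<M}. ?J n)"
    unfolding sum.distrib[symmetric] by (rule sum.cong[OF refl split])
  also have "(\<Sum>n\<in>{1..<M}. ?J n) \<le> (\<Sum>n<M. ?J n)" by (rule sum_mono2) (use J0 in auto)
  also have "(\<Sum>n\<in>{1..<M}. ?J (n - 1)) = (\<Sum>n\<in>{..<M - 1}. ?J n)"
    by (rule sum.reindex_bij_witness[where i = Suc and j = "\<lambda>n. n - 1"]) auto
  also have "(\<Sum>n\<in>{..<M - 1}. ?J n) \<le> (\<Sum>n<M. ?J n)" by (rule sum_mono2) (use J0 in auto)
  also have "(\<Sum>n<M. ?J n) = integral {0..T} f" using sum_consecutive_integrals[OF f dt, of M] M by simp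
  finally show ?thesis by simp
qed

lemma cmod_add2_sq: "(cmod (u + v))\<^sup>2 \<le> 2 * ((cmod u)\<^sup>2 + (cmod v)\<^sup>2)"
proof -
  have "(cmod (u + v))\<^sup>2 \<le> (cmod u + cmod v)\<^sup>2" by (rule power_mono[OF norm_triangle_ineq]) simp
  also have "\<dots> \<le> 2 * ((cmod u)\<^sup>2 + (cmod v)\<^sup>2)" using zero_le_power2[of "cmod u - cmod v"] by (simp add: power2_eq_square algebra_simps)
  finally show ?thesis .
qed

lemma cmod_add3_sq: "(cmod (u + v + w))\<^sup>2 \<le> 3 * ((cmod u)\<^sup>2 + (cmod v)\<^sup>2 + (cmod w)\<^sup>2)"
proof -
  have "cmod (u + v + w) \<le> cmod u + cmod v + cmod w"
    by (rule order_trans[OF norm_triangle_ineq add_right_mono[OF norm_triangle_ineq]])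
  then have "(cmod (u + v + w))\<^sup>2 \<le> (cmod u + cmod v + cmod w)\<^sup>2" by (rule power_mono) simp
  also have "\<dots> \<le> 3 * ((cmod u)\<^sup>2 + (cmod v)\<^sup>2 + (cmod w)\<^sup>2)"
    using zero_le_power2[of "cmod u - cmod v"] zero_le_power2[of "cmod u - cmod w"] zero_le_power2[of "cmod v - cmod w"]
    by (simp add: power2_eq_square algebra_simps)
  finally show ?thesis .
qed

lemma cmod_add4_sq: "(cmod (u + v + w + x))\<^sup>2 \<le> 4 * ((cmod u)\<^sup>2 + (cmod v)\<^sup>2 + (cmod w)\<^sup>2 + (cmod x)\<^sup>2)"
  using cmod_add2_sq[of "u + v" "w + x"] cmod_add2_sq[of u v] cmod_add2_sq[of w x] by (simp add: add.assoc)

text \<open>By Parseval j = 0 is the squared discrete L^2 norm and j = 3 the squared norm of the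
  gradient of the Laplacian, the two norms of the final estimate.\<close>

definition ksq :: "nat \<Rightarrow> nat \<Rightarrow> (freq \<Rightarrow> complex) \<Rightarrow> real" where
  "ksq K j u = (\<Sum>k\<in>modes K. kap k ^ j * (cmod (u k))\<^sup>2)"

lemma ksq_nonneg [simp]: "ksq K j u \<ge> 0"
  unfolding ksq_def by (intro sum_nonneg) simp

lemma ksq_zero: "ksq K 0 u = (\<Sum>k\<in>modes K. (cmod (u k))\<^sup>2)"
  by (simp add: ksq_def)

lemma ksq_add_le: "ksq K j (\<lambda>k. u k + v k) \<le> 2 * (ksq K j u + ksq K j v)"
proof -
  have "ksq K j (\<lambda>k. u k + v k) \<le> (\<Sum>k\<in>modes K. kap k ^ j * (2 * ((cmod (u k))\<^sup>2 + (cmod (v k))\<^sup>2)))"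
    unfolding ksq_def by (intro sum_mono mult_left_mono cmod_add2_sq) simp
  also have "\<dots> = 2 * (ksq K j u + ksq K j v)"
    unfolding ksq_def by (simp add: sum_distrib_left sum.distrib[symmetric] algebra_simps)
  finally show ?thesis .
qed

lemma ksq_le_weighted:
  assumes "j \<le> 3" "(\<Sum>k\<in>modes K. wt k ^ 3 * cmod (u k)) \<le> s"
  shows "ksq K j u \<le> 64 ^ 3 * s\<^sup>2"
proof -
  have "ksq K j u \<le> (\<Sum>k\<in>modes K. 64 ^ 3 * (wt k ^ 3 * cmod (u k))\<^sup>2)"
    unfolding ksq_def
  proof (rule sum_mono)
    fix k
    have "kap k ^ j \<le> (64 * wt k ^ 2) ^ j" by (rule power_mono[OF kap_le_wt kap_nonneg])
    also have "\<dots> \<le> (64 * wt k ^ 2) ^ 3"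
    proof (rule power_increasing[OF assms(1)])
      show "1 \<le> 64 * wt k ^ 2" using wt_pow_ge_1[of k 2] by linarith
    qed
    also have "\<dots> = 64 ^ 3 * wt k ^ 6" by (simp add: power_mult_distrib power_mult[symmetric])
    finally have "kap k ^ j * (cmod (u k))\<^sup>2 \<le> 64 ^ 3 * wt k ^ 6 * (cmod (u k))\<^sup>2" by (rule mult_right_mono) simp
    then show "kap k ^ j * (cmod (u k))\<^sup>2 \<le> 64 ^ 3 * (wt k ^ 3 * cmod (u k))\<^sup>2"
      by (simp add: power_mult_distrib power_mult[symmetric])
  qed
  also have "\<dots> = 64 ^ 3 * (\<Sum>k\<in>modes K. (wt k ^ 3 * cmod (u k))\<^sup>2)" by (simp only: sum_distrib_left)
  also have "\<dots> \<le> 64 ^ 3 * s\<^sup>2"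
  proof (rule mult_left_mono)
    have "(\<Sum>k\<in>modes K. (wt k ^ 3 * cmod (u k))\<^sup>2) \<le> (\<Sum>k\<in>modes K. wt k ^ 3 * cmod (u k))\<^sup>2"
      by (rule sum_square_le_square_sum) simp
    also have "\<dots> \<le> s\<^sup>2" by (rule power_mono[OF assms(2)]) (intro sum_nonneg; simp)
    finally show "(\<Sum>k\<in>modes K. (wt k ^ 3 * cmod (u k))\<^sup>2) \<le> s\<^sup>2" .
  qed simp
  finally show ?thesis .
qed

lemma kap4_le: "kap k ^ 4 \<le> 64 ^ 4 * wt k ^ 8"
  using power_mono[OF kap_le_wt kap_nonneg, of k 4] by (simp add: power_mult_distrib power_mult[symmetric])

text \<open>Two shares of 1/8, from the flux and from the explicit term, are absorbed and reduce the
  dissipation from 1 to 3/4; the residual is paired with z by Young's inequality.\<close>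

lemma error_step_mode:
  fixes z y x N \<tau> :: complex and \<kappa> dt A a s :: real
  assumes \<kappa>: "\<kappa> \<ge> 0" and dt: "dt > 0" and A: "A \<ge> 0" and a: "a \<ge> 0"
    and eq: "(3/2 * z - 2 * y + 1/2 * x) / complex_of_real dt =
      - complex_of_real \<kappa> * (- N + complex_of_real a * z - 2 * (complex_of_real \<kappa> * (2 * y - x)) + complex_of_real (A * dt * \<kappa>) * (z - y) + complex_of_real (\<kappa>\<^sup>2) * z) + \<tau>"
    and N: "(cmod N)\<^sup>2 \<le> \<kappa> * s" "s \<ge> 0"
  shows "1/4 * ((cmod z)\<^sup>2 + (cmod (2 * z - y))\<^sup>2) + A * dt\<^sup>2 / 2 * (\<kappa>\<^sup>2 * (cmod z)\<^sup>2) + 3/4 * (dt * (\<kappa> ^ 3 * (cmod z)\<^sup>2))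
     \<le> 1/4 * ((cmod y)\<^sup>2 + (cmod (2 * y - x))\<^sup>2) + A * dt\<^sup>2 / 2 * (\<kappa>\<^sup>2 * (cmod y)\<^sup>2)
       + dt * (2 * s + 1/16 * (\<kappa> ^ 3 * (cmod y)\<^sup>2) + 1/64 * (\<kappa> ^ 3 * (cmod x)\<^sup>2) + 256 * (cmod (2 * y - x))\<^sup>2
          + 1/2 * (cmod \<tau>)\<^sup>2 + 1/2 * (cmod z)\<^sup>2)"
proof -
  have w: "(cmod (2 * y - x))\<^sup>2 \<le> 8 * (cmod y)\<^sup>2 + 2 * (cmod x)\<^sup>2"
    using cmod_add2_sq[of "2 * y" "- x"] by (simp add: norm_mult power_mult_distrib)
  have t: "cmod \<tau> * cmod z \<le> 1/2 * (cmod \<tau>)\<^sup>2 + 1/2 * (cmod z)\<^sup>2"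
    using zero_le_power2[of "cmod \<tau> - cmod z"] by (simp add: power2_eq_square algebra_simps)
  have "dt * (\<kappa> * (cmod N * cmod z) + 2 * \<kappa>\<^sup>2 * (cmod (2 * y - x) * cmod z) + cmod \<tau> * cmod z)
    \<le> dt * ((1/8 * (\<kappa> ^ 3 * (cmod z)\<^sup>2) + 2 * s) + (1/8 * (\<kappa> ^ 3 * (cmod z)\<^sup>2) + 1/16 * (\<kappa> ^ 3 * (cmod y)\<^sup>2) + 1/64 * (\<kappa> ^ 3 * (cmod x)\<^sup>2) + 256 * (cmod (2 * y - x))\<^sup>2)
       + (1/2 * (cmod \<tau>)\<^sup>2 + 1/2 * (cmod z)\<^sup>2))"
    using dt by (intro mult_left_mono add_mono absorb_flux[OF \<kappa> N] absorb_explicit[OF \<kappa> w] t) simp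
  moreover have "\<dots> = dt * (2 * s + 1/16 * (\<kappa> ^ 3 * (cmod y)\<^sup>2) + 1/64 * (\<kappa> ^ 3 * (cmod x)\<^sup>2) + 256 * (cmod (2 * y - x))\<^sup>2
          + 1/2 * (cmod \<tau>)\<^sup>2 + 1/2 * (cmod z)\<^sup>2) + 1/4 * (dt * (\<kappa> ^ 3 * (cmod z)\<^sup>2))"
    by (simp add: algebra_simps)
  moreover have "p + q \<le> r + b \<Longrightarrow> b \<le> e \<Longrightarrow> e = g + 1/4 * q \<Longrightarrow> p + 3/4 * q \<le> r + g" for p q r b e g :: real by linarith
  ultimately show ?thesis using error_mode[OF \<kappa> dt A a eq] by blast
qed

text \<open>Here x = y, the ghost error being the initial error. As \<tau> is only of order dt, the
  product dt \<tau> z is split into 4 dt^2 \<tau>^2 + z^2 / 16 with no dt on the second part. The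
  first part is then of order dt^4; the second takes a quarter of z^2 / 4, hence the factor
  3/4.\<close>

lemma error_first_mode:
  fixes z y N N0 \<tau> :: complex and \<kappa> dt A a s s0 \<beta> :: real
  assumes \<kappa>: "\<kappa> \<ge> 0" and dt: "dt > 0" and A: "A \<ge> 0" and a: "a \<ge> 0" and \<beta>: "\<bar>\<kappa> * \<beta>\<bar> \<le> \<kappa> ^ 3"
    and eq: "(3/2 * z - 2 * y + 1/2 * y) / complex_of_real dt =
      - complex_of_real \<kappa> * (- N + complex_of_real a * z - 2 * (complex_of_real \<kappa> * (2 * y - y)) + complex_of_real (A * dt * \<kappa>) * (z - y) + complex_of_real (\<kappa>\<^sup>2) * z)
      + (\<tau> + complex_of_real (\<kappa> / 2) * N0 - complex_of_real (\<kappa> * \<beta> / 2) * y)"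
    and N: "(cmod N)\<^sup>2 \<le> \<kappa> * s" "s \<ge> 0" and N0: "(cmod N0)\<^sup>2 \<le> \<kappa> * s0" "s0 \<ge> 0"
  shows "3/4 * (1/4 * ((cmod z)\<^sup>2 + (cmod (2 * z - y))\<^sup>2) + A * dt\<^sup>2 / 2 * (\<kappa>\<^sup>2 * (cmod z)\<^sup>2)) + 7/16 * (dt * (\<kappa> ^ 3 * (cmod z)\<^sup>2))
     \<le> 1/4 * ((cmod y)\<^sup>2 + (cmod (2 * y - y))\<^sup>2) + A * dt\<^sup>2 / 2 * (\<kappa>\<^sup>2 * (cmod y)\<^sup>2)
       + dt * (2 * s + s0 + \<kappa> ^ 3 * (cmod y)\<^sup>2 + 256 * (cmod y)\<^sup>2) + 4 * dt\<^sup>2 * (cmod \<tau>)\<^sup>2"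
proof -
  define X where "X = \<kappa> ^ 3 * (cmod z)\<^sup>2"
  define V where "V = \<kappa> ^ 3 * (cmod y)\<^sup>2"
  have X0: "X \<ge> 0" and V0: "V \<ge> 0" using \<kappa> by (simp_all add: X_def V_def)
  have yy: "2 * y - y = y" by simp
  have w: "(cmod (2 * y - y))\<^sup>2 \<le> 8 * (cmod y)\<^sup>2 + 2 * (cmod y)\<^sup>2" unfolding yy by simp
  have flux: "\<kappa> * (cmod N * cmod z) \<le> 1/8 * X + 2 * s" unfolding X_def by (rule absorb_flux[OF \<kappa> N])
  have flux0: "\<kappa> * (cmod N0 * cmod z) \<le> 1/8 * X + 2 * s0" unfolding X_def by (rule absorb_flux[OF \<kappa> N0])
  have ex: "2 * \<kappa>\<^sup>2 * (cmod (2 * y - y) * cmod z) \<le> 1/8 * X + 1/16 * V + 1/64 * V + 256 * (cmod y)\<^sup>2"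
    using absorb_explicit[OF \<kappa> w, of "cmod z"] unfolding yy X_def V_def .
  have yz: "\<kappa> ^ 3 * (cmod y * cmod z) \<le> 1/4 * X + V"
  proof -
    have "cmod y * cmod z \<le> 1/4 * (cmod z)\<^sup>2 + (cmod y)\<^sup>2"
      using zero_le_power2[of "cmod z / 2 - cmod y"] by (simp add: power2_eq_square field_simps)
    from mult_left_mono[OF this, of "\<kappa> ^ 3"] \<kappa> show ?thesis by (simp add: X_def V_def algebra_simps)
  qed
  have tz: "dt * (cmod \<tau> * cmod z) \<le> 4 * dt\<^sup>2 * (cmod \<tau>)\<^sup>2 + 1/16 * (cmod z)\<^sup>2"
    using zero_le_power2[of "2 * dt * cmod \<tau> - cmod z / 4"] by (simp add: power2_eq_square field_simps)
  have tau: "cmod (\<tau> + complex_of_real (\<kappa> / 2) * N0 - complex_of_real (\<kappa> * \<beta> / 2) * y) * cmod z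
      \<le> cmod \<tau> * cmod z + 1/2 * (\<kappa> * (cmod N0 * cmod z)) + 1/2 * (\<kappa> ^ 3 * (cmod y * cmod z))"
  proof -
    have v: "cmod (complex_of_real (\<kappa> * \<beta> / 2) * y) \<le> 1/2 * (\<kappa> ^ 3 * cmod y)"
    proof -
      have "cmod (complex_of_real (\<kappa> * \<beta> / 2) * y) = \<bar>\<kappa> * \<beta>\<bar> / 2 * cmod y" unfolding norm_mult norm_of_real by simp
      also have "\<dots> \<le> \<kappa> ^ 3 / 2 * cmod y" using \<beta> by (intro mult_right_mono divide_right_mono) auto
      finally show ?thesis by simp
    qed
    have u: "cmod (complex_of_real (\<kappa> / 2) * N0) = 1/2 * (\<kappa> * cmod N0)" unfolding norm_mult norm_of_real using \<kappa> by simp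
    have "cmod (\<tau> + complex_of_real (\<kappa> / 2) * N0 - complex_of_real (\<kappa> * \<beta> / 2) * y) \<le> cmod \<tau> + 1/2 * (\<kappa> * cmod N0) + 1/2 * (\<kappa> ^ 3 * cmod y)"
      unfolding u[symmetric] using v
      by (intro order_trans[OF norm_triangle_ineq4] add_mono order_trans[OF norm_triangle_ineq]) auto
    from mult_right_mono[OF this, of "cmod z"] show ?thesis by (simp add: algebra_simps)
  qed
  have "dt * (\<kappa> * (cmod N * cmod z) + 2 * \<kappa>\<^sup>2 * (cmod (2 * y - y) * cmod z) + cmod (\<tau> + complex_of_real (\<kappa> / 2) * N0 - complex_of_real (\<kappa> * \<beta> / 2) * y) * cmod z)
    \<le> dt * ((1/8 * X + 2 * s) + (1/8 * X + 1/16 * V + 1/64 * V + 256 * (cmod y)\<^sup>2) + (cmod \<tau> * cmod z + 1/2 * (1/8 * X + 2 * s0) + 1/2 * (1/4 * X + V)))"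
    using dt by (intro mult_left_mono add_mono flux ex order_trans[OF tau] flux0 yz order_refl) auto
  also have "\<dots> = dt * (2 * s + s0 + 37/64 * V + 256 * (cmod y)\<^sup>2) + dt * (cmod \<tau> * cmod z) + 7/16 * (dt * X)"
    by (simp add: algebra_simps)
  also have "\<dots> \<le> dt * (2 * s + s0 + V + 256 * (cmod y)\<^sup>2) + (4 * dt\<^sup>2 * (cmod \<tau>)\<^sup>2 + 1/16 * (cmod z)\<^sup>2) + 7/16 * (dt * X)"
    using dt V0 by (intro add_mono mult_left_mono tz order_refl) auto
  finally have b: "dt * (\<kappa> * (cmod N * cmod z) + 2 * \<kappa>\<^sup>2 * (cmod (2 * y - y) * cmod z) + cmod (\<tau> + complex_of_real (\<kappa> / 2) * N0 - complex_of_real (\<kappa> * \<beta> / 2) * y) * cmod z)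
    \<le> dt * (2 * s + s0 + V + 256 * (cmod y)\<^sup>2) + (4 * dt\<^sup>2 * (cmod \<tau>)\<^sup>2 + 1/16 * (cmod z)\<^sup>2) + 7/16 * (dt * X)" .
  have dX: "0 \<le> dt * X" using dt X0 by simp
  have u0: "0 \<le> A * dt\<^sup>2 / 2 * (\<kappa>\<^sup>2 * (cmod z)\<^sup>2)" using A by simp
  have gen: "3/4 * (1/4 * (z2 + v) + u) + 7/16 * q \<le> r + g + t" if "1/4 * (z2 + v) + u + q \<le> r + b" "b \<le> g + (t + 1/16 * z2) + 7/16 * q" "0 \<le> q" "0 \<le> u" "0 \<le> v"
    for z2 v u q r b g t :: real
  proof -
    have e: "3/4 * (1/4 * (z2 + v) + u) = 3/16 * z2 + 3/16 * v + 3/4 * u" "1/4 * (z2 + v) = 1/4 * z2 + 1/4 * v" by simp_all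
    show ?thesis unfolding e(1) using that unfolding e(2) by linarith
  qed
  show ?thesis
    using gen[OF error_mode[OF \<kappa> dt A a eq, folded X_def] b dX u0 zero_le_power2] unfolding X_def V_def .
qed

text \<open>The G-norm of BDF2 for the pair (u, v), plus the contribution of the stabilising term,
  which telescopes in time.\<close>

definition eng :: "nat \<Rightarrow> real \<Rightarrow> real \<Rightarrow> (freq \<Rightarrow> complex) \<Rightarrow> (freq \<Rightarrow> complex) \<Rightarrow> real" where
  "eng K A dt u v = 1/4 * (ksq K 0 u + ksq K 0 (\<lambda>k. 2 * u k - v k)) + A * dt\<^sup>2 / 2 * ksq K 2 u"

lemma error_step_sum:
  fixes z y x N \<tau> :: "freq \<Rightarrow> complex" and dt A a :: real and s :: "freq \<Rightarrow> real"
  assumes dt: "dt > 0" and A: "A \<ge> 0" and a: "a \<ge> 0"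
    and eq: "\<And>k. k \<in> modes K \<Longrightarrow> (3/2 * z k - 2 * y k + 1/2 * x k) / complex_of_real dt =
      - complex_of_real (kap k) * (- N k + complex_of_real a * z k - 2 * (complex_of_real (kap k) * (2 * y k - x k))
        + complex_of_real (A * dt * kap k) * (z k - y k) + complex_of_real ((kap k)\<^sup>2) * z k) + \<tau> k"
    and N: "\<And>k. k \<in> modes K \<Longrightarrow> (cmod (N k))\<^sup>2 \<le> kap k * s k" "\<And>k. k \<in> modes K \<Longrightarrow> s k \<ge> 0"
  shows "eng K A dt z y + 3/4 * (dt * ksq K 3 z) \<le> eng K A dt y x
    + dt * (2 * (\<Sum>k\<in>modes K. s k) + 1/16 * ksq K 3 y + 1/64 * ksq K 3 x + 256 * ksq K 0 (\<lambda>k. 2 * y k - x k) + 1/2 * ksq K 0 \<tau> + 1/2 * ksq K 0 z)"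
  using sum_mono[of "modes K", OF error_step_mode[OF kap_nonneg dt A a eq N]]
  unfolding eng_def ksq_def by (simp only: power_0 mult_1_left sum.distrib sum_distrib_left distrib_left)

lemma error_first_sum:
  fixes z y N N0 \<tau> :: "freq \<Rightarrow> complex" and dt A a :: real and s s0 \<beta> :: "freq \<Rightarrow> real"
  assumes dt: "dt > 0" and A: "A \<ge> 0" and a: "a \<ge> 0" and \<beta>: "\<And>k. k \<in> modes K \<Longrightarrow> \<bar>kap k * \<beta> k\<bar> \<le> kap k ^ 3"
    and eq: "\<And>k. k \<in> modes K \<Longrightarrow> (3/2 * z k - 2 * y k + 1/2 * y k) / complex_of_real dt =
      - complex_of_real (kap k) * (- N k + complex_of_real a * z k - 2 * (complex_of_real (kap k) * (2 * y k - y k))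
        + complex_of_real (A * dt * kap k) * (z k - y k) + complex_of_real ((kap k)\<^sup>2) * z k)
      + (\<tau> k + complex_of_real (kap k / 2) * N0 k - complex_of_real (kap k * \<beta> k / 2) * y k)"
    and N: "\<And>k. k \<in> modes K \<Longrightarrow> (cmod (N k))\<^sup>2 \<le> kap k * s k" "\<And>k. k \<in> modes K \<Longrightarrow> s k \<ge> 0"
    and N0: "\<And>k. k \<in> modes K \<Longrightarrow> (cmod (N0 k))\<^sup>2 \<le> kap k * s0 k" "\<And>k. k \<in> modes K \<Longrightarrow> s0 k \<ge> 0"
  shows "3/4 * eng K A dt z y + 7/16 * (dt * ksq K 3 z) \<le> eng K A dt y y
    + dt * (2 * (\<Sum>k\<in>modes K. s k) + (\<Sum>k\<in>modes K. s0 k) + ksq K 3 y + 256 * ksq K 0 y) + 4 * dt\<^sup>2 * ksq K 0 \<tau>"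
  using sum_mono[of "modes K", OF error_first_mode[OF kap_nonneg dt A a \<beta> eq N N0]]
  unfolding eng_def ksq_def by (simp only: power_0 mult_1_left sum.distrib sum_distrib_left distrib_left)

text \<open>The ghost value carries the discrete initial potential m. Comparing half of \<kappa> m
  with its exact counterpart isolates the first-step truncation error and leaves two terms in the
  initial errors of flux and value, which are estimated separately.\<close>

lemma first_residual_split:
  fixes dt \<kappa> a b c1 c0 m n0 nc0 nc1 \<phi>0 \<beta> :: complex
  assumes "dt \<noteq> 0" "m = - n0 + \<beta> * \<phi>0" "\<beta> = a - 2 * \<kappa> + \<kappa>\<^sup>2"
  shows "(3/2 * c1 - 2 * c0 + 1/2 * (c0 + dt * \<kappa> * m)) / dt
      + \<kappa> * (- nc1 + a * c1 - 2 * (\<kappa> * (2 * c0 - (c0 + dt * \<kappa> * m))) + b * \<kappa> * (c1 - c0) + \<kappa>\<^sup>2 * c1)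
    = (3/2 * (c1 - c0) / dt - 1/2 * (- \<kappa> * (- nc0 + \<beta> * c0)) - (- \<kappa> * (- nc1 + \<beta> * c1)))
      + 2 * \<kappa>\<^sup>2 * (c1 - c0) + 2 * dt * \<kappa> ^ 3 * m + b * \<kappa>\<^sup>2 * (c1 - c0) + \<kappa> / 2 * (nc0 - n0) - \<kappa> * \<beta> / 2 * (c0 - \<phi>0)"
proof -
  have h: "(3/2 * c1 - 2 * c0 + 1/2 * (c0 + dt * \<kappa> * m)) / dt = 3/2 * (c1 - c0) / dt + 1/2 * (\<kappa> * m)"
    using assms(1) by (simp add: field_simps)
  have m: "1/2 * (\<kappa> * m) = - 1/2 * (- \<kappa> * (- nc0 + \<beta> * c0)) + \<kappa> / 2 * (nc0 - n0) - \<kappa> * \<beta> / 2 * (c0 - \<phi>0)"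
    unfolding assms(2) by (simp add: field_simps)
  show ?thesis unfolding h m unfolding assms(3) by (simp add: power2_eq_square power3_eq_cube algebra_simps)
qed

lemma integral_nonneg_everywhere:
  fixes f :: "real \<Rightarrow> real"
  assumes "\<And>t. f t \<ge> 0"
  shows "integral S f \<ge> 0"
  using assms by (cases "f integrable_on S") (auto intro: integral_nonneg simp: not_integrable_integral)

section \<open>Consistency and stability of the fully discrete scheme\<close>

context spfc
begin

definition flx :: "nat \<Rightarrow> real \<Rightarrow> grid \<Rightarrow> freq \<Rightarrow> real" where
  "flx K t f k = (cmod (fx (c t) k - hat K (FxN K f) k))\<^sup>2 + (cmod (fy (c t) k - hat K (FyN K f) k))\<^sup>2 + (cmod (fz (c t) k - hat K (FzN K f) k))\<^sup>2"

lemma flx_nonneg: "flx K t f k \<ge> 0"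
  by (simp add: flx_def)

lemma nonlinear_error_le:
  assumes "k \<in> modes K"
  shows "(cmod (nlco (c t) k - hat K (nlN K f) k))\<^sup>2 \<le> kap k * flx K t f k"
proof -
  have "nlco (c t) k - hat K (nlN K f) k = gx (\<lambda>k. fx (c t) k - hat K (FxN K f) k) k + gy (\<lambda>k. fy (c t) k - hat K (FyN K f) k) k + gz (\<lambda>k. fz (c t) k - hat K (FzN K f) k) k"
    unfolding hat_nlN[OF assms] nlco_def gx_def gy_def gz_def by (simp only: right_diff_distrib) simp
  then show ?thesis unfolding flx_def
    using flux_divergence_le[of "\<lambda>k. fx (c t) k - hat K (FxN K f) k" k "\<lambda>k. fy (c t) k - hat K (FyN K f) k" "\<lambda>k. fz (c t) k - hat K (FzN K f) k"] by simp
qed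

lemma two_hh_power_le: "(2 * hh K) ^ (m + j) \<le> 2 ^ (m + j) * hh K ^ m"
proof -
  have "hh K ^ (m + j) \<le> hh K ^ m" using hh_pos[of K] hh_le_1[of K] by (intro power_decreasing) auto
  then show ?thesis unfolding power_mult_distrib by (rule mult_left_mono) simp
qed

text \<open>Of the m + 4 derivatives one is spent on the gradient, leaving the exponent m + 3, of
  which m powers of h are kept. The cubic factor is uniform because h \<le> 1.\<close>

lemma flux_close:
  "\<exists>C\<ge>0. \<forall>K t f. t \<in> {0..T} \<longrightarrow> (\<Sum>k\<in>modes K. wt k * cmod (hat K f k - c t k)) \<le> (2 * hh K) ^ (m + 3) * Bc
    \<longrightarrow> (\<Sum>k\<in>modes K. flx K t f k) \<le> C * (hh K ^ m)\<^sup>2"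
proof -
  define q where "q = (2::real) ^ (m + 3)"
  define C0 where "C0 = q * (9 * (2 * pi * Bc + 4 * pi * q * Bc)\<^sup>2 * (4 * pi * Bc) + 3 * (2 * pi * Bc) ^ 3)"
  have q0: "q \<ge> 0" by (simp add: q_def)
  have C0: "C0 \<ge> 0" using Bc(1) q0 unfolding C0_def by (intro mult_nonneg_nonneg add_nonneg_nonneg) auto
  have "(\<Sum>k\<in>modes K. flx K t f k) \<le> 3 * C0\<^sup>2 * (hh K ^ m)\<^sup>2"
    if t: "t \<in> {0..T}" and close: "(\<Sum>k\<in>modes K. wt k * cmod (hat K f k - c t k)) \<le> (2 * hh K) ^ (m + 3) * Bc" for K t f
  proof -
    let ?p = "(2 * hh K) ^ (m + 3)"
    let ?\<eta> = "4 * pi * ?p * Bc"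
    let ?E = "9 * (2 * pi * Bc + ?\<eta>)\<^sup>2 * ?\<eta> + ?p * (3 * (2 * pi * Bc) ^ 3)"
    have p0: "0 \<le> ?p" using hh_pos[of K] by simp
    have p1: "?p \<le> q * hh K ^ m" unfolding q_def by (rule two_hh_power_le)
    have hm: "hh K ^ m \<le> 1" using hh_pos[of K] hh_le_1[of K] by (intro power_le_one) auto
    have hm0: "0 \<le> hh K ^ m" using hh_pos[of K] by simp
    have pq: "?p \<le> q" by (rule order_trans[OF p1]) (use mult_left_mono[OF hm q0] in simp)
    have \<eta>0: "0 \<le> ?\<eta>" using p0 Bc(1) by simp
    have \<eta>q: "?\<eta> \<le> 4 * pi * q * Bc" using pq Bc(1) by (intro mult_right_mono mult_left_mono) auto
    have E: "?E \<le> C0 * hh K ^ m"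
    proof -
      define H where "H = ?\<eta>"
      define J where "J v = 9 * (2 * pi * Bc + v)\<^sup>2 * (4 * pi * Bc) + 3 * (2 * pi * Bc) ^ 3" for v
      have J0: "0 \<le> J v" for v unfolding J_def using Bc(1) by (intro add_nonneg_nonneg mult_nonneg_nonneg) auto
      have "(2 * pi * Bc + H)\<^sup>2 \<le> (2 * pi * Bc + 4 * pi * q * Bc)\<^sup>2"
        unfolding H_def using \<eta>0 \<eta>q Bc(1) by (intro power_mono add_left_mono add_nonneg_nonneg) auto
      then have JJ: "J H \<le> J (4 * pi * q * Bc)" unfolding J_def using Bc(1) by (intro add_right_mono mult_right_mono mult_left_mono) auto
      have "?E = ?p * J H" unfolding J_def H_def[symmetric] distrib_left by (simp add: H_def mult_ac)
      also have "\<dots> \<le> (q * hh K ^ m) * J (4 * pi * q * Bc)" by (rule mult_mono[OF p1 JJ _ J0]) (use q0 hm0 in simp)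
      also have "\<dots> = C0 * hh K ^ m" by (simp add: C0_def J_def)
      finally show ?thesis .
    qed
    have w: "wien (m + 3 + 1) (c t) (Phi t)" and B: "wnorm (m + 3 + 1) (c t) \<le> Bc" using c_wien[OF t] Bc(3)[OF t] by (simp_all add: add.commute)
    note fc = flux_consistency[OF w B close]
    have sq: "(\<Sum>k\<in>modes K. (cmod (u k))\<^sup>2) \<le> C0\<^sup>2 * (hh K ^ m)\<^sup>2" if "L2_set (\<lambda>k. cmod (u k)) (modes K) \<le> ?E" for u :: "freq \<Rightarrow> complex"
    proof -
      have "(\<Sum>k\<in>modes K. (cmod (u k))\<^sup>2) = (L2_set (\<lambda>k. cmod (u k)) (modes K))\<^sup>2" unfolding L2_set_def by (rule real_sqrt_pow2[symmetric]) (intro sum_nonneg; simp)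
      also have "\<dots> \<le> (C0 * hh K ^ m)\<^sup>2" by (rule power_mono[OF order_trans[OF that E]]) (rule L2_set_nonneg)
      finally show ?thesis by (simp add: power_mult_distrib)
    qed
    have "(\<Sum>k\<in>modes K. flx K t f k) \<le> C0\<^sup>2 * (hh K ^ m)\<^sup>2 + C0\<^sup>2 * (hh K ^ m)\<^sup>2 + C0\<^sup>2 * (hh K ^ m)\<^sup>2"
      unfolding flx_def sum.distrib by (intro add_mono sq fc)
    then show ?thesis by simp
  qed
  then show ?thesis by (intro exI[of _ "3 * C0\<^sup>2"]) auto
qed

text \<open>The truncated Fourier series of the exact solution, as the grid function R, is inserted
  between the two fluxes: \<open>flux_close\<close> handles the exact side,
  \<open>flux_difference\<close> the numerical one, where f is measured only by \<open>q4\<close>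
  and by its distance to the solution.\<close>

lemma flux_error:
  "\<exists>C\<ge>0. \<exists>Q\<ge>0. \<forall>K t f. t \<in> {0..T} \<longrightarrow>
    (\<Sum>k\<in>modes K. flx K t f k) \<le> C * (hh K ^ m)\<^sup>2 + Q * (1 + q4 K f) * (\<Sum>k\<in>modes K. wt k * cmod (c t k - hat K f k))\<^sup>2"
proof -
  obtain C0 where C0: "C0 \<ge> 0" and cl: "\<And>K t f. t \<in> {0..T} \<Longrightarrow> (\<Sum>k\<in>modes K. wt k * cmod (hat K f k - c t k)) \<le> (2 * hh K) ^ (m + 3) * Bc
    \<Longrightarrow> (\<Sum>k\<in>modes K. flx K t f k) \<le> C0 * (hh K ^ m)\<^sup>2" using flux_close by blast
  define QR where "QR = (12 * pi\<^sup>2 * Bc\<^sup>2)\<^sup>2"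
  have QR: "QR \<ge> 0" by (simp add: QR_def)
  have "(\<Sum>k\<in>modes K. flx K t f k) \<le> 2 * C0 * (hh K ^ m)\<^sup>2 + (768 * pi\<^sup>2 * (1 + QR)) * (1 + q4 K f) * (\<Sum>k\<in>modes K. wt k * cmod (c t k - hat K f k))\<^sup>2"
    if t: "t \<in> {0..T}" for K t f
  proof -
    define R where "R = synth K (c t)"
    define W where "W = (\<Sum>k\<in>modes K. wt k * cmod (c t k - hat K f k))"
    have hR: "hat K R k = c t k" if "k \<in> modes K" for k unfolding R_def by (rule hat_synth) (simp_all add: c_minus[OF t] that)
    have 1: "(\<Sum>k\<in>modes K. flx K t R k) \<le> C0 * (hh K ^ m)\<^sup>2"
    proof (rule cl[OF t])
      have "(\<Sum>k\<in>modes K. wt k * cmod (hat K R k - c t k)) = (\<Sum>k\<in>modes K. 0)" by (rule sum.cong) (simp_all add: hR)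
      also have "\<dots> \<le> (2 * hh K) ^ (m + 3) * Bc" using hh_pos[of K] Bc(1) by simp
      finally show "(\<Sum>k\<in>modes K. wt k * cmod (hat K R k - c t k)) \<le> (2 * hh K) ^ (m + 3) * Bc" .
    qed
    have qR: "q4 K R \<le> QR" unfolding QR_def
    proof (rule q4_le_sup)
      have "(\<Sum>k\<in>modes K. wt k * cmod (hat K R k)) = (\<Sum>k\<in>modes K. wt k ^ 1 * cmod (c t k))" by (rule sum.cong) (simp_all add: hR)
      also have "\<dots> \<le> wnorm 1 (c t)" by (rule wnorm_finite_sum_le[OF c_wnorm_le(1)[OF t]]) auto
      also have "\<dots> \<le> Bc" by (rule c_wnorm_le(2)[OF t]) simp
      finally show "(\<Sum>k\<in>modes K. wt k * cmod (hat K R k)) \<le> Bc" .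
    qed
    have W: "(\<Sum>k\<in>modes K. wt k * cmod (hat K R k - hat K f k)) = W" unfolding W_def by (rule sum.cong) (simp_all add: hR)
    note fd = flux_difference[of K R f, unfolded W]
    let ?D = "\<lambda>k. (cmod (hat K (FxN K R) k - hat K (FxN K f) k))\<^sup>2 + (cmod (hat K (FyN K R) k - hat K (FyN K f) k))\<^sup>2 + (cmod (hat K (FzN K R) k - hat K (FzN K f) k))\<^sup>2"
    have tri: "(cmod (u - w))\<^sup>2 \<le> 2 * ((cmod (u - v))\<^sup>2 + (cmod (v - w))\<^sup>2)" for u v w :: complex
      using cmod_add2_sq[of "u - v" "v - w"] by simp
    have "flx K t f k \<le> 2 * flx K t R k + 2 * ?D k" for k
      using tri[of "fx (c t) k" "hat K (FxN K f) k" "hat K (FxN K R) k"] tri[of "fy (c t) k" "hat K (FyN K f) k" "hat K (FyN K R) k"]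
        tri[of "fz (c t) k" "hat K (FzN K f) k" "hat K (FzN K R) k"]
      unfolding flx_def distrib_left by linarith
    then have "(\<Sum>k\<in>modes K. flx K t f k) \<le> (\<Sum>k\<in>modes K. 2 * flx K t R k + 2 * ?D k)" by (rule sum_mono)
    also have "\<dots> = 2 * (\<Sum>k\<in>modes K. flx K t R k) + 2 * (\<Sum>k\<in>modes K. ?D k)" by (simp only: sum.distrib sum_distrib_left distrib_left)
    also have "\<dots> \<le> 2 * (C0 * (hh K ^ m)\<^sup>2) + 2 * (32 * (2 * pi * W)\<^sup>2 * (q4 K R + q4 K f) + 32 * (2 * pi * W)\<^sup>2 * (q4 K R + q4 K f) + 32 * (2 * pi * W)\<^sup>2 * (q4 K R + q4 K f))"
      unfolding sum.distrib by (intro add_mono mult_left_mono 1 fd) auto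
    also have "\<dots> = 2 * C0 * (hh K ^ m)\<^sup>2 + 768 * pi\<^sup>2 * W\<^sup>2 * (q4 K R + q4 K f)" by (simp add: power_mult_distrib)
    also have "\<dots> \<le> 2 * C0 * (hh K ^ m)\<^sup>2 + 768 * pi\<^sup>2 * W\<^sup>2 * ((1 + QR) * (1 + q4 K f))"
    proof (intro add_left_mono mult_left_mono)
      have "0 \<le> QR * q4 K f" using QR q4_nonneg[of K f] by simp
      then show "q4 K R + q4 K f \<le> (1 + QR) * (1 + q4 K f)" using qR by (simp add: algebra_simps)
    qed simp
    finally show ?thesis unfolding W_def[symmetric] by (simp only: mult_ac)
  qed
  moreover have "0 \<le> 768 * pi\<^sup>2 * (1 + QR)" using QR by simp
  ultimately show ?thesis using C0 by (intro exI[of _ "2 * C0"] conjI exI[of _ "768 * pi\<^sup>2 * (1 + QR)"]) auto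
qed

lemma kap4_sum_le:
  assumes "(\<Sum>k\<in>modes K. wt k ^ 8 * (cmod (u k))\<^sup>2) \<le> B" "r \<ge> 0"
  shows "(\<Sum>k\<in>modes K. (cmod (complex_of_real (r * (kap k)\<^sup>2) * u k))\<^sup>2) \<le> r\<^sup>2 * (64 ^ 4 * B)"
proof -
  have "(\<Sum>k\<in>modes K. (cmod (complex_of_real (r * (kap k)\<^sup>2) * u k))\<^sup>2) = (\<Sum>k\<in>modes K. r\<^sup>2 * (kap k ^ 4 * (cmod (u k))\<^sup>2))"
    by (rule sum.cong[OF refl], simp only: norm_mult norm_of_real power_mult_distrib power2_abs power_mult[symmetric]) simp
  also have "\<dots> \<le> (\<Sum>k\<in>modes K. r\<^sup>2 * (64 ^ 4 * wt k ^ 8 * (cmod (u k))\<^sup>2))"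
    by (intro sum_mono mult_left_mono mult_right_mono kap4_le) auto
  also have "\<dots> = r\<^sup>2 * (64 ^ 4 * (\<Sum>k\<in>modes K. wt k ^ 8 * (cmod (u k))\<^sup>2))" by (simp only: sum_distrib_left mult.assoc)
  also have "\<dots> \<le> r\<^sup>2 * (64 ^ 4 * B)" by (intro mult_left_mono assms) auto
  finally show ?thesis .
qed

text \<open>The exact coefficients inserted into the scheme, with the exact flux coefficients in
  place of the discrete ones. It is thus free of aliasing and measures the time discretisation
  alone.\<close>

definition residual :: "real \<Rightarrow> real \<Rightarrow> real \<Rightarrow> freq \<Rightarrow> complex" where
  "residual A dt t k = (3/2 * c t k - 2 * c (t - dt) k + 1/2 * c (t - 2 * dt) k) / complex_of_real dt
    + complex_of_real (kap k) * (- nlco (c t) k + complex_of_real (1 - \<epsilon>) * c t k - 2 * (complex_of_real (kap k) * (2 * c (t - dt) k - c (t - 2 * dt) k))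
      + complex_of_real (A * dt * kap k) * (c t k - c (t - dt) k) + complex_of_real ((kap k)\<^sup>2) * c t k)"

lemma residual_bound:
  assumes dt: "dt > 0" "0 \<le> t - 2 * dt" "t \<le> T" and A: "A \<ge> 0"
  shows "ksq K 0 (residual A dt t) \<le> 3 * (72 * dt ^ 3 * integral {t - 2 * dt..t} Z2
    + 2\<^sup>2 * (64 ^ 4 * (4 ^ 4 * (8 * dt ^ 3 * integral {t - 2 * dt..t} H2))) + (A * dt)\<^sup>2 * (64 ^ 4 * (dt\<^sup>2 * Bd)))"
proof -
  have t: "t \<in> {0..T}" using dt by auto
  define u where "u k = (3/2 * c t k - 2 * c (t - dt) k + 1/2 * c (t - 2 * dt) k) / complex_of_real dt - d t k" for k
  define v where "v k = c t k - 2 * c (t - dt) k + c (t - 2 * dt) k" for k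
  define w where "w k = c t k - c (t - dt) k" for k
  \<comment> \<open>The equation cancels everything except the BDF2 defect u, the extrapolation
    defect v and the stabilising increment w.\<close>
  have s: "residual A dt t k = u k + complex_of_real (2 * (kap k)\<^sup>2) * v k + complex_of_real (A * dt * (kap k)\<^sup>2) * w k" for k
  proof -
    define b where "b = (3/2 * c t k - 2 * c (t - dt) k + 1/2 * c (t - 2 * dt) k) / complex_of_real dt"
    show ?thesis
      unfolding residual_def u_def v_def w_def b_def[symmetric] d_eq[OF t] muco_def by (simp add: power2_eq_square algebra_simps)
  qed
  have "ksq K 0 (residual A dt t) \<le> (\<Sum>k\<in>modes K. 3 * ((cmod (u k))\<^sup>2 + (cmod (complex_of_real (2 * (kap k)\<^sup>2) * v k))\<^sup>2 + (cmod (complex_of_real (A * dt * (kap k)\<^sup>2) * w k))\<^sup>2))"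
    unfolding ksq_zero s by (intro sum_mono cmod_add3_sq)
  also have "\<dots> = 3 * ((\<Sum>k\<in>modes K. (cmod (u k))\<^sup>2) + (\<Sum>k\<in>modes K. (cmod (complex_of_real (2 * (kap k)\<^sup>2) * v k))\<^sup>2) + (\<Sum>k\<in>modes K. (cmod (complex_of_real (A * dt * (kap k)\<^sup>2) * w k))\<^sup>2))"
    by (simp only: sum_distrib_left[symmetric] sum.distrib)
  also have "\<dots> \<le> 3 * (72 * dt ^ 3 * integral {t - 2 * dt..t} Z2
    + 2\<^sup>2 * (64 ^ 4 * (4 ^ 4 * (8 * dt ^ 3 * integral {t - 2 * dt..t} H2))) + (A * dt)\<^sup>2 * (64 ^ 4 * (dt\<^sup>2 * Bd)))"
  proof (intro mult_left_mono add_mono kap4_sum_le)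
    show "(\<Sum>k\<in>modes K. (cmod (u k))\<^sup>2) \<le> 72 * dt ^ 3 * integral {t - 2 * dt..t} Z2" unfolding u_def by (rule c_bdf[OF dt]) simp
    show "(\<Sum>k\<in>modes K. wt k ^ 8 * (cmod (v k))\<^sup>2) \<le> 4 ^ 4 * (8 * dt ^ 3 * integral {t - 2 * dt..t} H2)"
      unfolding v_def by (rule c_second_difference[OF dt]) simp
    have "(\<Sum>k\<in>modes K. wt k ^ 8 * (cmod (w k))\<^sup>2) \<le> (t - (t - dt))\<^sup>2 * Bd"
      unfolding w_def by (rule c_difference) (use dt in auto)
    then show "(\<Sum>k\<in>modes K. wt k ^ 8 * (cmod (w k))\<^sup>2) \<le> dt\<^sup>2 * Bd" by simp
  qed (use A dt in auto)
  finally show ?thesis .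
qed

text \<open>The ghost value at time \<open>- dt\<close> is compared with \<open>c 0 + dt * kap * \<mu>\<close>, where \<open>\<mu>\<close> are the
  coefficients of the discrete initial potential, so that the ghost error equals the initial error.\<close>

definition first_residual :: "real \<Rightarrow> real \<Rightarrow> (freq \<Rightarrow> complex) \<Rightarrow> freq \<Rightarrow> complex" where
  "first_residual A dt \<mu> k = (3/2 * (c dt k - c 0 k) / complex_of_real dt - 1/2 * d 0 k - d dt k) + complex_of_real (2 * (kap k)\<^sup>2) * (c dt k - c 0 k)
    + complex_of_real (2 * dt * kap k ^ 3) * \<mu> k + complex_of_real (A * dt * (kap k)\<^sup>2) * (c dt k - c 0 k)"

lemma first_residual_bound:
  assumes dt: "dt > 0" "dt \<le> T" and A: "A \<ge> 0" and B: "(\<Sum>k\<in>modes K. kap k ^ 6 * (cmod (\<mu> k))\<^sup>2) \<le> B"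
  shows "ksq K 0 (first_residual A dt \<mu>) \<le> 4 * ((5/2 * W0 * dt)\<^sup>2 + 2\<^sup>2 * (64 ^ 4 * (dt\<^sup>2 * Bd)) + 4 * dt\<^sup>2 * B + (A * dt)\<^sup>2 * (64 ^ 4 * (dt\<^sup>2 * Bd)))"
proof -
  define u where "u k = 3/2 * (c dt k - c 0 k) / complex_of_real dt - 1/2 * d 0 k - d dt k" for k
  define w where "w k = c dt k - c 0 k" for k
  have wb: "(\<Sum>k\<in>modes K. wt k ^ 8 * (cmod (w k))\<^sup>2) \<le> dt\<^sup>2 * Bd"
    using c_difference[of 0 dt "modes K"] dt unfolding w_def by simp
  have mu: "(\<Sum>k\<in>modes K. (cmod (complex_of_real (2 * dt * kap k ^ 3) * \<mu> k))\<^sup>2) \<le> 4 * dt\<^sup>2 * B"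
  proof -
    have "(\<Sum>k\<in>modes K. (cmod (complex_of_real (2 * dt * kap k ^ 3) * \<mu> k))\<^sup>2) = (\<Sum>k\<in>modes K. 4 * dt\<^sup>2 * (kap k ^ 6 * (cmod (\<mu> k))\<^sup>2))"
      by (rule sum.cong[OF refl], simp only: norm_mult norm_of_real power_mult_distrib power2_abs power_mult[symmetric]) simp
    also have "\<dots> \<le> 4 * dt\<^sup>2 * B" unfolding sum_distrib_left[symmetric] by (rule mult_left_mono[OF B]) simp
    finally show ?thesis .
  qed
  have "ksq K 0 (first_residual A dt \<mu>) \<le> (\<Sum>k\<in>modes K. 4 * ((cmod (u k))\<^sup>2 + (cmod (complex_of_real (2 * (kap k)\<^sup>2) * w k))\<^sup>2
      + (cmod (complex_of_real (2 * dt * kap k ^ 3) * \<mu> k))\<^sup>2 + (cmod (complex_of_real (A * dt * (kap k)\<^sup>2) * w k))\<^sup>2))"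
    unfolding ksq_zero first_residual_def u_def[symmetric] unfolding w_def[symmetric] by (intro sum_mono cmod_add4_sq)
  also have "\<dots> = 4 * ((\<Sum>k\<in>modes K. (cmod (u k))\<^sup>2) + (\<Sum>k\<in>modes K. (cmod (complex_of_real (2 * (kap k)\<^sup>2) * w k))\<^sup>2)
      + (\<Sum>k\<in>modes K. (cmod (complex_of_real (2 * dt * kap k ^ 3) * \<mu> k))\<^sup>2) + (\<Sum>k\<in>modes K. (cmod (complex_of_real (A * dt * (kap k)\<^sup>2) * w k))\<^sup>2))"
    by (simp only: sum_distrib_left[symmetric] sum.distrib)
  also have "\<dots> \<le> 4 * ((5/2 * W0 * dt)\<^sup>2 + 2\<^sup>2 * (64 ^ 4 * (dt\<^sup>2 * Bd)) + 4 * dt\<^sup>2 * B + (A * dt)\<^sup>2 * (64 ^ 4 * (dt\<^sup>2 * Bd)))"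
  proof (intro mult_left_mono add_mono kap4_sum_le wb mu)
    show "(\<Sum>k\<in>modes K. (cmod (u k))\<^sup>2) \<le> (5/2 * W0 * dt)\<^sup>2" unfolding u_def by (rule c_first[OF dt]) simp
  qed (use A dt in auto)
  finally show ?thesis .
qed

text \<open>The error is taken against the Fourier coefficients of the solution, not those of its
  samples, because the former obey the equation; the difference of the two is aliasing and is added
  at the end.\<close>

definition err :: "nat \<Rightarrow> real \<Rightarrow> (int \<Rightarrow> grid) \<Rightarrow> nat \<Rightarrow> freq \<Rightarrow> complex" where
  "err K dt phi n k = c (real n * dt) k - hat K (phi (int n)) k"

lemma error_energy_step:
  assumes dt: "dt > 0" and A: "A \<ge> 0" and s: "bdf2_scheme K M dt \<epsilon> A (Phi 0) phi" and n: "1 \<le> n" "n < M"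
  shows "eng K A dt (err K dt phi (Suc n)) (err K dt phi n) + 3/4 * (dt * ksq K 3 (err K dt phi (Suc n)))
    \<le> eng K A dt (err K dt phi n) (err K dt phi (n - 1))
      + dt * (2 * (\<Sum>k\<in>modes K. flx K (real (Suc n) * dt) (phi (int (Suc n))) k) + 1/16 * ksq K 3 (err K dt phi n) + 1/64 * ksq K 3 (err K dt phi (n - 1))
        + 256 * ksq K 0 (\<lambda>k. 2 * err K dt phi n k - err K dt phi (n - 1) k) + 1/2 * ksq K 0 (residual A dt (real (Suc n) * dt)) + 1/2 * ksq K 0 (err K dt phi (Suc n)))"
proof (rule error_step_sum[OF dt A, where a = "1 - \<epsilon>" and N = "\<lambda>k. nlco (c (real (Suc n) * dt)) k - hat K (nlN K (phi (int (Suc n)))) k"])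
  have t: "real (Suc n) * dt - dt = real n * dt" "real (Suc n) * dt - 2 * dt = real (n - 1) * dt" using n by (simp_all add: algebra_simps of_nat_diff)
  have i: "int n + 1 = int (Suc n)" "int n - 1 = int (n - 1)" using n by (simp_all add: of_nat_diff)
  fix k assume k: "k \<in> modes K"
  have eq: "(3/2 * hat K (phi (int (Suc n))) k - 2 * hat K (phi (int n)) k + 1/2 * hat K (phi (int (n - 1))) k) / complex_of_real dt =
    - complex_of_real (kap k) * (- hat K (nlN K (phi (int (Suc n)))) k + complex_of_real (1 - \<epsilon>) * hat K (phi (int (Suc n))) k
      - 2 * (complex_of_real (kap k) * (2 * hat K (phi (int n)) k - hat K (phi (int (n - 1))) k))
      + complex_of_real (A * dt * kap k) * (hat K (phi (int (Suc n))) k - hat K (phi (int n)) k) + complex_of_real ((kap k)\<^sup>2) * hat K (phi (int (Suc n))) k)"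
    using scheme_mode[OF s _ _ k, of "int n"] n unfolding i by simp
  show "(3/2 * err K dt phi (Suc n) k - 2 * err K dt phi n k + 1/2 * err K dt phi (n - 1) k) / complex_of_real dt =
      - complex_of_real (kap k) * (- (nlco (c (real (Suc n) * dt)) k - hat K (nlN K (phi (int (Suc n)))) k) + complex_of_real (1 - \<epsilon>) * err K dt phi (Suc n) k
        - 2 * (complex_of_real (kap k) * (2 * err K dt phi n k - err K dt phi (n - 1) k))
        + complex_of_real (A * dt * kap k) * (err K dt phi (Suc n) k - err K dt phi n k) + complex_of_real ((kap k)\<^sup>2) * err K dt phi (Suc n) k)
      + residual A dt (real (Suc n) * dt) k"
    unfolding err_def residual_def t by (rule error_equation[OF eq])
  show "(cmod (nlco (c (real (Suc n) * dt)) k - hat K (nlN K (phi (int (Suc n)))) k))\<^sup>2 \<le> kap k * flx K (real (Suc n) * dt) (phi (int (Suc n))) k"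
    by (rule nonlinear_error_le[OF k])
  show "0 \<le> flx K (real (Suc n) * dt) (phi (int (Suc n))) k" by (rule flx_nonneg)
qed (use eps in simp)

lemma symbol_bound: "\<bar>kap k * (1 - \<epsilon> - 2 * kap k + (kap k)\<^sup>2)\<bar> \<le> kap k ^ 3"
proof (cases "k = 0")
  case False
  have g: "kap k \<ge> 36" by (rule kap_ge[OF False])
  have "2 * kap k \<le> kap k * kap k" using g by (intro mult_right_mono) auto
  then have "0 \<le> 1 - \<epsilon> - 2 * kap k + (kap k)\<^sup>2" using eps by (simp add: power2_eq_square)
  moreover have "1 - \<epsilon> - 2 * kap k + (kap k)\<^sup>2 \<le> (kap k)\<^sup>2" using g eps by simp
  then have "kap k * (1 - \<epsilon> - 2 * kap k + (kap k)\<^sup>2) \<le> kap k * (kap k)\<^sup>2" by (rule mult_left_mono) simp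
  ultimately show ?thesis by (simp add: power2_eq_square power3_eq_cube)
qed simp

lemma error_energy_first:
  assumes dt: "dt > 0" "dt \<le> T" and A: "A \<ge> 0" and M: "M > 0" and s: "bdf2_scheme K M dt \<epsilon> A (Phi 0) phi"
  shows "3/4 * eng K A dt (err K dt phi 1) (err K dt phi 0) + 7/16 * (dt * ksq K 3 (err K dt phi 1))
    \<le> eng K A dt (err K dt phi 0) (err K dt phi 0)
      + dt * (2 * (\<Sum>k\<in>modes K. flx K dt (phi 1) k) + (\<Sum>k\<in>modes K. flx K 0 (phi 0) k) + ksq K 3 (err K dt phi 0) + 256 * ksq K 0 (err K dt phi 0))
      + 4 * dt\<^sup>2 * ksq K 0 (first_residual A dt (hat K (muN K \<epsilon> (phi 0))))"
proof (rule error_first_sum[OF dt(1) A, where a = "1 - \<epsilon>" and N = "\<lambda>k. nlco (c dt) k - hat K (nlN K (phi 1)) k"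
    and N0 = "\<lambda>k. nlco (c 0) k - hat K (nlN K (phi 0)) k" and \<beta> = "\<lambda>k. 1 - \<epsilon> - 2 * kap k + (kap k)\<^sup>2"])
  have t: "dt \<in> {0..T}" using dt by auto
  fix k assume k: "k \<in> modes K"
  define mu where "mu = hat K (muN K \<epsilon> (phi 0)) k"
  define \<beta> where "\<beta> = 1 - \<epsilon> - 2 * kap k + (kap k)\<^sup>2"
  have hm: "hat K (phi (-1)) k = hat K (phi 0) k + complex_of_real dt * complex_of_real (kap k) * mu"
    using scheme_start(2)[OF s k] unfolding mu_def by simp
  have eq: "(3/2 * hat K (phi 1) k - 2 * hat K (phi 0) k + 1/2 * hat K (phi (-1)) k) / complex_of_real dt =
    - complex_of_real (kap k) * (- hat K (nlN K (phi 1)) k + complex_of_real (1 - \<epsilon>) * hat K (phi 1) k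
      - 2 * (complex_of_real (kap k) * (2 * hat K (phi 0) k - hat K (phi (-1)) k))
      + complex_of_real (A * dt * kap k) * (hat K (phi 1) k - hat K (phi 0) k) + complex_of_real ((kap k)\<^sup>2) * hat K (phi 1) k)"
    using scheme_mode[OF s _ _ k, of 0] M by simp
  have e1: "err K dt phi 1 k = c dt k - hat K (phi 1) k" and e0: "err K dt phi 0 k = c 0 k - hat K (phi 0) k" by (simp_all add: err_def)
  have em: "err K dt phi 0 k = c 0 k + complex_of_real dt * complex_of_real (kap k) * mu - hat K (phi (-1)) k" unfolding e0 hm by simp
  have "(3/2 * c dt k - 2 * c 0 k + 1/2 * (c 0 k + complex_of_real dt * complex_of_real (kap k) * mu)) / complex_of_real dt
      + complex_of_real (kap k) * (- nlco (c dt) k + complex_of_real (1 - \<epsilon>) * c dt k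
        - 2 * (complex_of_real (kap k) * (2 * c 0 k - (c 0 k + complex_of_real dt * complex_of_real (kap k) * mu)))
        + complex_of_real (A * dt) * complex_of_real (kap k) * (c dt k - c 0 k) + (complex_of_real (kap k))\<^sup>2 * c dt k)
    = (3/2 * (c dt k - c 0 k) / complex_of_real dt - 1/2 * (- complex_of_real (kap k) * (- nlco (c 0) k + complex_of_real \<beta> * c 0 k))
        - (- complex_of_real (kap k) * (- nlco (c dt) k + complex_of_real \<beta> * c dt k)))
      + 2 * (complex_of_real (kap k))\<^sup>2 * (c dt k - c 0 k) + 2 * complex_of_real dt * complex_of_real (kap k) ^ 3 * mu
      + complex_of_real (A * dt) * (complex_of_real (kap k))\<^sup>2 * (c dt k - c 0 k)
      + complex_of_real (kap k) / 2 * (nlco (c 0) k - hat K (nlN K (phi 0)) k) - complex_of_real (kap k) * complex_of_real \<beta> / 2 * (c 0 k - hat K (phi 0) k)"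
    by (rule first_residual_split) (use dt in \<open>simp_all add: mu_def hat_muN[OF k] \<beta>_def\<close>)
  then have res: "(3/2 * c dt k - 2 * c 0 k + 1/2 * (c 0 k + complex_of_real dt * complex_of_real (kap k) * mu)) / complex_of_real dt
      + complex_of_real (kap k) * (- nlco (c dt) k + complex_of_real (1 - \<epsilon>) * c dt k
        - 2 * (complex_of_real (kap k) * (2 * c 0 k - (c 0 k + complex_of_real dt * complex_of_real (kap k) * mu)))
        + complex_of_real (A * dt * kap k) * (c dt k - c 0 k) + complex_of_real ((kap k)\<^sup>2) * c dt k)
    = first_residual A dt (hat K (muN K \<epsilon> (phi 0))) k + complex_of_real (kap k / 2) * (nlco (c 0) k - hat K (nlN K (phi 0)) k) - complex_of_real (kap k * \<beta> / 2) * err K dt phi 0 k"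
    unfolding first_residual_def e0 mu_def[symmetric] d_eq[OF t] d_eq[OF zero_in] muco_def \<beta>_def[symmetric]
    by (simp only: of_real_mult of_real_divide of_real_power of_real_numeral)
  show "(3/2 * err K dt phi 1 k - 2 * err K dt phi 0 k + 1/2 * err K dt phi 0 k) / complex_of_real dt =
      - complex_of_real (kap k) * (- (nlco (c dt) k - hat K (nlN K (phi 1)) k) + complex_of_real (1 - \<epsilon>) * err K dt phi 1 k
        - 2 * (complex_of_real (kap k) * (2 * err K dt phi 0 k - err K dt phi 0 k))
        + complex_of_real (A * dt * kap k) * (err K dt phi 1 k - err K dt phi 0 k) + complex_of_real ((kap k)\<^sup>2) * err K dt phi 1 k)
      + (first_residual A dt (hat K (muN K \<epsilon> (phi 0))) k + complex_of_real (kap k / 2) * (nlco (c 0) k - hat K (nlN K (phi 0)) k)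
        - complex_of_real (kap k * (1 - \<epsilon> - 2 * kap k + (kap k)\<^sup>2) / 2) * err K dt phi 0 k)"
    using error_equation[OF eq, of "c dt k" "c 0 k" "c 0 k + complex_of_real dt * complex_of_real (kap k) * mu" "nlco (c dt) k"]
    unfolding res unfolding e1[symmetric] e0[symmetric] em[symmetric] \<beta>_def .
  show "(cmod (nlco (c dt) k - hat K (nlN K (phi 1)) k))\<^sup>2 \<le> kap k * flx K dt (phi 1) k"
    "(cmod (nlco (c 0) k - hat K (nlN K (phi 0)) k))\<^sup>2 \<le> kap k * flx K 0 (phi 0) k"
    by (rule nonlinear_error_le[OF k])+
  show "0 \<le> flx K dt (phi 1) k" "0 \<le> flx K 0 (phi 0) k" by (rule flx_nonneg)+
  show "\<bar>kap k * (1 - \<epsilon> - 2 * kap k + (kap k)\<^sup>2)\<bar> \<le> kap k ^ 3" by (rule symbol_bound)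
qed (use eps in simp)

text \<open>The strongest norm takes three derivatives, which leaves m + 1 of the m + 4 for powers
  of h.\<close>

lemma alias_ksq:
  assumes t: "t \<in> {0..T}" and j: "j \<le> 3"
  shows "ksq K j (\<lambda>k. hat K (QN K (Phi t)) k - c t k) \<le> 64 ^ 3 * (2 ^ (m + 1) * Bc)\<^sup>2 * (hh K ^ m)\<^sup>2"
proof -
  have w: "wien (3 + (m + 1)) (c t) (Phi t)" using c_wien[OF t] by (simp add: add.commute)
  have "(\<Sum>k\<in>modes K. wt k ^ 3 * cmod (hat K (QN K (Phi t)) k - c t k)) \<le> (2 * hh K) ^ (m + 1) * wnorm (3 + (m + 1)) (c t)" by (rule alias_bound[OF w])
  also have "\<dots> \<le> (2 ^ (m + 1) * hh K ^ m) * Bc"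
  proof (rule mult_mono[OF two_hh_power_le])
    show "wnorm (3 + (m + 1)) (c t) \<le> Bc" using Bc(3)[OF t] by (simp add: add.commute)
  qed (use hh_pos[of K] wnorm_nonneg in auto)
  finally have "(\<Sum>k\<in>modes K. wt k ^ 3 * cmod (hat K (QN K (Phi t)) k - c t k)) \<le> 2 ^ (m + 1) * hh K ^ m * Bc" .
  from ksq_le_weighted[OF j this] show ?thesis by (simp only: power_mult_distrib mult_ac)
qed

end

lemma sum_local_errors:
  fixes f g :: "real \<Rightarrow> real"
  assumes f: "f integrable_on {0..T}" "\<And>t. f t \<ge> 0" and g: "g integrable_on {0..T}" "\<And>t. g t \<ge> 0"
    and dt: "dt \<ge> 0" and M: "real M * dt = T" and abk: "a \<ge> 0" "b \<ge> 0" "k \<ge> 0"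
  shows "(\<Sum>n\<in>{1..<M}. 1/2 * (dt * (dt ^ 3 * (a * integral {real (n - 1) * dt..real (Suc n) * dt} f + b * integral {real (n - 1) * dt..real (Suc n) * dt} g) + k * dt ^ 4)))
    \<le> dt ^ 4 * (a * integral {0..T} f + b * integral {0..T} g + k * T)"
proof -
  let ?I = "\<lambda>f n. integral {real (n - 1) * dt..real (Suc n) * dt} f"
  have d4: "0 \<le> dt ^ 4" using dt by simp
  have "(\<Sum>n\<in>{1..<M}. 1/2 * (dt * (dt ^ 3 * (a * ?I f n + b * ?I g n) + k * dt ^ 4)))
      = (\<Sum>n\<in>{1..<M}. dt ^ 4 * (a / 2) * ?I f n + dt ^ 4 * (b / 2) * ?I g n + dt ^ 4 * (k / 2) * dt)"
    by (rule sum.cong[OF refl]) (simp add: power4_eq_xxxx power3_eq_cube algebra_simps add_divide_distrib)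
  also have "\<dots> = dt ^ 4 * (a / 2) * (\<Sum>n\<in>{1..<M}. ?I f n) + dt ^ 4 * (b / 2) * (\<Sum>n\<in>{1..<M}. ?I g n) + real (M - 1) * (dt ^ 4 * (k / 2) * dt)"
    by (simp only: sum.distrib sum_distrib_left[symmetric] sum_constant card_atLeastLessThan) (simp only: mult_ac)
  also have "\<dots> \<le> dt ^ 4 * (a / 2) * (2 * integral {0..T} f) + dt ^ 4 * (b / 2) * (2 * integral {0..T} g) + dt ^ 4 * (k * T)"
  proof (intro add_mono mult_left_mono)
    show "(\<Sum>n\<in>{1..<M}. ?I f n) \<le> 2 * integral {0..T} f" by (rule sum_overlapping_integrals[OF f dt M])
    show "(\<Sum>n\<in>{1..<M}. ?I g n) \<le> 2 * integral {0..T} g" by (rule sum_overlapping_integrals[OF g dt M])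
    have "real (M - 1) * dt \<le> (2 * real M) * dt" using dt by (intro mult_right_mono) auto
    then have "real (M - 1) * dt \<le> 2 * T" unfolding M[symmetric] by (simp only: mult.assoc)
    then have "dt ^ 4 * (k / 2) * (real (M - 1) * dt) \<le> dt ^ 4 * (k / 2) * (2 * T)" using d4 abk by (intro mult_left_mono) auto
    then show "real (M - 1) * (dt ^ 4 * (k / 2) * dt) \<le> dt ^ 4 * (k * T)" by (simp add: mult_ac)
  qed (use d4 abk in auto)
  also have "\<dots> = dt ^ 4 * (a * integral {0..T} f + b * integral {0..T} g + k * T)" by (simp add: algebra_simps)
  finally show ?thesis .
qed

lemma eng_bounds:
  assumes "A \<ge> 0"
  shows "ksq K 0 u \<le> 4 * eng K A dt u v" "ksq K 0 (\<lambda>k. 2 * u k - v k) \<le> 4 * eng K A dt u v" "eng K A dt u v \<ge> 0"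
proof -
  have U: "0 \<le> A * dt\<^sup>2 / 2 * ksq K 2 u" using assms by simp
  have gen: "p \<le> 4 * (1/4 * (p + q) + u)" "q \<le> 4 * (1/4 * (p + q) + u)" "0 \<le> 1/4 * (p + q) + u" if "0 \<le> p" "0 \<le> q" "0 \<le> u" for p q u :: real
    using that by (simp_all add: field_simps)
  show "ksq K 0 u \<le> 4 * eng K A dt u v" "ksq K 0 (\<lambda>k. 2 * u k - v k) \<le> 4 * eng K A dt u v" "eng K A dt u v \<ge> 0"
    unfolding eng_def by (rule gen[OF ksq_nonneg ksq_nonneg U])+
qed

section \<open>Convergence\<close>

context spfc
begin

lemma H2_integrable: "H2 integrable_on {0..T}"
  unfolding H2_def[abs_def] using L2_Hper_absolutely_integrable(3)[OF H(2)] by (rule set_lebesgue_integral_eq_integral(1))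

lemma H2_nonneg: "H2 t \<ge> 0"
  unfolding H2_def Hper_sq_def 
proof (rule infsum_nonneg)
  show "0 \<le> hweight 4 k * (cmod (fcoef (E2 t) k))\<^sup>2" for k using hweight_ge_1[of 4 k] by simp
qed

lemma Z2_integrable: "Z2 integrable_on {0..T}"
  using Z2_ai by (rule set_lebesgue_integral_eq_integral(1))

text \<open>The squared estimate for \<open>err\<close>. Every constant is fixed before M, K and phi
  are introduced, which is what makes the result uniform in the discretisation.\<close>

lemma mode_convergence:
  assumes A: "A \<ge> 0"
  shows "\<exists>C\<ge>0. \<exists>\<tau>0>0. \<forall>M K phi n. M > 0 \<longrightarrow> T / real M \<le> \<tau>0 \<longrightarrow> bdf2_scheme K M (T / real M) \<epsilon> A (Phi 0) phi \<longrightarrow> n \<le> M \<longrightarrow>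
    ksq K 0 (err K (T / real M) phi n) + T / real M * (\<Sum>j\<in>{1..n}. ksq K 3 (err K (T / real M) phi j)) \<le> C * ((T / real M) ^ 4 + (hh K ^ m)\<^sup>2)"
proof -
  obtain Ce Qe where Ce: "Ce \<ge> 0" and Qe: "Qe \<ge> 0" and fe: "\<And>K t f. t \<in> {0..T} \<Longrightarrow>
    (\<Sum>k\<in>modes K. flx K t f k) \<le> Ce * (hh K ^ m)\<^sup>2 + Qe * (1 + q4 K f) * (\<Sum>k\<in>modes K. wt k * cmod (c t k - hat K f k))\<^sup>2"
    using flux_error by blast
  obtain C1 where C1: "C1 \<ge> 0" and cl: "\<And>K t f. t \<in> {0..T} \<Longrightarrow> (\<Sum>k\<in>modes K. wt k * cmod (hat K f k - c t k)) \<le> (2 * hh K) ^ (m + 3) * Bc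
    \<Longrightarrow> (\<Sum>k\<in>modes K. flx K t f k) \<le> C1 * (hh K ^ m)\<^sup>2" using flux_close by blast
  obtain Q where Q: "Q \<ge> 0" and qb: "\<And>K M A phi n. M > 0 \<Longrightarrow> A \<ge> 0 \<Longrightarrow> bdf2_scheme K M (T / real M) \<epsilon> A (Phi 0) phi \<Longrightarrow> n \<le> M \<Longrightarrow> q4 K (phi (int n)) \<le> Q"
    using q4_bound by blast
  obtain B where B: "B \<ge> 0" "\<And>K. (\<Sum>k\<in>modes K. kap k ^ 6 * (cmod (hat K (muN K \<epsilon> (QN K (Phi 0))) k))\<^sup>2) \<le> B"
    using initial_mu_bound by blast
  define Q' where "Q' = Qe * (1 + Q)"
  have Q'0: "Q' \<ge> 0" using Qe Q by (simp add: Q'_def)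
  \<comment> \<open>Chosen so that the flux error takes at most 1/16 of the dissipation: 3/4 - 1/16
    \<ge> 5/8 and 7/16 - 1/16 = 3/8 are then the coefficients that \<open>bdf2_gronwall\<close> asks
    for.\<close>
  define \<delta> where "\<delta> = 1 / (32 * (Q' + 1))"
  have \<delta>: "\<delta> > 0" and Q\<delta>: "2 * Q' * \<delta> \<le> 1/16" using Q'0 by (simp_all add: \<delta>_def field_simps)
  obtain Cd where Cd: "Cd \<ge> 0" and ip: "\<And>K (u :: freq \<Rightarrow> complex).
    (\<Sum>k\<in>modes K. wt k * cmod (u k))\<^sup>2 \<le> \<delta> * (\<Sum>k\<in>modes K. kap k ^ 3 * (cmod (u k))\<^sup>2) + Cd * (\<Sum>k\<in>modes K. (cmod (u k))\<^sup>2)"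
    using wt_interpolation[OF \<delta>] by blast
  define CI where "CI = 64 ^ 3 * (2 ^ (m + 1) * Bc)\<^sup>2"
  have CI: "CI \<ge> 0" by (simp add: CI_def)
  \<comment> \<open>1024 = 256 * 4 for the explicit term and 2 = 4 / 2 for the residual pairing,
    with 4 the constant of \<open>eng_bounds\<close>; the rest is the low-frequency part of the flux
    error.\<close>
  define C where "C = 1026 + 8 * Q' * Cd"
  have QCd: "0 \<le> Q' * Cd" using Q'0 Cd by simp
  have C: "C > 0" using QCd by (simp add: C_def)
  define K1 where "K1 = (3 * (2\<^sup>2 * (64 ^ 4 * (4 ^ 4 * 8))) :: real)"
  define K2 where "K2 = 3 * (A\<^sup>2 * (64 ^ 4 * Bd))"
  define K3 where "K3 = 16 * ((5/2 * W0)\<^sup>2 + 2\<^sup>2 * (64 ^ 4 * Bd) + 4 * B + A\<^sup>2 * (64 ^ 4 * (T\<^sup>2 * Bd)))"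
  have K1: "K1 \<ge> 0" by (simp add: K1_def)
  have K2: "K2 \<ge> 0" using Bd_nonneg by (simp add: K2_def)
  have K3: "K3 \<ge> 0" using Bd_nonneg B(1) unfolding K3_def by (intro mult_nonneg_nonneg add_nonneg_nonneg) auto
  define KK where "KK = K3 + (216 * integral {0..T} Z2 + K1 * integral {0..T} H2 + K2 * T)"
  have KK: "KK \<ge> 0" unfolding KK_def using K1 K2 K3 T_pos integral_nonneg_everywhere[OF Z2_nonneg, of "{0..T}"] integral_nonneg_everywhere[OF H2_nonneg, of "{0..T}"]
    by (intro add_nonneg_nonneg mult_nonneg_nonneg) auto
  define G1 where "G1 = 2 * Ce + C1 + CI"
  have G1: "G1 \<ge> 0" using Ce C1 CI by (simp add: G1_def)
  \<comment> \<open>The right-hand side of \<open>bdf2_gronwall\<close> with initial values and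
    local errors inserted, times 4 because the claimed quantity is at most four times its left-hand
    side.\<close>
  define Cf where "Cf = 4 * (exp (8 * C * T) * ((1 + A * T\<^sup>2) * CI + T * CI + 4 * (T * G1) + 4 * KK))"
  have Cf: "Cf \<ge> 0" unfolding Cf_def using A CI T_pos G1 KK by (intro mult_nonneg_nonneg add_nonneg_nonneg) auto
  have "ksq K 0 (err K dt phi n) + dt * (\<Sum>j\<in>{1..n}. ksq K 3 (err K dt phi j)) \<le> Cf * (dt ^ 4 + (hh K ^ m)\<^sup>2)"
    if M0: "M > 0" and dt_def: "dt = T / real M" and small: "dt \<le> 1 / (4 * C)" and s: "bdf2_scheme K M dt \<epsilon> A (Phi 0) phi" and n: "n \<le> M" for M K phi n dt
  proof -
    have dt: "dt > 0" using M0 T_pos by (simp add: dt_def)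
    have MT: "real M * dt = T" using M0 by (simp add: dt_def)
    have dtT: "dt \<le> T" unfolding MT[symmetric] using M0 dt by simp
    have tin: "real i * dt \<in> {0..T}" if "i \<le> M" for i
      using that dt mult_right_mono[of "real i" "real M" dt] MT by auto
    define G where "G = (hh K ^ m)\<^sup>2"
    have G: "G \<ge> 0" by (simp add: G_def)
    define e where "e = err K dt phi"
    define S where "S i = eng K A dt (e i) (e (i - 1))" for i
    define X where "X i = ksq K 3 (e i)" for i
    have S0: "S i \<ge> 0" and SY: "ksq K 0 (e i) \<le> 4 * S i" and SZ: "ksq K 0 (\<lambda>k. 2 * e i k - e (i - 1) k) \<le> 4 * S i" for i
      unfolding S_def by (rule eng_bounds[OF A])+
    have X0: "X i \<ge> 0" for i by (simp add: X_def)
    have p0: "phi 0 = QN K (Phi 0)" using s unfolding bdf2_scheme_def Let_def by blast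
    have flux: "2 * (\<Sum>k\<in>modes K. flx K (real i * dt) (phi (int i)) k) \<le> 2 * Ce * G + 1/16 * X i + 8 * Q' * Cd * S i" if i: "i \<le> M" for i
    proof -
      let ?W = "(\<Sum>k\<in>modes K. wt k * cmod (e i k))\<^sup>2"
      have "(\<Sum>k\<in>modes K. flx K (real i * dt) (phi (int i)) k) \<le> Ce * G + Qe * (1 + q4 K (phi (int i))) * ?W"
        using fe[OF tin[OF i], of K "phi (int i)"] unfolding G_def e_def err_def .
      also have "\<dots> \<le> Ce * G + Q' * ?W"
        unfolding Q'_def using Qe qb[OF M0 A s[unfolded dt_def] i] by (intro add_left_mono mult_right_mono mult_left_mono) auto
      also have "\<dots> \<le> Ce * G + Q' * (\<delta> * X i + Cd * (4 * S i))"
      proof (intro add_left_mono mult_left_mono)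
        have "?W \<le> \<delta> * X i + Cd * ksq K 0 (e i)" using ip[of "e i" K] unfolding X_def ksq_def by simp
        also have "\<dots> \<le> \<delta> * X i + Cd * (4 * S i)" using SY[of i] Cd by (intro add_left_mono mult_left_mono)
        finally show "?W \<le> \<delta> * X i + Cd * (4 * S i)" .
      qed (rule Q'0)
      finally have "2 * (\<Sum>k\<in>modes K. flx K (real i * dt) (phi (int i)) k) \<le> 2 * Ce * G + (2 * Q' * \<delta>) * X i + 8 * Q' * Cd * S i"
        by (simp add: algebra_simps)
      also have "(2 * Q' * \<delta>) * X i \<le> 1/16 * X i" by (rule mult_right_mono[OF Q\<delta> X0])
      finally show ?thesis by simp
    qed
    have init: "ksq K j (e 0) \<le> CI * G" if "j \<le> 3" for j
    proof -
      have "ksq K j (e 0) = ksq K j (\<lambda>k. hat K (QN K (Phi 0)) k - c 0 k)"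
        unfolding ksq_def e_def err_def by (simp add: p0 norm_minus_commute)
      also have "\<dots> \<le> CI * G" unfolding CI_def G_def by (rule alias_ksq[OF zero_in that])
      finally show ?thesis .
    qed
    have flux0: "(\<Sum>k\<in>modes K. flx K 0 (phi 0) k) \<le> C1 * G"
      unfolding G_def
    proof (rule cl[OF zero_in])
      have w: "wien (1 + (m + 3)) (c 0) (Phi 0)" using c_wien[OF zero_in] by (simp add: add.commute)
      have "(\<Sum>k\<in>modes K. wt k * cmod (hat K (phi 0) k - c 0 k)) \<le> (2 * hh K) ^ (m + 3) * wnorm (1 + (m + 3)) (c 0)"
        using alias_bound[OF w, of K] by (simp add: p0)
      also have "\<dots> \<le> (2 * hh K) ^ (m + 3) * Bc"
        using hh_pos[of K] Bc(3)[OF zero_in] by (intro mult_left_mono) (auto simp: add.commute)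
      finally show "(\<Sum>k\<in>modes K. wt k * cmod (hat K (phi 0) k - c 0 k)) \<le> (2 * hh K) ^ (m + 3) * Bc" .
    qed
    define I where "I f i = integral {real (i - 2) * dt..real i * dt} f" for f :: "real \<Rightarrow> real" and i :: nat
    \<comment> \<open>The first step contributes dt^4 without a further factor dt, but only once;
      the later residuals are dt^3 times window integrals or dt^4, and carry the extra dt of the
      time sum.\<close>
    define \<rho> where "\<rho> i = dt * (G1 * G) + (if i = 1 then K3 * dt ^ 4 else 1/2 * (dt * (dt ^ 3 * (216 * I Z2 i + K1 * I H2 i) + K2 * dt ^ 4)))" for i
    have I0: "I Z2 i \<ge> 0" "I H2 i \<ge> 0" for i unfolding I_def by (rule integral_nonneg_everywhere, rule Z2_nonneg H2_nonneg)+
    have \<rho>0: "\<rho> i \<ge> 0" for i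
      unfolding \<rho>_def using dt G1 G K1 K2 K3 I0[of i] by (auto intro!: add_nonneg_nonneg mult_nonneg_nonneg)
    have CS: "(8 * Q' * Cd) * S i \<le> (C - 2) * S i" for i by (rule mult_right_mono[OF _ S0]) (simp add: C_def)
    have CS': "1024 * S i \<le> C * S i" for i by (rule mult_right_mono[OF _ S0]) (use QCd in \<open>simp add: C_def\<close>)
    have first: "3/4 * S 1 + 3/8 * (dt * X 1) \<le> S 0 + C * dt * (S 0 + S 1) + \<rho> 1"
    proof -
      have res: "4 * dt\<^sup>2 * ksq K 0 (first_residual A dt (hat K (muN K \<epsilon> (phi 0)))) \<le> K3 * dt ^ 4"
      proof -
        have "ksq K 0 (first_residual A dt (hat K (muN K \<epsilon> (phi 0)))) \<le> 4 * ((5/2 * W0 * dt)\<^sup>2 + 2\<^sup>2 * (64 ^ 4 * (dt\<^sup>2 * Bd)) + 4 * dt\<^sup>2 * B + (A * dt)\<^sup>2 * (64 ^ 4 * (dt\<^sup>2 * Bd)))"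
          using first_residual_bound[OF dt dtT A, of "hat K (muN K \<epsilon> (phi 0))" K B] B(2)[of K] unfolding p0 by blast
        also have "\<dots> \<le> 4 * ((5/2 * W0 * dt)\<^sup>2 + 2\<^sup>2 * (64 ^ 4 * (dt\<^sup>2 * Bd)) + 4 * dt\<^sup>2 * B + (A * dt)\<^sup>2 * (64 ^ 4 * (T\<^sup>2 * Bd)))"
          using dt dtT Bd_nonneg by (intro mult_left_mono add_left_mono mult_right_mono power_mono) auto
        also have "\<dots> = dt\<^sup>2 * (K3 / 4)" unfolding K3_def power_mult_distrib by (simp add: algebra_simps)
        finally have "4 * dt\<^sup>2 * ksq K 0 (first_residual A dt (hat K (muN K \<epsilon> (phi 0)))) \<le> 4 * dt\<^sup>2 * (dt\<^sup>2 * (K3 / 4))" by (rule mult_left_mono) simp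
        also have "\<dots> = K3 * dt ^ 4" by (simp add: power2_eq_square power4_eq_xxxx)
        finally show ?thesis .
      qed
      have f1: "2 * (\<Sum>k\<in>modes K. flx K dt (phi 1) k) \<le> 2 * Ce * G + 1/16 * X 1 + 8 * Q' * Cd * S 1" using flux[of 1] M0 by simp
      have y0: "256 * ksq K 0 (e 0) \<le> 1024 * S 0" using SY[of 0] by simp
      have x0: "ksq K 3 (e 0) \<le> CI * G" by (rule init) simp
      have "dt * (2 * (\<Sum>k\<in>modes K. flx K dt (phi 1) k) + (\<Sum>k\<in>modes K. flx K 0 (phi 0) k) + ksq K 3 (e 0) + 256 * ksq K 0 (e 0))
        \<le> dt * ((2 * Ce * G + 1/16 * X 1 + (C - 2) * S 1) + C1 * G + CI * G + C * S 0)"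
        using dt by (intro mult_left_mono add_mono order_trans[OF f1] flux0 x0 order_trans[OF y0] CS CS' order_refl) simp
      also have "\<dots> = dt * (G1 * G) + 1/16 * (dt * X 1) + C * dt * (S 0 + S 1) - 2 * (dt * S 1)" by (simp add: G1_def algebra_simps)
      finally have le: "dt * (2 * (\<Sum>k\<in>modes K. flx K dt (phi 1) k) + (\<Sum>k\<in>modes K. flx K 0 (phi 0) k) + ksq K 3 (e 0) + 256 * ksq K 0 (e 0))
        \<le> dt * (G1 * G) + 1/16 * (dt * X 1) + C * dt * (S 0 + S 1) - 2 * (dt * S 1)" .
      have d1: "0 \<le> dt * S 1" using dt S0[of 1] by simp
      have st: "3/4 * S 1 + 7/16 * (dt * X 1) \<le> S 0 + dt * (2 * (\<Sum>k\<in>modes K. flx K dt (phi 1) k) + (\<Sum>k\<in>modes K. flx K 0 (phi 0) k) + ksq K 3 (e 0) + 256 * ksq K 0 (e 0))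
         + 4 * dt\<^sup>2 * ksq K 0 (first_residual A dt (hat K (muN K \<epsilon> (phi 0))))"
        using error_energy_first[OF dt dtT A M0 s] unfolding S_def X_def e_def by simp
      have gen: "3/4 * p + 3/8 * x \<le> q + w + (a + b)" if "3/4 * p + 7/16 * x \<le> q + l + r" "l \<le> a + 1/16 * x + w - 2 * v" "r \<le> b" "0 \<le> v" for p x q l r a w v b :: real
        using that by linarith
      show ?thesis unfolding \<rho>_def using gen[OF st le res d1] by simp
    qed
    have step: "S (Suc i) + 5/8 * (dt * X (Suc i)) \<le> S i + dt * (1/16 * X i + 1/64 * X (i - 1)) + C * dt * (S i + S (Suc i)) + \<rho> (Suc i)" if i: "1 \<le> i" "i < M" for i
    proof -
      have t2: "real (Suc i) * dt - 2 * dt = real (Suc i - 2) * dt" using i by (simp add: of_nat_diff algebra_simps)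
      have tT: "real (Suc i) * dt \<le> T" using tin[of "Suc i"] i by simp
      have res: "ksq K 0 (residual A dt (real (Suc i) * dt)) \<le> dt ^ 3 * (216 * I Z2 (Suc i) + K1 * I H2 (Suc i)) + K2 * dt ^ 4"
      proof -
        have "ksq K 0 (residual A dt (real (Suc i) * dt)) \<le> 3 * (72 * dt ^ 3 * I Z2 (Suc i)
            + 2\<^sup>2 * (64 ^ 4 * (4 ^ 4 * (8 * dt ^ 3 * I H2 (Suc i)))) + (A * dt)\<^sup>2 * (64 ^ 4 * (dt\<^sup>2 * Bd)))"
          using residual_bound[OF dt _ tT A, of K] dt unfolding t2 I_def by simp
        also have "\<dots> = dt ^ 3 * (216 * I Z2 (Suc i) + K1 * I H2 (Suc i)) + K2 * dt ^ 4"
          unfolding K1_def K2_def by (simp add: power2_eq_square power4_eq_xxxx algebra_simps)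
        finally show ?thesis .
      qed
      define r where "r = dt ^ 3 * (216 * I Z2 (Suc i) + K1 * I H2 (Suc i)) + K2 * dt ^ 4"
      have f1: "2 * (\<Sum>k\<in>modes K. flx K (real (Suc i) * dt) (phi (int (Suc i))) k) \<le> 2 * Ce * G + 1/16 * X (Suc i) + 8 * Q' * Cd * S (Suc i)"
        by (rule flux) (use i in simp)
      have z: "256 * ksq K 0 (\<lambda>k. 2 * e i k - e (i - 1) k) \<le> 1024 * S i" using SZ[of i] by simp
      have y: "1/2 * ksq K 0 (e (Suc i)) \<le> 2 * S (Suc i)" using SY[of "Suc i"] by simp
      have cg: "2 * Ce * G \<le> G1 * G" using C1 CI G by (intro mult_right_mono) (auto simp: G1_def)
      have st: "S (Suc i) + 3/4 * (dt * X (Suc i)) \<le> S i + dt * (2 * (\<Sum>k\<in>modes K. flx K (real (Suc i) * dt) (phi (int (Suc i))) k) + 1/16 * X i + 1/64 * X (i - 1)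
          + 256 * ksq K 0 (\<lambda>k. 2 * e i k - e (i - 1) k) + 1/2 * ksq K 0 (residual A dt (real (Suc i) * dt)) + 1/2 * ksq K 0 (e (Suc i)))"
        using error_energy_step[OF dt A s i] unfolding S_def X_def e_def by simp
      have "dt * (2 * (\<Sum>k\<in>modes K. flx K (real (Suc i) * dt) (phi (int (Suc i))) k) + 1/16 * X i + 1/64 * X (i - 1)
          + 256 * ksq K 0 (\<lambda>k. 2 * e i k - e (i - 1) k) + 1/2 * ksq K 0 (residual A dt (real (Suc i) * dt)) + 1/2 * ksq K 0 (e (Suc i)))
        \<le> dt * ((G1 * G + 1/16 * X (Suc i) + (C - 2) * S (Suc i)) + 1/16 * X i + 1/64 * X (i - 1) + C * S i + 1/2 * r + 2 * S (Suc i))"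
        unfolding r_def
        using dt by (intro mult_left_mono[of _ _ dt] mult_left_mono[of _ _ "1/2"] add_mono order_trans[OF f1] order_trans[OF z] CS CS' cg res y order_refl) simp_all
      also have "\<dots> = dt * (G1 * G) + 1/16 * (dt * X (Suc i)) + dt * (1/16 * X i + 1/64 * X (i - 1)) + C * dt * (S i + S (Suc i)) + 1/2 * (dt * r)"
        by (simp add: algebra_simps)
      finally have le: "dt * (2 * (\<Sum>k\<in>modes K. flx K (real (Suc i) * dt) (phi (int (Suc i))) k) + 1/16 * X i + 1/64 * X (i - 1)
          + 256 * ksq K 0 (\<lambda>k. 2 * e i k - e (i - 1) k) + 1/2 * ksq K 0 (residual A dt (real (Suc i) * dt)) + 1/2 * ksq K 0 (e (Suc i)))
        \<le> dt * (G1 * G) + 1/16 * (dt * X (Suc i)) + dt * (1/16 * X i + 1/64 * X (i - 1)) + C * dt * (S i + S (Suc i)) + 1/2 * (dt * r)" .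
      have \<rho>e: "\<rho> (Suc i) = dt * (G1 * G) + 1/2 * (dt * r)" using i unfolding \<rho>_def r_def by simp
      have dX: "0 \<le> dt * X (Suc i)" using dt X0[of "Suc i"] by simp
      have gen: "p + 5/8 * x \<le> q + v + w + (a + b)" if "p + 3/4 * x \<le> q + l" "l \<le> a + 1/16 * x + v + w + b" "0 \<le> x" for p x q l a v w b :: real
        using that by linarith
      show ?thesis unfolding \<rho>e by (rule gen[OF st le dX])
    qed
    have small': "4 * C * dt \<le> 1" using small C by (simp add: field_simps)
    have gr: "S n + dt / 4 * (\<Sum>j\<in>{1..n}. X j) \<le> exp (8 * C * T) * (2 * S 0 + dt * X 0 + 4 * (\<Sum>j\<in>{1..M}. \<rho> j))"
      by (rule bdf2_gronwall[OF S0 X0 \<rho>0 dt less_imp_le[OF C] small' MT M0 first step n])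
    have sum\<rho>: "(\<Sum>j\<in>{1..M}. \<rho> j) \<le> T * G1 * G + dt ^ 4 * KK"
    proof -
      let ?r = "\<lambda>i. if i = 1 then K3 * dt ^ 4 else 1/2 * (dt * (dt ^ 3 * (216 * I Z2 i + K1 * I H2 i) + K2 * dt ^ 4))"
      have "(\<Sum>j\<in>{1..M}. \<rho> j) = real M * (dt * (G1 * G)) + (\<Sum>j\<in>{1..M}. ?r j)" unfolding \<rho>_def sum.distrib by simp
      also have "real M * (dt * (G1 * G)) = T * G1 * G" unfolding MT[symmetric] by simp
      also have "(\<Sum>j\<in>{1..M}. ?r j) = ?r 1 + (\<Sum>j\<in>{2..M}. ?r j)"
        using M0 by (subst sum.atLeast_Suc_atMost) (auto simp: numeral_2_eq_2)
      also have "(\<Sum>j\<in>{2..M}. ?r j) = (\<Sum>i\<in>{1..<M}. ?r (Suc i))"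
        by (rule sum.reindex_bij_witness[where i = Suc and j = "\<lambda>j. j - 1"]) auto
      also have "\<dots> = (\<Sum>i\<in>{1..<M}. 1/2 * (dt * (dt ^ 3 * (216 * integral {real (i - 1) * dt..real (Suc i) * dt} Z2 + K1 * integral {real (i - 1) * dt..real (Suc i) * dt} H2) + K2 * dt ^ 4)))"
        by (rule sum.cong[OF refl]) (simp add: I_def)
      finally have sp: "(\<Sum>j\<in>{1..M}. \<rho> j) = T * G1 * G + (?r 1 + (\<Sum>i\<in>{1..<M}. 1/2 * (dt * (dt ^ 3 * (216 * integral {real (i - 1) * dt..real (Suc i) * dt} Z2 + K1 * integral {real (i - 1) * dt..real (Suc i) * dt} H2) + K2 * dt ^ 4))))" .
      have "(\<Sum>i\<in>{1..<M}. 1/2 * (dt * (dt ^ 3 * (216 * integral {real (i - 1) * dt..real (Suc i) * dt} Z2 + K1 * integral {real (i - 1) * dt..real (Suc i) * dt} H2) + K2 * dt ^ 4)))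
          \<le> dt ^ 4 * (216 * integral {0..T} Z2 + K1 * integral {0..T} H2 + K2 * T)"
        by (rule sum_local_errors[OF Z2_integrable Z2_nonneg H2_integrable H2_nonneg less_imp_le[OF dt] MT _ K1 K2]) simp
      then have "(\<Sum>j\<in>{1..M}. \<rho> j) \<le> T * G1 * G + (?r 1 + dt ^ 4 * (216 * integral {0..T} Z2 + K1 * integral {0..T} H2 + K2 * T))"
        unfolding sp by (intro add_left_mono)
      also have "\<dots> = T * G1 * G + dt ^ 4 * KK" unfolding KK_def distrib_left[of "dt ^ 4" K3] by (simp only: simp_thms if_True mult.commute)
      finally show ?thesis .
    qed
    have S0b: "2 * S 0 \<le> (1 + A * T\<^sup>2) * CI * G"
    proof -
      have "2 * S 0 = ksq K 0 (e 0) + A * dt\<^sup>2 * ksq K 2 (e 0)" unfolding S_def eng_def by simp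
      also have "\<dots> \<le> CI * G + A * T\<^sup>2 * (CI * G)"
        using A dt dtT CI G by (intro add_mono init mult_mono mult_left_mono power_mono) auto
      finally show ?thesis by (simp add: algebra_simps)
    qed
    have X0b: "dt * X 0 \<le> T * CI * G"
      using mult_mono[OF dtT init[of 3]] dt T_pos unfolding X_def by (simp add: mult.assoc)
    have "ksq K 0 (e n) + dt * (\<Sum>j\<in>{1..n}. X j) \<le> 4 * (S n + dt / 4 * (\<Sum>j\<in>{1..n}. X j))" using SY[of n] by simp
    also have "\<dots> \<le> 4 * (exp (8 * C * T) * ((1 + A * T\<^sup>2) * CI * G + T * CI * G + 4 * (T * G1 * G + dt ^ 4 * KK)))"
      by (intro mult_left_mono order_trans[OF gr] add_mono S0b X0b sum\<rho>) auto
    also have "\<dots> \<le> 4 * (exp (8 * C * T) * (((1 + A * T\<^sup>2) * CI + T * CI + 4 * (T * G1) + 4 * KK) * (dt ^ 4 + G)))"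
    proof (intro mult_left_mono)
      define a where "a = (1 + A * T\<^sup>2) * CI + T * CI + 4 * (T * G1)"
      have a0: "0 \<le> a" unfolding a_def using A CI T_pos G1 by (intro add_nonneg_nonneg mult_nonneg_nonneg) auto
      have "(1 + A * T\<^sup>2) * CI * G + T * CI * G + 4 * (T * G1 * G + dt ^ 4 * KK) = a * G + 4 * KK * dt ^ 4" by (simp add: a_def algebra_simps)
      also have "\<dots> \<le> a * (dt ^ 4 + G) + 4 * KK * (dt ^ 4 + G)" using a0 KK dt G by (intro add_mono mult_left_mono) auto
      also have "\<dots> = (a + 4 * KK) * (dt ^ 4 + G)" by (simp only: distrib_right)
      finally show "(1 + A * T\<^sup>2) * CI * G + T * CI * G + 4 * (T * G1 * G + dt ^ 4 * KK) \<le> ((1 + A * T\<^sup>2) * CI + T * CI + 4 * (T * G1) + 4 * KK) * (dt ^ 4 + G)"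
        unfolding a_def .
    qed auto
    finally show ?thesis unfolding Cf_def G_def X_def e_def by (simp only: mult.assoc)
  qed
  then show ?thesis using Cf C by (intro exI[of _ Cf] conjI exI[of _ "1 / (4 * C)"]) auto
qed

lemma convergence:
  assumes A: "A \<ge> 0"
  shows "\<exists>C > 0. \<exists>\<tau>0 > 0. \<exists>h0 > 0. \<forall>M K phi.
     M > 0 \<longrightarrow> T / real M \<le> \<tau>0 \<longrightarrow> hh K \<le> h0 \<longrightarrow>
     bdf2_scheme K M (T / real M) \<epsilon> A (Phi 0) phi \<longrightarrow>
     Max ((\<lambda>n. l2N K (\<lambda>p q r. QN K (Phi (real n * (T / real M))) p q r - phi (int n) p q r)) ` {0..M})
     + sqrt ((T / real M) * (\<Sum>j\<in>{1..M}.
          gradl2sqN K (LapN K (\<lambda>p q r. QN K (Phi (real j * (T / real M))) p q r - phi (int j) p q r))))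
     \<le> C * ((T / real M)^2 + hh K ^ m)"
proof -
  obtain C \<tau>0 where C: "C \<ge> 0" and \<tau>0: "\<tau>0 > 0" and conv: "\<And>M K phi n. M > 0 \<Longrightarrow> T / real M \<le> \<tau>0 \<Longrightarrow> bdf2_scheme K M (T / real M) \<epsilon> A (Phi 0) phi \<Longrightarrow> n \<le> M \<Longrightarrow>
    ksq K 0 (err K (T / real M) phi n) + T / real M * (\<Sum>j\<in>{1..n}. ksq K 3 (err K (T / real M) phi j)) \<le> C * ((T / real M) ^ 4 + (hh K ^ m)\<^sup>2)"
    using mode_convergence[OF A] by blast
  define CI where "CI = 64 ^ 3 * (2 ^ (m + 1) * Bc)\<^sup>2"
  have CI: "CI \<ge> 0" by (simp add: CI_def)
  define D1 where "D1 = 2 * (CI + C)"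
  define D2 where "D2 = 2 * (T * CI + C)"
  have D1: "D1 \<ge> 0" and D2: "D2 \<ge> 0" using CI C T_pos by (simp_all add: D1_def D2_def)
  have "Max ((\<lambda>n. l2N K (\<lambda>p q r. QN K (Phi (real n * dt)) p q r - phi (int n) p q r)) ` {0..M})
     + sqrt (dt * (\<Sum>j\<in>{1..M}. gradl2sqN K (LapN K (\<lambda>p q r. QN K (Phi (real j * dt)) p q r - phi (int j) p q r))))
     \<le> (sqrt D1 + sqrt D2 + 1) * (dt\<^sup>2 + hh K ^ m)"
    if M0: "M > 0" and dt_def: "dt = T / real M" and small: "dt \<le> \<tau>0" and s: "bdf2_scheme K M dt \<epsilon> A (Phi 0) phi" for M K phi dt
  proof -
    have dt: "dt > 0" using M0 T_pos by (simp add: dt_def)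
    have MT: "real M * dt = T" using M0 by (simp add: dt_def)
    have tin: "real i * dt \<in> {0..T}" if "i \<le> M" for i
      using that dt mult_right_mono[of "real i" "real M" dt] MT by auto
    define G where "G = (hh K ^ m)\<^sup>2"
    define g where "g n = (\<lambda>p q r. QN K (Phi (real n * dt)) p q r - phi (int n) p q r)" for n
    have hm: "0 \<le> hh K ^ m" using hh_pos[of K] by simp
    have G: "0 \<le> G" by (simp add: G_def)
    have d4: "0 \<le> dt ^ 4" by simp
    \<comment> \<open>The samples are compared with the numerical solution through the exact
      coefficients: an aliasing part plus \<open>err\<close>.\<close>
    have split: "ksq K j (hat K (g n)) \<le> 2 * (CI * G + ksq K j (err K dt phi n))" if "n \<le> M" "j \<le> 3" for n j
    proof -
      have "hat K (g n) k = (hat K (QN K (Phi (real n * dt))) k - c (real n * dt) k) + err K dt phi n k" for k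
        unfolding g_def hat_diff err_def by simp
      then have "ksq K j (hat K (g n)) \<le> 2 * (ksq K j (\<lambda>k. hat K (QN K (Phi (real n * dt))) k - c (real n * dt) k) + ksq K j (err K dt phi n))"
        using ksq_add_le[of K j "\<lambda>k. hat K (QN K (Phi (real n * dt))) k - c (real n * dt) k" "err K dt phi n"] by (simp add: ksq_def)
      also have "\<dots> \<le> 2 * (CI * G + ksq K j (err K dt phi n))"
        unfolding CI_def G_def by (intro mult_left_mono add_right_mono alias_ksq tin that) simp
      finally show ?thesis .
    qed
    \<comment> \<open>Passes from the squared estimate to the claimed one by dt^4 + h^(2m) \<le>
      (dt^2 + h^m)^2.\<close>
    have root: "sqrt y \<le> sqrt D * (dt\<^sup>2 + hh K ^ m)" if "y \<le> D * (dt ^ 4 + G)" "D \<ge> 0" for y D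
    proof -
      have "dt ^ 4 + G \<le> (dt\<^sup>2 + hh K ^ m)\<^sup>2"
        using hm unfolding G_def power2_sum by (simp add: power_mult[symmetric])
      then have "sqrt (dt ^ 4 + G) \<le> dt\<^sup>2 + hh K ^ m" using hm by (intro real_le_lsqrt) auto
      then have "sqrt D * sqrt (dt ^ 4 + G) \<le> sqrt D * (dt\<^sup>2 + hh K ^ m)" using that by (intro mult_left_mono) auto
      moreover have "sqrt y \<le> sqrt (D * (dt ^ 4 + G))" using that by simp
      ultimately show ?thesis by (simp add: real_sqrt_mult)
    qed
    note cv = conv[OF M0 small[unfolded dt_def] s[unfolded dt_def], folded dt_def G_def]
    have one: "l2N K (g n) \<le> sqrt D1 * (dt\<^sup>2 + hh K ^ m)" if n: "n \<le> M" for n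
      unfolding l2N_eq ksq_zero[symmetric]
    proof (rule root[OF _ D1])
      have "0 \<le> dt * (\<Sum>j\<in>{1..n}. ksq K 3 (err K dt phi j))" using dt by (intro mult_nonneg_nonneg sum_nonneg) auto
      then have "ksq K 0 (err K dt phi n) \<le> C * (dt ^ 4 + G)" using cv[OF n] by linarith
      moreover have "CI * G \<le> CI * (dt ^ 4 + G)" using CI d4 by (intro mult_left_mono) auto
      moreover have "ksq K 0 (hat K (g n)) \<le> 2 * (CI * G + ksq K 0 (err K dt phi n))" by (rule split[OF n]) simp
      ultimately show "ksq K 0 (hat K (g n)) \<le> D1 * (dt ^ 4 + G)" unfolding D1_def by (simp add: distrib_right)
    qed
    have "Max ((\<lambda>n. l2N K (g n)) ` {0..M}) \<le> sqrt D1 * (dt\<^sup>2 + hh K ^ m)" by (rule Max.boundedI) (auto intro: one)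
    moreover have "sqrt (dt * (\<Sum>j\<in>{1..M}. gradl2sqN K (LapN K (g j)))) \<le> sqrt D2 * (dt\<^sup>2 + hh K ^ m)"
    proof (rule root[OF _ D2])
      have "(\<Sum>j\<in>{1..M}. gradl2sqN K (LapN K (g j))) = (\<Sum>j\<in>{1..M}. ksq K 3 (hat K (g j)))" unfolding gradl2sqN_LapN ksq_def ..
      also have "\<dots> \<le> (\<Sum>j\<in>{1..M}. 2 * (CI * G + ksq K 3 (err K dt phi j)))" by (rule sum_mono, rule split) auto
      also have "\<dots> = 2 * (real M * (CI * G) + (\<Sum>j\<in>{1..M}. ksq K 3 (err K dt phi j)))" by (simp add: sum_distrib_left[symmetric] sum.distrib)
      finally have "dt * (\<Sum>j\<in>{1..M}. gradl2sqN K (LapN K (g j))) \<le> dt * (2 * (real M * (CI * G) + (\<Sum>j\<in>{1..M}. ksq K 3 (err K dt phi j))))"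
        using dt by (intro mult_left_mono) auto
      also have "\<dots> = 2 * (T * CI * G + dt * (\<Sum>j\<in>{1..M}. ksq K 3 (err K dt phi j)))" unfolding MT[symmetric] by (simp add: algebra_simps)
      also have "\<dots> \<le> 2 * (T * CI * (dt ^ 4 + G) + C * (dt ^ 4 + G))"
      proof (intro mult_left_mono add_mono)
        show "dt * (\<Sum>j\<in>{1..M}. ksq K 3 (err K dt phi j)) \<le> C * (dt ^ 4 + G)" using cv[of M] ksq_nonneg[of K 0 "err K dt phi M"] by linarith
      qed (use T_pos CI d4 in auto)
      also have "\<dots> = D2 * (dt ^ 4 + G)" unfolding D2_def by (simp only: distrib_right mult.assoc distrib_left)
      finally show "dt * (\<Sum>j\<in>{1..M}. gradl2sqN K (LapN K (g j))) \<le> D2 * (dt ^ 4 + G)" .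
    qed
    moreover have "0 \<le> dt\<^sup>2 + hh K ^ m" using hm by simp
    ultimately show ?thesis unfolding g_def distrib_right[of _ 1] distrib_right[of "sqrt D1"] mult_1 by linarith
  qed
  \<comment> \<open>The summand 1 makes the constant strictly positive even if \<open>D1\<close> and
    \<open>D2\<close> vanish.\<close>
  moreover have "0 < sqrt D1 + sqrt D2 + 1" using D1 D2 by (simp add: add_nonneg_pos)
  ultimately show ?thesis using \<tau>0 by (intro exI[of _ "sqrt D1 + sqrt D2 + 1"] conjI exI[of _ \<tau>0] exI[of _ "1::real"]) auto
qed

end

theorem theorem4p1:
  fixes Phi :: "real \<Rightarrow> real \<Rightarrow> real \<Rightarrow> real \<Rightarrow> real"
    and T \<epsilon> A :: real and m :: nat
  assumes T_pos: "0 < T"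
    and eps: "0 < \<epsilon>" "\<epsilon> < 1"
    and A_ge: "A \<ge> \<epsilon>^2 / 16"
    and sol: "sPFC_solution \<epsilon> T Phi"
    and init: "in_Hper (m + 6) (Phi 0)"
    and reg1: "H_time_C0 3 T Phi"
    and reg2: "H_time_Hper 2 4 T Phi"
    and reg3: "Linf_Hper (m + 6) T Phi"
  shows "\<exists>C > 0. \<exists>\<tau>0 > 0. \<exists>h0 > 0. \<forall>M K phi.
     M > 0 \<longrightarrow> T / real M \<le> \<tau>0 \<longrightarrow> hh K \<le> h0 \<longrightarrow>
     bdf2_scheme K M (T / real M) \<epsilon> A (Phi 0) phi \<longrightarrow>
     Max ((\<lambda>n. l2N K (\<lambda>p q r. QN K (Phi (real n * (T / real M))) p q r - phi (int n) p q r))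
            ` {0..M})
     + sqrt ((T / real M) * (\<Sum>j\<in>{1..M}.
          gradl2sqN K (LapN K (\<lambda>p q r. QN K (Phi (real j * (T / real M))) p q r - phi (int j) p q r))))
     \<le> C * ((T / real M)^2 + hh K ^ m)"
proof -
  obtain D where D: "D 0 = Phi" "\<And>a. a \<le> 3 \<Longrightarrow> L2_C0 T (D a)" "\<And>a. a < 3 \<Longrightarrow> wderiv_C0 T (D a) (D (Suc a))"
    using reg1 unfolding H_time_C0_def by blast
  obtain E where E: "E 0 = Phi" "\<And>a. a \<le> 2 \<Longrightarrow> L2_Hper 4 T (E a)" "\<And>a. a < 2 \<Longrightarrow> wderiv_Hper T (E a) (E (Suc a))"
    using reg2 unfolding H_time_Hper_def by blast
  obtain P where P: "wderiv_Hper T Phi P" "AE t in lebesgue. t \<in> {0..T} \<longrightarrow> (\<forall>k. fcoef (P t) k =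
      complex_of_real (- 4 * pi^2 * real_of_int (fst k ^ 2 + fst (snd k) ^ 2 + snd (snd k) ^ 2)) * fcoef (muc \<epsilon> (Phi t)) k)"
    using sol unfolding sPFC_solution_def by blast
  have kap: "complex_of_real (- 4 * pi^2 * real_of_int (fst k ^ 2 + fst (snd k) ^ 2 + snd (snd k) ^ 2)) = - complex_of_real (kap k)" for k
    unfolding kap_def of_real_minus[symmetric] by (rule arg_cong) simp
  \<comment> \<open>The three sources of time derivatives are passed on separately; their agreement
    in each mode is proved inside the locale.\<close>
  interpret spfc Phi "D 1" "D 2" "D 3" "E 1" "E 2" P T \<epsilon> m
  proof
    show "AE t in lebesgue. t \<in> {0..T} \<longrightarrow> (\<forall>k. fcoef (P t) k = - complex_of_real (kap k) * fcoef (muc \<epsilon> (Phi t)) k)"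
      using P(2) unfolding kap .
    show "L2_C0 T Phi" "L2_C0 T (D 1)" "L2_C0 T (D 2)" "L2_C0 T (D 3)" using D(2)[of 0] D(2)[of 1] D(2)[of 2] D(2)[of 3] D(1) by simp_all
    show "wderiv_C0 T Phi (D 1)" "wderiv_C0 T (D 1) (D 2)" "wderiv_C0 T (D 2) (D 3)"
      using D(3)[of 0] D(3)[of 1] D(3)[of 2] D(1) by (simp_all add: numeral_2_eq_2 numeral_3_eq_3)
    show "L2_Hper 4 T (E 1)" "L2_Hper 4 T (E 2)" using E(2)[of 1] E(2)[of 2] by simp_all
    show "wderiv_Hper T Phi (E 1)" "wderiv_Hper T (E 1) (E 2)" using E(3)[of 0] E(3)[of 1] E(1) by (simp_all add: numeral_2_eq_2)
  qed (use T_pos eps reg3 P in auto)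
  have "A \<ge> 0" by (rule order_trans[OF _ A_ge]) simp
  then show ?thesis by (rule convergence)
qed

end
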